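(* Let $A$ be a short local algebra of Hilbert type $(e,a)$ which is not self-injective. Assume that there exists a non-projective indecomposable $A$-module $M$ which is semi-Gorenstein-projective or $\infty$-torsionfree. Then $2\le a=e-1$ and $J^2=\operatorname{soc}{}_AA=\operatorname{soc}A_A$. Moreover, let $t=t(M)$. We have in addition: (1) If $M$ is torsionless and semi-Gorenstein-projective, then $\operatorname{\mathbf{dim}}\Omega^iM=(t,at)$ for all $i\ge0$. (2) If $M$ is $\infty$-torsionfree, then $\operatorname{\mathbf{dim}}\mho^iM=(t,at)$ for all $i\ge0$. (3) If $M$ is reflexive and semi-Gorenstein-projective, or if $M$ is $\infty$-torsionfree, then also $\operatorname{\mathbf{dim}}M^*=(t,at)$. (4) If $M$ is Gorenstein-projective, then $\operatorname{\mathbf{dim}}X=(t,at)$ for $X=\Omega^iM$ and $X=\mho^iM$ with $i\ge0$, as well as for $X=M^*$.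
   Context: Let $k$ be a field. All algebras $A$ are finite-dimensional local (not necessarily commutative) $k$-algebras with radical $J$ such that $A/J=k$. $A$ is short if $J^3=0$. $|M|$ denotes the length of a module $M$. Put $e=|J/J^2|$ and $a=|J^2|$; $(e,a)$ is the Hilbert type of the short local algebra $A$. Modules are left $A$-modules of finite length. $A$ is self-injective if ${}_AA$ is injective. $\operatorname{soc}{}_AA$ and $\operatorname{soc}A_A$ are the socles of $A$ as left and right module. For a module $M$: $t(M)=|M/JM|$; $\Omega M$ is the kernel of a projective cover $PM\to M$. If $M$ (left or right) has Loewy length at most $2$, its dimension vector is $\operatorname{\mathbf{dim}}M=(|\operatorname{top}M|,|\operatorname{rad}M|)$, where $\operatorname{rad}M=JM$ for a left module ($MJ$ for a right module) and $\operatorname{top}M=M/\operatorname{rad}M$; asserting that $\operatorname{\mathbf{dim}}X$ has a certain value includes that $X$ has Loewy length at most $2$. $\mho M$ is the cokernel of a minimal left $\operatorname{add}A$-approximation of $M$, i.e. of a left minimal map $u\colon M\to P$ with $P$ projective such that every map from $M$ to a projective module factors through $u$. $M^*=\operatorname{Hom}_A(M,{}_AA)$ (a right $A$-module). $M$ is torsionless if it is a submodule of a projective module; reflexive if the canonical map $M\to M^{**}$ is bijective; semi-Gorenstein-projective if $\operatorname{Ext}^i_A(M,A)=0$ for all $i\ge1$; $\infty$-torsionfree if $\operatorname{Tr}M$ is semi-Gorenstein-projective, where $\operatorname{Tr}$ is Auslander's transpose; Gorenstein-projective if it is an image $\operatorname{Im}d_i$ in an exact complex $P_\bullet=(P_i,d_i)_{i\in\mathbb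 Z}$ of projective modules whose $A$-dual $P_\bullet^*$ is again exact. *)

theory Defs
  imports "HOL-Library.Extended_Nat" "HOL-Algebra.Module" "HOL-Algebra.QuotRing"
    "HOL-Algebra.Ideal_Product"
begin

section \<open>Left modules over a (not necessarily commutative) ring\<close>

text \<open>
  The locale \<^locale>\<open>Module.module\<close> of the library requires a commutative base
  ring; the record type and \<^locale>\<open>submodule\<close> do not, and are used here. A right \<open>A\<close>-module is a left
  module over the opposite ring \<open>opp A\<close>. The fields \<^const>\<open>mult\<close> and
  \<^const>\<open>one\<close> of a module record are ignored throughout.
\<close>

locale left_module = R?: ring R + M?: abelian_group M
  for R :: "('a, 'x) ring_scheme" (structure) and M :: "('a, 'm, 'y) module_scheme" (structure) +
  assumes smult_closed:
      "\<lbrakk>a \<in> carrier R; x \<in> carrier M\<rbrakk> \<Longrightarrow> a \<odot>\<^bsub>M\<^esub> x \<in> carrier M"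
    and smult_l_distr:
      "\<lbrakk>a \<in> carrier R; b \<in> carrier R; x \<in> carrier M\<rbrakk> \<Longrightarrow>
        (a \<oplus>\<^bsub>R\<^esub> b) \<odot>\<^bsub>M\<^esub> x = a \<odot>\<^bsub>M\<^esub> x \<oplus>\<^bsub>M\<^esub> b \<odot>\<^bsub>M\<^esub> x"
    and smult_r_distr:
      "\<lbrakk>a \<in> carrier R; x \<in> carrier M; y \<in> carrier M\<rbrakk> \<Longrightarrow>
        a \<odot>\<^bsub>M\<^esub> (x \<oplus>\<^bsub>M\<^esub> y) = a \<odot>\<^bsub>M\<^esub> x \<oplus>\<^bsub>M\<^esub> a \<odot>\<^bsub>M\<^esub> y"
    and smult_assoc:
      "\<lbrakk>a \<in> carrier R; b \<in> carrier R; x \<in> carrier M\<rbrakk> \<Longrightarrow>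
        (a \<otimes>\<^bsub>R\<^esub> b) \<odot>\<^bsub>M\<^esub> x = a \<odot>\<^bsub>M\<^esub> (b \<odot>\<^bsub>M\<^esub> x)"
    and smult_one:
      "x \<in> carrier M \<Longrightarrow> \<one>\<^bsub>R\<^esub> \<odot>\<^bsub>M\<^esub> x = x"

definition opp :: "('a, 'x) ring_scheme \<Rightarrow> ('a, 'x) ring_scheme" where
  "opp A = A\<lparr>mult := \<lambda>x y. y \<otimes>\<^bsub>A\<^esub> x\<rparr>"

definition regular :: "('a, 'x) ring_scheme \<Rightarrow> ('a, 'a) module" where
  "regular A = \<lparr>carrier = carrier A, mult = mult A, one = one A, zero = zero A, add = add A,
     smult = mult A\<rparr>"

definition sub :: "('a, 'm) module \<Rightarrow> 'm set \<Rightarrow> ('a, 'm) module" where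
  "sub M N = M\<lparr>carrier := N\<rparr>"

definition quot :: "('a, 'm) module \<Rightarrow> 'm set \<Rightarrow> ('a, 'm set) module" where
  "quot M N = \<lparr>carrier = a_rcosets\<^bsub>M\<^esub> N, mult = undefined, one = undefined,
     zero = N, add = set_add M, smult = (\<lambda>r X. \<Union>x\<in>X. N +>\<^bsub>M\<^esub> (r \<odot>\<^bsub>M\<^esub> x))\<rparr>"

definition submodule_span :: "('a, 'x) ring_scheme \<Rightarrow> ('a, 'm) module \<Rightarrow> 'm set \<Rightarrow> 'm set" where
  "submodule_span A M S = \<Inter>{N. submodule N A M \<and> S \<subseteq> N}"

text \<open>\<open>ideal_smult A I M\<close> is \<open>I M\<close>.\<close>
definition ideal_smult :: "('a, 'x) ring_scheme \<Rightarrow> 'a set \<Rightarrow> ('a, 'm) module \<Rightarrow> 'm set" where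
  "ideal_smult A I M = submodule_span A M {r \<odot>\<^bsub>M\<^esub> x | r x. r \<in> I \<and> x \<in> carrier M}"

definition mod_hom ::
  "('a, 'x) ring_scheme \<Rightarrow> ('a, 'm) module \<Rightarrow> ('a, 'n) module \<Rightarrow> ('m \<Rightarrow> 'n) set" where
  "mod_hom A M N = {f \<in> carrier M \<rightarrow> carrier N.
     (\<forall>x\<in>carrier M. \<forall>y\<in>carrier M. f (x \<oplus>\<^bsub>M\<^esub> y) = f x \<oplus>\<^bsub>N\<^esub> f y) \<and>
     (\<forall>r\<in>carrier A. \<forall>x\<in>carrier M. f (r \<odot>\<^bsub>M\<^esub> x) = r \<odot>\<^bsub>N\<^esub> f x)}"

definition mod_iso :: "('a, 'x) ring_scheme \<Rightarrow> ('a, 'm) module \<Rightarrow> ('a, 'n) module \<Rightarrow> bool" where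
  "mod_iso A M N \<longleftrightarrow> left_module A M \<and> left_module A N \<and>
     (\<exists>f\<in>mod_hom A M N. bij_betw f (carrier M) (carrier N))"

text \<open>The length of a module: the supremum of the lengths of strict chains of submodules.\<close>
definition mod_length :: "('a, 'x) ring_scheme \<Rightarrow> ('a, 'm) module \<Rightarrow> enat" where
  "mod_length A M = (SUP n \<in> {n. \<exists>c :: nat \<Rightarrow> 'm set.
      (\<forall>i\<le>n. submodule (c i) A M) \<and> (\<forall>i<n. c i \<subset> c (Suc i))}. enat n)"

definition fl_module :: "('a, 'x) ring_scheme \<Rightarrow> ('a, 'm) module \<Rightarrow> bool" where
  "fl_module A M \<longleftrightarrow> left_module A M \<and> mod_length A M < \<infinity>"

definition simple_submodule :: "'m set \<Rightarrow> ('a, 'x) ring_scheme \<Rightarrow> ('a, 'm) module \<Rightarrow> bool" where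
  "simple_submodule S A M \<longleftrightarrow> submodule S A M \<and> S \<noteq> {\<zero>\<^bsub>M\<^esub>} \<and>
     (\<forall>N. submodule N A M \<and> N \<subseteq> S \<longrightarrow> N = {\<zero>\<^bsub>M\<^esub>} \<or> N = S)"

definition soc :: "('a, 'x) ring_scheme \<Rightarrow> ('a, 'm) module \<Rightarrow> 'm set" where
  "soc A M = submodule_span A M (\<Union>{S. simple_submodule S A M})"

definition maximal_submodule :: "'m set \<Rightarrow> ('a, 'x) ring_scheme \<Rightarrow> ('a, 'm) module \<Rightarrow> bool" where
  "maximal_submodule N A M \<longleftrightarrow> submodule N A M \<and> N \<noteq> carrier M \<and>
     (\<forall>L. submodule L A M \<and> N \<subseteq> L \<longrightarrow> L = N \<or> L = carrier M)"

definition indecomposable :: "('a, 'x) ring_scheme \<Rightarrow> ('a, 'm) module \<Rightarrow> bool" where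
  "indecomposable A M \<longleftrightarrow> carrier M \<noteq> {\<zero>\<^bsub>M\<^esub>} \<and>
     (\<forall>X Y. submodule X A M \<and> submodule Y A M \<and>
        X \<inter> Y = {\<zero>\<^bsub>M\<^esub>} \<and> X <+>\<^bsub>M\<^esub> Y = carrier M \<longrightarrow>
        X = {\<zero>\<^bsub>M\<^esub>} \<or> Y = {\<zero>\<^bsub>M\<^esub>})"


section \<open>Short local algebras\<close>

definition jacobson_radical :: "('a, 'x) ring_scheme \<Rightarrow> 'a set" where
  "jacobson_radical A = carrier A \<inter> \<Inter>{I. maximal_submodule I A (regular A)}"

text \<open>
  A \<open>K\<close>-algebra is a ring record extended by the scalar multiplication with \<open>K\<close>;
  this is the locale \<^locale>\<open>algebra\<close> of the library without commutativity.
\<close>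
locale fin_dim_algebra = K?: field K + Module.module K A + A?: ring A
  for K :: "('k, 'x) ring_scheme" (structure) and A :: "('k, 'a, 'y) module_scheme" (structure) +
  assumes smult_mult_l:
      "\<lbrakk>c \<in> carrier K; x \<in> carrier A; y \<in> carrier A\<rbrakk> \<Longrightarrow>
        (c \<odot>\<^bsub>A\<^esub> x) \<otimes>\<^bsub>A\<^esub> y = c \<odot>\<^bsub>A\<^esub> (x \<otimes>\<^bsub>A\<^esub> y)"
    and smult_mult_r:
      "\<lbrakk>c \<in> carrier K; x \<in> carrier A; y \<in> carrier A\<rbrakk> \<Longrightarrow>
        x \<otimes>\<^bsub>A\<^esub> (c \<odot>\<^bsub>A\<^esub> y) = c \<odot>\<^bsub>A\<^esub> (x \<otimes>\<^bsub>A\<^esub> y)"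
    and fin_dim:
      "\<exists>B. finite B \<and> B \<subseteq> carrier A \<and>
        (\<forall>x\<in>carrier A. \<exists>c\<in>B \<rightarrow> carrier K. x = (\<Oplus>\<^bsub>A\<^esub>b\<in>B. c b \<odot>\<^bsub>A\<^esub> b))"

text \<open>The condition \<open>A/J = k\<close> says that the canonical map \<open>k \<rightarrow> A/J\<close> is bijective.\<close>
locale split_local_algebra = fin_dim_algebra +
  assumes unique_maximal_left_ideal: "\<exists>!I. maximal_submodule I A (regular A)"
    and residue_field:
      "bij_betw (\<lambda>c. jacobson_radical A +>\<^bsub>A\<^esub> (c \<odot>\<^bsub>A\<^esub> \<one>\<^bsub>A\<^esub>))
        (carrier K) (carrier (A Quot jacobson_radical A))"

locale short_local_algebra = split_local_algebra +
  assumes short: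
    "ideal_prod A (ideal_prod A (jacobson_radical A) (jacobson_radical A)) (jacobson_radical A)
      = {\<zero>\<^bsub>A\<^esub>}"

definition hilbert_type :: "('a, 'x) ring_scheme \<Rightarrow> nat \<Rightarrow> nat \<Rightarrow> bool" where
  "hilbert_type A e a \<longleftrightarrow> (let J = jacobson_radical A; J2 = ideal_prod A J J in
     mod_length A (quot (sub (regular A) J) J2) = enat e \<and>
     mod_length A (sub (regular A) J2) = enat a)"

text \<open>\<open>top_length A J M\<close> is \<open>|M/JM|\<close>.\<close>
definition top_length :: "('a, 'x) ring_scheme \<Rightarrow> 'a set \<Rightarrow> ('a, 'm) module \<Rightarrow> enat" where
  "top_length A J M = mod_length A (quot M (ideal_smult A J M))"

text \<open>
  \<open>has_dim_vec A J M x y\<close>: \<open>M\<close> has Loewy length at most 2 and dimension vector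
  \<open>(x, y)\<close>. For a right module, \<open>A\<close> is replaced by \<open>opp A\<close>, while \<open>J\<close> is
  still the radical of \<open>A\<close>, so that \<^const>\<open>ideal_smult\<close> yields \<open>MJ\<close>.
\<close>
definition has_dim_vec ::
  "('a, 'x) ring_scheme \<Rightarrow> 'a set \<Rightarrow> ('a, 'm) module \<Rightarrow> nat \<Rightarrow> nat \<Rightarrow> bool" where
  "has_dim_vec A J M x y \<longleftrightarrow>
     left_module A M \<and>
     ideal_smult A J (sub M (ideal_smult A J M)) = {\<zero>\<^bsub>M\<^esub>} \<and>
     top_length A J M = enat x \<and>
     mod_length A (sub M (ideal_smult A J M)) = enat y"


section \<open>Projective and injective modules, covers and approximations\<close>

text \<open>
  Auxiliary modules that are quantified over have their carrier in the type
  \<^typ>\<open>nat \<Rightarrow> 'a\<close>. A module of finite length over \<open>A\<close> is a quotient of some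
  \<open>A\<^sup>n\<close>, so its carrier injects into this type: every finite length module is isomorphic
  to one of type \<open>'a umod\<close>.
\<close>
type_synonym 'a umod = "('a, nat \<Rightarrow> 'a) module"

definition projective :: "('a, 'x) ring_scheme \<Rightarrow> ('a, 'p) module \<Rightarrow> bool" where
  "projective A P \<longleftrightarrow> fl_module A P \<and>
     (\<forall>(X :: 'a umod) (Y :: 'a umod) g f.
        fl_module A X \<and> fl_module A Y \<and>
        g \<in> mod_hom A X Y \<and> g ` carrier X = carrier Y \<and> f \<in> mod_hom A P Y \<longrightarrow>
        (\<exists>h\<in>mod_hom A P X. \<forall>p\<in>carrier P. g (h p) = f p))"

definition injective :: "('a, 'x) ring_scheme \<Rightarrow> ('a, 'q) module \<Rightarrow> bool" where
  "injective A Q \<longleftrightarrow> fl_module A Q \<and>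
     (\<forall>(X :: 'a umod) (Y :: 'a umod) g f.
        fl_module A X \<and> fl_module A Y \<and>
        g \<in> mod_hom A X Y \<and> inj_on g (carrier X) \<and> f \<in> mod_hom A X Q \<longrightarrow>
        (\<exists>h\<in>mod_hom A Y Q. \<forall>x\<in>carrier X. h (g x) = f x))"

definition self_injective :: "('a, 'x) ring_scheme \<Rightarrow> bool" where
  "self_injective A \<longleftrightarrow> injective A (regular A)"

definition projective_cover ::
  "('a, 'x) ring_scheme \<Rightarrow> ('a, 'p) module \<Rightarrow> ('p \<Rightarrow> 'm) \<Rightarrow> ('a, 'm) module \<Rightarrow> bool" where
  "projective_cover A P p M \<longleftrightarrow> projective A P \<and>
     p \<in> mod_hom A P M \<and> p ` carrier P = carrier M \<and>
     (\<forall>N. submodule N A P \<and> N <+>\<^bsub>P\<^esub> a_kernel P M p = carrier P \<longrightarrow> N = carrier P)"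

text \<open>Minimal left \<open>add A\<close>-approximations.\<close>
definition min_left_approx ::
  "('a, 'x) ring_scheme \<Rightarrow> ('a, 'm) module \<Rightarrow> ('m \<Rightarrow> 'p) \<Rightarrow> ('a, 'p) module \<Rightarrow> bool" where
  "min_left_approx A M u P \<longleftrightarrow> projective A P \<and> u \<in> mod_hom A M P \<and>
     (\<forall>(Q :: 'a umod) f. projective A Q \<and> f \<in> mod_hom A M Q \<longrightarrow>
        (\<exists>h\<in>mod_hom A P Q. \<forall>x\<in>carrier M. h (u x) = f x)) \<and>
     (\<forall>h\<in>mod_hom A P P. (\<forall>x\<in>carrier M. h (u x) = u x) \<longrightarrow>
        bij_betw h (carrier P) (carrier P))"

text \<open>
  \<open>\<Omega>\<close> and \<open>\<mho>\<close> are determined up to isomorphism only and are rendered as relations: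
  \<open>is_Omega A M X\<close> and \<open>is_mho A M X\<close> say that \<open>X\<close> is (isomorphic to)
  \<open>\<Omega>M\<close> and \<open>\<mho>M\<close>, respectively.
\<close>
definition is_Omega :: "('a, 'x) ring_scheme \<Rightarrow> ('a, 'm) module \<Rightarrow> ('a, 'n) module \<Rightarrow> bool" where
  "is_Omega A M X \<longleftrightarrow>
     (\<exists>(P :: 'a umod) p. projective_cover A P p M \<and> mod_iso A (sub P (a_kernel P M p)) X)"

definition is_mho :: "('a, 'x) ring_scheme \<Rightarrow> ('a, 'm) module \<Rightarrow> ('a, 'n) module \<Rightarrow> bool" where
  "is_mho A M X \<longleftrightarrow>
     (\<exists>(P :: 'a umod) u. min_left_approx A M u P \<and> mod_iso A (quot P (u ` carrier M)) X)"

primrec is_Omega_pow ::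
  "('a, 'x) ring_scheme \<Rightarrow> nat \<Rightarrow> ('a, 'm) module \<Rightarrow> 'a umod \<Rightarrow> bool" where
  "is_Omega_pow A 0 M X \<longleftrightarrow> mod_iso A M X"
| "is_Omega_pow A (Suc i) M X \<longleftrightarrow> (\<exists>Y. is_Omega_pow A i M Y \<and> is_Omega A Y X)"

primrec is_mho_pow ::
  "('a, 'x) ring_scheme \<Rightarrow> nat \<Rightarrow> ('a, 'm) module \<Rightarrow> 'a umod \<Rightarrow> bool" where
  "is_mho_pow A 0 M X \<longleftrightarrow> mod_iso A M X"
| "is_mho_pow A (Suc i) M X \<longleftrightarrow> (\<exists>Y. is_mho_pow A i M Y \<and> is_mho A Y X)"


section \<open>Duality\<close>

text \<open>
  \<open>dual A M\<close> is \<open>Hom\<^sub>A(M, A)\<close>, a left module over \<open>opp A\<close> via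
  \<open>(f r)(m) = f(m) r\<close>. Since \<open>opp (opp A) = A\<close>, the bidual of \<open>M\<close> is
  \<open>dual (opp A) (dual A M)\<close>. Homomorphisms are taken to be \<^const>\<open>extensional\<close> so that
  equality of elements of the dual is equality of maps on the carrier.
\<close>
definition dual :: "('a, 'x) ring_scheme \<Rightarrow> ('a, 'm) module \<Rightarrow> ('a, 'm \<Rightarrow> 'a) module" where
  "dual A M = \<lparr>carrier = mod_hom A M (regular A) \<inter> extensional (carrier M),
     mult = undefined, one = undefined,
     zero = (\<lambda>m\<in>carrier M. \<zero>\<^bsub>A\<^esub>),
     add = (\<lambda>f g. \<lambda>m\<in>carrier M. f m \<oplus>\<^bsub>A\<^esub> g m),
     smult = (\<lambda>r f. \<lambda>m\<in>carrier M. f m \<otimes>\<^bsub>A\<^esub> r)\<rparr>"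

definition dual_map :: "('a, 'm) module \<Rightarrow> ('m \<Rightarrow> 'n) \<Rightarrow> ('n \<Rightarrow> 'a) \<Rightarrow> ('m \<Rightarrow> 'a)" where
  "dual_map M f \<phi> = (\<lambda>m\<in>carrier M. \<phi> (f m))"

definition torsionless :: "('a, 'x) ring_scheme \<Rightarrow> ('a, 'm) module \<Rightarrow> bool" where
  "torsionless A M \<longleftrightarrow>
     (\<exists>(P :: 'a umod) u. projective A P \<and> u \<in> mod_hom A M P \<and> inj_on u (carrier M))"

definition reflexive_module :: "('a, 'x) ring_scheme \<Rightarrow> ('a, 'm) module \<Rightarrow> bool" where
  "reflexive_module A M \<longleftrightarrow>
     bij_betw (\<lambda>m. \<lambda>f\<in>carrier (dual A M). f m)
       (carrier M) (carrier (dual (opp A) (dual A M)))"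


section \<open>Ext, semi-Gorenstein-projective and Gorenstein-projective modules\<close>

text \<open>A projective resolution \<open>\<dots> \<rightarrow> P 2 \<rightarrow> P 1 \<rightarrow> P 0 \<rightarrow> M \<rightarrow> 0\<close>
  with differentials \<open>d i : P (i + 1) \<rightarrow> P i\<close> and augmentation \<open>p\<close>.\<close>
definition proj_resolution ::
  "('a, 'x) ring_scheme \<Rightarrow> (nat \<Rightarrow> ('a, 'p) module) \<Rightarrow> (nat \<Rightarrow> 'p \<Rightarrow> 'p) \<Rightarrow> ('p \<Rightarrow> 'm) \<Rightarrow>
    ('a, 'm) module \<Rightarrow> bool" where
  "proj_resolution A P d p M \<longleftrightarrow>
     (\<forall>i. projective A (P i) \<and> d i \<in> mod_hom A (P (Suc i)) (P i)) \<and>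
     p \<in> mod_hom A (P 0) M \<and> p ` carrier (P 0) = carrier M \<and>
     d 0 ` carrier (P 1) = a_kernel (P 0) M p \<and>
     (\<forall>i. d (Suc i) ` carrier (P (Suc (Suc i))) = a_kernel (P (Suc i)) (P i) (d i))"

text \<open>
  \<open>ext_vanishes A j M N\<close> is \<open>Ext\<^sup>j\<^sup>+\<^sup>1(M, N) = 0\<close>: the complex \<open>Hom(P, N)\<close> for a projective
  resolution \<open>P\<close> of \<open>M\<close> has no cohomology in degree \<open>j + 1\<close>.
\<close>
definition ext_vanishes ::
  "('a, 'x) ring_scheme \<Rightarrow> nat \<Rightarrow> ('a, 'm) module \<Rightarrow> ('a, 'n) module \<Rightarrow> bool" where
  "ext_vanishes A j M N \<longleftrightarrow>
     (\<exists>(P :: nat \<Rightarrow> 'a umod) d p. proj_resolution A P d p M \<and>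
        (\<forall>f\<in>mod_hom A (P (Suc j)) N.
           (\<forall>x\<in>carrier (P (Suc (Suc j))). f (d (Suc j) x) = \<zero>\<^bsub>N\<^esub>) \<longrightarrow>
           (\<exists>g\<in>mod_hom A (P j) N. \<forall>x\<in>carrier (P (Suc j)). f x = g (d j x))))"

definition semi_Gorenstein_projective ::
  "('a, 'x) ring_scheme \<Rightarrow> ('a, 'm) module \<Rightarrow> bool" where
  "semi_Gorenstein_projective A M \<longleftrightarrow> fl_module A M \<and> (\<forall>j. ext_vanishes A j M (regular A))"

text \<open>
  Auslander's transpose: the cokernel (a right module) of \<open>f\<^sup>* : P\<^sub>0\<^sup>* \<rightarrow> P\<^sub>1\<^sup>*\<close> for a minimal
  projective presentation \<open>f : P\<^sub>1 \<rightarrow> P\<^sub>0\<close> of \<open>M\<close>; again a relation up to isomorphism.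
\<close>
definition is_transpose ::
  "('a, 'x) ring_scheme \<Rightarrow> ('a, 'm) module \<Rightarrow> ('a, 'n) module \<Rightarrow> bool" where
  "is_transpose A M T \<longleftrightarrow>
     (\<exists>(P0 :: 'a umod) (P1 :: 'a umod) p f.
        projective_cover A P0 p M \<and>
        projective_cover A P1 f (sub P0 (a_kernel P0 M p)) \<and>
        mod_iso (opp A) (quot (dual A P1) (dual_map P1 f ` carrier (dual A P0))) T)"

definition inf_torsionfree :: "('a, 'x) ring_scheme \<Rightarrow> ('a, 'm) module \<Rightarrow> bool" where
  "inf_torsionfree A M \<longleftrightarrow>
     (\<exists>T :: 'a umod. is_transpose A M T \<and> semi_Gorenstein_projective (opp A) T)"

text \<open>The differentials are \<open>d i : P i \<rightarrow> P (i - 1)\<close>.\<close>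
definition Gorenstein_projective :: "('a, 'x) ring_scheme \<Rightarrow> ('a, 'm) module \<Rightarrow> bool" where
  "Gorenstein_projective A M \<longleftrightarrow>
     (\<exists>(P :: int \<Rightarrow> 'a umod) d.
        (\<forall>i. projective A (P i) \<and> d i \<in> mod_hom A (P i) (P (i - 1))) \<and>
        (\<forall>i. d (i + 1) ` carrier (P (i + 1)) = a_kernel (P i) (P (i - 1)) (d i)) \<and>
        (\<forall>i. dual_map (P i) (d i) ` carrier (dual A (P (i - 1))) =
             a_kernel (dual A (P i)) (dual A (P (i + 1))) (dual_map (P (i + 1)) (d (i + 1)))) \<and>
        (\<exists>i. mod_iso A (sub (P (i - 1)) (d i ` carrier (P i))) M))"

end

theory Submission
  imports Defs
begin

text \<open>
  A minimal projective resolution of \<open>M\<close> (or of \<open>Tr M\<close>, over the opposite algebra) that stays exact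
  under \<open>Hom(-, A)\<close> is a complex of matrices with coefficients in \<open>J\<close> that is exact for row vectors
  and for column vectors. Baer's criterion shows that \<open>Ext\<^sup>1(k, A) \<noteq> 0\<close> if \<open>A\<close> is not self-injective;
  hence \<open>k\<close> is not a direct summand of a syzygy, so a syzygy \<open>K \<subseteq> J F\<close> satisfies \<open>J K = J\<^sup>2 F\<close>. The
  pairing of rows and columns transfers this to the transposed complex, and the condition
  \<open>Ext\<^sup>1(k, A) = 0\<close> is left-right symmetric. Counting lengths gives
  \<open>n\<^sub>i\<^sub>+\<^sub>1 + a n\<^sub>i\<^sub>-\<^sub>1 = e n\<^sub>i\<close> and \<open>n\<^sub>i\<^sub>-\<^sub>1 + a n\<^sub>i\<^sub>+\<^sub>1 = e n\<^sub>i\<close> for the ranks \<open>n\<^sub>i\<close> of the free modules. For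
  \<open>a \<ge> 2\<close> this forces \<open>n\<^sub>i\<^sub>+\<^sub>1 = n\<^sub>i\<^sub>-\<^sub>1\<close>, then \<open>e = a + 1\<close> and \<open>n\<^sub>i = t\<close> for all \<open>i\<close>, so that all syzygies have
  dimension vector \<open>(t, a t)\<close>. Cosyzygies and duals are read off the transposed complex.
\<close>

text \<open>The complexes at hand are one-sided, and this shapes the proof. A
  semi-Gorenstein-projective module gives exactness only beyond its own place, whereas the counts
  need it on both sides of a differential and so concern the places \<open>Suc i\<close>. To reach
  \<open>M\<close> itself the complex is prolonged to the left: by one place if functionals separate
  the points of \<open>M\<close>, by a second one if \<open>M\<close> is reflexive. In a resolution
  of \<open>Tr M\<close> the module \<open>M\<close> sits at place 1 from the start, but that
  complex lives over \<open>opp A\<close>; there the left-right symmetry of Ext^1(k, A) = 0 is used.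
  Two small values of \<open>a\<close> must be excluded before the ranks can be compared. For
  \<open>J^2 = 0\<close> the differentials kill \<open>J F\<close>, and k splits off a syzygy. For
  \<open>a = 1\<close> the left socle is \<open>J^2\<close>, and then \<open>A\<close> is so close
  to a Frobenius algebra that Ext^1(k, A) = 0. Finally, the vanishing of Ext is tested in each
  degree on a resolution of its own, so all these have to be compared with one minimal
  resolution.\<close>

lemma opp_simps [simp]:
  "carrier (opp A) = carrier A" "zero (opp A) = zero A" "add (opp A) = add A" "one (opp A) = one A"
  "mult (opp A) x y = mult A y x" "opp (opp A) = A" "a_inv (opp A) = a_inv A" "finsum (opp A) = finsum A"
  "a_minus (opp A) = a_minus A"
  by (auto simp: opp_def a_inv_def m_inv_def finsum_def a_minus_def finprod_def fun_eq_iff)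

lemma regular_simps [simp]:
  "carrier (regular A) = carrier A" "zero (regular A) = zero A" "add (regular A) = add A"
  "smult (regular A) = mult A" "a_inv (regular A) = a_inv A" "finsum (regular A) = finsum A"
  "a_minus (regular A) = a_minus A"
  by (auto simp: regular_def a_inv_def m_inv_def finsum_def a_minus_def finprod_def fun_eq_iff)

lemma sub_simps [simp]:
  "carrier (sub M N) = N" "zero (sub M N) = zero M" "add (sub M N) = add M"
  "smult (sub M N) = smult M" "sub (sub M N) N' = sub M N'"
  by (auto simp: sub_def)

lemma (in ring) ring_opp: "ring (opp R)"
  by (rule ringI) (auto intro!: abelian_groupI monoidI simp: l_distr r_distr m_assoc a_assoc a_comm a_lcomm
      intro: l_neg)

lemma ring_opp_iff [simp]: "ring (opp R) \<longleftrightarrow> ring R"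
  using ring.ring_opp opp_simps(6) by metis

section \<open>Left modules and their submodules\<close>

lemma left_moduleI:
  assumes "ring A" "abelian_group M"
    "\<And>a x. \<lbrakk>a \<in> carrier A; x \<in> carrier M\<rbrakk> \<Longrightarrow> a \<odot>\<^bsub>M\<^esub> x \<in> carrier M"
    "\<And>a b x. \<lbrakk>a \<in> carrier A; b \<in> carrier A; x \<in> carrier M\<rbrakk> \<Longrightarrow>
        (a \<oplus>\<^bsub>A\<^esub> b) \<odot>\<^bsub>M\<^esub> x = a \<odot>\<^bsub>M\<^esub> x \<oplus>\<^bsub>M\<^esub> b \<odot>\<^bsub>M\<^esub> x"
    "\<And>a x y. \<lbrakk>a \<in> carrier A; x \<in> carrier M; y \<in> carrier M\<rbrakk> \<Longrightarrow>
        a \<odot>\<^bsub>M\<^esub> (x \<oplus>\<^bsub>M\<^esub> y) = a \<odot>\<^bsub>M\<^esub> x \<oplus>\<^bsub>M\<^esub> a \<odot>\<^bsub>M\<^esub> y"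
    "\<And>a b x. \<lbrakk>a \<in> carrier A; b \<in> carrier A; x \<in> carrier M\<rbrakk> \<Longrightarrow>
        (a \<otimes>\<^bsub>A\<^esub> b) \<odot>\<^bsub>M\<^esub> x = a \<odot>\<^bsub>M\<^esub> (b \<odot>\<^bsub>M\<^esub> x)"
    "\<And>x. x \<in> carrier M \<Longrightarrow> \<one>\<^bsub>A\<^esub> \<odot>\<^bsub>M\<^esub> x = x"
  shows "left_module A M"
  using assms by (simp add: left_module_def left_module_axioms_def)

context left_module
begin

lemma smult_zero_r [simp]: "a \<in> carrier R \<Longrightarrow> a \<odot>\<^bsub>M\<^esub> \<zero>\<^bsub>M\<^esub> = \<zero>\<^bsub>M\<^esub>"
  by (metis M.add.l_cancel_one' M.zero_closed smult_closed smult_r_distr M.r_zero)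

lemma smult_zero_l [simp]: "x \<in> carrier M \<Longrightarrow> \<zero> \<odot>\<^bsub>M\<^esub> x = \<zero>\<^bsub>M\<^esub>"
  by (metis M.add.l_cancel_one' R.zero_closed smult_closed smult_l_distr R.r_zero)

lemma smult_minus_l:
  assumes "a \<in> carrier R" "x \<in> carrier M"
  shows "(\<ominus> a) \<odot>\<^bsub>M\<^esub> x = \<ominus>\<^bsub>M\<^esub> (a \<odot>\<^bsub>M\<^esub> x)"
proof -
  have "(\<ominus> a) \<odot>\<^bsub>M\<^esub> x \<oplus>\<^bsub>M\<^esub> a \<odot>\<^bsub>M\<^esub> x = \<zero>\<^bsub>M\<^esub>"
    using assms by (metis R.a_inv_closed R.l_neg smult_l_distr smult_zero_l)
  then show ?thesis using assms by (metis M.minus_equality R.a_inv_closed smult_closed)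
qed

lemma smult_minus_r:
  assumes "a \<in> carrier R" "x \<in> carrier M"
  shows "a \<odot>\<^bsub>M\<^esub> (\<ominus>\<^bsub>M\<^esub> x) = \<ominus>\<^bsub>M\<^esub> (a \<odot>\<^bsub>M\<^esub> x)"
proof -
  have "a \<odot>\<^bsub>M\<^esub> (\<ominus>\<^bsub>M\<^esub> x) \<oplus>\<^bsub>M\<^esub> a \<odot>\<^bsub>M\<^esub> x = \<zero>\<^bsub>M\<^esub>"
    using assms by (metis M.a_inv_closed M.l_neg smult_r_distr smult_zero_r)
  then show ?thesis using assms by (metis M.minus_equality M.a_inv_closed smult_closed)
qed

lemma minus_eq_zero_iff [simp]:
  assumes "x \<in> carrier M" "y \<in> carrier M" shows "x \<ominus>\<^bsub>M\<^esub> y = \<zero>\<^bsub>M\<^esub> \<longleftrightarrow> x = y"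
  using assms M.minus_unique[of "\<ominus>\<^bsub>M\<^esub> y"] M.r_neg M.l_neg M.a_inv_closed
  by (metis M.minus_equality M.minus_minus a_minus_def)

lemma minus_add_cancel:
  assumes "x \<in> carrier M" "y \<in> carrier M" shows "(x \<ominus>\<^bsub>M\<^esub> y) \<oplus>\<^bsub>M\<^esub> y = x"
  using assms M.l_neg M.a_assoc unfolding a_minus_def by simp

lemma add_minus_add_cancel:
  assumes "x \<in> carrier M" "y \<in> carrier M" "z \<in> carrier M"
  shows "(x \<oplus>\<^bsub>M\<^esub> y) \<ominus>\<^bsub>M\<^esub> (x \<oplus>\<^bsub>M\<^esub> z) = y \<ominus>\<^bsub>M\<^esub> z"
proof -
  have "(x \<oplus>\<^bsub>M\<^esub> y) \<ominus>\<^bsub>M\<^esub> (x \<oplus>\<^bsub>M\<^esub> z) = y \<oplus>\<^bsub>M\<^esub> (x \<oplus>\<^bsub>M\<^esub> (\<ominus>\<^bsub>M\<^esub> x \<oplus>\<^bsub>M\<^esub> \<ominus>\<^bsub>M\<^esub> z))"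
    using assms by (simp add: a_minus_def M.minus_add M.a_assoc M.a_lcomm)
  then show ?thesis using assms by (simp add: a_minus_def M.r_neg2)
qed

lemma minus_minus_cancel:
  assumes "x \<in> carrier M" "y \<in> carrier M" shows "x \<ominus>\<^bsub>M\<^esub> (x \<ominus>\<^bsub>M\<^esub> y) = y"
  using assms by (simp add: a_minus_def M.minus_add M.r_neg2)

lemma smult_minus_one: "x \<in> carrier M \<Longrightarrow> (\<ominus> \<one>) \<odot>\<^bsub>M\<^esub> x = \<ominus>\<^bsub>M\<^esub> x"
  by (simp add: smult_minus_l smult_one)

text \<open>Closure under negation is multiplication by \<open>\<ominus> \<one>\<close> and is
  therefore not among the conditions.\<close>

lemma submodI:
  assumes "N \<subseteq> carrier M" "\<zero>\<^bsub>M\<^esub> \<in> N" "\<And>x y. \<lbrakk>x \<in> N; y \<in> N\<rbrakk> \<Longrightarrow> x \<oplus>\<^bsub>M\<^esub> y \<in> N"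
    and sm: "\<And>r x. \<lbrakk>r \<in> carrier R; x \<in> N\<rbrakk> \<Longrightarrow> r \<odot>\<^bsub>M\<^esub> x \<in> N"
  shows "submodule N R M"
proof -
  have "\<ominus>\<^bsub>M\<^esub> x \<in> N" if "x \<in> N" for x
    using sm[of "\<ominus> \<one>" x] that assms(1) smult_minus_one by auto
  then have "subgroup N (add_monoid M)"
    using assms by (auto intro!: subgroup.intro simp: a_inv_def[symmetric])
  then show ?thesis using assms by (simp add: submodule_def submodule_axioms_def)
qed

end

lemma submodD:
  assumes "submodule N A M"
  shows "N \<subseteq> carrier M" "\<And>x. x \<in> N \<Longrightarrow> x \<in> carrier M" "\<zero>\<^bsub>M\<^esub> \<in> N"
    "\<And>x y. \<lbrakk>x \<in> N; y \<in> N\<rbrakk> \<Longrightarrow> x \<oplus>\<^bsub>M\<^esub> y \<in> N"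
    "\<And>r x. \<lbrakk>r \<in> carrier A; x \<in> N\<rbrakk> \<Longrightarrow> r \<odot>\<^bsub>M\<^esub> x \<in> N"
    "\<And>x. x \<in> N \<Longrightarrow> \<ominus>\<^bsub>M\<^esub> x \<in> N"
    "\<And>x y. \<lbrakk>x \<in> N; y \<in> N\<rbrakk> \<Longrightarrow> x \<ominus>\<^bsub>M\<^esub> y \<in> N"
proof -
  have s: "subgroup N (add_monoid M)" using assms by (simp add: submodule_def)
  show "N \<subseteq> carrier M" "\<And>x. x \<in> N \<Longrightarrow> x \<in> carrier M" "\<zero>\<^bsub>M\<^esub> \<in> N"
    and add: "\<And>x y. \<lbrakk>x \<in> N; y \<in> N\<rbrakk> \<Longrightarrow> x \<oplus>\<^bsub>M\<^esub> y \<in> N"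
    and inv: "\<And>x. x \<in> N \<Longrightarrow> \<ominus>\<^bsub>M\<^esub> x \<in> N"
    using subgroup.subset[OF s] subgroup.one_closed[OF s] subgroup.m_closed[OF s] subgroup.m_inv_closed[OF s]
    by (simp_all add: a_inv_def subset_iff)
  show "\<And>x y. \<lbrakk>x \<in> N; y \<in> N\<rbrakk> \<Longrightarrow> x \<ominus>\<^bsub>M\<^esub> y \<in> N"
    using add inv by (simp add: a_minus_def)
  show "\<And>r x. \<lbrakk>r \<in> carrier A; x \<in> N\<rbrakk> \<Longrightarrow> r \<odot>\<^bsub>M\<^esub> x \<in> N"
    using assms by (simp add: submodule_def submodule_axioms_def)
qed

text \<open>Length depends on the lattice of submodules only. This is how lengths over
  \<open>A\<close> and over \<open>opp A\<close> are compared, whose actions on \<open>J/J^2\<close>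
  and on \<open>J^2\<close> agree.\<close>

lemma submodule_cong:
  assumes "carrier A = carrier B" "carrier M = carrier M'" "zero M = zero M'" "add M = add M'"
    "\<And>r x. \<lbrakk>r \<in> carrier A; x \<in> carrier M\<rbrakk> \<Longrightarrow> r \<odot>\<^bsub>M\<^esub> x = r \<odot>\<^bsub>M'\<^esub> x"
  shows "submodule N A M \<longleftrightarrow> submodule N B M'"
proof -
  have "subgroup N (add_monoid M) \<longleftrightarrow> subgroup N (add_monoid M')"
    using assms by (simp add: subgroup_def m_inv_def)
  moreover have "subgroup N (add_monoid M) \<Longrightarrow> N \<subseteq> carrier M" using subgroup.subset[of N "add_monoid M"] by simp
  ultimately show ?thesis
    using assms by (auto simp: submodule_def submodule_axioms_def subset_iff)
qed

text \<open>Restricts the module to the record type without extension, on which \<open>sub\<close>,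
  \<open>quot\<close> and \<open>mod_hom\<close> are defined.\<close>

locale lmod = left_module R M for R :: "('a, 'x) ring_scheme" (structure) and M :: "('a, 'm) module" (structure)

context lmod
begin

text \<open>The additive inverse is described inside the carrier of the record, so it has to be
  checked that it survives the passage to \<open>sub M N\<close>.\<close>

lemma sub_inv:
  assumes "submodule N R M" "x \<in> N" shows "\<ominus>\<^bsub>sub M N\<^esub> x = \<ominus>\<^bsub>M\<^esub> x"
proof -
  have "subgroup N (add_monoid M)" using assms by (simp add: submodule_def)
  from M.add.m_inv_consistent[OF this assms(2)] show ?thesis
    by (simp add: a_inv_def sub_def)
qed

lemma sub_left_module:
  assumes N: "submodule N R M" shows "left_module R (sub M N)"
proof (rule left_moduleI)
  note d = submodD[OF N]
  show "abelian_group (sub M N)"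
  proof (rule abelian_groupI)
    show "\<exists>y\<in>carrier (sub M N). y \<oplus>\<^bsub>sub M N\<^esub> x = \<zero>\<^bsub>sub M N\<^esub>" if "x \<in> carrier (sub M N)" for x
    proof -
      have "\<ominus>\<^bsub>M\<^esub> x \<in> N" "\<ominus>\<^bsub>M\<^esub> x \<oplus>\<^bsub>M\<^esub> x = \<zero>\<^bsub>M\<^esub>" using that d(2,6) M.l_neg by auto
      then show ?thesis by auto
    qed
  qed (use d(2-4) M.a_assoc M.a_comm in auto)
qed (use submodD[OF N] R.ring_axioms in \<open>auto simp: smult_l_distr smult_r_distr smult_assoc smult_one\<close>)

lemma submodule_sub:
  assumes N: "submodule N R M"
  shows "submodule L R (sub M N) \<longleftrightarrow> submodule L R M \<and> L \<subseteq> N"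
proof -
  interpret N: lmod R "sub M N" by (rule lmod.intro) (rule sub_left_module[OF N])
  note d = submodD[OF N]
  show ?thesis
  proof safe
    assume L: "submodule L R (sub M N)"
    note dl = submodD[OF L]
    show "x \<in> L \<Longrightarrow> x \<in> N" for x using dl by auto
    show "submodule L R M" using dl d by (intro submodI) auto
  next
    assume L: "submodule L R M" "L \<subseteq> N"
    then show "submodule L R (sub M N)" using submodD[OF L(1)] by (intro N.submodI) auto
  qed
qed

lemma carrier_submodule: "submodule (carrier M) R M"
  by (intro submodI) (auto intro: smult_closed)

lemma zero_submodule: "submodule {\<zero>\<^bsub>M\<^esub>} R M"
  by (intro submodI) auto

lemma sub_carrier [simp]: "sub M (carrier M) = M"
  by (simp add: sub_def)

lemma submodule_Int:
  assumes "submodule X R M" "submodule Y R M" shows "submodule (X \<inter> Y) R M"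
  using submodD[OF assms(1)] submodD[OF assms(2)] by (intro submodI) auto

lemma submodule_sum:
  assumes "submodule X R M" "submodule Y R M" shows "submodule (X <+>\<^bsub>M\<^esub> Y) R M"
proof (intro submodI)
  note dx = submodD[OF assms(1)] and dy = submodD[OF assms(2)]
  show "X <+>\<^bsub>M\<^esub> Y \<subseteq> carrier M" using dx dy by (auto simp: set_add_def')
  show "\<zero>\<^bsub>M\<^esub> \<in> X <+>\<^bsub>M\<^esub> Y" using dx(3) dy(3) M.l_zero[OF M.zero_closed]
    unfolding set_add_def' by (metis (mono_tags, lifting) UN_iff singletonI)
  show "u \<oplus>\<^bsub>M\<^esub> v \<in> X <+>\<^bsub>M\<^esub> Y" if uv: "u \<in> X <+>\<^bsub>M\<^esub> Y" "v \<in> X <+>\<^bsub>M\<^esub> Y" for u v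
  proof -
    obtain x y x' y' where h: "x \<in> X" "y \<in> Y" "x' \<in> X" "y' \<in> Y" "u = x \<oplus>\<^bsub>M\<^esub> y" "v = x' \<oplus>\<^bsub>M\<^esub> y'"
      using uv by (auto simp: set_add_def')
    have "u \<oplus>\<^bsub>M\<^esub> v = (x \<oplus>\<^bsub>M\<^esub> x') \<oplus>\<^bsub>M\<^esub> (y \<oplus>\<^bsub>M\<^esub> y')"
      using h dx dy by (simp add: M.a_ac)
    moreover have "x \<oplus>\<^bsub>M\<^esub> x' \<in> X" "y \<oplus>\<^bsub>M\<^esub> y' \<in> Y" using h dx(4) dy(4) by auto
    ultimately show ?thesis unfolding set_add_def' by blast
  qed
  show "r \<odot>\<^bsub>M\<^esub> u \<in> X <+>\<^bsub>M\<^esub> Y" if "r \<in> carrier R" "u \<in> X <+>\<^bsub>M\<^esub> Y" for r u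
  proof -
    obtain x y where h: "x \<in> X" "y \<in> Y" "u = x \<oplus>\<^bsub>M\<^esub> y"
      using \<open>u \<in> X <+>\<^bsub>M\<^esub> Y\<close> by (auto simp: set_add_def')
    then have "r \<odot>\<^bsub>M\<^esub> u = r \<odot>\<^bsub>M\<^esub> x \<oplus>\<^bsub>M\<^esub> r \<odot>\<^bsub>M\<^esub> y"
      using smult_r_distr \<open>r \<in> carrier R\<close> dx(2) dy(2) by simp
    moreover have "r \<odot>\<^bsub>M\<^esub> x \<in> X" "r \<odot>\<^bsub>M\<^esub> y \<in> Y" using h dx(5) dy(5) \<open>r \<in> carrier R\<close> by auto
    ultimately show ?thesis unfolding set_add_def' by blast
  qed
qed

lemma sum_upper:
  assumes "submodule X R M" "submodule Y R M" shows "X \<subseteq> X <+>\<^bsub>M\<^esub> Y" "Y \<subseteq> X <+>\<^bsub>M\<^esub> Y"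
proof -
  note dx = submodD[OF assms(1)] and dy = submodD[OF assms(2)]
  show "X \<subseteq> X <+>\<^bsub>M\<^esub> Y"
  proof
    fix x assume "x \<in> X"
    moreover from this have "x = x \<oplus>\<^bsub>M\<^esub> \<zero>\<^bsub>M\<^esub>" using dx by simp
    ultimately show "x \<in> X <+>\<^bsub>M\<^esub> Y" using dy(3) unfolding set_add_def' by blast
  qed
  show "Y \<subseteq> X <+>\<^bsub>M\<^esub> Y"
  proof
    fix x assume "x \<in> Y"
    moreover from this have "x = \<zero>\<^bsub>M\<^esub> \<oplus>\<^bsub>M\<^esub> x" using dy by simp
    ultimately show "x \<in> X <+>\<^bsub>M\<^esub> Y" using dx(3) unfolding set_add_def' by blast
  qed
qed

lemma span_submodule: assumes "S \<subseteq> carrier M" shows "submodule (submodule_span R M S) R M"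
proof (intro submodI)
  show "submodule_span R M S \<subseteq> carrier M"
    using carrier_submodule assms by (auto simp: submodule_span_def)
qed (auto simp: submodule_span_def dest: submodD)

end

lemma span_least: "\<lbrakk>submodule N A M; S \<subseteq> N\<rbrakk> \<Longrightarrow> submodule_span A M S \<subseteq> N"
  by (auto simp: submodule_span_def)

lemma span_upper: "S \<subseteq> submodule_span A M S"
  by (auto simp: submodule_span_def)

section \<open>Homomorphisms\<close>

lemma mod_homI:
  assumes "\<And>x. x \<in> carrier M \<Longrightarrow> f x \<in> carrier N"
    "\<And>x y. \<lbrakk>x \<in> carrier M; y \<in> carrier M\<rbrakk> \<Longrightarrow> f (x \<oplus>\<^bsub>M\<^esub> y) = f x \<oplus>\<^bsub>N\<^esub> f y"
    "\<And>r x. \<lbrakk>r \<in> carrier A; x \<in> carrier M\<rbrakk> \<Longrightarrow> f (r \<odot>\<^bsub>M\<^esub> x) = r \<odot>\<^bsub>N\<^esub> f x"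
  shows "f \<in> mod_hom A M N"
  using assms by (auto simp: mod_hom_def Pi_iff subset_iff)

lemma mod_homD:
  assumes "f \<in> mod_hom A M N"
  shows "\<And>x. x \<in> carrier M \<Longrightarrow> f x \<in> carrier N"
    "\<And>x y. \<lbrakk>x \<in> carrier M; y \<in> carrier M\<rbrakk> \<Longrightarrow> f (x \<oplus>\<^bsub>M\<^esub> y) = f x \<oplus>\<^bsub>N\<^esub> f y"
    "\<And>r x. \<lbrakk>r \<in> carrier A; x \<in> carrier M\<rbrakk> \<Longrightarrow> f (r \<odot>\<^bsub>M\<^esub> x) = r \<odot>\<^bsub>N\<^esub> f x"
  using assms by (auto simp: mod_hom_def Pi_iff subset_iff)

lemma mod_hom_cong:
  "\<lbrakk>f \<in> mod_hom A M N; left_module A M; \<And>x. x \<in> carrier M \<Longrightarrow> g x = f x\<rbrakk> \<Longrightarrow> g \<in> mod_hom A M N"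
  using abelian_group.axioms(1)[OF left_module.axioms(2), of A M]
  by (intro mod_homI) (auto simp: mod_homD left_module.smult_closed abelian_monoid.a_closed)

lemma mod_hom_comp:
  "\<lbrakk>f \<in> mod_hom A L M; g \<in> mod_hom A M N\<rbrakk> \<Longrightarrow> (\<lambda>x. g (f x)) \<in> mod_hom A L N"
  by (auto simp: mod_hom_def Pi_iff subset_iff)

lemma mod_hom_id: "(\<lambda>x. x) \<in> mod_hom A M M"
  by (auto simp: mod_hom_def Pi_iff subset_iff)

lemma mod_hom_sub:
  "\<lbrakk>f \<in> mod_hom A M N; L \<subseteq> carrier M; \<And>x. x \<in> L \<Longrightarrow> f x \<in> K\<rbrakk> \<Longrightarrow> f \<in> mod_hom A (sub M L) (sub N K)"
  by (auto simp: mod_hom_def Pi_iff subset_iff)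

lemma mod_hom_sub_cod: "\<lbrakk>f \<in> mod_hom A M N; \<And>x. x \<in> carrier M \<Longrightarrow> f x \<in> K\<rbrakk> \<Longrightarrow> f \<in> mod_hom A M (sub N K)"
  by (auto simp: mod_hom_def Pi_iff subset_iff)

lemma mod_hom_sub_incl: "\<lbrakk>f \<in> mod_hom A M (sub N K); K \<subseteq> carrier N\<rbrakk> \<Longrightarrow> f \<in> mod_hom A M N"
  by (auto simp: mod_hom_def Pi_iff subset_iff)

lemma mod_hom_zero:
  assumes "f \<in> mod_hom A M N" "left_module A M" "left_module A N" shows "f \<zero>\<^bsub>M\<^esub> = \<zero>\<^bsub>N\<^esub>"
proof -
  interpret M: lmod A M by (rule lmod.intro) fact
  interpret N: lmod A N by (rule lmod.intro) fact
  have "f (\<zero>\<^bsub>A\<^esub> \<odot>\<^bsub>M\<^esub> \<zero>\<^bsub>M\<^esub>) = \<zero>\<^bsub>A\<^esub> \<odot>\<^bsub>N\<^esub> f \<zero>\<^bsub>M\<^esub>"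
    using mod_homD(3)[OF assms(1)] by blast
  then show ?thesis using mod_homD(1)[OF assms(1)] by simp
qed

lemma mod_hom_uminus:
  assumes "f \<in> mod_hom A M N" "left_module A M" "left_module A N" "x \<in> carrier M"
  shows "f (\<ominus>\<^bsub>M\<^esub> x) = \<ominus>\<^bsub>N\<^esub> f x"
proof -
  interpret M: lmod A M by (rule lmod.intro) fact
  interpret N: lmod A N by (rule lmod.intro) fact
  show ?thesis using mod_homD[OF assms(1)] assms(4)
    by (metis M.R.a_inv_closed M.R.one_closed M.smult_minus_one N.smult_minus_one)
qed

lemma mod_hom_minus:
  assumes "f \<in> mod_hom A M N" "left_module A M" "left_module A N" "x \<in> carrier M" "y \<in> carrier M"
  shows "f (x \<ominus>\<^bsub>M\<^esub> y) = f x \<ominus>\<^bsub>N\<^esub> f y"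
proof -
  interpret M: lmod A M by (rule lmod.intro) fact
  show ?thesis using assms mod_homD[OF assms(1)] mod_hom_uminus[OF assms(1-3)] by (simp add: a_minus_def)
qed

lemma mod_hom_add:
  assumes "f \<in> mod_hom A M N" "g \<in> mod_hom A M N" "left_module A N"
  shows "(\<lambda>x. f x \<oplus>\<^bsub>N\<^esub> g x) \<in> mod_hom A M N"
proof -
  interpret N: lmod A N by (rule lmod.intro) fact
  show ?thesis using mod_homD[OF assms(1)] mod_homD[OF assms(2)]
    by (intro mod_homI) (auto simp: N.smult_r_distr N.M.a_ac)
qed

lemma mod_hom_diff:
  assumes "f \<in> mod_hom A M N" "g \<in> mod_hom A M N" "left_module A N"
  shows "(\<lambda>x. f x \<ominus>\<^bsub>N\<^esub> g x) \<in> mod_hom A M N"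
proof -
  interpret N: lmod A N by (rule lmod.intro) fact
  show ?thesis using mod_homD[OF assms(1)] mod_homD[OF assms(2)]
    by (intro mod_homI) (auto simp: a_minus_def N.smult_r_distr N.smult_minus_r N.M.minus_add N.M.a_ac)
qed

lemma kernel_submodule:
  assumes "f \<in> mod_hom A M N" "left_module A M" "left_module A N"
  shows "submodule (a_kernel M N f) A M"
proof -
  interpret M: lmod A M by (rule lmod.intro) fact
  interpret N: lmod A N by (rule lmod.intro) fact
  show ?thesis using mod_homD[OF assms(1)] mod_hom_zero[OF assms]
    by (intro M.submodI) (auto simp: a_kernel_def' M.smult_closed)
qed

lemma image_submodule:
  assumes "f \<in> mod_hom A M N" "left_module A M" "left_module A N" "submodule L A M"
  shows "submodule (f ` L) A N"
proof -
  interpret M: lmod A M by (rule lmod.intro) fact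
  interpret N: lmod A N by (rule lmod.intro) fact
  note h = mod_homD[OF assms(1)] and d = submodD[OF assms(4)]
  show ?thesis
  proof (intro N.submodI)
    show "\<zero>\<^bsub>N\<^esub> \<in> f ` L" using d(3) mod_hom_zero[OF assms(1-3)] by force
    show "x \<oplus>\<^bsub>N\<^esub> y \<in> f ` L" if "x \<in> f ` L" "y \<in> f ` L" for x y
      using that h(2) d(2,4) by (smt (verit) image_iff)
    show "r \<odot>\<^bsub>N\<^esub> x \<in> f ` L" if "r \<in> carrier A" "x \<in> f ` L" for r x
      using that h(3) d(2,5) by (smt (verit) image_iff)
  qed (use h d in auto)
qed

lemma vimage_submodule:
  assumes "f \<in> mod_hom A M N" "left_module A M" "left_module A N" "submodule L A N"
  shows "submodule {x \<in> carrier M. f x \<in> L} A M"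
proof -
  interpret M: lmod A M by (rule lmod.intro) fact
  interpret N: lmod A N by (rule lmod.intro) fact
  show ?thesis using mod_homD[OF assms(1)] mod_hom_zero[OF assms(1-3)] submodD[OF assms(4)]
    by (intro M.submodI) (auto simp: M.smult_closed)
qed

lemma kernel_eq_iff:
  assumes "f \<in> mod_hom A M N" "left_module A M" "left_module A N" "x \<in> carrier M" "y \<in> carrier M"
  shows "f x = f y \<longleftrightarrow> x \<ominus>\<^bsub>M\<^esub> y \<in> a_kernel M N f"
proof -
  interpret M: lmod A M by (rule lmod.intro) fact
  interpret N: lmod A N by (rule lmod.intro) fact
  have "f x \<in> carrier N" "f y \<in> carrier N" using mod_homD(1)[OF assms(1)] assms(4,5) by auto
  then have "f x = f y \<longleftrightarrow> f x \<ominus>\<^bsub>N\<^esub> f y = \<zero>\<^bsub>N\<^esub>" by simp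
  then show ?thesis
    using mod_hom_minus[OF assms] assms(4,5) by (simp add: a_kernel_def')
qed

lemma inj_on_kernel:
  assumes "f \<in> mod_hom A M N" "left_module A M" "left_module A N"
  shows "inj_on f (carrier M) \<longleftrightarrow> a_kernel M N f = {\<zero>\<^bsub>M\<^esub>}"
proof -
  interpret M: lmod A M by (rule lmod.intro) fact
  interpret N: lmod A N by (rule lmod.intro) fact
  show ?thesis
  proof
    assume i: "inj_on f (carrier M)"
    show "a_kernel M N f = {\<zero>\<^bsub>M\<^esub>}"
    proof (intro equalityI subsetI)
      fix x assume "x \<in> a_kernel M N f"
      then have "x \<in> carrier M" "f x = f \<zero>\<^bsub>M\<^esub>" using mod_hom_zero[OF assms] unfolding a_kernel_def' by auto
      then show "x \<in> {\<zero>\<^bsub>M\<^esub>}" using inj_onD[OF i] M.M.zero_closed by blast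
    next
      fix x assume "x \<in> {\<zero>\<^bsub>M\<^esub>}"
      then show "x \<in> a_kernel M N f" using mod_hom_zero[OF assms] M.M.zero_closed unfolding a_kernel_def' by blast
    qed
  next
    assume k: "a_kernel M N f = {\<zero>\<^bsub>M\<^esub>}"
    show "inj_on f (carrier M)"
    proof (rule inj_onI)
      fix x y assume xy: "x \<in> carrier M" "y \<in> carrier M" "f x = f y"
      then have "x \<ominus>\<^bsub>M\<^esub> y = \<zero>\<^bsub>M\<^esub>" using kernel_eq_iff[OF assms xy(1,2)] k by simp
      then show "x = y" using xy by simp
    qed
  qed
qed

text \<open>Universal property of a surjection, mostly used instead of quotient modules:
  \<open>f\<close> composed with a set-theoretic section of \<open>q\<close> does not depend on the
  section, as two preimages differ by an element that \<open>f\<close> kills.\<close>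

lemma mod_hom_factor:
  assumes q: "q \<in> mod_hom A M N" "q ` carrier M = carrier N"
    and f: "f \<in> mod_hom A M L" and M: "left_module A M" and N: "left_module A N" and L: "left_module A L"
    and k: "\<And>x. \<lbrakk>x \<in> carrier M; q x = \<zero>\<^bsub>N\<^esub>\<rbrakk> \<Longrightarrow> f x = \<zero>\<^bsub>L\<^esub>"
  obtains g where "g \<in> mod_hom A N L" "\<And>x. x \<in> carrier M \<Longrightarrow> g (q x) = f x"
proof -
  interpret M: lmod A M by (rule lmod.intro) fact
  have ex: "\<exists>x'. x' \<in> carrier M \<and> x = q x'" if "x \<in> carrier N" for x
    using that unfolding q(2)[symmetric] by blast
  define g where "g = (\<lambda>y. f (inv_into (carrier M) q y))"
  have gq: "g (q x) = f x" if x: "x \<in> carrier M" for x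
  proof -
    let ?y = "inv_into (carrier M) q (q x)"
    have y: "?y \<in> carrier M" "q ?y = q x"
      using x by (auto intro!: inv_into_into f_inv_into_f)
    then have "?y \<ominus>\<^bsub>M\<^esub> x \<in> a_kernel M N q" using kernel_eq_iff[OF q(1) M N y(1) x] by simp
    then have "?y \<ominus>\<^bsub>M\<^esub> x \<in> a_kernel M L f" using k by (simp add: a_kernel_def')
    then show ?thesis using kernel_eq_iff[OF f M L y(1) x] by (simp add: g_def)
  qed
  have "g \<in> mod_hom A N L"
  proof (intro mod_homI)
    show "g x \<in> carrier L" if xN: "x \<in> carrier N" for x
    proof -
      obtain x' where "x' \<in> carrier M" "x = q x'" using ex[OF xN] by blast
      then show ?thesis using gq mod_homD(1)[OF f] by simp
    qed
    show "g (x \<oplus>\<^bsub>N\<^esub> y) = g x \<oplus>\<^bsub>L\<^esub> g y" if xy: "x \<in> carrier N" "y \<in> carrier N" for x y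
    proof -
      obtain x' y' where h: "x' \<in> carrier M" "y' \<in> carrier M" "x = q x'" "y = q y'" using ex[OF xy(1)] ex[OF xy(2)] by blast
      then have "x \<oplus>\<^bsub>N\<^esub> y = q (x' \<oplus>\<^bsub>M\<^esub> y')" using mod_homD(2)[OF q(1)] by simp
      then show ?thesis using h gq mod_homD(2)[OF f] by simp
    qed
    show "g (r \<odot>\<^bsub>N\<^esub> x) = r \<odot>\<^bsub>L\<^esub> g x" if rx: "r \<in> carrier A" "x \<in> carrier N" for r x
    proof -
      obtain x' where h: "x' \<in> carrier M" "x = q x'" using ex[OF rx(2)] by blast
      then have "r \<odot>\<^bsub>N\<^esub> x = q (r \<odot>\<^bsub>M\<^esub> x')" using mod_homD(3)[OF q(1)] rx by simp
      then show ?thesis using h gq mod_homD(3)[OF f] rx M.smult_closed by simp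
    qed
  qed
  then show ?thesis using that gq by blast
qed

lemma mod_hom_inv:
  assumes f: "f \<in> mod_hom A M N" "bij_betw f (carrier M) (carrier N)" and "left_module A M"
  shows "inv_into (carrier M) f \<in> mod_hom A N M" 
    "bij_betw (inv_into (carrier M) f) (carrier N) (carrier M)"
    "\<And>x. x \<in> carrier M \<Longrightarrow> inv_into (carrier M) f (f x) = x"
    "\<And>y. y \<in> carrier N \<Longrightarrow> f (inv_into (carrier M) f y) = y"
proof -
  interpret M: lmod A M by (rule lmod.intro) fact
  let ?g = "inv_into (carrier M) f"
  show b: "bij_betw ?g (carrier N) (carrier M)" by (rule bij_betw_inv_into[OF f(2)])
  show l: "\<And>x. x \<in> carrier M \<Longrightarrow> ?g (f x) = x" using f(2) by (simp add: bij_betw_def)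
  show r: "\<And>y. y \<in> carrier N \<Longrightarrow> f (?g y) = y" using f(2) by (auto simp: bij_betw_def f_inv_into_f)
  have c: "\<And>y. y \<in> carrier N \<Longrightarrow> ?g y \<in> carrier M" using b by (auto simp: bij_betw_def)
  show "?g \<in> mod_hom A N M"
  proof (intro mod_homI)
    show "?g (x \<oplus>\<^bsub>N\<^esub> y) = ?g x \<oplus>\<^bsub>M\<^esub> ?g y" if "x \<in> carrier N" "y \<in> carrier N" for x y
      using that l[of "?g x \<oplus>\<^bsub>M\<^esub> ?g y"] mod_homD(2)[OF f(1), of "?g x" "?g y"] r c by simp
    show "?g (s \<odot>\<^bsub>N\<^esub> x) = s \<odot>\<^bsub>M\<^esub> ?g x" if "s \<in> carrier A" "x \<in> carrier N" for s x
      using that l[of "s \<odot>\<^bsub>M\<^esub> ?g x"] mod_homD(3)[OF f(1), of s "?g x"] r c M.smult_closed by simp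
  qed (use c in auto)
qed

text \<open>The module axioms pass to the image of a map that respects the operations. That zero
  goes to zero is a separate hypothesis, since \<open>Q\<close> is not yet known to be a group.
  Serves for quotients and for duals.\<close>

lemma surj_left_module:
  assumes M: "left_module A M" and q: "q \<in> mod_hom A M Q" "q ` carrier M = carrier Q" "q \<zero>\<^bsub>M\<^esub> = \<zero>\<^bsub>Q\<^esub>"
  shows "left_module A Q"
proof -
  interpret M: lmod A M by (rule lmod.intro) fact
  note h = mod_homD[OF q(1)]
  have ex: "\<exists>x'\<in>carrier M. x = q x'" if "x \<in> carrier Q" for x
    using that unfolding q(2)[symmetric] by blast
  show ?thesis
  proof (rule left_moduleI)
    show "ring A" by (rule M.R.ring_axioms)
    show "abelian_group Q"
    proof (rule abelian_groupI)
      fix x assume x: "x \<in> carrier Q"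
      then obtain x' where x': "x' \<in> carrier M" "x = q x'" using ex by blast
      show "\<zero>\<^bsub>Q\<^esub> \<oplus>\<^bsub>Q\<^esub> x = x"
        using x' h(2)[of "\<zero>\<^bsub>M\<^esub>" x'] q(3) by simp
      show "\<exists>y\<in>carrier Q. y \<oplus>\<^bsub>Q\<^esub> x = \<zero>\<^bsub>Q\<^esub>"
        using x' h(2)[of "\<ominus>\<^bsub>M\<^esub> x'" x'] h(1)[of "\<ominus>\<^bsub>M\<^esub> x'"] q(3) M.M.l_neg[of x'] M.M.a_inv_closed[of x'] by metis
      fix y assume y: "y \<in> carrier Q"
      then obtain y' where y': "y' \<in> carrier M" "y = q y'" using ex by blast
      show "x \<oplus>\<^bsub>Q\<^esub> y \<in> carrier Q" using x' y' h(1,2) M.M.a_closed by metis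
      show "x \<oplus>\<^bsub>Q\<^esub> y = y \<oplus>\<^bsub>Q\<^esub> x" using x' y' h(2) M.M.a_comm by metis
      fix z assume z: "z \<in> carrier Q"
      then obtain z' where z': "z' \<in> carrier M" "z = q z'" using ex by blast
      show "x \<oplus>\<^bsub>Q\<^esub> y \<oplus>\<^bsub>Q\<^esub> z = x \<oplus>\<^bsub>Q\<^esub> (y \<oplus>\<^bsub>Q\<^esub> z)"
        using x' y' z' h(2) M.M.a_assoc M.M.a_closed by metis
    qed (use q(3) h(1) M.M.zero_closed in metis)
  next
    fix a b x assume a: "a \<in> carrier A" and b: "b \<in> carrier A" and x: "x \<in> carrier Q"
    then obtain x' where x': "x' \<in> carrier M" "x = q x'" using ex by blast
    show "(a \<oplus>\<^bsub>A\<^esub> b) \<odot>\<^bsub>Q\<^esub> x = a \<odot>\<^bsub>Q\<^esub> x \<oplus>\<^bsub>Q\<^esub> b \<odot>\<^bsub>Q\<^esub> x"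
      using a b x' h(2,3) M.smult_l_distr[OF a b x'(1)] M.smult_closed M.R.a_closed by metis
    show "(a \<otimes>\<^bsub>A\<^esub> b) \<odot>\<^bsub>Q\<^esub> x = a \<odot>\<^bsub>Q\<^esub> (b \<odot>\<^bsub>Q\<^esub> x)"
      using a b x' h(3) M.smult_assoc[OF a b x'(1)] M.smult_closed M.R.m_closed by metis
  next
    fix a x y assume a: "a \<in> carrier A" and x: "x \<in> carrier Q" and y: "y \<in> carrier Q"
    then obtain x' y' where x': "x' \<in> carrier M" "x = q x'" "y' \<in> carrier M" "y = q y'" using ex by blast
    show "a \<odot>\<^bsub>Q\<^esub> (x \<oplus>\<^bsub>Q\<^esub> y) = a \<odot>\<^bsub>Q\<^esub> x \<oplus>\<^bsub>Q\<^esub> a \<odot>\<^bsub>Q\<^esub> y"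
      using a x' h(2,3) M.smult_r_distr[OF a x'(1,3)] M.smult_closed M.M.a_closed by metis
  next
    fix a x assume a: "a \<in> carrier A" and x: "x \<in> carrier Q"
    then show "a \<odot>\<^bsub>Q\<^esub> x \<in> carrier Q" using ex h(1,3) M.smult_closed by metis
  next
    fix x assume x: "x \<in> carrier Q"
    then show "\<one>\<^bsub>A\<^esub> \<odot>\<^bsub>Q\<^esub> x = x" using ex h(3) M.smult_one M.R.one_closed by metis
  qed
qed

section \<open>Quotients\<close>

lemma quot_simps [simp]:
  "carrier (quot M N) = a_rcosets\<^bsub>M\<^esub> N" "zero (quot M N) = N" "add (quot M N) = set_add M"
  "smult (quot M N) r X = (\<Union>x\<in>X. N +>\<^bsub>M\<^esub> (r \<odot>\<^bsub>M\<^esub> x))"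
  by (simp_all add: quot_def)

context lmod
begin

lemma coset_eq_iff:
  assumes N: "submodule N R M" and x: "x \<in> carrier M" and y: "y \<in> carrier M"
  shows "N +>\<^bsub>M\<^esub> x = N +>\<^bsub>M\<^esub> y \<longleftrightarrow> x \<ominus>\<^bsub>M\<^esub> y \<in> N"
proof
  note d = submodD[OF N]
  assume e: "N +>\<^bsub>M\<^esub> x = N +>\<^bsub>M\<^esub> y"
  have "\<zero>\<^bsub>M\<^esub> \<oplus>\<^bsub>M\<^esub> x \<in> N +>\<^bsub>M\<^esub> x" using d(3) unfolding a_r_coset_def' by blast
  then obtain n where n: "n \<in> N" "x = n \<oplus>\<^bsub>M\<^esub> y" using e x unfolding a_r_coset_def' by auto
  then have "x \<ominus>\<^bsub>M\<^esub> y = n" using y d(2) by (simp add: a_minus_def M.a_assoc M.r_neg)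
  then show "x \<ominus>\<^bsub>M\<^esub> y \<in> N" using n by simp
next
  note d = submodD[OF N]
  assume xy: "x \<ominus>\<^bsub>M\<^esub> y \<in> N"
  have *: "N +>\<^bsub>M\<^esub> x \<subseteq> N +>\<^bsub>M\<^esub> y" if x: "x \<in> carrier M" and y: "y \<in> carrier M" and xy: "x \<ominus>\<^bsub>M\<^esub> y \<in> N" for x y
  proof
    fix z assume "z \<in> N +>\<^bsub>M\<^esub> x"
    then obtain n where n: "n \<in> N" "z = n \<oplus>\<^bsub>M\<^esub> x" unfolding a_r_coset_def' by auto
    have "z = (n \<oplus>\<^bsub>M\<^esub> (x \<ominus>\<^bsub>M\<^esub> y)) \<oplus>\<^bsub>M\<^esub> y"
      using n(2) d(2)[OF n(1)] x y minus_add_cancel[OF x y] by (simp add: M.a_assoc)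
    then show "z \<in> N +>\<^bsub>M\<^esub> y" using d(4)[OF n(1) xy] unfolding a_r_coset_def' by blast
  qed
  have "y \<ominus>\<^bsub>M\<^esub> x = \<ominus>\<^bsub>M\<^esub> (x \<ominus>\<^bsub>M\<^esub> y)" using x y by (simp add: a_minus_def M.minus_add M.a_comm)
  then have "y \<ominus>\<^bsub>M\<^esub> x \<in> N" using d(6)[OF xy] by simp
  then show "N +>\<^bsub>M\<^esub> x = N +>\<^bsub>M\<^esub> y" using * x y xy by blast
qed

lemma proj_hom:
  assumes N: "submodule N R M"
  shows "(\<lambda>x. N +>\<^bsub>M\<^esub> x) \<in> mod_hom R M (quot M N)" (is ?a)
    "(\<lambda>x. N +>\<^bsub>M\<^esub> x) ` carrier M = carrier (quot M N)" (is ?b)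
    "a_kernel M (quot M N) (\<lambda>x. N +>\<^bsub>M\<^esub> x) = N" (is ?c)
    "left_module R (quot M N)" (is ?d)
proof -
  note d = submodD[OF N]
  have z: "N +>\<^bsub>M\<^esub> \<zero>\<^bsub>M\<^esub> = N" using d(1) by (simp add: M.a_coset_add_zero)
  show b: ?b by (auto simp: A_RCOSETS_def RCOSETS_def a_r_coset_def)
  show a: ?a
  proof (rule mod_homI)
    show "N +>\<^bsub>M\<^esub> x \<in> carrier (quot M N)" if "x \<in> carrier M" for x using b that by blast
    show "N +>\<^bsub>M\<^esub> (x \<oplus>\<^bsub>M\<^esub> y) = (N +>\<^bsub>M\<^esub> x) \<oplus>\<^bsub>quot M N\<^esub> (N +>\<^bsub>M\<^esub> y)"
      if x: "x \<in> carrier M" and y: "y \<in> carrier M" for x y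
    proof (intro equalityI subsetI)
      fix z assume "z \<in> N +>\<^bsub>M\<^esub> (x \<oplus>\<^bsub>M\<^esub> y)"
      then obtain n where n: "n \<in> N" "z = n \<oplus>\<^bsub>M\<^esub> (x \<oplus>\<^bsub>M\<^esub> y)" unfolding a_r_coset_def' by auto
      then have "z = (n \<oplus>\<^bsub>M\<^esub> x) \<oplus>\<^bsub>M\<^esub> (\<zero>\<^bsub>M\<^esub> \<oplus>\<^bsub>M\<^esub> y)" using x y d(2) by (simp add: M.a_assoc)
      moreover have "n \<oplus>\<^bsub>M\<^esub> x \<in> N +>\<^bsub>M\<^esub> x" "\<zero>\<^bsub>M\<^esub> \<oplus>\<^bsub>M\<^esub> y \<in> N +>\<^bsub>M\<^esub> y" using n(1) d(3) unfolding a_r_coset_def' by blast+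
      ultimately show "z \<in> (N +>\<^bsub>M\<^esub> x) \<oplus>\<^bsub>quot M N\<^esub> (N +>\<^bsub>M\<^esub> y)" by (auto simp: set_add_def')
    next
      fix z assume "z \<in> (N +>\<^bsub>M\<^esub> x) \<oplus>\<^bsub>quot M N\<^esub> (N +>\<^bsub>M\<^esub> y)"
      then obtain n n' where n: "n \<in> N" "n' \<in> N" "z = (n \<oplus>\<^bsub>M\<^esub> x) \<oplus>\<^bsub>M\<^esub> (n' \<oplus>\<^bsub>M\<^esub> y)" by (auto simp: set_add_def' a_r_coset_def')
      have "n \<in> carrier M" "n' \<in> carrier M" using n d(2) by auto
      then have "z = (n \<oplus>\<^bsub>M\<^esub> n') \<oplus>\<^bsub>M\<^esub> (x \<oplus>\<^bsub>M\<^esub> y)" using x y n(3) by (simp add: M.a_ac)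
      then show "z \<in> N +>\<^bsub>M\<^esub> (x \<oplus>\<^bsub>M\<^esub> y)" using d(4)[OF n(1,2)] unfolding a_r_coset_def' by blast
    qed
    show "N +>\<^bsub>M\<^esub> (r \<odot>\<^bsub>M\<^esub> x) = r \<odot>\<^bsub>quot M N\<^esub> (N +>\<^bsub>M\<^esub> x)" if r: "r \<in> carrier R" and x: "x \<in> carrier M" for r x
    proof -
      \<comment> \<open>The scalar multiple of a coset is a union over its elements; all members of
        this union are one and the same coset.\<close>
      have "N +>\<^bsub>M\<^esub> (r \<odot>\<^bsub>M\<^esub> u) = N +>\<^bsub>M\<^esub> (r \<odot>\<^bsub>M\<^esub> x)" if u: "u \<in> N +>\<^bsub>M\<^esub> x" for u
      proof -
        obtain n where n: "n \<in> N" "u = n \<oplus>\<^bsub>M\<^esub> x" using u unfolding a_r_coset_def' by auto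
        have nM: "n \<in> carrier M" using n d(2) by simp
        have c: "r \<odot>\<^bsub>M\<^esub> n \<in> carrier M" "r \<odot>\<^bsub>M\<^esub> x \<in> carrier M" using r x nM smult_closed by auto
        have "r \<odot>\<^bsub>M\<^esub> u = r \<odot>\<^bsub>M\<^esub> n \<oplus>\<^bsub>M\<^esub> r \<odot>\<^bsub>M\<^esub> x" using n(2) r x nM smult_r_distr by simp
        then have "r \<odot>\<^bsub>M\<^esub> u \<ominus>\<^bsub>M\<^esub> r \<odot>\<^bsub>M\<^esub> x = r \<odot>\<^bsub>M\<^esub> n" using c by (simp add: a_minus_def M.a_assoc M.r_neg)
        then have "r \<odot>\<^bsub>M\<^esub> u \<ominus>\<^bsub>M\<^esub> r \<odot>\<^bsub>M\<^esub> x \<in> N" using d(5) r n(1) by simp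
        moreover have "r \<odot>\<^bsub>M\<^esub> u \<in> carrier M" using r smult_closed n(2) nM x by simp
        ultimately show ?thesis using coset_eq_iff[OF N _ c(2)] by simp
      qed
      moreover have "\<zero>\<^bsub>M\<^esub> \<oplus>\<^bsub>M\<^esub> x \<in> N +>\<^bsub>M\<^esub> x" using d(3) unfolding a_r_coset_def' by blast
      ultimately show ?thesis unfolding quot_simps by blast
    qed
  qed
  show ?d by (rule surj_left_module[OF left_module_axioms a b]) (simp add: z)
  show ?c
  proof (rule Set.set_eqI)
    fix x
    have "x \<in> carrier M \<Longrightarrow> N +>\<^bsub>M\<^esub> x = N \<longleftrightarrow> x \<in> N"
      using coset_eq_iff[OF N _ M.zero_closed, of x] z by (simp add: a_minus_def M.minus_equality[of "\<zero>\<^bsub>M\<^esub>" "\<zero>\<^bsub>M\<^esub>"])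
    then show "x \<in> a_kernel M (quot M N) (\<lambda>x. N +>\<^bsub>M\<^esub> x) \<longleftrightarrow> x \<in> N"
      using d(2) by (auto simp: a_kernel_def')
  qed
qed

end

section \<open>Length\<close>

definition has_chain :: "('a, 'x) ring_scheme \<Rightarrow> ('a, 'm) module \<Rightarrow> nat \<Rightarrow> bool" where
  "has_chain A M n \<longleftrightarrow> (\<exists>c :: nat \<Rightarrow> 'm set.
      (\<forall>i\<le>n. submodule (c i) A M) \<and> (\<forall>i<n. c i \<subset> c (Suc i)))"

lemma has_chain_mono: "has_chain A M n \<Longrightarrow> m \<le> n \<Longrightarrow> has_chain A M m"
  unfolding has_chain_def by (metis le_trans order_less_le_trans)

text \<open>Turns the supremum into the existence of a chain. The number 0 is listed separately,
  because it lies below every supremum, even that of an empty set.\<close>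

lemma le_mod_length: "enat n \<le> mod_length A M \<longleftrightarrow> n = 0 \<or> has_chain A M n"
proof
  assume "n = 0 \<or> has_chain A M n"
  then show "enat n \<le> mod_length A M"
    unfolding mod_length_def has_chain_def[symmetric] by (auto intro: SUP_upper simp: zero_enat_def[symmetric])
next
  assume le: "enat n \<le> mod_length A M"
  show "n = 0 \<or> has_chain A M n"
  proof (rule ccontr)
    assume *: "\<not> (n = 0 \<or> has_chain A M n)"
    have "mod_length A M \<le> enat (n - 1)"
      unfolding mod_length_def has_chain_def[symmetric]
    proof (rule SUP_least)
      fix m assume "m \<in> {n. has_chain A M n}"
      then have "\<not> n \<le> m" using * has_chain_mono by blast
      then show "enat m \<le> enat (n - 1)" by simp
    qed
    with le have "enat n \<le> enat (n - 1)" by (rule order_trans)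
    then show False using * by auto
  qed
qed

lemma has_chain_zero: "left_module A M \<Longrightarrow> has_chain A M 0"
  unfolding has_chain_def using lmod.zero_submodule[OF lmod.intro] by fastforce

lemma le_mod_length': "left_module A M \<Longrightarrow> enat n \<le> mod_length A M \<longleftrightarrow> has_chain A M n"
  by (auto simp: le_mod_length has_chain_zero)

text \<open>An extended natural number is determined by the natural numbers below it. Identities
  between lengths, infinite ones included, are thus proved by moving finite chains.\<close>

lemma enat_eqI: "(\<And>n. enat n \<le> x \<longleftrightarrow> enat n \<le> y) \<Longrightarrow> x = (y :: enat)"
proof -
  assume h: "\<And>n. enat n \<le> x \<longleftrightarrow> enat n \<le> y"
  have *: "u \<le> v" if "\<And>n. enat n \<le> u \<Longrightarrow> enat n \<le> v" for u v :: enat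
  proof (cases v)
    case (enat k)
    show ?thesis
    proof (cases u)
      case (enat l)
      then show ?thesis using that by simp
    next
      case infinity
      then show ?thesis using that[of "Suc k"] enat by simp
    qed
  qed simp
  have "x \<le> y" by (rule *) (rule iffD1[OF h])
  moreover have "y \<le> x" by (rule *) (rule iffD2[OF h])
  ultimately show "x = y" by (rule order.antisym)
qed

lemma le_enat_add: "enat n \<le> x + y \<longleftrightarrow> (\<exists>p q. n = p + q \<and> enat p \<le> x \<and> enat q \<le> y)"
proof
  assume h: "enat n \<le> x + y"
  show "\<exists>p q. n = p + q \<and> enat p \<le> x \<and> enat q \<le> y"
  proof (cases "enat n \<le> x")
    case True
    then show ?thesis by (intro exI[of _ n] exI[of _ 0]) (simp add: zero_enat_def[symmetric])
  next
    case False
    then obtain k where k: "x = enat k" "k < n" by (cases x) auto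
    then have "enat (n - k) \<le> y" using h by (cases y) auto
    then show ?thesis using k by (intro exI[of _ k] exI[of _ "n - k"]) auto
  qed
next
  assume "\<exists>p q. n = p + q \<and> enat p \<le> x \<and> enat q \<le> y"
  then show "enat n \<le> x + y" by (metis add_mono plus_enat_simps(1))
qed

lemma mod_length_cong:
  assumes "\<And>N. submodule N A M \<longleftrightarrow> submodule N B M'"
  shows "mod_length A M = mod_length B M'"
  unfolding mod_length_def using assms by simp

text \<open>Deleting the repetitions of a weak chain leaves one step for each proper inclusion. The
  equation for the top member is what the induction needs in order to append the next one.\<close>

lemma compress_chain:
  fixes c :: "nat \<Rightarrow> 'm set"
  assumes "\<And>i. i \<le> n \<Longrightarrow> submodule (c i) A M" "\<And>i. i < n \<Longrightarrow> c i \<subseteq> c (Suc i)"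
  shows "\<exists>d. d (card {i. i < n \<and> c i \<noteq> c (Suc i)}) = c n \<and>
    (\<forall>i\<le>card {i. i < n \<and> c i \<noteq> c (Suc i)}. submodule (d i) A M) \<and>
    (\<forall>i<card {i. i < n \<and> c i \<noteq> c (Suc i)}. d i \<subset> d (Suc i))"
  using assms
proof (induction n)
  case 0
  then show ?case by (intro exI[of _ c]) auto
next
  case (Suc n)
  let ?k = "card {i. i < n \<and> c i \<noteq> c (Suc i)}"
  have "submodule (c i) A M" if "i \<le> n" for i using Suc.prems(1)[of i] that by simp
  moreover have "c i \<subseteq> c (Suc i)" if "i < n" for i using Suc.prems(2)[of i] that by simp
  ultimately obtain d where d: "d ?k = c n" "\<And>i. i \<le> ?k \<Longrightarrow> submodule (d i) A M" "\<And>i. i < ?k \<Longrightarrow> d i \<subset> d (Suc i)"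
    using Suc.IH by blast
  show ?case
  proof (cases "c n = c (Suc n)")
    case True
    then have "{i. i < Suc n \<and> c i \<noteq> c (Suc i)} = {i. i < n \<and> c i \<noteq> c (Suc i)}" using less_Suc_eq by auto
    then show ?thesis using d True by auto
  next
    case False
    then have "{i. i < Suc n \<and> c i \<noteq> c (Suc i)} = insert n {i. i < n \<and> c i \<noteq> c (Suc i)}" using less_Suc_eq by auto
    then have k: "card {i. i < Suc n \<and> c i \<noteq> c (Suc i)} = Suc ?k" by simp
    have s: "c n \<subset> c (Suc n)" using Suc.prems(2) False by auto
    show ?thesis unfolding k
      by (intro exI[of _ "\<lambda>i. if i \<le> ?k then d i else c (Suc n)"])
        (use d s Suc.prems(1) in \<open>auto simp: less_Suc_eq le_Suc_eq\<close>)
  qed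
qed

lemma has_chain_compress:
  assumes "\<And>i. i \<le> n \<Longrightarrow> submodule (c i) A M" "\<And>i. i < n \<Longrightarrow> c i \<subseteq> c (Suc i)"
  shows "has_chain A M (card {i. i < n \<and> c i \<noteq> c (Suc i)})"
  unfolding has_chain_def
  by (rule exE[OF compress_chain[where c = c and n = n, OF assms]], assumption, assumption, rule exI, erule conjunct2)

text \<open>Additivity of length. A chain in \<open>M\<close> induces weak chains in the kernel and
  in \<open>N\<close>, and at each step at least one of them grows, since a submodule is determined
  by its trace on the kernel and its image once it is comparable with another one. Conversely, a
  chain in the kernel is continued by the preimages of a chain in \<open>N\<close>.\<close>

theorem mod_length_hom:
  assumes f: "f \<in> mod_hom A M N" "f ` carrier M = carrier N" and M: "left_module A M" and N: "left_module A N"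
  shows "mod_length A M = mod_length A (sub M (a_kernel M N f)) + mod_length A N"
proof (rule enat_eqI)
  interpret M: lmod A M by (rule lmod.intro) fact
  interpret N: lmod A N by (rule lmod.intro) fact
  let ?K = "a_kernel M N f"
  have Ksub: "submodule ?K A M" by (rule kernel_submodule[OF f(1) M N])
  have Klm: "left_module A (sub M ?K)" by (rule M.sub_left_module[OF Ksub])
  note h = mod_homD[OF f(1)]
  fix n
  have "has_chain A M n \<longleftrightarrow> (\<exists>p q. n = p + q \<and> has_chain A (sub M ?K) p \<and> has_chain A N q)"
  proof
    assume "has_chain A M n"
    then obtain c where c: "\<And>i. i \<le> n \<Longrightarrow> submodule (c i) A M" "\<And>i. i < n \<Longrightarrow> c i \<subset> c (Suc i)"
      unfolding has_chain_def by blast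
    let ?a = "\<lambda>i. c i \<inter> ?K" and ?b = "\<lambda>i. f ` c i"
    have sa: "submodule (?a i) A (sub M ?K)" if "i \<le> n" for i
      using M.submodule_sub[OF Ksub] M.submodule_Int[OF c(1)[OF that] Ksub] by auto
    have sb: "submodule (?b i) A N" if "i \<le> n" for i
      by (rule image_submodule[OF f(1) M N c(1)[OF that]])
    let ?P = "{i. i < n \<and> ?a i \<noteq> ?a (Suc i)}" and ?Q = "{i. i < n \<and> ?b i \<noteq> ?b (Suc i)}"
    have "has_chain A (sub M ?K) (card ?P)"
    proof -
      have "?a i \<subseteq> ?a (Suc i)" if "i < n" for i using c(2)[OF that] by blast
      then show ?thesis by (intro has_chain_compress[where c = ?a] sa)
    qed
    moreover have "has_chain A N (card ?Q)"
    proof -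
      have "?b i \<subseteq> ?b (Suc i)" if "i < n" for i using c(2)[OF that] by blast
      then show ?thesis by (intro has_chain_compress[where c = ?b] sb)
    qed
    moreover have "n \<le> card ?P + card ?Q"
    proof -
      have "{..<n} \<subseteq> ?P \<union> ?Q"
      proof
        fix i assume "i \<in> {..<n}"
        then have i: "i < n" by simp
        show "i \<in> ?P \<union> ?Q"
        proof (rule ccontr)
          assume "i \<notin> ?P \<union> ?Q"
          then have e: "?a i = ?a (Suc i)" "?b i = ?b (Suc i)" using i by auto
          note di = submodD[OF c(1)[of i]] and ds = submodD[OF c(1)[of "Suc i"]]
          have "x \<in> c i" if x: "x \<in> c (Suc i)" for x
          proof -
            obtain y where y: "y \<in> c i" "f x = f y" using e(2) x by (metis imageE imageI)
            have cx: "x \<in> carrier M" using ds(2) x i by auto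
            have cy: "y \<in> carrier M" "y \<in> c (Suc i)" using di(2) y i c(2)[OF i] by auto
            have "x \<ominus>\<^bsub>M\<^esub> y \<in> ?K" using kernel_eq_iff[OF f(1) M N cx cy(1)] y by simp
            then have "x \<ominus>\<^bsub>M\<^esub> y \<in> c i" using e(1) ds(7)[OF _ x cy(2)] i by auto
            then have "(x \<ominus>\<^bsub>M\<^esub> y) \<oplus>\<^bsub>M\<^esub> y \<in> c i" using di(4) y i by auto
            then show ?thesis using M.minus_add_cancel[OF cx cy(1)] by simp
          qed
          then show False using c(2)[OF i] by blast
        qed
      qed
      then have "card {..<n} \<le> card (?P \<union> ?Q)" by (intro card_mono) auto
      then show ?thesis using card_Un_le[of ?P ?Q] by simp
    qed
    \<comment> \<open>Both induced chains may grow at the same step, so their lengths may add up to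
      more than \<open>n\<close>; they are cut down to a sum of exactly \<open>n\<close>.\<close>
    moreover define p where "p = min n (card ?P)"
    ultimately have "n = p + (n - p)" "has_chain A (sub M ?K) p" "has_chain A N (n - p)"
      by (auto intro: has_chain_mono)
    then show "\<exists>p q. n = p + q \<and> has_chain A (sub M ?K) p \<and> has_chain A N q" by blast
  next
    assume "\<exists>p q. n = p + q \<and> has_chain A (sub M ?K) p \<and> has_chain A N q"
    then obtain p q where n: "n = p + q" and pq: "has_chain A (sub M ?K) p" "has_chain A N q" by blast
    from pq(1) obtain c where c: "\<And>i. i \<le> p \<Longrightarrow> submodule (c i) A (sub M ?K)" "\<And>i. i < p \<Longrightarrow> c i \<subset> c (Suc i)"
      unfolding has_chain_def by metis
    from pq(2) obtain d where d: "\<And>i. i \<le> q \<Longrightarrow> submodule (d i) A N" "\<And>i. i < q \<Longrightarrow> d i \<subset> d (Suc i)"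
      unfolding has_chain_def by metis
    have cM: "submodule (c i) A M" "c i \<subseteq> ?K" if "i \<le> p" for i using M.submodule_sub[OF Ksub] c(1)[OF that] by auto
    let ?v = "\<lambda>i. {x \<in> carrier M. f x \<in> d i}"
    have vs: "submodule (?v i) A M" if "i \<le> q" for i by (rule vimage_submodule[OF f(1) M N d(1)[OF that]])
    have Kv: "?K \<subseteq> ?v i" if "i \<le> q" for i using submodD(3)[OF d(1)[OF that]] by (auto simp: a_kernel_def')
    have vv: "?v i \<subset> ?v (Suc i)" if i: "i < q" for i
    proof
      show "?v i \<subseteq> ?v (Suc i)" using d(2)[OF i] by auto
      obtain y where y: "y \<in> d (Suc i)" "y \<notin> d i" using d(2)[OF i] by blast
      then have "y \<in> carrier N" using submodD(2)[OF d(1)[of "Suc i"]] i by auto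
      then obtain x where "x \<in> carrier M" "y = f x" using f(2) by blast
      then show "?v i \<noteq> ?v (Suc i)" using y by auto
    qed
    \<comment> \<open>At the index \<open>p\<close> the chain already consists of preimages:
      \<open>?v 0\<close> contains the kernel and takes the place of \<open>c p\<close>.\<close>
    let ?e = "\<lambda>i. if i < p then c i else ?v (i - p)"
    have "\<forall>i\<le>n. submodule (?e i) A M" using cM vs n by auto
    moreover have "?e i \<subset> ?e (Suc i)" if i: "i < n" for i
    proof -
      consider "Suc i < p" | "Suc i = p" | "p \<le> i" by linarith
      then show ?thesis
      proof cases
        case 1 then show ?thesis using c(2)[of i] by simp
      next
        case 2
        then have "c i \<subset> c p" "c p \<subseteq> ?K" "?K \<subseteq> ?v 0" using c(2)[of i] cM(2)[of p] Kv[of 0] by auto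
        then have "c i \<subset> ?v 0" by blast
        then show ?thesis using 2 by auto
      next
        case 3
        then have "?v (i - p) \<subset> ?v (Suc (i - p))" using vv[of "i - p"] i n by simp
        then show ?thesis using 3 by (simp add: Suc_diff_le)
      qed
    qed
    ultimately show "has_chain A M n" unfolding has_chain_def by (intro exI[of _ ?e] conjI) blast+
  qed
  then show "enat n \<le> mod_length A M \<longleftrightarrow> enat n \<le> mod_length A (sub M ?K) + mod_length A N"
    by (simp add: le_enat_add le_mod_length' M N Klm)
qed

lemma mod_length_zero:
  assumes "left_module A M" shows "mod_length A (sub M {\<zero>\<^bsub>M\<^esub>}) = 0"
proof -
  interpret M: lmod A M by (rule lmod.intro) fact
  have "\<not> has_chain A (sub M {\<zero>\<^bsub>M\<^esub>}) 1"
  proof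
    assume "has_chain A (sub M {\<zero>\<^bsub>M\<^esub>}) 1"
    then obtain c where c: "\<And>i. i \<le> 1 \<Longrightarrow> submodule (c i) A (sub M {\<zero>\<^bsub>M\<^esub>})" "\<And>i. i < 1 \<Longrightarrow> c i \<subset> c (Suc i)"
      unfolding has_chain_def by metis
    have "\<zero>\<^bsub>M\<^esub> \<in> c 0" "c 1 \<subseteq> {\<zero>\<^bsub>M\<^esub>}" "c 0 \<subset> c 1"
      using submodD(3)[OF c(1)[of 0]] submodD(1)[OF c(1)[of 1]] c(2)[of 0] by auto
    then show False by blast
  qed
  then have "\<not> enat 1 \<le> mod_length A (sub M {\<zero>\<^bsub>M\<^esub>})" by (simp add: le_mod_length)
  then show ?thesis by (cases "mod_length A (sub M {\<zero>\<^bsub>M\<^esub>})") (auto simp: zero_enat_def)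
qed

lemma mod_length_bij:
  assumes f: "f \<in> mod_hom A M N" "bij_betw f (carrier M) (carrier N)" and M: "left_module A M" and N: "left_module A N"
  shows "mod_length A M = mod_length A N"
proof -
  have "a_kernel M N f = {\<zero>\<^bsub>M\<^esub>}" "f ` carrier M = carrier N"
    using f inj_on_kernel[OF f(1) M N] by (auto simp: bij_betw_def)
  then show ?thesis using mod_length_hom[OF f(1) _ M N] mod_length_zero[OF M] by simp
qed

lemma mod_length_quot:
  assumes M: "left_module A M" and N: "submodule N A M"
  shows "mod_length A M = mod_length A (sub M N) + mod_length A (quot M N)"
proof -
  interpret M: lmod A M by (rule lmod.intro) fact
  show ?thesis using mod_length_hom[OF M.proj_hom(1,2)[OF N] M M.proj_hom(4)[OF N]] M.proj_hom(3)[OF N] by simp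
qed

lemma mod_length_mono:
  assumes M: "left_module A M" and N: "submodule N A M" and L: "submodule L A M" and NL: "N \<subseteq> L"
  shows "mod_length A (sub M N) \<le> mod_length A (sub M L)"
proof -
  interpret M: lmod A M by (rule lmod.intro) fact
  have "submodule N A (sub M L)" using M.submodule_sub[OF L] N NL by simp
  then show ?thesis using mod_length_quot[OF M.sub_left_module[OF L]] by (simp add: )
qed

lemma mod_length_strict:
  assumes M: "left_module A M" and N: "submodule N A M" and L: "submodule L A M" and NL: "N \<subset> L"
    and fin: "mod_length A (sub M N) = enat k"
  shows "enat (Suc k) \<le> mod_length A (sub M L)"
proof -
  interpret M: lmod A M by (rule lmod.intro) fact
  have lm: "left_module A (sub M N)" "left_module A (sub M L)" using M.sub_left_module N L by auto
  have "has_chain A (sub M N) k" using fin lm by (simp add: le_mod_length'[symmetric])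
  then obtain c where c: "\<And>i. i \<le> k \<Longrightarrow> submodule (c i) A (sub M N)" "\<And>i. i < k \<Longrightarrow> c i \<subset> c (Suc i)"
    unfolding has_chain_def by blast
  have cM: "submodule (c i) A M" "c i \<subseteq> N" if "i \<le> k" for i using M.submodule_sub[OF N] c(1)[OF that] by auto
  have cL: "c i \<subset> L" if "i \<le> k" for i using cM(2)[OF that] NL by blast
  have "has_chain A (sub M L) (Suc k)"
    unfolding has_chain_def
    by (intro exI[of _ "\<lambda>i. if i \<le> k then c i else L"])
      (use cM(1) cL c(2) L M.submodule_sub[OF L] in \<open>auto simp: le_Suc_eq less_Suc_eq\<close>)
  then show ?thesis using lm by (simp add: le_mod_length')
qed

text \<open>The form in which counting produces equalities: an inclusion between submodules of equal
  finite length is not proper.\<close>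

lemma submodule_eq_of_length:
  assumes M: "left_module A M" and N: "submodule N A M" and L: "submodule L A M" and NL: "N \<subseteq> L"
    and "mod_length A (sub M N) = enat k" "mod_length A (sub M L) \<le> enat k"
  shows "N = L"
  using mod_length_strict[OF M N L _ assms(5)] NL assms(6)
  by (metis Suc_n_not_le_n enat_ord_simps(1) order_trans psubsetI)

lemma mod_length_image:
  assumes f: "f \<in> mod_hom A M N" and M: "left_module A M" and N: "left_module A N"
    and L: "submodule L A M"
  shows "mod_length A (sub M L) = mod_length A (sub M (a_kernel M N f \<inter> L)) + mod_length A (sub N (f ` L))"
proof -
  interpret M: lmod A M by (rule lmod.intro) fact
  interpret N: lmod A N by (rule lmod.intro) fact
  have i: "submodule (f ` L) A N" by (rule image_submodule[OF f M N L])
  have h: "f \<in> mod_hom A (sub M L) (sub N (f ` L))" using submodD(1)[OF L] by (intro mod_hom_sub[OF f]) auto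
  have "a_kernel (sub M L) (sub N (f ` L)) f = a_kernel M N f \<inter> L"
    using submodD(1)[OF L] by (auto simp: a_kernel_def')
  then show ?thesis using mod_length_hom[OF h _ M.sub_left_module[OF L] N.sub_left_module[OF i]] by simp
qed

section \<open>Free modules\<close>

text \<open>Vectors are functions on all natural numbers that vanish from \<open>n\<close> on, so
  that equality of vectors is equality of functions and \<open>A^n\<close> lies inside
  \<open>A^(n+1)\<close>. Restricting the entries to \<open>J\<close> or to \<open>J^2\<close> gives
  \<open>J F\<close> and \<open>J^2 F\<close> for a free module \<open>F\<close>.\<close>

definition coords :: "('a, 'x) ring_scheme \<Rightarrow> 'a set \<Rightarrow> nat \<Rightarrow> (nat \<Rightarrow> 'a) set" where
  "coords A I n = {x. (\<forall>i<n. x i \<in> I) \<and> (\<forall>i\<ge>n. x i = \<zero>\<^bsub>A\<^esub>)}"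

definition free :: "('a, 'x) ring_scheme \<Rightarrow> nat \<Rightarrow> 'a umod" where
  "free A n = \<lparr>carrier = coords A (carrier A) n, mult = undefined, one = undefined,
     zero = (\<lambda>i. \<zero>\<^bsub>A\<^esub>), add = (\<lambda>x y i. x i \<oplus>\<^bsub>A\<^esub> y i), smult = (\<lambda>r x i. r \<otimes>\<^bsub>A\<^esub> x i)\<rparr>"

definition evec :: "('a, 'x) ring_scheme \<Rightarrow> nat \<Rightarrow> nat \<Rightarrow> 'a" where
  "evec A k = (\<lambda>i. if i = k then \<one>\<^bsub>A\<^esub> else \<zero>\<^bsub>A\<^esub>)"

primrec lincomb :: "('a, 'm) module \<Rightarrow> (nat \<Rightarrow> 'm) \<Rightarrow> nat \<Rightarrow> (nat \<Rightarrow> 'a) \<Rightarrow> 'm" where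
  "lincomb M v 0 x = \<zero>\<^bsub>M\<^esub>"
| "lincomb M v (Suc n) x = lincomb M v n x \<oplus>\<^bsub>M\<^esub> x n \<odot>\<^bsub>M\<^esub> v n"

primrec dot :: "('a, 'x) ring_scheme \<Rightarrow> nat \<Rightarrow> (nat \<Rightarrow> 'a) \<Rightarrow> (nat \<Rightarrow> 'a) \<Rightarrow> 'a" where
  "dot A 0 x b = \<zero>\<^bsub>A\<^esub>"
| "dot A (Suc n) x b = dot A n x b \<oplus>\<^bsub>A\<^esub> x n \<otimes>\<^bsub>A\<^esub> b n"

text \<open>The column that represents a functional on row vectors, padded by zeros so that it
  belongs to \<open>coords\<close>.\<close>

definition covec :: "('a, 'x) ring_scheme \<Rightarrow> nat \<Rightarrow> ((nat \<Rightarrow> 'a) \<Rightarrow> 'a) \<Rightarrow> nat \<Rightarrow> 'a" where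
  "covec A n \<phi> = (\<lambda>i. if i < n then \<phi> (evec A i) else \<zero>\<^bsub>A\<^esub>)"

text \<open>A homomorphism \<open>D : A\<^sup>m \<rightarrow> A\<^sup>n\<close> of left modules is a matrix acting on row vectors from the right;
  \<open>tr A n m D\<close> is the action of the same matrix on column vectors, a homomorphism
  \<open>A\<^sup>n \<rightarrow> A\<^sup>m\<close> of right modules.\<close>
definition tr :: "('a, 'x) ring_scheme \<Rightarrow> nat \<Rightarrow> nat \<Rightarrow> ((nat \<Rightarrow> 'a) \<Rightarrow> (nat \<Rightarrow> 'a)) \<Rightarrow> (nat \<Rightarrow> 'a) \<Rightarrow> (nat \<Rightarrow> 'a)" where
  "tr A n m D b = covec A m (\<lambda>x. dot A n (D x) b)"

lemma free_simps [simp]: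
  "carrier (free A n) = coords A (carrier A) n" "zero (free A n) = (\<lambda>i. \<zero>\<^bsub>A\<^esub>)"
  "add (free A n) x y = (\<lambda>i. x i \<oplus>\<^bsub>A\<^esub> y i)" "smult (free A n) r x = (\<lambda>i. r \<otimes>\<^bsub>A\<^esub> x i)"
  by (simp_all add: free_def)

text \<open>Only the carrier of \<open>free A n\<close> depends on \<open>n\<close>. This moves
  \<open>coords A I n\<close> into \<open>A^(n+1)\<close> in the induction for its length.\<close>

lemma sub_free: "sub (free A n) X = sub (free A m) X"
  by (simp add: sub_def free_def)

lemma coords_opp [simp]: "coords (opp A) I n = coords A I n"
  by (simp add: coords_def)

lemma evec_opp [simp]: "evec (opp A) = evec A"
  by (simp add: evec_def fun_eq_iff)

lemma covec_opp [simp]: "covec (opp A) = covec A"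
  by (simp add: covec_def fun_eq_iff)

lemma dot_opp [simp]: "dot (opp A) n x b = dot A n b x"
  by (induction n) auto

lemma coords_mono: "I \<subseteq> L \<Longrightarrow> coords A I n \<subseteq> coords A L n"
  by (auto simp: coords_def)

lemma free_left_module: assumes "ring A" shows "left_module A (free A n)"
proof -
  interpret ring A by fact
  show ?thesis
  proof (rule left_moduleI)
    show "abelian_group (free A n)"
    proof (rule abelian_groupI)
      fix x assume x: "x \<in> carrier (free A n)"
      then have "(\<lambda>i. \<ominus>\<^bsub>A\<^esub> x i) \<in> carrier (free A n)" "(\<lambda>i. \<ominus>\<^bsub>A\<^esub> x i) \<oplus>\<^bsub>free A n\<^esub> x = \<zero>\<^bsub>free A n\<^esub>"
        by (auto simp: coords_def fun_eq_iff) (metis l_neg minus_zero not_le l_zero zero_closed)+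
      then show "\<exists>y\<in>carrier (free A n). y \<oplus>\<^bsub>free A n\<^esub> x = \<zero>\<^bsub>free A n\<^esub>" by blast
    next
      fix x y assume "x \<in> carrier (free A n)" "y \<in> carrier (free A n)"
      then show "x \<oplus>\<^bsub>free A n\<^esub> y = y \<oplus>\<^bsub>free A n\<^esub> x"
        by (auto simp: coords_def fun_eq_iff) (metis a_comm not_le)
    next
      fix x y z assume "x \<in> carrier (free A n)" "y \<in> carrier (free A n)" "z \<in> carrier (free A n)"
      then have "x i \<in> carrier A \<and> y i \<in> carrier A \<and> z i \<in> carrier A" for i
        by (cases "i < n") (auto simp: coords_def)
      then show "x \<oplus>\<^bsub>free A n\<^esub> y \<oplus>\<^bsub>free A n\<^esub> z = x \<oplus>\<^bsub>free A n\<^esub> (y \<oplus>\<^bsub>free A n\<^esub> z)"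
        by (simp add: fun_eq_iff a_assoc)
    next
      fix x assume "x \<in> carrier (free A n)"
      then have "x i \<in> carrier A" for i by (cases "i < n") (auto simp: coords_def)
      then show "\<zero>\<^bsub>free A n\<^esub> \<oplus>\<^bsub>free A n\<^esub> x = x" by (simp add: fun_eq_iff)
    qed (auto simp: coords_def)
  next
    fix a b x assume ab: "a \<in> carrier A" "b \<in> carrier A" and "x \<in> carrier (free A n)"
    then have x: "x i \<in> carrier A" for i by (cases "i < n") (auto simp: coords_def)
    show "(a \<oplus>\<^bsub>A\<^esub> b) \<odot>\<^bsub>free A n\<^esub> x = a \<odot>\<^bsub>free A n\<^esub> x \<oplus>\<^bsub>free A n\<^esub> b \<odot>\<^bsub>free A n\<^esub> x"
      using ab x by (simp add: fun_eq_iff l_distr)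
    show "(a \<otimes>\<^bsub>A\<^esub> b) \<odot>\<^bsub>free A n\<^esub> x = a \<odot>\<^bsub>free A n\<^esub> (b \<odot>\<^bsub>free A n\<^esub> x)"
      using ab x by (simp add: fun_eq_iff m_assoc)
  next
    fix a x y assume a: "a \<in> carrier A" and "x \<in> carrier (free A n)" "y \<in> carrier (free A n)"
    then have "x i \<in> carrier A \<and> y i \<in> carrier A" for i by (cases "i < n") (auto simp: coords_def)
    then show "a \<odot>\<^bsub>free A n\<^esub> (x \<oplus>\<^bsub>free A n\<^esub> y) = a \<odot>\<^bsub>free A n\<^esub> x \<oplus>\<^bsub>free A n\<^esub> a \<odot>\<^bsub>free A n\<^esub> y"
      using a by (simp add: fun_eq_iff r_distr)
  next
    fix x assume "x \<in> carrier (free A n)"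
    then have x: "x i \<in> carrier A" for i by (cases "i < n") (auto simp: coords_def)
    then show "\<one>\<^bsub>A\<^esub> \<odot>\<^bsub>free A n\<^esub> x = x" by (simp add: fun_eq_iff)
  qed (auto simp: coords_def ring_axioms)
qed

lemma regular_left_module: assumes "ring A" shows "left_module A (regular A)"
proof -
  interpret ring A by fact
  show ?thesis
    by (rule left_moduleI)
      (auto intro!: abelian_groupI simp: ring_axioms l_distr r_distr m_assoc a_assoc intro: a_comm l_neg)
qed

context ring
begin

interpretation reg: lmod R "regular R"
  by (rule lmod.intro) (rule regular_left_module[OF ring_axioms])

lemma coords_i: "x \<in> coords R (carrier R) n \<Longrightarrow> x i \<in> carrier R"
  by (cases "i < n") (auto simp: coords_def)

lemma evec_closed [simp]: "k < n \<Longrightarrow> evec R k \<in> coords R (carrier R) n"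
  by (auto simp: evec_def coords_def)

lemma dot_lincomb: "dot R n x b = lincomb (regular R) b n x"
  by (induction n) auto

end

context lmod
begin

lemma lincomb_closed:
  "\<lbrakk>\<And>i. i < n \<Longrightarrow> v i \<in> carrier M; \<And>i. i < n \<Longrightarrow> x i \<in> carrier R\<rbrakk> \<Longrightarrow> lincomb M v n x \<in> carrier M"
  by (induction n) (auto simp: smult_closed)

lemma lincomb_in:
  "\<lbrakk>submodule N R M; \<And>i. i < n \<Longrightarrow> x i \<odot>\<^bsub>M\<^esub> v i \<in> N\<rbrakk> \<Longrightarrow> lincomb M v n x \<in> N"
  by (induction n) (auto dest: submodD)

lemma lincomb_cong:
  "\<lbrakk>\<And>i. i < n \<Longrightarrow> v i = w i; \<And>i. i < n \<Longrightarrow> x i = y i\<rbrakk> \<Longrightarrow> lincomb M v n x = lincomb M w n y"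
  by (induction n) auto

lemma lincomb_add:
  "\<lbrakk>\<And>i. i < n \<Longrightarrow> v i \<in> carrier M; \<And>i. i < n \<Longrightarrow> x i \<in> carrier R; \<And>i. i < n \<Longrightarrow> y i \<in> carrier R\<rbrakk> \<Longrightarrow>
    lincomb M v n (\<lambda>i. x i \<oplus> y i) = lincomb M v n x \<oplus>\<^bsub>M\<^esub> lincomb M v n y"
proof (induction n)
  case (Suc n)
  then have "lincomb M v n x \<in> carrier M" "lincomb M v n y \<in> carrier M" by (auto intro: lincomb_closed)
  with Suc show ?case by (simp add: smult_l_distr smult_closed M.a_ac)
qed simp

lemma lincomb_smult:
  "\<lbrakk>\<And>i. i < n \<Longrightarrow> v i \<in> carrier M; \<And>i. i < n \<Longrightarrow> x i \<in> carrier R; r \<in> carrier R\<rbrakk> \<Longrightarrow>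
    lincomb M v n (\<lambda>i. r \<otimes> x i) = r \<odot>\<^bsub>M\<^esub> lincomb M v n x"
proof (induction n)
  case (Suc n)
  then have "lincomb M v n x \<in> carrier M" by (auto intro: lincomb_closed)
  with Suc show ?case by (simp add: smult_assoc smult_closed smult_r_distr)
qed simp

lemma lincomb_hom:
  assumes "\<And>i. i < n \<Longrightarrow> v i \<in> carrier M"
  shows "lincomb M v n \<in> mod_hom R (free R n) M"
proof (rule mod_homI)
  show "lincomb M v n x \<in> carrier M" if "x \<in> carrier (free R n)" for x
    using that assms by (auto intro!: lincomb_closed simp: R.coords_i)
  show "lincomb M v n (x \<oplus>\<^bsub>free R n\<^esub> y) = lincomb M v n x \<oplus>\<^bsub>M\<^esub> lincomb M v n y"
    if "x \<in> carrier (free R n)" "y \<in> carrier (free R n)" for x y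
    using that assms lincomb_add[of n v x y] by (simp add: R.coords_i)
  show "lincomb M v n (r \<odot>\<^bsub>free R n\<^esub> x) = r \<odot>\<^bsub>M\<^esub> lincomb M v n x"
    if "r \<in> carrier R" "x \<in> carrier (free R n)" for r x
    using that assms lincomb_smult[of n v x r] by (simp add: R.coords_i)
qed

lemma lincomb_null:
  "\<lbrakk>\<And>i. i < n \<Longrightarrow> x i \<odot>\<^bsub>M\<^esub> v i = \<zero>\<^bsub>M\<^esub>\<rbrakk> \<Longrightarrow> lincomb M v n x = \<zero>\<^bsub>M\<^esub>"
  by (induction n) auto

lemma lincomb_evec:
  "\<lbrakk>k < n; \<And>i. i < n \<Longrightarrow> v i \<in> carrier M\<rbrakk> \<Longrightarrow> lincomb M v n (evec R k) = v k"
proof (induction n)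
  case (Suc n)
  show ?case
  proof (cases "k = n")
    case True
    have "lincomb M v n (evec R k) = \<zero>\<^bsub>M\<^esub>"
      using True Suc.prems by (intro lincomb_null) (auto simp: evec_def)
    then show ?thesis using Suc.prems True by (simp add: evec_def smult_one)
  next
    case False
    then have "lincomb M v n (evec R k) = v k" using Suc by simp
    then show ?thesis using Suc.prems False by (simp add: evec_def)
  qed
qed simp

lemma hom_lincomb:
  assumes f: "f \<in> mod_hom R M N" and N: "left_module R N"
  shows "\<lbrakk>\<And>i. i < n \<Longrightarrow> v i \<in> carrier M; \<And>i. i < n \<Longrightarrow> x i \<in> carrier R\<rbrakk> \<Longrightarrow>
    f (lincomb M v n x) = lincomb N (\<lambda>i. f (v i)) n x"
proof (induction n)
  case 0
  then show ?case using mod_hom_zero[OF f left_module_axioms N] by simp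
next
  case (Suc n)
  then have "lincomb M v n x \<in> carrier M" by (auto intro: lincomb_closed)
  with Suc show ?case using mod_homD[OF f] by (simp add: smult_closed)
qed

end

context ring
begin

interpretation reg: lmod R "regular R"
  by (rule lmod.intro) (rule regular_left_module[OF ring_axioms])

interpretation fr: lmod R "free R n" for n
  by (rule lmod.intro) (rule free_left_module[OF ring_axioms])

lemma lincomb_free_coord:
  "\<lbrakk>\<And>k. k < m \<Longrightarrow> v k \<in> coords R (carrier R) n; \<And>k. k < m \<Longrightarrow> x k \<in> carrier R\<rbrakk> \<Longrightarrow>
    lincomb (free R n) v m x i = dot R m x (\<lambda>k. v k i)"
  by (induction m) auto

lemma lincomb_free_expand:
  assumes x: "x \<in> coords R (carrier R) n" shows "lincomb (free R n) (evec R) n x = x"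
proof -
  have "m \<le> n \<Longrightarrow> lincomb (free R n) (evec R) m x = (\<lambda>i. if i < m then x i else \<zero>)" for m
  proof (induction m)
    case (Suc m)
    then show ?case using coords_i[OF x] by (auto simp: fun_eq_iff evec_def less_Suc_eq)
  qed (simp add: fun_eq_iff)
  from this[of n] show ?thesis using x by (auto simp: coords_def fun_eq_iff)
qed

lemma hom_free_eq:
  assumes f: "f \<in> mod_hom R (free R n) N" and N: "left_module R N" and x: "x \<in> coords R (carrier R) n"
  shows "f x = lincomb N (\<lambda>i. f (evec R i)) n x"
proof -
  have "f (lincomb (free R n) (evec R) n x) = lincomb N (\<lambda>i. f (evec R i)) n x"
    by (rule fr.hom_lincomb[OF f N]) (auto simp: coords_i[OF x])
  then show ?thesis by (simp add: lincomb_free_expand[OF x])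
qed

lemma hom_free_ext:
  assumes "f \<in> mod_hom R (free R n) N" "g \<in> mod_hom R (free R n) N" "left_module R N"
    "\<And>i. i < n \<Longrightarrow> f (evec R i) = g (evec R i)" "x \<in> coords R (carrier R) n"
  shows "f x = g x"
proof -
  interpret N: lmod R N by (rule lmod.intro) fact
  show ?thesis unfolding hom_free_eq[OF assms(1,3,5)] hom_free_eq[OF assms(2,3,5)]
    by (rule N.lincomb_cong) (auto simp: assms)
qed

lemma dot_hom: "b \<in> coords R (carrier R) n \<Longrightarrow> (\<lambda>x. dot R n x b) \<in> mod_hom R (free R n) (regular R)"
  using reg.lincomb_hom[of n b] by (simp add: dot_lincomb coords_i cong: mod_hom_def)

lemma dot_closed [simp]: "\<lbrakk>x \<in> coords R (carrier R) n; b \<in> coords R (carrier R) n\<rbrakk> \<Longrightarrow> dot R n x b \<in> carrier R"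
  using mod_homD(1)[OF dot_hom] by simp

lemma dot_evec [simp]: "\<lbrakk>k < n; b \<in> coords R (carrier R) n\<rbrakk> \<Longrightarrow> dot R n (evec R k) b = b k"
  using reg.lincomb_evec[of k n b] by (simp add: dot_lincomb coords_i)

lemma covec_closed: "\<phi> \<in> mod_hom R (free R n) (regular R) \<Longrightarrow> covec R n \<phi> \<in> coords R (carrier R) n"
  using mod_homD(1)[of \<phi> R "free R n" "regular R"] by (auto simp: covec_def coords_def evec_def)

lemma functional_eq:
  assumes \<phi>: "\<phi> \<in> mod_hom R (free R n) (regular R)" and x: "x \<in> coords R (carrier R) n"
  shows "\<phi> x = dot R n x (covec R n \<phi>)"
  unfolding dot_lincomb hom_free_eq[OF \<phi> reg.left_module_axioms x]
  by (rule reg.lincomb_cong) (auto simp: covec_def)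

end

context ring
begin

text \<open>Here and in the next lemmas, statements about columns are statements about rows over
  \<open>opp R\<close>, where \<open>dot\<close> exchanges its arguments.\<close>

lemma dot_evec_right [simp]: "\<lbrakk>k < n; x \<in> coords R (carrier R) n\<rbrakk> \<Longrightarrow> dot R n x (evec R k) = x k"
  using ring.dot_evec[OF ring_opp, of k n x] by simp

lemma dot_hom_right: "x \<in> coords R (carrier R) n \<Longrightarrow> dot R n x \<in> mod_hom (opp R) (free (opp R) n) (regular (opp R))"
  using ring.dot_hom[OF ring_opp, of x n] by simp

lemma dot_add_right:
  "\<lbrakk>x \<in> coords R (carrier R) n; b \<in> coords R (carrier R) n; c \<in> coords R (carrier R) n\<rbrakk> \<Longrightarrow>
    dot R n x (\<lambda>i. b i \<oplus> c i) = dot R n x b \<oplus> dot R n x c"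
  using mod_homD(2)[OF dot_hom_right, of x n b c] by simp

lemma dot_smult_right:
  "\<lbrakk>x \<in> coords R (carrier R) n; b \<in> coords R (carrier R) n; r \<in> carrier R\<rbrakk> \<Longrightarrow>
    dot R n x (\<lambda>i. b i \<otimes> r) = dot R n x b \<otimes> r"
  using mod_homD(3)[OF dot_hom_right, of x n r b] by simp

lemma dot_smult_left:
  "\<lbrakk>x \<in> coords R (carrier R) n; b \<in> coords R (carrier R) n; r \<in> carrier R\<rbrakk> \<Longrightarrow>
    dot R n (\<lambda>i. r \<otimes> x i) b = r \<otimes> dot R n x b"
  using mod_homD(3)[OF dot_hom, of b n r x] by simp

text \<open>Pairing with the unit rows recovers the entries. Identities between columns, in
  particular between transposed maps, are proved by pairing both sides with all rows.\<close>

lemma dot_nondeg: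
  assumes "b \<in> coords R (carrier R) n" "c \<in> coords R (carrier R) n"
    "\<And>x. x \<in> coords R (carrier R) n \<Longrightarrow> dot R n x b = dot R n x c"
  shows "b = c"
proof
  fix i show "b i = c i"
  proof (cases "i < n")
    case True
    show ?thesis using assms(3)[OF evec_closed[OF True]] assms(1,2) True by simp
  next
    case False
    then show ?thesis using assms(1,2) by (auto simp: coords_def)
  qed
qed

lemma dot_nondeg_left:
  assumes "x \<in> coords R (carrier R) n" "y \<in> coords R (carrier R) n"
    "\<And>b. b \<in> coords R (carrier R) n \<Longrightarrow> dot R n x b = dot R n y b"
  shows "x = y"
  using ring.dot_nondeg[OF ring_opp, of x n y] assms by simp

lemma tr_closed:
  assumes D: "D \<in> mod_hom R (free R m) (free R n)" and b: "b \<in> coords R (carrier R) n"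
  shows "tr R n m D b \<in> coords R (carrier R) m"
  unfolding tr_def by (rule covec_closed, rule mod_hom_comp[OF D dot_hom[OF b]])

text \<open>Adjointness of a matrix acting on rows and the same matrix acting on columns. Together
  with the nondegeneracy of the pairing it characterizes \<open>tr\<close>, whose definition by
  entries is rarely unfolded.\<close>

lemma tr_adj:
  assumes D: "D \<in> mod_hom R (free R m) (free R n)" and b: "b \<in> coords R (carrier R) n"
    and x: "x \<in> coords R (carrier R) m"
  shows "dot R m x (tr R n m D b) = dot R n (D x) b"
  unfolding tr_def by (rule functional_eq[symmetric], rule mod_hom_comp[OF D dot_hom[OF b]], rule x)

lemma tr_eqI:
  assumes D: "D \<in> mod_hom R (free R m) (free R n)" and b: "b \<in> coords R (carrier R) n"
    and c: "c \<in> coords R (carrier R) m"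
    and e: "\<And>x. x \<in> coords R (carrier R) m \<Longrightarrow> dot R m x c = dot R n (D x) b"
  shows "tr R n m D b = c"
  by (rule dot_nondeg[OF tr_closed[OF D b] c]) (simp add: tr_adj[OF D b] e)

lemma tr_hom:
  assumes D: "D \<in> mod_hom R (free R m) (free R n)"
  shows "tr R n m D \<in> mod_hom (opp R) (free (opp R) n) (free (opp R) m)"
proof (rule mod_homI)
  have Dc: "D x \<in> coords R (carrier R) n" if "x \<in> coords R (carrier R) m" for x
    using mod_homD(1)[OF D] that by simp
  note tc = tr_closed[OF D]
  have fc: "(\<lambda>i. x i \<oplus> y i) \<in> coords R (carrier R) k"
    if "x \<in> coords R (carrier R) k" "y \<in> coords R (carrier R) k" for x y k
    using that by (auto simp: coords_def)
  have fc2: "(\<lambda>i. x i \<otimes> r) \<in> coords R (carrier R) k"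
    if "x \<in> coords R (carrier R) k" "r \<in> carrier R" for x r k
    using that by (auto simp: coords_def)
  show "tr R n m D x \<in> carrier (free (opp R) m)" if "x \<in> carrier (free (opp R) n)" for x
    using tc that by simp
  show "tr R n m D (x \<oplus>\<^bsub>free (opp R) n\<^esub> y) = tr R n m D x \<oplus>\<^bsub>free (opp R) m\<^esub> tr R n m D y"
    if "x \<in> carrier (free (opp R) n)" "y \<in> carrier (free (opp R) n)" for x y
    using that tc fc by (auto intro!: tr_eqI[OF D] simp: dot_add_right tr_adj[OF D] Dc)
  show "tr R n m D (r \<odot>\<^bsub>free (opp R) n\<^esub> x) = r \<odot>\<^bsub>free (opp R) m\<^esub> tr R n m D x"
    if "r \<in> carrier (opp R)" "x \<in> carrier (free (opp R) n)" for r x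
    using that tc fc2 by (auto intro!: tr_eqI[OF D] simp: dot_smult_right tr_adj[OF D] Dc)
qed

lemma tr_tr:
  assumes D: "D \<in> mod_hom R (free R m) (free R n)" and x: "x \<in> coords R (carrier R) m"
  shows "tr (opp R) m n (tr R n m D) x = D x"
proof (rule ring.tr_eqI[OF ring_opp tr_hom[OF D]])
  show "x \<in> coords (opp R) (carrier (opp R)) m" "D x \<in> coords (opp R) (carrier (opp R)) n"
    using mod_homD(1)[OF D] x by auto
  show "dot (opp R) n b (D x) = dot (opp R) m (tr R n m D b) x" if "b \<in> coords (opp R) (carrier (opp R)) n" for b
    using that tr_adj[OF D _ x] by simp
qed

lemma tr_comp:
  assumes D: "D \<in> mod_hom R (free R m) (free R n)" and E: "E \<in> mod_hom R (free R n) (free R k)"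
    and b: "b \<in> coords R (carrier R) k"
  shows "tr R k m (\<lambda>x. E (D x)) b = tr R n m D (tr R k n E b)"
proof (rule tr_eqI[OF mod_hom_comp[OF D E] b])
  show "tr R n m D (tr R k n E b) \<in> coords R (carrier R) m"
    by (rule tr_closed[OF D tr_closed[OF E b]])
  show "dot R m x (tr R n m D (tr R k n E b)) = dot R k (E (D x)) b" if x: "x \<in> coords R (carrier R) m" for x
    using tr_adj[OF D tr_closed[OF E b] x] tr_adj[OF E b, of "D x"] mod_homD(1)[OF D] x by simp
qed

end

lemma coords_submodule:
  assumes "ring A" "submodule I A (regular A)" shows "submodule (coords A I n) A (free A n)"
proof -
  interpret ring A by fact
  interpret fr: lmod A "free A n" by (rule lmod.intro) (rule free_left_module[OF assms(1)])
  note d = submodD[OF assms(2)]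
  show ?thesis using d(2-5) by (intro fr.submodI) (auto simp: coords_def)
qed

text \<open>Induction along the last coordinate, a homomorphism on \<open>coords A I (Suc n)\<close>
  with kernel \<open>coords A I n\<close> and image \<open>I\<close>.\<close>

lemma coords_length:
  assumes A: "ring A" and I: "submodule I A (regular A)" and k: "mod_length A (sub (regular A) I) = enat k"
  shows "mod_length A (sub (free A n) (coords A I n)) = enat (n * k)"
proof (induction n)
  case 0
  have "coords A I 0 = {\<zero>\<^bsub>free A 0\<^esub>}" by (auto simp: coords_def)
  then show ?case using mod_length_zero[OF free_left_module[OF A]] by (simp add: zero_enat_def)
next
  case (Suc n)
  interpret ring A by fact
  interpret fr: lmod A "free A (Suc n)" by (rule lmod.intro) (rule free_left_module[OF A])
  interpret reg: lmod A "regular A" by (rule lmod.intro) (rule regular_left_module[OF A])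
  note d = submodD[OF I]
  let ?f = "\<lambda>x :: nat \<Rightarrow> 'a. x n"
  have f: "?f \<in> mod_hom A (free A (Suc n)) (regular A)"
    by (rule mod_homI) (auto simp: coords_def)
  have C: "submodule (coords A I (Suc n)) A (free A (Suc n))" by (rule coords_submodule[OF A I])
  have "a_kernel (free A (Suc n)) (regular A) ?f \<inter> coords A I (Suc n) = coords A I n"
  proof (intro equalityI subsetI)
    fix x assume "x \<in> a_kernel (free A (Suc n)) (regular A) ?f \<inter> coords A I (Suc n)"
    then have x: "x n = \<zero>\<^bsub>A\<^esub>" "\<And>i. i < Suc n \<Longrightarrow> x i \<in> I" "\<And>i. i \<ge> Suc n \<Longrightarrow> x i = \<zero>\<^bsub>A\<^esub>"
      by (auto simp: a_kernel_def' coords_def)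
    have "x i = \<zero>\<^bsub>A\<^esub>" if "i \<ge> n" for i using x(1,3) that by (cases "i = n") auto
    then show "x \<in> coords A I n" using x(2) by (auto simp: coords_def)
  next
    fix x assume "x \<in> coords A I n"
    then have x: "\<And>i. i < n \<Longrightarrow> x i \<in> I" "\<And>i. i \<ge> n \<Longrightarrow> x i = \<zero>\<^bsub>A\<^esub>" by (auto simp: coords_def)
    have "x i \<in> I" for i using x d(3) by (cases "i < n") auto
    then show "x \<in> a_kernel (free A (Suc n)) (regular A) ?f \<inter> coords A I (Suc n)"
      using x d(1) by (auto simp: a_kernel_def' coords_def)
  qed
  moreover have "?f ` coords A I (Suc n) = I"
  proof (intro equalityI subsetI)
    fix r assume "r \<in> I"
    then have "(\<lambda>i. if i = n then r else \<zero>\<^bsub>A\<^esub>) \<in> coords A I (Suc n)" using d(3) by (auto simp: coords_def)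
    then show "r \<in> ?f ` coords A I (Suc n)" by (rule image_eqI[rotated]) simp
  qed (auto simp: coords_def)
  moreover have "mod_length A (sub (free A (Suc n)) (coords A I n)) = enat (n * k)"
    using Suc sub_free by metis
  ultimately show ?case
    using mod_length_image[OF f fr.left_module_axioms reg.left_module_axioms C] k by (simp add: add.commute)
qed

section \<open>Short local rings\<close>

text \<open>All that is needed of a short local algebra over \<open>k\<close>. The centrality condition replaces the
  ground field: it holds since \<open>A = k 1 + J\<close>, and it makes all conditions left-right symmetric.\<close>
locale short_local_ring = ring R for R :: "('a, 'x) ring_scheme" (structure) +
  fixes J :: "'a set" and e a :: nat
  assumes J_ideal: "ideal J R"
    and unit: "\<lbrakk>x \<in> carrier R; x \<notin> J\<rbrakk> \<Longrightarrow> \<exists>y\<in>carrier R. x \<otimes> y = \<one> \<and> y \<otimes> x = \<one>"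
    and one_notin_J: "\<one> \<notin> J"
    and central: "x \<in> carrier R \<Longrightarrow> \<exists>z\<in>carrier R. (\<forall>y\<in>carrier R. z \<otimes> y = y \<otimes> z) \<and> x \<ominus> z \<in> J"
    and J3: "\<lbrakk>x \<in> J; y \<in> J; z \<in> J\<rbrakk> \<Longrightarrow> x \<otimes> y \<otimes> z = \<zero>"
    and len_J: "mod_length R (quot (sub (regular R) J) (ideal_prod R J J)) = enat e"
    and len_J2: "mod_length R (sub (regular R) (ideal_prod R J J)) = enat a"
begin

abbreviation V :: "nat \<Rightarrow> (nat \<Rightarrow> 'a) set" where "V n \<equiv> coords R (carrier R) n"
abbreviation J2 :: "'a set" where "J2 \<equiv> ideal_prod R J J"
abbreviation zv :: "nat \<Rightarrow> 'a" where "zv \<equiv> (\<lambda>i. \<zero>)"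

sublocale reg: lmod R "regular R"
  by (rule lmod.intro) (rule regular_left_module[OF ring_axioms])

sublocale fr: lmod R "free R n" for n
  by (rule lmod.intro) (rule free_left_module[OF ring_axioms])

lemma J_carrier: "x \<in> J \<Longrightarrow> x \<in> carrier R"
  using J_ideal by (rule ideal.Icarr)

lemma J2_ideal: "ideal J2 R"
  by (rule ideal_prod_is_ideal[OF J_ideal J_ideal])

lemma ideal_submodule: "ideal I R \<Longrightarrow> submodule I R (regular R)"
  by (rule reg.submodI)
    (auto simp: ideal.Icarr ideal.I_l_closed additive_subgroup.zero_closed additive_subgroup.a_closed ideal.axioms(1))

lemmas J_sub = ideal_submodule[OF J_ideal]
lemmas J2_sub = ideal_submodule[OF J2_ideal]

lemma J2_J: "x \<in> J2 \<Longrightarrow> x \<in> J"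
  using ideal_prod_inter[OF J_ideal J_ideal] by auto

lemma JJ_J2: "\<lbrakk>x \<in> J; y \<in> J\<rbrakk> \<Longrightarrow> x \<otimes> y \<in> J2"
  by (rule ideal_prod.prod)

lemma J2_mult_J: "\<lbrakk>x \<in> J2; y \<in> J\<rbrakk> \<Longrightarrow> x \<otimes> y = \<zero>"
  by (induction rule: ideal_prod.induct) (auto simp: J3 l_distr J_carrier J2_J)

lemma J_mult_J2: "\<lbrakk>x \<in> J2; y \<in> J\<rbrakk> \<Longrightarrow> y \<otimes> x = \<zero>"
  by (induction rule: ideal_prod.induct) (auto simp: J3 r_distr J_carrier J2_J m_assoc[symmetric])

lemma J_mult: "\<lbrakk>x \<in> J; y \<in> carrier R\<rbrakk> \<Longrightarrow> x \<otimes> y \<in> J" "\<lbrakk>x \<in> J; y \<in> carrier R\<rbrakk> \<Longrightarrow> y \<otimes> x \<in> J"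
  using J_ideal by (auto intro: ideal.I_r_closed ideal.I_l_closed)

lemma J2_mult: "\<lbrakk>x \<in> J2; y \<in> carrier R\<rbrakk> \<Longrightarrow> x \<otimes> y \<in> J2" "\<lbrakk>x \<in> J2; y \<in> carrier R\<rbrakk> \<Longrightarrow> y \<otimes> x \<in> J2"
  using J2_ideal by (auto intro: ideal.I_r_closed ideal.I_l_closed)

lemma zero_J [simp]: "\<zero> \<in> J" "\<zero> \<in> J2"
  using J_ideal J2_ideal by (auto simp: additive_subgroup.zero_closed ideal.axioms(1))

lemma J_eq_zero_of_unit:
  assumes "u \<in> carrier R" "u \<notin> J" "x \<in> carrier R" "x \<otimes> u = \<zero>" shows "x = \<zero>"
proof -
  obtain w where "w \<in> carrier R" "u \<otimes> w = \<one>" using unit assms(1,2) by blast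
  then have "x = (x \<otimes> u) \<otimes> w" using assms(1,3) by (simp add: m_assoc)
  then show ?thesis using \<open>w \<in> carrier R\<close> unfolding assms(4) by simp
qed

lemma coords_J_V: "x \<in> coords R J n \<Longrightarrow> x \<in> V n"
  using coords_mono[of J "carrier R"] J_carrier by blast

lemma coords_J2_J: "x \<in> coords R J2 n \<Longrightarrow> x \<in> coords R J n"
  using coords_mono[of J2 J] J2_J by blast

lemma zv_coords [simp]: "zv \<in> coords R J n" "zv \<in> coords R J2 n" "zv \<in> V n"
  by (auto simp: coords_def)

text \<open>All conditions but the two lengths are visibly symmetric. Each ring element is central
  up to an element of \<open>J\<close>, so left and right multiplication agree on
  \<open>J/J^2\<close> and on \<open>J^2\<close>; hence left and right submodules of these two
  modules are the same sets.\<close>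

lemma opp_short: "short_local_ring (opp R) J e a"
proof -
  have ip: "ideal_prod (opp R) J J = J2"
  proof (intro equalityI subsetI)
    fix x assume "x \<in> ideal_prod (opp R) J J"
    then show "x \<in> J2" by (induction rule: ideal_prod.induct) (auto intro: ideal_prod.prod ideal_prod.sum)
  next
    fix x assume "x \<in> J2"
    then show "x \<in> ideal_prod (opp R) J J"
    proof (induction rule: ideal_prod.induct)
      case (prod i j) then show ?case using ideal_prod.prod[of j J i J "opp R"] by simp
    next
      case (sum s t) then show ?case using ideal_prod.sum[of s "opp R" J J t] by simp
    qed
  qed
  have cent: "\<exists>z\<in>carrier R. (\<forall>y\<in>carrier R. z \<otimes> y = y \<otimes> z) \<and> x \<ominus> z \<in> J \<and> (\<exists>j\<in>J. x = z \<oplus> j)"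
    if x: "x \<in> carrier R" for x
  proof -
    obtain z where z: "z \<in> carrier R" "\<forall>y\<in>carrier R. z \<otimes> y = y \<otimes> z" "x \<ominus> z \<in> J" using central[OF x] by blast
    have "x = z \<oplus> (x \<ominus> z)" using reg.minus_add_cancel[of x z] z x J_carrier[OF z(3)] by (simp add: a_comm)
    then show ?thesis using z by blast
  qed
  \<comment> \<open>For \<open>r = z \<oplus> j\<close> with \<open>z\<close> central, the
    commutator of \<open>r\<close> and \<open>x\<close> is that of \<open>j\<close> and
    \<open>x\<close>, and both products lie in \<open>J^2\<close>.\<close>
  have comm: "r \<otimes> x \<ominus> x \<otimes> r \<in> J2" if rx: "r \<in> carrier R" "x \<in> J" for r x
  proof -
    obtain z j where z: "z \<in> carrier R" "\<forall>y\<in>carrier R. z \<otimes> y = y \<otimes> z" "j \<in> J" "r = z \<oplus> j" using cent[OF rx(1)] by blast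
    have c: "x \<in> carrier R" "j \<in> carrier R" using J_carrier rx z by auto
    have "r \<otimes> x \<ominus> x \<otimes> r = j \<otimes> x \<ominus> x \<otimes> j"
      using z(1,2,4) c reg.add_minus_add_cancel[of "x \<otimes> z" "j \<otimes> x" "x \<otimes> j"] by (simp add: l_distr r_distr)
    then show ?thesis using submodD(7)[OF J2_sub, of "j \<otimes> x" "x \<otimes> j"] JJ_J2 z(3) rx(2) by simp
  qed
  \<comment> \<open>On \<open>J^2\<close> the summand \<open>j\<close> acts as zero from both sides,
    so that only the central summand is left.\<close>
  have comm2: "r \<otimes> x = x \<otimes> r" if rx: "r \<in> carrier R" "x \<in> J2" for r x
  proof -
    obtain z j where z: "z \<in> carrier R" "\<forall>y\<in>carrier R. z \<otimes> y = y \<otimes> z" "j \<in> J" "r = z \<oplus> j" using cent[OF rx(1)] by blast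
    have c: "x \<in> carrier R" "j \<in> carrier R" using J_carrier J2_J rx z by auto
    show ?thesis using z c J_mult_J2[OF rx(2) z(3)] J2_mult_J[OF rx(2) z(3)] by (simp add: l_distr r_distr)
  qed
  show ?thesis
  proof (intro short_local_ring.intro short_local_ring_axioms.intro)
    show "ring (opp R)" by (rule ring_opp)
    show "ideal J (opp R)"
    proof (rule idealI)
      show "subgroup J (add_monoid (opp R))"
        using ideal.axioms(1)[OF J_ideal] by (simp add: additive_subgroup_def subgroup_def m_inv_def)
    qed (auto simp: ring_axioms J_mult)
    show "mod_length (opp R) (quot (sub (regular (opp R)) J) (ideal_prod (opp R) J J)) = enat e"
      unfolding ip len_J[symmetric]
    proof (rule mod_length_cong, rule submodule_cong)
      let ?Q = "quot (sub (regular R) J) J2" and ?Q' = "quot (sub (regular (opp R)) J) J2"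
      have J2J: "submodule J2 R (sub (regular R) J)" using reg.submodule_sub[OF J_sub] J2_sub J2_J by blast
      interpret jm: lmod R "sub (regular R) J" by (rule lmod.intro, rule reg.sub_left_module[OF J_sub])
      have coset: "J2 +>\<^bsub>sub (regular (opp R)) J\<^esub> x = J2 +>\<^bsub>sub (regular R) J\<^esub> x" for x
        by (simp add: a_r_coset_def')
      show "carrier ?Q' = carrier ?Q" by (simp add: A_RCOSETS_def RCOSETS_def r_coset_def)
      show "add ?Q' = add ?Q" by (simp add: set_add_def set_mult_def fun_eq_iff)
      fix r X assume r: "r \<in> carrier (opp R)" and X: "X \<in> carrier ?Q'"
      then have XJ: "x \<in> J" if "x \<in> X" for x
        using that submodD(1)[OF J2J] ideal.axioms(1)[OF J_ideal]
        by (auto simp: A_RCOSETS_def RCOSETS_def r_coset_def additive_subgroup.a_closed J2_J)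
      have "J2 +>\<^bsub>sub (regular R) J\<^esub> (x \<otimes> r) = J2 +>\<^bsub>sub (regular R) J\<^esub> (r \<otimes> x)" if "x \<in> X" for x
      proof -
        have xJ: "x \<in> J" using XJ that by simp
        have rR: "r \<in> carrier R" using r by simp
        have "a_minus (sub (regular R) J) (r \<otimes> x) (x \<otimes> r) = r \<otimes> x \<ominus> x \<otimes> r"
          using reg.sub_inv[OF J_sub, of "x \<otimes> r"] J_mult[OF xJ rR] by (simp add: a_minus_def)
        then show ?thesis
          using jm.coset_eq_iff[OF J2J, of "r \<otimes> x" "x \<otimes> r"] comm[OF rR xJ] J_mult[OF xJ rR] by simp
      qed
      then show "r \<odot>\<^bsub>?Q'\<^esub> X = r \<odot>\<^bsub>?Q\<^esub> X" unfolding quot_simps coset by (intro SUP_cong) simp_all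
    qed simp_all
    show "mod_length (opp R) (sub (regular (opp R)) (ideal_prod (opp R) J J)) = enat a"
      unfolding ip len_J2[symmetric]
      by (rule mod_length_cong, rule submodule_cong) (simp_all add: comm2[symmetric])
  next
    fix x assume "x \<in> carrier (opp R)" "x \<notin> J"
    then show "\<exists>y\<in>carrier (opp R). x \<otimes>\<^bsub>opp R\<^esub> y = \<one>\<^bsub>opp R\<^esub> \<and> y \<otimes>\<^bsub>opp R\<^esub> x = \<one>\<^bsub>opp R\<^esub>"
      using unit[of x] by auto
  next
    fix x assume "x \<in> carrier (opp R)"
    then show "\<exists>z\<in>carrier (opp R). (\<forall>y\<in>carrier (opp R). z \<otimes>\<^bsub>opp R\<^esub> y = y \<otimes>\<^bsub>opp R\<^esub> z) \<and> x \<ominus>\<^bsub>opp R\<^esub> z \<in> J"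
      using central[of x] unfolding opp_simps by metis
  next
    fix x y z assume "x \<in> J" "y \<in> J" "z \<in> J"
    then show "x \<otimes>\<^bsub>opp R\<^esub> y \<otimes>\<^bsub>opp R\<^esub> z = \<zero>\<^bsub>opp R\<^esub>"
      using J3[of z y x] J_carrier by (simp add: m_assoc)
  qed (simp add: one_notin_J)
qed

lemma J2_opp: "ideal_prod (opp R) J J = J2"
proof -
  have *: "ideal_prod S J J \<subseteq> ideal_prod (opp S) J J" for S :: "('a, 'x) ring_scheme"
  proof
    fix x assume "x \<in> ideal_prod S J J"
    then show "x \<in> ideal_prod (opp S) J J"
    proof (induction rule: ideal_prod.induct)
      case (prod i j) then show ?case using ideal_prod.prod[of j J i J "opp S"] by simp
    next
      case (sum s t) then show ?case using ideal_prod.sum[of s "opp S" J J t] by simp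
    qed
  qed
  show ?thesis using *[of R] *[of "opp R"] by simp
qed

lemma mod_length_simple:
  assumes M: "left_module R M" and nz: "carrier M \<noteq> {\<zero>\<^bsub>M\<^esub>}"
    and s: "\<And>N. submodule N R M \<Longrightarrow> N = {\<zero>\<^bsub>M\<^esub>} \<or> N = carrier M"
  shows "mod_length R M = enat 1"
proof (rule antisym)
  interpret M: lmod R M by (rule lmod.intro) fact
  have "\<not> has_chain R M 2"
  proof
    assume "has_chain R M 2"
    then obtain c where c: "\<And>i. i \<le> 2 \<Longrightarrow> submodule (c i) R M" "\<And>i. i < 2 \<Longrightarrow> c i \<subset> c (Suc i)"
      unfolding has_chain_def by metis
    have "c 0 \<subset> c 1" "c 1 \<subset> c 2" using c(2)[of 0] c(2)[of 1] by (auto simp: numeral_2_eq_2)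
    moreover have "c 1 = {\<zero>\<^bsub>M\<^esub>} \<or> c 1 = carrier M" "\<zero>\<^bsub>M\<^esub> \<in> c 0" "c 2 \<subseteq> carrier M"
      using s[OF c(1)[of 1]] submodD(3)[OF c(1)[of 0]] submodD(1)[OF c(1)[of 2]] by auto
    ultimately show False by (elim disjE) auto
  qed
  then have "\<not> enat 2 \<le> mod_length R M" by (simp add: le_mod_length)
  then show "mod_length R M \<le> enat 1" by (cases "mod_length R M") auto
  have "{\<zero>\<^bsub>M\<^esub>} \<subset> carrier M" using nz M.M.zero_closed by blast
  from mod_length_strict[OF M M.zero_submodule M.carrier_submodule this, of 0]
  show "enat 1 \<le> mod_length R M" using mod_length_zero[OF M] by (simp add: zero_enat_def)
qed

lemma len_J': "mod_length R (sub (regular R) J) = enat (e + a)"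
proof -
  have J2J: "submodule J2 R (sub (regular R) J)" using reg.submodule_sub[OF J_sub] J2_sub J2_J by blast
  show ?thesis using mod_length_quot[OF reg.sub_left_module[OF J_sub] J2J] len_J len_J2 by (simp add: add.commute)
qed

text \<open>The summand 1 is the length of \<open>R/J\<close>, which is simple because a nonzero
  coset is represented by a unit.\<close>

lemma len_R: "mod_length R (regular R) = enat (1 + e + a)"
proof -
  have "mod_length R (quot (regular R) J) = enat 1"
  proof (rule mod_length_simple)
    let ?p = "\<lambda>x. J +>\<^bsub>regular R\<^esub> x"
    show lm: "left_module R (quot (regular R) J)" by (rule reg.proj_hom(4)[OF J_sub])
    note ph = reg.proj_hom(1)[OF J_sub] and ps = reg.proj_hom(2)[OF J_sub] and pk = reg.proj_hom(3)[OF J_sub]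
    have "?p \<one> \<in> carrier (quot (regular R) J)" using ps by auto
    moreover have "?p \<one> \<noteq> \<zero>\<^bsub>quot (regular R) J\<^esub>" using pk one_notin_J one_closed
      by (metis (mono_tags, lifting) a_kernel_def' mem_Collect_eq regular_simps(1))
    ultimately show "carrier (quot (regular R) J) \<noteq> {\<zero>\<^bsub>quot (regular R) J\<^esub>}" by blast
    fix N assume N: "submodule N R (quot (regular R) J)"
    note d = submodD[OF N]
    have "N = carrier (quot (regular R) J)" if ne: "N \<noteq> {\<zero>\<^bsub>quot (regular R) J\<^esub>}"
    proof -
      obtain X where X: "X \<in> N" "X \<noteq> \<zero>\<^bsub>quot (regular R) J\<^esub>" using ne d(3) by blast
      then obtain x where x: "x \<in> carrier R" "X = ?p x" using d(2)[OF X(1)] ps by (metis imageE regular_simps(1))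
      then have "x \<notin> J" using X(2) pk by (auto simp: a_kernel_def')
      then obtain y where y: "y \<in> carrier R" "y \<otimes> x = \<one>" using unit x by blast
      have "?p z \<in> N" if z: "z \<in> carrier R" for z
      proof -
        have "(z \<otimes> y) \<odot>\<^bsub>quot (regular R) J\<^esub> ?p x \<in> N" using d(5) X(1) x y z by blast
        moreover have "(z \<otimes> y) \<odot>\<^bsub>quot (regular R) J\<^esub> ?p x = ?p (z \<otimes> y \<otimes> x)"
          using mod_homD(3)[OF ph, of "z \<otimes> y" x] x y z by simp
        moreover have "z \<otimes> y \<otimes> x = z" using x y z by (simp add: m_assoc)
        ultimately show ?thesis by simp
      qed
      then have "carrier (quot (regular R) J) \<subseteq> N" unfolding ps[symmetric] by auto
      then show ?thesis using d(1) by blast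
    qed
    then show "N = {\<zero>\<^bsub>quot (regular R) J\<^esub>} \<or> N = carrier (quot (regular R) J)" by blast
  qed
  then show ?thesis using mod_length_quot[OF reg.left_module_axioms J_sub] len_J' by simp
qed

lemma len_coords:
  "mod_length R (sub (free R n) (coords R J n)) = enat (n * (e + a))"
  "mod_length R (sub (free R n) (coords R J2 n)) = enat (n * a)"
  "mod_length R (free R n) = enat (n * (1 + e + a))"
proof -
  show "mod_length R (sub (free R n) (coords R J n)) = enat (n * (e + a))"
    by (rule coords_length[OF ring_axioms J_sub len_J'])
  show "mod_length R (sub (free R n) (coords R J2 n)) = enat (n * a)"
    by (rule coords_length[OF ring_axioms J2_sub len_J2])
  have "submodule (carrier R) R (regular R)" using reg.carrier_submodule by simp
  moreover have "sub (regular R) (carrier R) = regular R" using reg.sub_carrier by simp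
  ultimately show "mod_length R (free R n) = enat (n * (1 + e + a))"
    using coords_length[OF ring_axioms, of "carrier R" "1 + e + a" n] len_R fr.sub_carrier[of n] by simp
qed

lemmas coords_J_sub = coords_submodule[OF ring_axioms J_sub]
lemmas coords_J2_sub = coords_submodule[OF ring_axioms J2_sub]

lemma free_fl: "fl_module R (free R n)"
  by (simp add: fl_module_def fr.left_module_axioms len_coords(3))

lemma dot_in:
  assumes "submodule I R (regular R)" "\<And>k. k < m \<Longrightarrow> x k \<otimes> b k \<in> I" shows "dot R m x b \<in> I"
  unfolding dot_lincomb by (rule reg.lincomb_in[OF assms(1)]) (simp add: assms(2))

lemma dot_zero:
  assumes "\<And>k. k < m \<Longrightarrow> x k \<otimes> b k = \<zero>" shows "dot R m x b = \<zero>"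
  using reg.lincomb_null[of m x b] assms by (simp add: dot_lincomb)

lemma hom_free_coord:
  assumes D: "D \<in> mod_hom R (free R m) (free R n)" and x: "x \<in> V m"
  shows "D x i = dot R m x (\<lambda>k. D (evec R k) i)"
proof -
  have "D (evec R k) \<in> V n" if "k < m" for k using mod_homD(1)[OF D] that by simp
  then show ?thesis unfolding hom_free_eq[OF D fr.left_module_axioms x]
    by (intro lincomb_free_coord[where n = n]) (auto simp: coords_i[OF x])
qed

text \<open>A matrix with entries in \<open>J\<close> moves each layer of the radical filtration
  into the next one, and \<open>J^3 = 0\<close> ends the filtration.\<close>

lemma rad_hom:
  assumes D: "D \<in> mod_hom R (free R m) (free R n)" and r: "\<And>x. x \<in> V m \<Longrightarrow> D x \<in> coords R J n"
  shows "x \<in> coords R J m \<Longrightarrow> D x \<in> coords R J2 n" "x \<in> coords R J2 m \<Longrightarrow> D x = zv"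
proof -
  have ev: "D (evec R k) i \<in> J" if "k < m" for k i
  proof -
    have "D (evec R k) \<in> coords R J n" by (rule r) (use that in simp)
    then show ?thesis by (cases "i < n") (auto simp: coords_def)
  qed
  have Dv: "i \<ge> n \<Longrightarrow> D x i = \<zero>" if "x \<in> V m" for i x using mod_homD(1)[OF D, of x] that by (auto simp: coords_def)
  show "D x \<in> coords R J2 n" if x: "x \<in> coords R J m"
  proof -
    have "D x i \<in> J2" for i unfolding hom_free_coord[OF D coords_J_V[OF x]]
      by (rule dot_in[OF J2_sub]) (use x ev in \<open>auto simp: coords_def JJ_J2\<close>)
    then show ?thesis using Dv[OF coords_J_V[OF x]] by (auto simp: coords_def)
  qed
  show "D x = zv" if x: "x \<in> coords R J2 m"
  proof
    fix i show "D x i = \<zero>" unfolding hom_free_coord[OF D coords_J_V[OF coords_J2_J[OF x]]]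
      by (rule dot_zero) (use x ev in \<open>auto simp: coords_def J2_mult_J\<close>)
  qed
qed

lemma tr_rad:
  assumes D: "D \<in> mod_hom R (free R m) (free R n)" and r: "\<And>x. x \<in> V m \<Longrightarrow> D x \<in> coords R J n"
    and b: "b \<in> V n"
  shows "tr R n m D b \<in> coords R J m"
proof -
  have "dot R n (D (evec R k)) b \<in> J" if "k < m" for k
  proof -
    have "D (evec R k) \<in> coords R J n" by (rule r) (use that in simp)
    then show ?thesis by (intro dot_in[OF J_sub]) (use coords_i[OF b] in \<open>auto simp: coords_def J_mult\<close>)
  qed
  then show ?thesis by (auto simp: tr_def covec_def coords_def)
qed

text \<open>Under these two conditions the lengths of kernel and image depend on the ranks alone.
  Additivity on \<open>J A^p\<close>, which contains the kernel and has image
  \<open>J^2 A^q\<close>, gives the kernel; additivity on all of \<open>A^p\<close> then gives the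
  image.\<close>

lemma len_hom:
  assumes E: "E \<in> mod_hom R (free R p) (free R q)" and k: "a_kernel (free R p) (free R q) E \<subseteq> coords R J p"
    and im: "E ` coords R J p = coords R J2 q"
  shows "q * a \<le> p * (e + a)"
    "mod_length R (sub (free R p) (a_kernel (free R p) (free R q) E)) = enat (p * (e + a) - q * a)"
    "mod_length R (sub (free R q) (E ` V p)) = enat (p + q * a)"
proof -
  let ?K = "a_kernel (free R p) (free R q) E"
  have KJ: "?K \<inter> coords R J p = ?K" using k by blast
  have 1: "enat (p * (e + a)) = mod_length R (sub (free R p) ?K) + enat (q * a)"
    using mod_length_image[OF E fr.left_module_axioms fr.left_module_axioms coords_J_sub] im len_coords KJ by simp
  then obtain \<kappa> where \<kappa>: "mod_length R (sub (free R p) ?K) = enat \<kappa>" "p * (e + a) = \<kappa> + q * a"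
    by (cases "mod_length R (sub (free R p) ?K)") auto
  then show "q * a \<le> p * (e + a)" "mod_length R (sub (free R p) ?K) = enat (p * (e + a) - q * a)" by auto
  have "?K \<inter> V p = ?K" by (auto simp: a_kernel_def')
  then have "enat (p * (1 + e + a)) = enat \<kappa> + mod_length R (sub (free R q) (E ` V p))"
    using mod_length_image[OF E fr.left_module_axioms fr.left_module_axioms fr.carrier_submodule] len_coords(3) \<kappa>(1)
      fr.sub_carrier by simp
  then show "mod_length R (sub (free R q) (E ` V p)) = enat (p + q * a)"
    using \<kappa>(2) by (cases "mod_length R (sub (free R q) (E ` V p))") (auto simp: algebra_simps)
qed

subsection \<open>Minimal generators\<close>

abbreviation JM :: "('a, 'm) module \<Rightarrow> 'm set" where "JM X \<equiv> ideal_smult R J X"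

lemma JM_sub: "left_module R X \<Longrightarrow> submodule (JM X) R X"
  unfolding ideal_smult_def
  by (rule lmod.span_submodule[OF lmod.intro]) (auto simp: left_module.smult_closed J_carrier)

lemma JM_I: "\<lbrakk>r \<in> J; x \<in> carrier X\<rbrakk> \<Longrightarrow> r \<odot>\<^bsub>X\<^esub> x \<in> JM X"
  unfolding ideal_smult_def by (rule subsetD[OF span_upper]) blast

lemma JM_least: "\<lbrakk>submodule N R X; \<And>r x. \<lbrakk>r \<in> J; x \<in> carrier X\<rbrakk> \<Longrightarrow> r \<odot>\<^bsub>X\<^esub> x \<in> N\<rbrakk> \<Longrightarrow> JM X \<subseteq> N"
  unfolding ideal_smult_def by (rule span_least) auto

lemma nakayama:
  assumes X: "left_module R X" and N: "submodule N R X" and g: "\<And>x. x \<in> carrier X \<Longrightarrow> \<exists>y\<in>N. \<exists>z\<in>JM X. x = y \<oplus>\<^bsub>X\<^esub> z"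
  shows "N = carrier X"
proof -
  interpret X: lmod R X by (rule lmod.intro) fact
  note d = submodD[OF N]
  have all: "x \<in> L" if L: "submodule L R X" "N \<subseteq> L" "\<And>r x. \<lbrakk>r \<in> J; x \<in> carrier X\<rbrakk> \<Longrightarrow> r \<odot>\<^bsub>X\<^esub> x \<in> L" and x: "x \<in> carrier X" for L x
  proof -
    have "JM X \<subseteq> L" by (rule JM_least[OF L(1,3)])
    then show ?thesis using g[OF x] L(2) submodD(4)[OF L(1)] by blast
  qed
  have colon: "submodule {x \<in> carrier X. \<forall>r\<in>J. r \<odot>\<^bsub>X\<^esub> x \<in> L} R X" if L: "submodule L R X" for L
  proof (rule X.submodI)
    note l = submodD[OF L]
    show "s \<odot>\<^bsub>X\<^esub> x \<in> {x \<in> carrier X. \<forall>r\<in>J. r \<odot>\<^bsub>X\<^esub> x \<in> L}" if "s \<in> carrier R" "x \<in> {x \<in> carrier X. \<forall>r\<in>J. r \<odot>\<^bsub>X\<^esub> x \<in> L}" for s x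
      using that J_mult(1) by (auto simp: X.smult_closed X.smult_assoc[symmetric] J_carrier)
  qed (use submodD(3,4)[OF L] in \<open>auto simp: X.smult_r_distr J_carrier\<close>)
  let ?L2 = "{x \<in> carrier X. \<forall>r\<in>J. r \<odot>\<^bsub>X\<^esub> x \<in> N}"
  let ?L3 = "{x \<in> carrier X. \<forall>r\<in>J. r \<odot>\<^bsub>X\<^esub> x \<in> ?L2}"
  have L2: "submodule ?L2 R X" by (rule colon[OF N])
  have L3: "submodule ?L3 R X" by (rule colon[OF L2])
  have N2: "N \<subseteq> ?L2" using d(2,5) J_carrier by auto
  have N3: "N \<subseteq> ?L3" using d(2,5) J_carrier X.smult_closed by auto
  have s3: "x \<in> ?L3" if x: "x \<in> carrier X" for x
  proof (rule all[OF L3 N3 _ x])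
    fix r x assume rx: "r \<in> J" "x \<in> carrier X"
    have "s \<odot>\<^bsub>X\<^esub> (t \<odot>\<^bsub>X\<^esub> (r \<odot>\<^bsub>X\<^esub> x)) = \<zero>\<^bsub>X\<^esub>" if "s \<in> J" "t \<in> J" for s t
    proof -
      have "s \<odot>\<^bsub>X\<^esub> (t \<odot>\<^bsub>X\<^esub> (r \<odot>\<^bsub>X\<^esub> x)) = (s \<otimes> t \<otimes> r) \<odot>\<^bsub>X\<^esub> x"
        using that rx by (simp add: X.smult_assoc J_carrier X.smult_closed)
      then show ?thesis using J3 that rx by simp
    qed
    then show "r \<odot>\<^bsub>X\<^esub> x \<in> ?L3" using rx d(3) by (auto simp: X.smult_closed J_carrier)
  qed
  have s2: "x \<in> ?L2" if x: "x \<in> carrier X" for x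
    by (rule all[OF L2 N2 _ x]) (use s3 in blast)
  have "x \<in> N" if x: "x \<in> carrier X" for x
    by (rule all[OF N subset_refl _ x]) (use s2 in blast)
  then show ?thesis using d(1) by blast
qed

lemma JM_image:
  assumes X: "left_module R X" and q: "q \<in> mod_hom R (free R n) X" "q ` V n = carrier X"
  shows "JM X = q ` coords R J n"
proof
  interpret X: lmod R X by (rule lmod.intro) fact
  have s: "submodule (q ` coords R J n) R X" by (rule image_submodule[OF q(1) fr.left_module_axioms X coords_J_sub])
  show "JM X \<subseteq> q ` coords R J n"
  proof (rule JM_least[OF s])
    fix r x assume r: "r \<in> J" and x: "x \<in> carrier X"
    then obtain y where y: "y \<in> V n" "x = q y" using q(2) by (metis imageE)
    have "r \<odot>\<^bsub>free R n\<^esub> y \<in> coords R J n" using r y J_mult by (auto simp: coords_def J_carrier)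
    moreover have "q (r \<odot>\<^bsub>free R n\<^esub> y) = r \<odot>\<^bsub>X\<^esub> x" using mod_homD(3)[OF q(1), of r y] r y J_carrier by simp
    ultimately show "r \<odot>\<^bsub>X\<^esub> x \<in> q ` coords R J n" by (metis image_eqI)
  qed
  show "q ` coords R J n \<subseteq> JM X"
  proof
    fix z assume "z \<in> q ` coords R J n"
    then obtain x where x: "x \<in> coords R J n" "z = q x" by blast
    have "lincomb X (\<lambda>i. q (evec R i)) n x \<in> JM X"
      by (rule X.lincomb_in[OF JM_sub[OF X]], rule JM_I) (use x mod_homD(1)[OF q(1)] in \<open>auto simp: coords_def evec_def\<close>)
    then show "z \<in> JM X" using hom_free_eq[OF q(1) X coords_J_V[OF x(1)]] x by simp
  qed
qed

text \<open>A presentation with kernel in the radical induces an isomorphism of tops, so its rank is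
  \<open>t(X)\<close>.\<close>

lemma top_length_eq:
  assumes X: "left_module R X" and q: "q \<in> mod_hom R (free R n) X" "q ` V n = carrier X"
    and k: "a_kernel (free R n) X q \<subseteq> coords R J n"
  shows "top_length R J X = enat n"
proof -
  interpret X: lmod R X by (rule lmod.intro) fact
  note p = X.proj_hom[OF JM_sub[OF X]]
  let ?f = "\<lambda>x. JM X +>\<^bsub>X\<^esub> q x"
  have f: "?f \<in> mod_hom R (free R n) (quot X (JM X))" by (rule mod_hom_comp[OF q(1) p(1)])
  have fs: "?f ` carrier (free R n) = carrier (quot X (JM X))" using q(2) p(2) by (simp add: image_image[symmetric])
  have "a_kernel (free R n) (quot X (JM X)) ?f = {x \<in> V n. q x \<in> JM X}"
    using p(3) mod_homD(1)[OF q(1)] by (auto simp: a_kernel_def')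
  also have "\<dots> = coords R J n"
  proof (intro equalityI subsetI)
    fix x assume "x \<in> {x \<in> V n. q x \<in> JM X}"
    then obtain y where y: "y \<in> coords R J n" "q x = q y" "x \<in> V n" using JM_image[OF X q] by auto
    then have "x \<ominus>\<^bsub>free R n\<^esub> y \<in> coords R J n"
      using kernel_eq_iff[OF q(1) fr.left_module_axioms X, of x y] coords_J_V k by auto
    then have "(x \<ominus>\<^bsub>free R n\<^esub> y) \<oplus>\<^bsub>free R n\<^esub> y \<in> coords R J n" using submodD(4)[OF coords_J_sub] y(1) by blast
    then show "x \<in> coords R J n" using fr.minus_add_cancel[of x n y] y coords_J_V by simp
  qed (use JM_image[OF X q] coords_J_V in auto)
  finally show ?thesis
    using mod_length_hom[OF f fs fr.left_module_axioms p(4)] len_coords(1,3)[of n]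
    unfolding top_length_def by (cases "mod_length R (quot X (JM X))") (auto simp: algebra_simps)
qed

text \<open>Projective covers by hand. A family that is independent modulo \<open>J X\<close> has at
  most as many members as the length of \<open>X\<close>; one of maximal size generates
  \<open>X\<close> modulo \<open>J X\<close>, hence generates \<open>X\<close> by Nakayama's
  lemma.\<close>

lemma min_generators:
  assumes X: "left_module R X" and fin: "mod_length R X \<noteq> \<infinity>"
  obtains n q where "q \<in> mod_hom R (free R n) X" "q ` V n = carrier X" "a_kernel (free R n) X q \<subseteq> coords R J n"
proof -
  interpret X: lmod R X by (rule lmod.intro) fact
  obtain l where l: "mod_length R X = enat l" using fin by auto
  note p = X.proj_hom[OF JM_sub[OF X]]
  note js = submodD[OF JM_sub[OF X]]
  \<comment> \<open>Independence modulo \<open>J X\<close>: a combination lies in \<open>J X\<close>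
    only if all its coefficients lie in \<open>J\<close>.\<close>
  define good where "good n v \<longleftrightarrow> (\<forall>i<n. v i \<in> carrier X) \<and> (\<forall>x\<in>V n. lincomb X v n x \<in> JM X \<longrightarrow> x \<in> coords R J n)" for n v
  have lJ: "lincomb X v n x \<in> JM X" if "\<forall>i<n. v i \<in> carrier X" "x \<in> coords R J n" for n v x
    by (rule X.lincomb_in[OF JM_sub[OF X]], rule JM_I) (use that in \<open>auto simp: coords_def\<close>)
  have bound: "n \<le> l" if g: "good n v" for n v
  proof -
    have h: "lincomb X v n \<in> mod_hom R (free R n) X" using g by (intro X.lincomb_hom) (auto simp: good_def)
    let ?f = "\<lambda>x. JM X +>\<^bsub>X\<^esub> lincomb X v n x"
    have f: "?f \<in> mod_hom R (free R n) (quot X (JM X))" by (rule mod_hom_comp[OF h p(1)])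
    have "a_kernel (free R n) (quot X (JM X)) ?f \<inter> V n = {x \<in> V n. lincomb X v n x \<in> JM X}"
      using p(3) mod_homD(1)[OF h] by (auto simp: a_kernel_def')
    also have "\<dots> = coords R J n" using g lJ[of n v] coords_J_V by (auto simp: good_def)
    finally have "enat (n * (1 + e + a)) = enat (n * (e + a)) + mod_length R (sub (quot X (JM X)) (?f ` V n))"
      using mod_length_image[OF f fr.left_module_axioms p(4) fr.carrier_submodule] len_coords fr.sub_carrier by simp
    then have "mod_length R (sub (quot X (JM X)) (?f ` V n)) = enat n"
      by (cases "mod_length R (sub (quot X (JM X)) (?f ` V n))") (auto simp: algebra_simps)
    moreover have "mod_length R (sub (quot X (JM X)) (?f ` V n)) \<le> mod_length R (sub (quot X (JM X)) (carrier (quot X (JM X))))"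
    proof -
      interpret Q: lmod R "quot X (JM X)" by (rule lmod.intro) (rule p(4))
      have i: "submodule (?f ` V n) R (quot X (JM X))"
        using image_submodule[OF f fr.left_module_axioms p(4) fr.carrier_submodule] by simp
      show ?thesis by (rule mod_length_mono[OF p(4) i Q.carrier_submodule submodD(1)[OF i]])
    qed
    moreover have "sub (quot X (JM X)) (carrier (quot X (JM X))) = quot X (JM X)" by (simp add: sub_def)
    moreover have "mod_length R (quot X (JM X)) \<le> mod_length R X"
      using mod_length_quot[OF X JM_sub[OF X]] by simp
    ultimately show "n \<le> l" using l by (metis enat_ord_simps(1) order_trans)
  qed
  have "\<exists>v. good 0 v" by (auto simp: good_def coords_def)
  moreover have "\<forall>n. (\<exists>v. good n v) \<longrightarrow> n \<le> l" using bound by blast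
  ultimately have "\<exists>n. (\<exists>v. good n v) \<and> (\<forall>m. (\<exists>v. good m v) \<longrightarrow> m \<le> n)"
    by (rule Nat.ex_has_greatest_nat[where P = "\<lambda>n. \<exists>v. good n v"])
  then obtain n v where g: "good n v" and mx: "\<And>m w. good m w \<Longrightarrow> m \<le> n" by blast
  have h: "lincomb X v n \<in> mod_hom R (free R n) X" using g by (intro X.lincomb_hom) (auto simp: good_def)
  let ?N = "lincomb X v n ` V n"
  have N: "submodule ?N R X" using image_submodule[OF h fr.left_module_axioms X fr.carrier_submodule] by simp
  have "?N = carrier X"
  proof (rule nakayama[OF X N])
    fix x assume x: "x \<in> carrier X"
    show "\<exists>y\<in>?N. \<exists>z\<in>JM X. x = y \<oplus>\<^bsub>X\<^esub> z"
    proof (rule ccontr)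
      assume no: "\<not> ?thesis"
      \<comment> \<open>A vector outside \<open>?N + J X\<close> can be appended without losing
        independence, since a unit coefficient of \<open>x\<close> would express \<open>x\<close> by
        the old members modulo \<open>J X\<close>. This contradicts the choice of
        \<open>n\<close>.\<close>
      define w where "w = v(n := x)"
      have "good (Suc n) w"
        unfolding good_def
      proof (intro conjI ballI impI)
        show "\<forall>i<Suc n. w i \<in> carrier X" using g x by (auto simp: w_def good_def)
        fix u assume u: "u \<in> V (Suc n)" and uJ: "lincomb X w (Suc n) u \<in> JM X"
        define u' where "u' = u(n := \<zero>)"
        have u'V: "u' \<in> V n" using u by (auto simp: u'_def coords_def)
        have un: "u n \<in> carrier R" by (rule coords_i[OF u])
        define y where "y = lincomb X v n u'"
        have eq: "lincomb X w (Suc n) u = y \<oplus>\<^bsub>X\<^esub> u n \<odot>\<^bsub>X\<^esub> x"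
          using X.lincomb_cong[of n w v u u'] by (simp add: w_def u'_def y_def)
        have yN: "y \<in> ?N" using u'V by (simp add: y_def)
        have yX: "y \<in> carrier X" using submodD(2)[OF N yN] .
        have unJ: "u n \<in> J"
        proof (rule ccontr)
          assume "u n \<notin> J"
          then obtain t where t: "t \<in> carrier R" "t \<otimes> u n = \<one>" using unit[OF un] by blast
          define z where "z = y \<oplus>\<^bsub>X\<^esub> u n \<odot>\<^bsub>X\<^esub> x"
          have zJ: "z \<in> JM X" using uJ eq by (simp add: z_def)
          have zX: "z \<in> carrier X" using js(2)[OF zJ] .
          have "t \<odot>\<^bsub>X\<^esub> z = t \<odot>\<^bsub>X\<^esub> y \<oplus>\<^bsub>X\<^esub> x"
            using t un yX x by (simp add: z_def X.smult_r_distr X.smult_closed X.smult_assoc[symmetric] X.smult_one)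
          then have "x = (\<ominus>\<^bsub>X\<^esub> (t \<odot>\<^bsub>X\<^esub> y)) \<oplus>\<^bsub>X\<^esub> t \<odot>\<^bsub>X\<^esub> z"
            using t yX x X.smult_closed by (simp add: X.M.r_neg1)
          then show False using no submodD(5,6)[OF N] js(5) t(1) yN zJ by blast
        qed
        have "u n \<odot>\<^bsub>X\<^esub> x \<in> JM X" by (rule JM_I[OF unJ x])
        then have "(y \<oplus>\<^bsub>X\<^esub> u n \<odot>\<^bsub>X\<^esub> x) \<ominus>\<^bsub>X\<^esub> u n \<odot>\<^bsub>X\<^esub> x \<in> JM X" using js(7) uJ eq by simp
        moreover have "(y \<oplus>\<^bsub>X\<^esub> u n \<odot>\<^bsub>X\<^esub> x) \<ominus>\<^bsub>X\<^esub> u n \<odot>\<^bsub>X\<^esub> x = y"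
          using yX x un X.smult_closed by (simp add: a_minus_def X.M.a_assoc X.M.r_neg)
        ultimately have "u' \<in> coords R J n" using g u'V by (auto simp: good_def y_def)
        then show "u \<in> coords R J (Suc n)" using u unJ by (auto simp: u'_def coords_def less_Suc_eq split: if_splits)
      qed
      then show False using mx by fastforce
    qed
  qed
  moreover have "a_kernel (free R n) X (lincomb X v n) \<subseteq> coords R J n"
    using g js(3) by (auto simp: a_kernel_def' good_def)
  ultimately show ?thesis using that h by blast
qed

end

text \<open>The condition \<open>Ext\<^sup>1(k, A) = 0\<close>.\<close>
definition ext1_top_vanishes :: "('a, 'x) ring_scheme \<Rightarrow> 'a set \<Rightarrow> bool" where
  "ext1_top_vanishes A J \<longleftrightarrow>
    (\<forall>g\<in>mod_hom A (sub (regular A) J) (regular A). \<exists>b\<in>carrier A. \<forall>r\<in>J. g r = r \<otimes>\<^bsub>A\<^esub> b)"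

lemma lincomb_sub [simp]: "lincomb (sub M N) v n x = lincomb M v n x"
  by (induction n) auto

section \<open>Left-right symmetry of the condition Ext^1(k, A) = 0\<close>

context short_local_ring
begin

lemma len_J2_zero: "a = 0 \<longleftrightarrow> J2 = {\<zero>}"
proof
  assume "a = 0"
  then have "{\<zero>} = J2"
    using submodule_eq_of_length[OF reg.left_module_axioms reg.zero_submodule J2_sub, of 0]
      mod_length_zero[OF reg.left_module_axioms] len_J2 by (simp add: zero_enat_def)
  then show "J2 = {\<zero>}" by simp
next
  assume "J2 = {\<zero>}"
  then show "a = 0" using len_J2 mod_length_zero[OF reg.left_module_axioms] by (simp add: zero_enat_def)
qed

lemma JM_J: "JM (sub (regular R) J) = J2"
proof
  have lm: "left_module R (sub (regular R) J)" by (rule reg.sub_left_module[OF J_sub])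
  have J2J: "submodule J2 R (sub (regular R) J)" using reg.submodule_sub[OF J_sub] J2_sub J2_J by blast
  show "JM (sub (regular R) J) \<subseteq> J2" by (rule JM_least[OF J2J]) (simp add: JJ_J2)
  show "J2 \<subseteq> JM (sub (regular R) J)"
  proof
    fix x assume "x \<in> J2"
    then show "x \<in> JM (sub (regular R) J)"
    proof (induction rule: ideal_prod.induct)
      case (prod i j)
      then show ?case using JM_I[of i j "sub (regular R) J"] by simp
    next
      case (sum s t)
      then show ?case using submodD(4)[OF JM_sub[OF lm], of s t] by simp
    qed
  qed
qed

text \<open>A minimal generating column \<open>v\<close> of the left ideal \<open>J\<close> has
  exactly \<open>e\<close> entries, and all relations between them have coefficients in
  \<open>J\<close>. It encodes a homomorphism on \<open>J\<close> by the column of its values on the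
  generators.\<close>

lemma generators_J:
  obtains v where "v \<in> coords R J e" "J = (\<lambda>u. dot R e u v) ` V e" "J2 = (\<lambda>u. dot R e u v) ` coords R J e"
    "\<And>u. \<lbrakk>u \<in> V e; dot R e u v = \<zero>\<rbrakk> \<Longrightarrow> u \<in> coords R J e"
proof -
  let ?X = "sub (regular R) J"
  have lm: "left_module R ?X" by (rule reg.sub_left_module[OF J_sub])
  have "mod_length R ?X \<noteq> \<infinity>" using len_J' by simp
  obtain n q where
    q: "q \<in> mod_hom R (free R n) ?X" "q ` V n = carrier ?X" and k: "a_kernel (free R n) ?X q \<subseteq> coords R J n"
    by (rule min_generators[OF lm \<open>mod_length R ?X \<noteq> \<infinity>\<close>])
  have J2: "J2 = q ` coords R J n" using JM_image[OF lm q] JM_J by simp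
  have "top_length R J ?X = enat n" by (rule top_length_eq[OF lm q k])
  moreover have "top_length R J ?X = enat e" unfolding top_length_def JM_J using len_J by simp
  ultimately have n: "n = e" by simp
  have q': "q \<in> mod_hom R (free R e) (regular R)" using mod_hom_sub_incl[OF q(1)] J_carrier n by auto
  define v where "v = covec R e q"
  have qv: "q u = dot R e u v" if "u \<in> V e" for u unfolding v_def by (rule functional_eq[OF q' that])
  have "v \<in> coords R J e" using mod_homD(1)[OF q(1)] n by (auto simp: v_def covec_def coords_def evec_def)
  moreover have "J = (\<lambda>u. dot R e u v) ` V e" using q(2) qv n by (simp cong: image_cong)
  moreover have "J2 = (\<lambda>u. dot R e u v) ` coords R J e"
    unfolding J2 n by (rule image_cong) (auto simp: qv coords_J_V)
  moreover have "u \<in> coords R J e" if "u \<in> V e" "dot R e u v = \<zero>" for u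
    using k that qv n by (auto simp: a_kernel_def')
  ultimately show ?thesis using that by blast
qed

context
  fixes v
  assumes v: "v \<in> coords R J e" "J = (\<lambda>u. dot R e u v) ` V e" "J2 = (\<lambda>u. dot R e u v) ` coords R J e"
    "\<And>u. \<lbrakk>u \<in> V e; dot R e u v = \<zero>\<rbrakk> \<Longrightarrow> u \<in> coords R J e"
begin

text \<open>The column of values on the generators of the homomorphism that multiplies
  \<open>J\<close> by \<open>b\<close> from the right. Ext^1(k, A) = 0 means that every homomorphism
  from \<open>J\<close> to \<open>A\<close> has a column of this form.\<close>

definition Phi :: "'a \<Rightarrow> nat \<Rightarrow> 'a" where "Phi b = (\<lambda>i. v i \<otimes> b)"

interpretation op: short_local_ring "opp R" J e a by (rule opp_short)

lemma v_J: "v i \<in> J" using v(1) by (cases "i < e") (auto simp: coords_def)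

lemma v_zero: "i \<ge> e \<Longrightarrow> v i = \<zero>" using v(1) by (auto simp: coords_def)

lemma v_V: "v \<in> V e" using v(1) coords_J_V by blast

lemma Phi_hom: "Phi \<in> mod_hom (opp R) (regular (opp R)) (free (opp R) e)"
  by (rule mod_homI) (auto simp: Phi_def coords_def r_distr m_assoc v_J v_zero J_carrier)

lemma dot_Phi: "\<lbrakk>u \<in> V e; b \<in> carrier R\<rbrakk> \<Longrightarrow> dot R e u (Phi b) = dot R e u v \<otimes> b"
  unfolding Phi_def by (rule dot_smult_right[OF _ v_V])

lemma v_eq: "i < e \<Longrightarrow> v i = dot R e (evec R i) v"
  using v_V by simp

lemma Phi_J: "b \<in> J \<Longrightarrow> Phi b \<in> coords R J2 e"
  by (auto simp: Phi_def coords_def JJ_J2 v_J v_zero J_carrier)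

lemma Phi_zero: "b \<in> J2 \<Longrightarrow> Phi b = zv"
  using v_J by (auto simp: Phi_def J_mult_J2)

lemma Phi_zeroD:
  assumes "Phi b = zv" "b \<in> carrier R" "r \<in> J" shows "r \<otimes> b = \<zero>"
proof -
  obtain u where u: "u \<in> V e" "r = dot R e u v" using v(2) assms(3) by blast
  have "r \<otimes> b = dot R e u (Phi b)" using dot_Phi[OF u(1) assms(2)] u(2) by simp
  also have "\<dots> = \<zero>" unfolding assms(1) by (rule dot_zero) (use coords_i[OF u(1)] in simp)
  finally show ?thesis .
qed

text \<open>The relations between the generators have coefficients in \<open>J\<close>, so a column
  that is annihilated by all rows over \<open>J\<close> respects them and defines a homomorphism on
  \<open>J\<close>.\<close>

lemma hom_from_J:
  assumes s: "s \<in> V e" and k: "\<And>u. u \<in> coords R J e \<Longrightarrow> dot R e u s = \<zero>"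
  obtains g where "g \<in> mod_hom R (sub (regular R) J) (regular R)" "\<And>u. u \<in> V e \<Longrightarrow> g (dot R e u v) = dot R e u s"
proof -
  have lm: "left_module R (sub (regular R) J)" by (rule reg.sub_left_module[OF J_sub])
  have "(\<lambda>u. dot R e u v) \<in> mod_hom R (free R e) (sub (regular R) J)"
    by (rule mod_hom_sub_cod[OF dot_hom[OF v_V]]) (use v(2) in auto)
  from mod_hom_factor[OF this _ dot_hom[OF s] fr.left_module_axioms lm reg.left_module_axioms]
  show ?thesis using that v(2,4) k by auto
qed

text \<open>The homomorphism with the column \<open>s\<close> is right multiplication by some
  \<open>b\<close>. It vanishes on \<open>J^2\<close>, whose elements are the combinations of the
  generators with coefficients in \<open>J\<close>; this is the last clause.\<close>

lemma ext1_Phi: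
  assumes ext: "ext1_top_vanishes R J" and s: "s \<in> V e" and k: "\<And>u. u \<in> coords R J e \<Longrightarrow> dot R e u s = \<zero>"
  obtains b where "b \<in> carrier R" "Phi b = s" "\<And>w. w \<in> J2 \<Longrightarrow> w \<otimes> b = \<zero>"
proof -
  obtain g where g: "g \<in> mod_hom R (sub (regular R) J) (regular R)" "\<And>u. u \<in> V e \<Longrightarrow> g (dot R e u v) = dot R e u s"
    using hom_from_J[OF s k] by blast
  obtain b where b: "b \<in> carrier R" "\<forall>r\<in>J. g r = r \<otimes> b" using ext g(1) unfolding ext1_top_vanishes_def by blast
  have "Phi b = s"
  proof
    fix i show "Phi b i = s i"
    proof (cases "i < e")
      case True
      then have "v i \<otimes> b = g (v i)" using b(2) v_J by simp
      also have "\<dots> = s i" using g(2)[of "evec R i"] True v_eq s by simp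
      finally show ?thesis by (simp add: Phi_def)
    next
      case False
      then show ?thesis using s v(1) b(1) by (auto simp: Phi_def coords_def)
    qed
  qed
  moreover have "w \<otimes> b = \<zero>" if w: "w \<in> J2" for w
  proof -
    obtain u where u: "u \<in> coords R J e" "w = dot R e u v" using v(3) w by (metis imageE)
    then show ?thesis using b(2) g(2)[OF coords_J_V[OF u(1)]] k[OF u(1)] J2_J[OF w] by simp
  qed
  ultimately show ?thesis using that b(1) by blast
qed

lemma len_Phi_J:
  "enat (e + a) = mod_length (opp R) (sub (regular (opp R)) (a_kernel (regular (opp R)) (free (opp R) e) Phi \<inter> J)) +
    mod_length (opp R) (sub (free (opp R) e) (Phi ` J))"
  using mod_length_image[OF Phi_hom op.reg.left_module_axioms op.fr.left_module_axioms op.J_sub] op.len_J' by simp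

lemma ker_Phi_sub: "submodule (a_kernel (regular (opp R)) (free (opp R) e) Phi \<inter> J) (opp R) (regular (opp R))"
  by (rule op.reg.submodule_Int[OF kernel_submodule[OF Phi_hom op.reg.left_module_axioms op.fr.left_module_axioms] op.J_sub])

lemma Phi_J_sub: "submodule (Phi ` J) (opp R) (free (opp R) e)"
  by (rule image_submodule[OF Phi_hom op.reg.left_module_axioms op.fr.left_module_axioms op.J_sub])

text \<open>The socle condition makes \<open>J^2\<close> the kernel of \<open>Phi\<close> on
  \<open>J\<close>, and for \<open>a = 1\<close> a count of lengths shows that \<open>Phi\<close>
  maps \<open>J\<close> onto all columns over \<open>J^2\<close>. So every homomorphism from
  \<open>J\<close> into \<open>J^2\<close> is a right multiplication. A general one is brought into
  this form by subtracting multiplication with a central element that agrees with it on the simple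
  ideal \<open>J^2\<close>.\<close>

lemma ext1_of_frobenius_aux:
  assumes a1: "a = 1" and soc: "\<And>x. \<lbrakk>x \<in> carrier R; \<And>r. r \<in> J \<Longrightarrow> r \<otimes> x = \<zero>\<rbrakk> \<Longrightarrow> x \<in> J2"
  shows "ext1_top_vanishes R J"
  unfolding ext1_top_vanishes_def
proof
  have "a_kernel (regular (opp R)) (free (opp R) e) Phi \<inter> J = J2"
  proof (intro equalityI subsetI)
    fix b assume "b \<in> a_kernel (regular (opp R)) (free (opp R) e) Phi \<inter> J"
    then have b: "b \<in> carrier R" "Phi b = zv" by (auto simp: a_kernel_def')
    show "b \<in> J2" by (rule soc[OF b(1) Phi_zeroD[OF b(2,1)]])
  next
    fix b assume b: "b \<in> J2"
    then show "b \<in> a_kernel (regular (opp R)) (free (opp R) e) Phi \<inter> J"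
      using Phi_zero[OF b] J2_J[OF b] J_carrier[OF J2_J[OF b]] by (simp add: a_kernel_def')
  qed
  then have "enat (e + a) = enat a + mod_length (opp R) (sub (free (opp R) e) (Phi ` J))"
    using len_Phi_J op.len_J2 J2_opp by simp
  then have "mod_length (opp R) (sub (free (opp R) e) (Phi ` J)) = enat (e * a)"
    using a1 by (cases "mod_length (opp R) (sub (free (opp R) e) (Phi ` J))") auto
  then have PJ: "Phi ` J = coords R J2 e"
    using submodule_eq_of_length[OF op.fr.left_module_axioms Phi_J_sub op.coords_J2_sub, where k = "e * a"]
      op.len_coords(2)[of e] Phi_J by (auto simp: J2_opp)
  fix g assume g: "g \<in> mod_hom R (sub (regular R) J) (regular R)"
  have lm: "left_module R (sub (regular R) J)" by (rule reg.sub_left_module[OF J_sub])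
  note gh = mod_homD[OF g, simplified]
  obtain s where s: "s \<in> J2" "s \<noteq> \<zero>" using len_J2_zero a1 zero_J(2) by fastforce
  have sR: "s \<in> carrier R" using J2_J J_carrier s(1) by blast
  have gJ: "g x \<in> J" if x: "x \<in> J" for x
  proof (rule ccontr)
    assume gx: "g x \<notin> J"
    have "s \<otimes> g x = g (s \<otimes> x)" using gh(3)[OF sR x] by simp
    also have "\<dots> = \<zero>" using J2_mult_J[OF s(1) x] mod_hom_zero[OF g lm reg.left_module_axioms] by simp
    finally show False using J_eq_zero_of_unit[OF gh(1)[OF x] gx sR] s(2) by simp
  qed
  have gJ2: "g x \<in> J2" if "x \<in> J2" for x using that
  proof (induction rule: ideal_prod.induct)
    case (prod i j)
    then show ?case using gh(3)[of i j] J_carrier gJ JJ_J2 by simp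
  next
    case (sum x y)
    then show ?case using gh(2)[of x y] J2_J submodD(4)[OF J2_sub, of "g x" "g y"] by simp
  qed
  \<comment> \<open>By \<open>a = 1\<close> each nonzero element of \<open>J^2\<close> generates
    it.\<close>
  have rs: "\<exists>r\<in>carrier R. t = r \<otimes> s" if t: "t \<in> J2" for t
  proof -
    have h: "(\<lambda>r. r \<otimes> s) \<in> mod_hom R (regular R) (regular R)"
      by (rule mod_homI) (auto simp: sR l_distr m_assoc)
    have im: "submodule ((\<lambda>r. r \<otimes> s) ` carrier R) R (regular R)"
      using image_submodule[OF h reg.left_module_axioms reg.left_module_axioms reg.carrier_submodule] by simp
    let ?I = "(\<lambda>r. r \<otimes> s) ` carrier R"
    have sI: "s \<in> ?I" using sR by (intro image_eqI[of _ _ \<one>]) auto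
    have "{\<zero>} \<subset> ?I" using submodD(3)[OF im] sI s(2) by auto
    then have "enat (Suc 0) \<le> mod_length R (sub (regular R) ?I)"
      using mod_length_strict[OF reg.left_module_axioms reg.zero_submodule im, of 0]
        mod_length_zero[OF reg.left_module_axioms] by (simp add: zero_enat_def)
    moreover have IJ2: "?I \<subseteq> J2" using J2_mult s(1) by auto
    then have "mod_length R (sub (regular R) ?I) \<le> enat 1"
      using mod_length_mono[OF reg.left_module_axioms im J2_sub] len_J2 a1 by simp
    ultimately have "mod_length R (sub (regular R) ?I) = enat 1" by simp
    then have "?I = J2" using submodule_eq_of_length[OF reg.left_module_axioms im J2_sub IJ2] len_J2 a1 by simp
    then show ?thesis using t by blast
  qed
  obtain r where r: "r \<in> carrier R" "g s = r \<otimes> s" using rs gJ2[OF s(1)] by blast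
  \<comment> \<open>\<open>J\<close> annihilates \<open>s\<close>, so the factor \<open>r\<close>
    may be replaced by a central one, and left multiplication turns into right
    multiplication.\<close>
  obtain z where z: "z \<in> carrier R" "\<forall>y\<in>carrier R. z \<otimes> y = y \<otimes> z" "r \<ominus> z \<in> J" using central[OF r(1)] by blast
  have "(r \<ominus> z) \<otimes> s = \<zero>" by (rule J_mult_J2[OF s(1) z(3)])
  then have "r \<otimes> s \<ominus> z \<otimes> s = \<zero>" using r z(1) sR by (simp add: minus_eq l_distr l_minus)
  then have gs: "g s = s \<otimes> z" using r z(1,2) sR reg.minus_eq_zero_iff[of "r \<otimes> s" "z \<otimes> s"] by simp
  define h where "h x = g x \<ominus> x \<otimes> z" for x
  have xz: "(\<lambda>x. x \<otimes> z) \<in> mod_hom R (sub (regular R) J) (regular R)"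
    by (rule mod_homI) (auto simp: z(1) l_distr m_assoc J_carrier)
  have h: "h \<in> mod_hom R (sub (regular R) J) (regular R)"
    using mod_hom_diff[OF g xz reg.left_module_axioms] by (simp add: h_def[abs_def])
  note hh = mod_homD[OF h, simplified]
  have hs: "h s = \<zero>" unfolding h_def gs using sR z(1) by (simp add: minus_eq r_neg)
  have hJ2: "h t = \<zero>" if t: "t \<in> J2" for t
  proof -
    obtain r where "r \<in> carrier R" "t = r \<otimes> s" using rs[OF t] by blast
    then show ?thesis using hh(3)[of r s] J2_J[OF s(1)] hs by simp
  qed
  \<comment> \<open>Since \<open>h\<close> vanishes on \<open>J^2\<close>, its values are
    annihilated by \<open>J\<close>, and the socle condition puts them into
    \<open>J^2\<close>.\<close>
  have hJ: "h x \<in> J2" if x: "x \<in> J" for x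
  proof (rule soc)
    show "h x \<in> carrier R" using hh(1)[OF x] .
    show "r \<otimes> h x = \<zero>" if "r \<in> J" for r
      using hh(3)[of r x] x that J_carrier hJ2[OF JJ_J2[OF that x]] by simp
  qed
  have "(\<lambda>i. if i < e then h (v i) else \<zero>) \<in> coords R J2 e" using hJ v_J by (auto simp: coords_def)
  then have "(\<lambda>i. if i < e then h (v i) else \<zero>) \<in> Phi ` J" unfolding PJ .
  then obtain b where b: "b \<in> J" "Phi b = (\<lambda>i. if i < e then h (v i) else \<zero>)" by (elim imageE) simp
  have "h x = x \<otimes> b" if x: "x \<in> J" for x
  proof -
    obtain u where u: "u \<in> V e" "x = dot R e u v" using v(2) x by blast
    interpret JM: lmod R "sub (regular R) J" by (rule lmod.intro) (rule lm)
    have "h (lincomb (sub (regular R) J) v e u) = lincomb (regular R) (\<lambda>i. h (v i)) e u"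
      by (rule JM.hom_lincomb[OF h reg.left_module_axioms]) (use v_J coords_i[OF u(1)] in auto)
    also have "\<dots> = lincomb (regular R) (Phi b) e u" by (rule reg.lincomb_cong) (auto simp: b(2))
    also have "\<dots> = x \<otimes> b" using dot_Phi[OF u(1), of b] b(1) J_carrier u(2) by (simp add: dot_lincomb)
    finally show ?thesis using u(2) by (simp add: dot_lincomb)
  qed
  then have "g x = x \<otimes> (b \<oplus> z)" if x: "x \<in> J" for x
    using x b(1) z(1) gh(1)[OF x] J_carrier reg.minus_add_cancel[of "g x" "x \<otimes> z"] by (simp add: h_def r_distr)
  then show "\<exists>b\<in>carrier R. \<forall>r\<in>J. g r = r \<otimes> b" using b(1) z(1) J_carrier by blast
qed

text \<open>\<open>Phi\<close> maps \<open>J\<close> onto all columns over \<open>J^2\<close> with a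
  kernel that contains \<open>J^2\<close>, and comparing lengths gives \<open>e a \<le> e\<close>.
  For the second claim, write \<open>x\<close> in terms of the generators. If its coefficient at
  \<open>i\<close> were a unit, then \<open>x\<close> could not annihilate the \<open>b\<close> in
  \<open>J\<close> whose column \<open>Phi b\<close> has a nonzero entry at \<open>i\<close>
  only.\<close>

lemma ext1_opp_conditions:
  assumes ext: "ext1_top_vanishes R J" and a: "J2 \<noteq> {\<zero>}"
  shows "a = 1" "\<And>x. \<lbrakk>x \<in> carrier R; \<And>r. r \<in> J \<Longrightarrow> x \<otimes> r = \<zero>\<rbrakk> \<Longrightarrow> x \<in> J2"
proof -
  obtain t where t: "t \<in> J2" "t \<noteq> \<zero>" using a zero_J(2) by blast
  have tR: "t \<in> carrier R" using J2_J J_carrier t(1) by blast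
  have claim: "\<exists>b\<in>J. Phi b = s" if s: "s \<in> coords R J2 e" for s
  proof -
    have sV: "s \<in> V e" using s coords_J2_J coords_J_V by blast
    have "dot R e u s = \<zero>" if "u \<in> coords R J e" for u
      by (rule dot_zero) (use s that J_mult_J2 in \<open>auto simp: coords_def\<close>)
    from ext1_Phi[OF ext sV this] obtain b where b: "b \<in> carrier R" "Phi b = s" "\<And>w. w \<in> J2 \<Longrightarrow> w \<otimes> b = \<zero>" by blast
    have "b \<in> J" using J_eq_zero_of_unit[OF b(1) _ tR b(3)[OF t(1)]] t(2) by blast
    then show ?thesis using b(2) by blast
  qed
  then have PJ: "Phi ` J = coords R J2 e" using Phi_J by blast
  let ?K = "a_kernel (regular (opp R)) (free (opp R) e) Phi \<inter> J"
  have K: "J2 \<subseteq> ?K" by (auto simp: a_kernel_def' Phi_zero J2_J J_carrier)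
  have 1: "enat (e + a) = mod_length (opp R) (sub (regular (opp R)) ?K) + enat (e * a)"
    using len_Phi_J op.len_coords(2)[of e] by (simp add: J2_opp PJ)
  have 2: "enat a \<le> mod_length (opp R) (sub (regular (opp R)) ?K)"
    using mod_length_mono[OF op.reg.left_module_axioms op.J2_sub ker_Phi_sub] K op.len_J2 by (simp add: J2_opp)
  have "e + a \<ge> a + e * a" using 1 2 by (cases "mod_length (opp R) (sub (regular (opp R)) ?K)") auto
  then have ea: "e * a \<le> e" by simp
  have e0: "e \<noteq> 0"
  proof
    assume "e = 0"
    then have "J \<subseteq> {\<zero>}" using v(2) by auto
    then show False using t J2_J by blast
  qed
  have "a \<noteq> 0" using len_J2_zero a by simp
  with ea e0 show "a = 1" by (cases a) auto
  fix x assume x: "x \<in> carrier R" "\<And>r. r \<in> J \<Longrightarrow> x \<otimes> r = \<zero>"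
  have xJ: "x \<in> J"
  proof (rule ccontr)
    assume "x \<notin> J"
    then obtain y where "y \<in> carrier R" "y \<otimes> x = \<one>" using unit x(1) by blast
    then have "t = y \<otimes> (x \<otimes> t)" using x(1) tR by (simp add: m_assoc[symmetric])
    then show False using x(2)[OF J2_J[OF t(1)]] t(2) \<open>y \<in> carrier R\<close> by simp
  qed
  then obtain u where u: "u \<in> V e" "x = dot R e u v" using v(2) by blast
  show "x \<in> J2"
  proof (cases "u \<in> coords R J e")
    case True
    then show ?thesis using v(3) u(2) by blast
  next
    case False
    then obtain i where i: "i < e" "u i \<notin> J" using u(1) by (auto simp: coords_def)
    define s where "s = (\<lambda>k. if k = i then t else \<zero>)"
    have s: "s \<in> coords R J2 e" using i t(1) by (auto simp: s_def coords_def)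
    then obtain b where b: "b \<in> J" "Phi b = s" using claim by blast
    have s_alt: "s = (\<lambda>k. evec R i k \<otimes> t)" using tR by (auto simp: s_def evec_def)
    have "\<zero> = x \<otimes> b" using x(2) b(1) by simp
    also have "\<dots> = dot R e u s" using dot_Phi[OF u(1), of b] b J_carrier u(2) by simp
    also have "\<dots> = u i \<otimes> t" unfolding s_alt using dot_smult_right[OF u(1) evec_closed[OF i(1)] tR] i(1) u(1) by simp
    finally have z: "u i \<otimes> t = \<zero>" by simp
    obtain y where "y \<in> carrier R" "y \<otimes> u i = \<one>" using unit coords_i[OF u(1)] i(2) by blast
    then have "t = y \<otimes> (u i \<otimes> t)" using coords_i[OF u(1)] tR by (simp add: m_assoc[symmetric])
    then show ?thesis using z t(2) \<open>y \<in> carrier R\<close> by simp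
  qed
qed

text \<open>Outside the reach of the Frobenius criterion, which has \<open>a = 1\<close>. Here
  \<open>Phi\<close> kills \<open>J\<close>, while its image contains all columns over
  \<open>J\<close>; so \<open>e^2 \<le> 1\<close>. Either \<open>J\<close> is zero, or it consists
  of the central multiples of one element \<open>x\<close>, and then a homomorphism on it is
  multiplication by a central element.\<close>

lemma ext1_opp_rad_square_zero:
  assumes ext: "ext1_top_vanishes R J" and a: "J2 = {\<zero>}"
  shows "ext1_top_vanishes (opp R) J"
  unfolding ext1_top_vanishes_def
proof
  have JJ0: "x \<otimes> y = \<zero>" if "x \<in> J" "y \<in> J" for x y using JJ_J2[OF that] a by simp
  have claim: "\<exists>b\<in>carrier R. Phi b = s" if s: "s \<in> coords R J e" for s
  proof -
    have "dot R e u s = \<zero>" if "u \<in> coords R J e" for u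
      by (rule dot_zero) (use s that JJ0 in \<open>auto simp: coords_def\<close>)
    from ext1_Phi[OF ext coords_J_V[OF s] this] show ?thesis by blast
  qed
  have a0: "a = 0" using a len_J2_zero by simp
  let ?K = "a_kernel (regular (opp R)) (free (opp R) e) Phi"
  have Ks: "submodule ?K (opp R) (regular (opp R))"
    by (rule kernel_submodule[OF Phi_hom op.reg.left_module_axioms op.fr.left_module_axioms])
  have Is: "submodule (Phi ` carrier R) (opp R) (free (opp R) e)"
    using image_submodule[OF Phi_hom op.reg.left_module_axioms op.fr.left_module_axioms op.reg.carrier_submodule] by simp
  have KC: "?K \<inter> carrier R = ?K" by (auto simp: a_kernel_def')
  have "sub (regular (opp R)) (carrier R) = regular (opp R)" using op.reg.sub_carrier by simp
  then have 1: "enat (1 + e) = mod_length (opp R) (sub (regular (opp R)) ?K) + mod_length (opp R) (sub (free (opp R) e) (Phi ` carrier R))"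
    using mod_length_image[OF Phi_hom op.reg.left_module_axioms op.fr.left_module_axioms op.reg.carrier_submodule]
      op.len_R a0 KC by simp
  have "J \<subseteq> ?K" by (auto simp: a_kernel_def' Phi_def v_J JJ0 J_carrier)
  then have 2: "enat e \<le> mod_length (opp R) (sub (regular (opp R)) ?K)"
    using mod_length_mono[OF op.reg.left_module_axioms op.J_sub Ks] op.len_J' a0 by simp
  have "coords R J e \<subseteq> Phi ` carrier R" using claim by blast
  then have 3: "enat (e * e) \<le> mod_length (opp R) (sub (free (opp R) e) (Phi ` carrier R))"
    using mod_length_mono[OF op.fr.left_module_axioms op.coords_J_sub Is] op.len_coords(1)[of e] a0 by simp
  have "e + e * e \<le> 1 + e" using 1 2 3
    by (cases "mod_length (opp R) (sub (regular (opp R)) ?K)"; cases "mod_length (opp R) (sub (free (opp R) e) (Phi ` carrier R))") auto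
  then have "e * e \<le> 1" by simp
  then have e: "e = 0 \<or> e = 1" by (cases e) auto
  fix g assume g: "g \<in> mod_hom (opp R) (sub (regular (opp R)) J) (regular (opp R))"
  have lm: "left_module (opp R) (sub (regular (opp R)) J)" by (rule op.reg.sub_left_module[OF op.J_sub])
  have g0: "g \<zero> = \<zero>" using mod_hom_zero[OF g lm op.reg.left_module_axioms] by simp
  note gh = mod_homD[OF g, simplified]
  show "\<exists>b\<in>carrier (opp R). \<forall>r\<in>J. g r = r \<otimes>\<^bsub>opp R\<^esub> b"
  proof (cases "e = 0")
    case True
    then have "J = {\<zero>}" using v(2) zero_J(1) by auto
    then show ?thesis using g0 by (intro bexI[of _ \<zero>]) auto
  next
    case False
    then have e1: "e = 1" using e by simp
    define x where "x = v 0"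
    have xJ: "x \<in> J" using v_J x_def by simp
    have xR: "x \<in> carrier R" using xJ J_carrier by simp
    \<comment> \<open>\<open>J\<close> annihilates \<open>x\<close>, so the coefficient of
      \<open>x\<close> matters only modulo \<open>J\<close> and can be taken central.\<close>
    have Jx: "\<exists>z\<in>carrier R. (\<forall>y\<in>carrier R. z \<otimes> y = y \<otimes> z) \<and> r = z \<otimes> x" if r: "r \<in> J" for r
    proof -
      obtain u where u: "u \<in> V e" "r = dot R e u v" using v(2) r by blast
      then have ru: "r = u 0 \<otimes> x" using e1 xR coords_i[OF u(1)] by (simp add: x_def)
      obtain z where z: "z \<in> carrier R" "\<forall>y\<in>carrier R. z \<otimes> y = y \<otimes> z" "u 0 \<ominus> z \<in> J"
        using central[OF coords_i[OF u(1)]] by blast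
      have "(u 0 \<ominus> z) \<otimes> x = \<zero>" using JJ0 z(3) xJ by simp
      then have "u 0 \<otimes> x \<ominus> z \<otimes> x = \<zero>" using coords_i[OF u(1)] z(1) xR by (simp add: minus_eq l_distr l_minus)
      then show ?thesis using ru z(1,2) xR coords_i[OF u(1)] reg.minus_eq_zero_iff[of "u 0 \<otimes> x" "z \<otimes> x"] by auto
    qed
    have x0: "x \<noteq> \<zero>"
    proof
      assume "x = \<zero>"
      then have "dot R e (evec R 0) v = \<zero>" using e1 v_eq[of 0, symmetric] by (simp only: x_def)
      then have "evec R 0 \<in> coords R J e" using v(4)[of "evec R 0"] e1 by simp
      then show False using e1 one_notin_J by (auto simp: coords_def evec_def)
    qed
    have gx: "g x \<in> J"
    proof (rule ccontr)
      assume "g x \<notin> J"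
      then obtain y where y: "y \<in> carrier R" "y \<otimes> g x = \<one>" using unit gh(1)[OF xJ] by blast
      have "g x \<otimes> x = g (x \<otimes> x)" using gh(3)[OF xR xJ] by simp
      then have "g x \<otimes> x = \<zero>" using JJ0 xJ g0 by simp
      moreover have "x = y \<otimes> (g x \<otimes> x)" using y gh(1)[OF xJ] xR by (simp add: m_assoc[symmetric])
      ultimately show False using x0 y(1) by simp
    qed
    obtain z where z: "z \<in> carrier R" "\<forall>y\<in>carrier R. z \<otimes> y = y \<otimes> z" "g x = z \<otimes> x" using Jx[OF gx] by blast
    have "g r = z \<otimes> r" if r: "r \<in> J" for r
    proof -
      obtain w where w: "w \<in> carrier R" "\<forall>y\<in>carrier R. w \<otimes> y = y \<otimes> w" "r = w \<otimes> x" using Jx[OF r] by blast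
      have "r = x \<otimes> w" using w xR by simp
      then show ?thesis using gh(3)[OF w(1) xJ] z(1,3) xR w(1) by (simp add: m_assoc)
    qed
    then show ?thesis using z(1) by (intro bexI[of _ z]) auto
  qed
qed

end

lemma ext1_of_frobenius:
  assumes a1: "a = 1" and soc: "\<And>x. \<lbrakk>x \<in> carrier R; \<And>r. r \<in> J \<Longrightarrow> r \<otimes> x = \<zero>\<rbrakk> \<Longrightarrow> x \<in> J2"
  shows "ext1_top_vanishes R J"
  using generators_J ext1_of_frobenius_aux[OF _ _ _ _ assms] by metis

text \<open>If \<open>J^2\<close> is not zero, the conditions that Ext^1(k, A) = 0 forces on one
  side are those of the Frobenius criterion for the other side. Needed because the resolution of
  \<open>Tr M\<close> lives over \<open>opp A\<close>, whereas self-injectivity is a condition on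
  left modules.\<close>

theorem ext1_opp: assumes ext: "ext1_top_vanishes R J" shows "ext1_top_vanishes (opp R) J"
proof -
  obtain v where v: "v \<in> coords R J e" "J = (\<lambda>u. dot R e u v) ` V e" "J2 = (\<lambda>u. dot R e u v) ` coords R J e"
    "\<And>u. \<lbrakk>u \<in> V e; dot R e u v = \<zero>\<rbrakk> \<Longrightarrow> u \<in> coords R J e"
    using generators_J by blast
  show ?thesis
  proof (cases "J2 = {\<zero>}")
    case True
    then show ?thesis using ext1_opp_rad_square_zero[OF v ext] by simp
  next
    case False
    show ?thesis
    proof (rule short_local_ring.ext1_of_frobenius[OF opp_short])
      show "a = 1" by (rule ext1_opp_conditions(1)[OF v ext False])
      fix x assume x: "x \<in> carrier (opp R)" "\<And>r. r \<in> J \<Longrightarrow> r \<otimes>\<^bsub>opp R\<^esub> x = \<zero>\<^bsub>opp R\<^esub>"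
      then show "x \<in> ideal_prod (opp R) J J" using ext1_opp_conditions(2)[OF v ext False, of x] J2_opp by simp
    qed
  qed
qed

end

section \<open>Minimal complexes that are exact together with their duals\<close>

text \<open>\<open>D i : A\<^sup>n\<^sup>(\<^sup>i\<^sup>+\<^sup>1\<^sup>) \<rightarrow> A\<^sup>n\<^sup>(\<^sup>i\<^sup>)\<close> are matrices with coefficients in \<open>J\<close>; both the
  complex of row vectors and the complex of column vectors are exact at all inner places.\<close>
locale min_complex = short_local_ring R J e a
  for R :: "('a, 'x) ring_scheme" (structure) and J :: "'a set" and e a :: nat +
  fixes n :: "nat \<Rightarrow> nat" and D :: "nat \<Rightarrow> (nat \<Rightarrow> 'a) \<Rightarrow> (nat \<Rightarrow> 'a)"
  assumes hom: "D i \<in> mod_hom R (free R (n (Suc i))) (free R (n i))"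
    and rad: "x \<in> coords R (carrier R) (n (Suc i)) \<Longrightarrow> D i x \<in> coords R J (n i)"
    and rows: "a_kernel (free R (n (Suc i))) (free R (n i)) (D i)
      = D (Suc i) ` coords R (carrier R) (n (Suc (Suc i)))"
    and cols: "a_kernel (free (opp R) (n (Suc i))) (free (opp R) (n (Suc (Suc i))))
        (tr R (n (Suc i)) (n (Suc (Suc i))) (D (Suc i)))
      = tr R (n i) (n (Suc i)) (D i) ` coords R (carrier R) (n i)"
begin

abbreviation T :: "nat \<Rightarrow> (nat \<Rightarrow> 'a) \<Rightarrow> (nat \<Rightarrow> 'a)" where "T i \<equiv> tr R (n i) (n (Suc i)) (D i)"

lemma D_V: "x \<in> V (n (Suc i)) \<Longrightarrow> D i x \<in> V (n i)"
  using mod_homD(1)[OF hom] by simp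

lemma T_hom: "T i \<in> mod_hom (opp R) (free (opp R) (n i)) (free (opp R) (n (Suc i)))"
  by (rule tr_hom[OF hom])

lemma T_V: "b \<in> V (n i) \<Longrightarrow> T i b \<in> V (n (Suc i))"
  by (rule tr_closed[OF hom])

lemma T_rad: "b \<in> V (n i) \<Longrightarrow> T i b \<in> coords R J (n (Suc i))"
  by (rule tr_rad[OF hom rad])

lemma adj: "\<lbrakk>x \<in> V (n (Suc i)); b \<in> V (n i)\<rbrakk> \<Longrightarrow> dot R (n (Suc i)) x (T i b) = dot R (n i) (D i x) b"
  by (rule tr_adj[OF hom])

lemma D_zero: "x \<in> V (n (Suc i)) \<Longrightarrow> D i x = zv \<longleftrightarrow> (\<exists>y\<in>V (n (Suc (Suc i))). x = D (Suc i) y)"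
  using rows[of i] by (auto simp: a_kernel_def')

lemma T_zero: "b \<in> V (n (Suc i)) \<Longrightarrow> T (Suc i) b = zv \<longleftrightarrow> (\<exists>c\<in>V (n i). b = T i c)"
  using cols[of i] by (auto simp: a_kernel_def')

lemma DD: "x \<in> V (n (Suc (Suc i))) \<Longrightarrow> D i (D (Suc i) x) = zv"
  using D_zero D_V by blast

lemma D_rad: "x \<in> coords R J (n (Suc i)) \<Longrightarrow> D i x \<in> coords R J2 (n i)"
  "x \<in> coords R J2 (n (Suc i)) \<Longrightarrow> D i x = zv"
  using rad_hom[OF hom rad] by auto

lemma T_rad2: "b \<in> coords R J (n i) \<Longrightarrow> T i b \<in> coords R J2 (n (Suc i))"
  "b \<in> coords R J2 (n i) \<Longrightarrow> T i b = zv"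
  using short_local_ring.rad_hom[OF opp_short T_hom] T_rad by (auto simp: J2_opp)

lemma D_ker: "a_kernel (free R (n (Suc i))) (free R (n i)) (D i) \<subseteq> coords R J (n (Suc i))"
  using rows rad by auto

lemma T_ker: "a_kernel (free (opp R) (n (Suc i))) (free (opp R) (n (Suc (Suc i)))) (T (Suc i)) \<subseteq> coords R J (n (Suc i))"
  using cols T_rad by auto

text \<open>The image of \<open>y\<close> under \<open>D i\<close> is annihilated by
  \<open>J\<close> but lies outside the radical of the syzygy, so it spans a direct summand k. As
  Ext^1 of the syzygy vanishes by exactness of the columns, so does Ext^1(k, A).\<close>

lemma ext1_of_simple_summand:
  assumes y: "y \<in> V (n (Suc i))" "y \<notin> coords R J (n (Suc i))"
    and z: "\<And>r. r \<in> J \<Longrightarrow> D i (\<lambda>k. r \<otimes> y k) = zv"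
  shows "ext1_top_vanishes R J"
  unfolding ext1_top_vanishes_def
proof
  fix g assume g: "g \<in> mod_hom R (sub (regular R) J) (regular R)"
  let ?p = "n (Suc i)" and ?q = "n (Suc (Suc i))" and ?s = "n (Suc (Suc (Suc i)))"
  obtain j where j: "j < ?p" "y j \<notin> J" using y by (auto simp: coords_def)
  obtain w where w: "w \<in> carrier R" "y j \<otimes> w = \<one>" using unit[OF coords_i[OF y(1)] j(2)] by blast
  have lm: "left_module R (sub (regular R) J)" by (rule reg.sub_left_module[OF J_sub])
  have pr: "(\<lambda>x. x j \<otimes> w) \<in> mod_hom R (sub (free R ?p) (coords R J ?p)) (sub (regular R) J)"
    by (rule mod_homI) (use j(1) w(1) in \<open>auto simp: coords_def J_mult l_distr m_assoc J_carrier\<close>)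
  have Dj: "D (Suc i) \<in> mod_hom R (free R ?q) (sub (free R ?p) (coords R J ?p))"
    by (rule mod_hom_sub_cod[OF hom]) (simp add: rad)
  \<comment> \<open>The coordinate \<open>j\<close>, normalized by \<open>w\<close>, sends
    \<open>r y\<close> to \<open>r\<close>; so \<open>\<phi>\<close> takes the value
    \<open>g r\<close> on a preimage of \<open>r y\<close>. It vanishes on boundaries, hence is the
    pairing with a column \<open>T (Suc i) b\<close>, and the pairing of \<open>y\<close> with
    \<open>b\<close> is the element that represents \<open>g\<close>.\<close>
  define \<phi> where "\<phi> x = g (D (Suc i) x j \<otimes> w)" for x
  have \<phi>: "\<phi> \<in> mod_hom R (free R ?q) (regular R)"
    unfolding \<phi>_def by (rule mod_hom_comp[OF mod_hom_comp[OF Dj pr] g])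
  define c where "c = covec R ?q \<phi>"
  have c: "c \<in> V ?q" unfolding c_def by (rule covec_closed[OF \<phi>])
  have \<phi>c: "\<phi> x = dot R ?q x c" if "x \<in> V ?q" for x unfolding c_def by (rule functional_eq[OF \<phi> that])
  have "T (Suc (Suc i)) c = zv"
  proof (rule dot_nondeg[OF T_V[OF c] zv_coords(3)])
    fix x assume x: "x \<in> V ?s"
    have "dot R ?s x (T (Suc (Suc i)) c) = \<phi> (D (Suc (Suc i)) x)" using adj[OF x c] \<phi>c[OF D_V[OF x]] by simp
    also have "\<dots> = \<zero>" using DD[OF x] w(1) mod_hom_zero[OF g lm reg.left_module_axioms] by (simp add: \<phi>_def)
    also have "\<dots> = dot R ?s x zv" by (rule dot_zero[symmetric]) (simp add: coords_i[OF x])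
    finally show "dot R ?s x (T (Suc (Suc i)) c) = dot R ?s x zv" .
  qed
  then obtain b where b: "b \<in> V ?p" "c = T (Suc i) b" using T_zero[OF c] by blast
  have "g r = r \<otimes> dot R ?p y b" if r: "r \<in> J" for r
  proof -
    have rR: "r \<in> carrier R" using r J_carrier by simp
    have ryV: "(\<lambda>k. r \<otimes> y k) \<in> V ?p" using y(1) rR by (auto simp: coords_def)
    then obtain x where x: "x \<in> V ?q" "(\<lambda>k. r \<otimes> y k) = D (Suc i) x" using D_zero z[OF r] by blast
    have "D (Suc i) x j = r \<otimes> y j" using fun_cong[OF x(2), of j] by simp
    then have "g r = \<phi> x" using rR coords_i[OF y(1)] w by (simp add: \<phi>_def m_assoc)
    also have "\<dots> = dot R ?p (\<lambda>k. r \<otimes> y k) b" using \<phi>c[OF x(1)] b adj[OF x(1) b(1)] x(2) by simp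
    also have "\<dots> = r \<otimes> dot R ?p y b" by (rule dot_smult_left[OF y(1) b(1) rR])
    finally show ?thesis .
  qed
  then show "\<exists>b\<in>carrier R. \<forall>r\<in>J. g r = r \<otimes> b" using dot_closed[OF y(1) b(1)] by blast
qed

end

section \<open>Complexes in the case Ext^1(k, A) \<noteq> 0: ranks, Hilbert type and socles\<close>

locale core_complex = min_complex +
  assumes no_ext1: "\<not> ext1_top_vanishes R J" and n1: "n 1 > 0"
begin

interpretation op: short_local_ring "opp R" J e a by (rule opp_short)

text \<open>With \<open>J^2 = 0\<close> the differential \<open>D 0\<close> kills everything over
  \<open>J\<close>, and the first unit row spans a summand k of the syzygy.\<close>

lemma J2_nonzero: "J2 \<noteq> {\<zero>}"
proof
  assume z: "J2 = {\<zero>}"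
  have y: "evec R 0 \<in> V (n (Suc 0))" "evec R 0 \<notin> coords R J (n (Suc 0))"
    using n1 one_notin_J by (auto simp: coords_def evec_def)
  have "D 0 (\<lambda>k. r \<otimes> evec R 0 k) = zv" if "r \<in> J" for r
  proof -
    have "(\<lambda>k. r \<otimes> evec R 0 k) \<in> coords R J (n (Suc 0))" using n1 that J_carrier by (auto simp: coords_def evec_def)
    from D_rad(1)[OF this] show ?thesis unfolding z by (auto simp: coords_def fun_eq_iff) (metis not_le)
  qed
  from ext1_of_simple_summand[OF y this] no_ext1 show False by blast
qed

lemma a_pos: "a > 0"
  using J2_nonzero len_J2_zero by auto

text \<open>This is \<open>J K = J^2 F\<close> for the syzygy \<open>K\<close> in \<open>F\<close>.
  A row over \<open>J^2\<close> is a cycle, hence of the form \<open>D (Suc i) y\<close>; moreover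
  \<open>J y\<close> consists of cycles, so a \<open>y\<close> outside the radical would split off
  k.\<close>

lemma D_rad_image: "D (Suc i) ` coords R J (n (Suc (Suc i))) = coords R J2 (n (Suc i))"
proof (intro equalityI subsetI)
  fix x assume x: "x \<in> coords R J2 (n (Suc i))"
  then obtain y where y: "y \<in> V (n (Suc (Suc i)))" "x = D (Suc i) y"
    using D_zero[of x i] D_rad(2)[OF x] coords_J_V[OF coords_J2_J[OF x]] by blast
  have "D (Suc i) (\<lambda>k. r \<otimes> y k) = zv" if r: "r \<in> J" for r
  proof
    fix k
    have "D (Suc i) (\<lambda>k. r \<otimes> y k) k = r \<otimes> x k"
      using mod_homD(3)[OF hom, of r y "Suc i"] y r J_carrier by simp
    then show "D (Suc i) (\<lambda>k. r \<otimes> y k) k = \<zero>"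
      using x r J_mult_J2 J_carrier by (cases "k < n (Suc i)") (auto simp: coords_def)
  qed
  then have "y \<in> coords R J (n (Suc (Suc i)))" using ext1_of_simple_summand[OF y(1)] no_ext1 by blast
  then show "x \<in> D (Suc i) ` coords R J (n (Suc (Suc i)))" using y(2) by blast
qed (use D_rad in auto)

text \<open>Transferred by the pairing, without a second appeal to Ext. Let
  \<open>s = T (Suc i) b\<close>. If \<open>b\<close> had a unit entry, then for \<open>w\<close> in
  \<open>J^2\<close> the multiple by \<open>w\<close> of the corresponding unit row would be
  \<open>D (Suc i) y\<close> with \<open>y\<close> over \<open>J\<close>; its pairing with
  \<open>b\<close> equals that of \<open>y\<close> with \<open>s\<close>, which is zero, and so
  \<open>w = 0\<close>.\<close>

lemma T_rad_image: "T (Suc i) ` coords R J (n (Suc i)) = coords R J2 (n (Suc (Suc i)))"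
proof (intro equalityI subsetI)
  fix s assume s: "s \<in> coords R J2 (n (Suc (Suc i)))"
  have sV: "s \<in> V (n (Suc (Suc i)))" using coords_J_V[OF coords_J2_J[OF s]] .
  then obtain b where b: "b \<in> V (n (Suc i))" "s = T (Suc i) b" using T_zero[of s "Suc i"] T_rad2(2)[OF s] by blast
  have "b i' \<in> J" if i': "i' < n (Suc i)" for i'
  proof (rule ccontr)
    assume bi: "b i' \<notin> J"
    have "w = \<zero>" if w: "w \<in> J2" for w
    proof -
      have wR: "w \<in> carrier R" using w J2_J J_carrier by blast
      have "(\<lambda>k. w \<otimes> evec R i' k) \<in> coords R J2 (n (Suc i))" using w wR i' by (auto simp: coords_def evec_def)
      then obtain y where y: "y \<in> coords R J (n (Suc (Suc i)))" "(\<lambda>k. w \<otimes> evec R i' k) = D (Suc i) y"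
        using D_rad_image by (metis imageE)
      have "w \<otimes> b i' = dot R (n (Suc i)) (\<lambda>k. w \<otimes> evec R i' k) b"
        using dot_smult_left[OF evec_closed[OF i'] b(1) wR] i' b(1) by simp
      also have "\<dots> = dot R (n (Suc (Suc i))) y s" using adj[OF coords_J_V[OF y(1)] b(1)] y(2) b(2) by simp
      also have "\<dots> = \<zero>" by (rule dot_zero) (use y(1) s J_mult_J2 in \<open>auto simp: coords_def\<close>)
      finally show ?thesis using J_eq_zero_of_unit[OF coords_i[OF b(1)] bi wR] by simp
    qed
    then show False using J2_nonzero zero_J(2) by blast
  qed
  then have "b \<in> coords R J (n (Suc i))" using b(1) by (auto simp: coords_def)
  then show "s \<in> T (Suc i) ` coords R J (n (Suc i))" using b(2) by blast
qed (use T_rad2 in auto)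

lemmas D_len = len_hom[OF hom D_ker D_rad_image]
lemmas T_len = op.len_hom[OF T_hom, simplified, OF T_ker, unfolded J2_opp, OF T_rad_image]

text \<open>Exactness at the place \<open>Suc (Suc i)\<close>: the kernel of one differential is the
  image of the next, and \<open>len_hom\<close> computes both lengths.\<close>

lemma rec_rows: "n (Suc (Suc (Suc i))) + n (Suc i) * a = n (Suc (Suc i)) * e"
proof -
  have "enat (n (Suc (Suc i)) * (e + a) - n (Suc i) * a) = enat (n (Suc (Suc (Suc i))) + n (Suc (Suc i)) * a)"
    using D_len(2)[of i] D_len(3)[of "Suc i"] rows[of "Suc i"] by simp
  then show ?thesis using D_len(1)[of i] by (simp add: algebra_simps)
qed

lemma rec_cols: "n (Suc i) + n (Suc (Suc (Suc i))) * a = n (Suc (Suc i)) * e"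
proof -
  have "enat (n (Suc (Suc i)) * (e + a) - n (Suc (Suc (Suc i))) * a) = enat (n (Suc i) + n (Suc (Suc i)) * a)"
    using T_len(2)[of "Suc i"] T_len(3)[of i] cols[of "Suc i"] by simp
  then show ?thesis using T_len(1)[of "Suc i"] by (simp add: algebra_simps)
qed

text \<open>The inequality between ranks in \<open>D_len\<close> carries a zero rank back to the
  previous place.\<close>

lemma n_pos: "n (Suc i) > 0"
proof (induction i)
  case 0 then show ?case using n1 by simp
next
  case (Suc i)
  show ?case
  proof (rule ccontr)
    assume "\<not> ?thesis"
    then have "n (Suc (Suc i)) = 0" by simp
    then have "n (Suc i) * a = 0" using D_len(1)[of i] by simp
    then show False using Suc a_pos by simp
  qed
qed

lemma J2_coords_nonzero: assumes "m > 0" shows "\<exists>x\<in>coords R J2 m. x \<noteq> zv"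
proof -
  obtain t where t: "t \<in> J2" "t \<noteq> \<zero>" using J2_nonzero zero_J(2) by blast
  then have "(\<lambda>k. if k = 0 then t else \<zero>) \<in> coords R J2 m" "(\<lambda>k. if k = 0 then t else \<zero>) \<noteq> zv"
    using assms by (auto simp: coords_def fun_eq_iff)
  then show ?thesis by blast
qed

text \<open>If \<open>S\<close> is the left socle, then \<open>S\<close>-columns are cycles. Comparing lengths bounds the length of \<open>S\<close>.\<close>
lemma left_socle:
  assumes x: "x \<in> carrier R" "\<And>r. r \<in> J \<Longrightarrow> r \<otimes> x = \<zero>"
  shows "x \<in> J2"
proof (rule ccontr)
  assume xJ2: "x \<notin> J2"
  obtain t where t: "t \<in> J2" "t \<noteq> \<zero>" using J2_nonzero zero_J(2) by blast
  define S where "S = {s \<in> carrier R. \<forall>r\<in>J. r \<otimes> s = \<zero>}"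
  have SJ: "s \<in> J" if "s \<in> S" for s
  proof (rule ccontr)
    assume "s \<notin> J"
    then show False using J_eq_zero_of_unit[of s t] that t J2_J J_carrier by (auto simp: S_def)
  qed
  have S: "submodule S (opp R) (regular (opp R))"
    by (rule op.reg.submodI) (auto simp: S_def r_distr J_carrier m_assoc[symmetric])
  have "J2 \<subseteq> S" by (auto simp: S_def J2_J J_carrier J_mult_J2)
  moreover have "x \<in> S" using x by (simp add: S_def)
  ultimately have "J2 \<subset> S" using xJ2 by blast
  from mod_length_strict[OF op.reg.left_module_axioms op.J2_sub S, unfolded J2_opp, OF \<open>J2 \<subset> S\<close>]
  have c1: "enat (Suc a) \<le> mod_length (opp R) (sub (regular (opp R)) S)" using op.len_J2 J2_opp by simp
  have "mod_length (opp R) (sub (regular (opp R)) S) \<le> mod_length (opp R) (sub (regular (opp R)) J)"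
    by (rule mod_length_mono[OF op.reg.left_module_axioms S op.J_sub]) (use SJ in blast)
  then obtain c where c: "mod_length (opp R) (sub (regular (opp R)) S) = enat c" "Suc a \<le> c"
    using c1 op.len_J' by (cases "mod_length (opp R) (sub (regular (opp R)) S)") auto
  \<comment> \<open>\<open>S\<close> has length \<open>c \<ge> a + 1\<close>, and columns over
    \<open>S\<close> are boundaries; hence \<open>?m c \<le> n (Suc i) + ?m a\<close>, and the ranks
    cannot grow. It remains to exclude equality.\<close>
  have "n (Suc (Suc i)) < n (Suc i)" for i
  proof -
    let ?m = "n (Suc (Suc i))"
    have Ssub: "submodule (coords R S ?m) (opp R) (free (opp R) ?m)"
      using coords_submodule[OF op.ring_axioms S, of ?m] by simp
    have Slen: "mod_length (opp R) (sub (free (opp R) ?m) (coords R S ?m)) = enat (?m * c)"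
      using coords_length[OF op.ring_axioms S c(1), of ?m] by simp
    have Isub: "submodule (T (Suc i) ` V (n (Suc i))) (opp R) (free (opp R) ?m)"
      using image_submodule[OF T_hom op.fr.left_module_axioms op.fr.left_module_axioms op.fr.carrier_submodule, of "Suc i"] by simp
    have sub: "coords R S ?m \<subseteq> T (Suc i) ` V (n (Suc i))"
    proof
      fix b assume b: "b \<in> coords R S ?m"
      then have bV: "b \<in> V ?m" by (auto simp: coords_def S_def)
      have "T (Suc (Suc i)) b = zv"
      proof (rule dot_nondeg[OF T_V[OF bV] zv_coords(3)])
        fix x assume x: "x \<in> V (n (Suc (Suc (Suc i))))"
        have "dot R ?m (D (Suc (Suc i)) x) b = \<zero>"
          by (rule dot_zero) (use rad[OF x] b in \<open>auto simp: coords_def S_def\<close>)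
        moreover have "dot R (n (Suc (Suc (Suc i)))) x zv = \<zero>" by (rule dot_zero) (simp add: coords_i[OF x])
        ultimately show "dot R (n (Suc (Suc (Suc i)))) x (T (Suc (Suc i)) b) = dot R (n (Suc (Suc (Suc i)))) x zv"
          using adj[OF x bV] by simp
      qed
      then show "b \<in> T (Suc i) ` V (n (Suc i))" using T_zero[OF bV] by blast
    qed
    have le: "?m * c \<le> n (Suc i) + ?m * a"
      using mod_length_mono[OF op.fr.left_module_axioms Ssub Isub sub] Slen T_len(3)[of i] by simp
    have "?m + ?m * a \<le> ?m * c" using mult_le_mono2[OF c(2), of ?m] by simp
    then have le': "?m \<le> n (Suc i)" using le by simp
    show ?thesis
    proof (rule ccontr)
      assume "\<not> ?thesis"
      then have "n (Suc i) = ?m" using le' by simp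
      then have "n (Suc i) + ?m * a \<le> ?m * c" using \<open>?m + ?m * a \<le> ?m * c\<close> by simp
      \<comment> \<open>Equality would put all boundary columns over the left socle, where they pair
        to zero with rows over \<open>J\<close>. But every row over \<open>J^2\<close> is
        \<open>D (Suc i) z\<close> with \<open>z\<close> over \<open>J\<close>, so by adjointness it
        would pair to zero with all columns.\<close>
      then have eq: "coords R S ?m = T (Suc i) ` V (n (Suc i))"
        using submodule_eq_of_length[OF op.fr.left_module_axioms Ssub Isub sub Slen] T_len(3)[of i] by simp
      obtain y where y: "y \<in> coords R J2 (n (Suc i))" "y \<noteq> zv" using J2_coords_nonzero[OF n_pos] by blast
      then obtain z where z: "z \<in> coords R J ?m" "y = D (Suc i) z" using D_rad_image by (metis imageE)
      have "y = zv"
      proof (rule dot_nondeg_left)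
        show "y \<in> V (n (Suc i))" using coords_J_V[OF coords_J2_J[OF y(1)]] .
        fix b assume b: "b \<in> V (n (Suc i))"
        have Tb: "T (Suc i) b \<in> coords R S ?m" using eq b by blast
        have "dot R (n (Suc i)) y b = dot R ?m z (T (Suc i) b)" using adj[OF coords_J_V[OF z(1)] b] z(2) by simp
        also have "\<dots> = \<zero>" by (rule dot_zero) (use z(1) Tb in \<open>auto simp: coords_def S_def\<close>)
        also have "\<dots> = dot R (n (Suc i)) zv b" by (rule dot_zero[symmetric]) (simp add: coords_i[OF b])
        finally show "dot R (n (Suc i)) y b = dot R (n (Suc i)) zv b" .
      qed simp
      then show False using y(2) by simp
    qed
  qed
  \<comment> \<open>The ranks would drop by at least 1 at each step, which cannot go on for more
    than \<open>n 1\<close> steps.\<close>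
  then have "n (Suc i) + i \<le> n 1" for i
  proof (induction i)
    case (Suc i)
    then show ?case by (metis Suc_leI add_Suc_right add_Suc_shift add_le_cancel_right order_trans)
  qed simp
  from this[of "Suc (n 1)"] show False by simp
qed

text \<open>For \<open>a = 1\<close> the Frobenius criterion applies, its socle condition being
  \<open>left_socle\<close>.\<close>

lemma a_ge_2: "a \<ge> 2"
proof -
  have "a \<noteq> 1" using ext1_of_frobenius[OF _ left_socle] no_ext1 by blast
  then show ?thesis using a_pos by simp
qed

text \<open>The two recursions have the same right-hand side; their difference is
  \<open>(a - 1) (?x - ?y) = 0\<close>.\<close>

lemma n_step2: "n (Suc (Suc (Suc i))) = n (Suc i)"
proof -
  let ?x = "n (Suc (Suc (Suc i)))" and ?y = "n (Suc i)"
  have "?x + ?y * a = ?y + ?x * a" using rec_rows[of i] rec_cols[of i] by simp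
  then have "int ?x + int ?y * int a = int ?y + int ?x * int a" by (metis of_nat_add of_nat_mult)
  then have "(int a - 1) * (int ?x - int ?y) = 0" by (simp add: algebra_simps)
  then show ?thesis using a_ge_2 by simp
qed

text \<open>As the ranks have period 2, the recursion says \<open>n (a + 1) = n' e\<close> for
  neighbouring ranks in both orders; multiplying the two equations gives
  \<open>(a + 1)^2 = e^2\<close>.\<close>

lemma e_eq: "e = Suc a" and n_step: "n (Suc (Suc i)) = n (Suc i)"
proof -
  have 1: "n (Suc j) * Suc a = n (Suc (Suc j)) * e" for j using rec_rows[of j] n_step2[of j] by simp
  have "n (Suc j) * Suc a * Suc a = n (Suc j) * e * e" for j
    using 1[of j] 1[of "Suc j"] n_step2[of j] by (metis mult.assoc mult.commute)
  then have "Suc a * Suc a = e * e" using n_pos[of 0] by (metis mult.assoc mult_cancel1 less_irrefl)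
  then show e: "e = Suc a" by (metis power2_eq_square power2_eq_iff_nonneg zero_le)
  have "n (Suc i) * Suc a = n (Suc (Suc i)) * Suc a" using 1[of i] unfolding e .
  then show "n (Suc (Suc i)) = n (Suc i)" unfolding mult_cancel2 by simp
qed

lemma n_const: "n (Suc i) = n 1"
  by (induction i) (simp_all add: n_step)

text \<open>Rows over \<open>S\<close> are cycles, because the columns \<open>T 0 b\<close> have
  entries in \<open>J\<close>. The ranks are constant by now, so the count forces equality without
  any descent, and equality is incompatible with \<open>T_rad_image\<close>: nonzero columns over
  \<open>J^2\<close> would pair to zero with all rows.\<close>

lemma right_socle:
  assumes x: "x \<in> carrier R" "\<And>r. r \<in> J \<Longrightarrow> x \<otimes> r = \<zero>"
  shows "x \<in> J2"
proof (rule ccontr)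
  assume xJ2: "x \<notin> J2"
  obtain t where t: "t \<in> J2" "t \<noteq> \<zero>" using J2_nonzero zero_J(2) by blast
  define S where "S = {s \<in> carrier R. \<forall>r\<in>J. s \<otimes> r = \<zero>}"
  have SJ: "s \<in> J" if "s \<in> S" for s
  proof (rule ccontr)
    assume "s \<notin> J"
    then show False using op.J_eq_zero_of_unit[of s t] that t J2_J J_carrier by (auto simp: S_def)
  qed
  have S: "submodule S R (regular R)"
    by (rule reg.submodI) (auto simp: S_def l_distr J_carrier m_assoc)
  have "J2 \<subseteq> S" by (auto simp: S_def J2_J J_carrier J2_mult_J)
  moreover have "x \<in> S" using x by (simp add: S_def)
  ultimately have "J2 \<subset> S" using xJ2 by blast
  from mod_length_strict[OF reg.left_module_axioms J2_sub S \<open>J2 \<subset> S\<close>]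
  have c1: "enat (Suc a) \<le> mod_length R (sub (regular R) S)" using len_J2 by simp
  have "mod_length R (sub (regular R) S) \<le> mod_length R (sub (regular R) J)"
    by (rule mod_length_mono[OF reg.left_module_axioms S J_sub]) (use SJ in blast)
  then obtain c where c: "mod_length R (sub (regular R) S) = enat c" "Suc a \<le> c"
    using c1 len_J' by (cases "mod_length R (sub (regular R) S)") auto
  let ?m = "n (Suc 0)"
  have Ssub: "submodule (coords R S ?m) R (free R ?m)" by (rule coords_submodule[OF ring_axioms S])
  have Slen: "mod_length R (sub (free R ?m) (coords R S ?m)) = enat (?m * c)" by (rule coords_length[OF ring_axioms S c(1)])
  let ?I = "D (Suc 0) ` V (n (Suc (Suc 0)))"
  have Isub: "submodule ?I R (free R ?m)"
    using image_submodule[OF hom fr.left_module_axioms fr.left_module_axioms fr.carrier_submodule, of "Suc 0"] by simp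
  have sub: "coords R S ?m \<subseteq> ?I"
  proof
    fix y assume y: "y \<in> coords R S ?m"
    then have yV: "y \<in> V ?m" by (auto simp: coords_def S_def)
    have "D 0 y = zv"
    proof (rule dot_nondeg_left[OF D_V[OF yV] zv_coords(3)])
      fix b assume b: "b \<in> V (n 0)"
      have "dot R ?m y (T 0 b) = \<zero>"
        by (rule dot_zero) (use T_rad[OF b] y in \<open>auto simp: coords_def S_def\<close>)
      moreover have "dot R (n 0) zv b = \<zero>" by (rule dot_zero) (simp add: coords_i[OF b])
      ultimately show "dot R (n 0) (D 0 y) b = dot R (n 0) zv b" using adj[OF yV b] by simp
    qed
    then show "y \<in> ?I" using D_zero[OF yV] by blast
  qed
  have "?m + ?m * a \<le> ?m * c" using mult_le_mono2[OF c(2), of ?m] by simp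
  then have eq: "coords R S ?m = ?I"
    using submodule_eq_of_length[OF fr.left_module_axioms Ssub Isub sub Slen] D_len(3)[of 0] n_const[of 1] by simp
  obtain y where y: "y \<in> coords R J2 (n (Suc (Suc 0)))" "y \<noteq> zv" using J2_coords_nonzero[OF n_pos] by blast
  then obtain b where b: "b \<in> coords R J ?m" "y = T (Suc 0) b" using T_rad_image by (metis imageE)
  have "y = zv"
  proof (rule dot_nondeg)
    show "y \<in> V (n (Suc (Suc 0)))" using coords_J_V[OF coords_J2_J[OF y(1)]] .
    fix u assume u: "u \<in> V (n (Suc (Suc 0)))"
    have Du: "D (Suc 0) u \<in> coords R S ?m" using eq u by blast
    have "dot R (n (Suc (Suc 0))) u y = dot R ?m (D (Suc 0) u) b" using adj[OF u coords_J_V[OF b(1)]] b(2) by simp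
    also have "\<dots> = \<zero>" by (rule dot_zero) (use b(1) Du in \<open>auto simp: coords_def S_def\<close>)
    also have "\<dots> = dot R (n (Suc (Suc 0))) u zv" by (rule dot_zero[symmetric]) (simp add: coords_i[OF u])
    finally show "dot R (n (Suc (Suc 0))) u y = dot R (n (Suc (Suc 0))) u zv" .
  qed simp
  then show False using y(2) by simp
qed

lemma len_D_image: "mod_length R (sub (free R (n (Suc i))) (D (Suc i) ` V (n (Suc (Suc i))))) = enat (Suc a * n 1)"
  using D_len(3)[of i] n_const[of i] n_const[of "Suc i"] by (simp add: algebra_simps)

lemma len_T_image: "mod_length (opp R) (sub (free (opp R) (n (Suc i))) (T i ` V (n i))) = enat (Suc a * n 1)"
  using T_len(2)[of i] cols[of i] n_const[of i] n_const[of "Suc i"] e_eq by (simp add: algebra_simps)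

lemma J2_D_image: "coords R J2 (n (Suc i)) \<subseteq> D (Suc i) ` V (n (Suc (Suc i)))"
  using D_rad_image[of i] coords_J_V by blast

lemma J2_T_image: "coords R J2 (n (Suc i)) \<subseteq> T i ` V (n i)"
proof
  fix b assume b: "b \<in> coords R J2 (n (Suc i))"
  then show "b \<in> T i ` V (n i)"
    using T_rad2(2)[of b "Suc i"] T_zero[of b i] coords_J_V[OF coords_J2_J[OF b]] by blast
qed

end

section \<open>Projective modules over short local rings\<close>

context short_local_ring
begin

lemma lift_free:
  assumes f: "f \<in> mod_hom R (free R n) Y" and g: "g \<in> mod_hom R X Y"
    and X: "left_module R X" and Y: "left_module R Y" and im: "f ` V n \<subseteq> g ` carrier X"
  obtains h where "h \<in> mod_hom R (free R n) X" "\<And>x. x \<in> V n \<Longrightarrow> g (h x) = f x"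
proof -
  interpret X: lmod R X by (rule lmod.intro) fact
  define v where "v i = (SOME x. x \<in> carrier X \<and> g x = f (evec R i))" for i
  have v: "v i \<in> carrier X \<and> g (v i) = f (evec R i)" if i: "i < n" for i
  proof -
    have "f (evec R i) \<in> g ` carrier X" by (rule subsetD[OF im]) (use i in auto)
    then have "\<exists>x. x \<in> carrier X \<and> g x = f (evec R i)" by auto
    then show ?thesis unfolding v_def by (rule someI_ex)
  qed
  have h: "lincomb X v n \<in> mod_hom R (free R n) X" by (rule X.lincomb_hom) (use v in blast)
  have "g (lincomb X v n x) = f x" if x: "x \<in> V n" for x
    by (rule hom_free_ext[OF mod_hom_comp[OF h g] f Y _ x]) (use v X.lincomb_evec in auto)
  then show ?thesis using that h by blast
qed

lemma JM_free: "JM (free R n) = coords R J n"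
  using JM_image[OF fr.left_module_axioms mod_hom_id, of n] by simp

text \<open>An endomorphism that is the identity modulo the radical. It is injective, since
  \<open>u - 1\<close> moves each radical layer into the next one and so pushes a kernel element
  down to zero, and surjective by Nakayama's lemma.\<close>

lemma unipotent_bij:
  assumes u: "u \<in> mod_hom R (free R n) (free R n)"
    and d: "\<And>x. x \<in> V n \<Longrightarrow> u x \<ominus>\<^bsub>free R n\<^esub> x \<in> coords R J n"
  shows "bij_betw u (V n) (V n)"
proof -
  let ?N = "\<lambda>x. u x \<ominus>\<^bsub>free R n\<^esub> x"
  note uh = mod_homD[OF u, simplified]
  have N: "?N \<in> mod_hom R (free R n) (free R n)" by (rule mod_hom_diff[OF u mod_hom_id fr.left_module_axioms])
  have "a_kernel (free R n) (free R n) u = {\<zero>\<^bsub>free R n\<^esub>}"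
  proof (intro equalityI subsetI)
    fix x assume "x \<in> a_kernel (free R n) (free R n) u"
    then have x: "x \<in> V n" "u x = \<zero>\<^bsub>free R n\<^esub>" by (auto simp: a_kernel_def')
    have xN: "x = u x \<ominus>\<^bsub>free R n\<^esub> ?N x"
      by (rule fr.minus_minus_cancel[symmetric]) (use x uh(1) in auto)
    have "x \<in> coords R J n" using submodD(7)[OF coords_J_sub _ d[OF x(1)], of "u x"] xN x(2) by simp
    then have "?N x \<in> coords R J2 n" using rad_hom(1)[OF N d] by simp
    then have "x \<in> coords R J2 n" using submodD(7)[OF coords_J2_sub, of "u x" n "?N x"] xN x(2) by simp
    then have "?N x = \<zero>\<^bsub>free R n\<^esub>" using rad_hom(2)[OF N d] by simp
    then have "u x = x" using fr.minus_eq_zero_iff[where n = n and x = "u x" and y = x] x uh(1) by simp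
    then have "x = \<zero>\<^bsub>free R n\<^esub>" using x(2) by simp
    then show "x \<in> {\<zero>\<^bsub>free R n\<^esub>}" by simp
  next
    fix x assume "x \<in> {\<zero>\<^bsub>free R n\<^esub>}"
    then show "x \<in> a_kernel (free R n) (free R n) u"
      using mod_hom_zero[OF u fr.left_module_axioms fr.left_module_axioms] by (auto simp: a_kernel_def')
  qed
  then have inj: "inj_on u (V n)" using inj_on_kernel[OF u fr.left_module_axioms fr.left_module_axioms] by simp
  have im: "submodule (u ` V n) R (free R n)"
    using image_submodule[OF u fr.left_module_axioms fr.left_module_axioms fr.carrier_submodule] by simp
  have "u ` V n = carrier (free R n)"
  proof (rule nakayama[OF fr.left_module_axioms im])
    fix x assume x: "x \<in> carrier (free R n)"
    then have xV: "x \<in> V n" "u x \<in> carrier (free R n)" using uh(1) by auto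
    have "x = u x \<oplus>\<^bsub>free R n\<^esub> \<ominus>\<^bsub>free R n\<^esub> ?N x"
      using fr.minus_minus_cancel[OF xV(2) x] unfolding a_minus_def[of "free R n" "u x" "?N x"] by (rule sym)
    then show "\<exists>y\<in>u ` V n. \<exists>z\<in>JM (free R n). x = y \<oplus>\<^bsub>free R n\<^esub> z"
      unfolding JM_free using submodD(6)[OF coords_J_sub d[OF xV(1)]] xV(1) by blast
  qed
  then show ?thesis using inj by (simp add: bij_betw_def)
qed

lemma iso_free_projective:
  assumes P: "left_module R P" and q: "q \<in> mod_hom R (free R n) P" "bij_betw q (V n) (carrier P)"
  shows "projective R P"
  unfolding projective_def
proof (intro conjI allI impI)
  have b: "bij_betw q (carrier (free R n)) (carrier P)" using q(2) by simp
  note inv = mod_hom_inv[OF q(1) b fr.left_module_axioms]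
  show "fl_module R P"
    unfolding fl_module_def mod_length_bij[OF q(1) b fr.left_module_axioms P, symmetric] len_coords(3) using P by simp
  fix X Y :: "'a umod" and g f
  assume h: "fl_module R X \<and> fl_module R Y \<and> g \<in> mod_hom R X Y \<and> g ` carrier X = carrier Y \<and> f \<in> mod_hom R P Y"
  then have lm: "left_module R X" "left_module R Y" and g: "g \<in> mod_hom R X Y" "g ` carrier X = carrier Y"
    and f: "f \<in> mod_hom R P Y" by (auto simp: fl_module_def)
  have fq: "(\<lambda>x. f (q x)) \<in> mod_hom R (free R n) Y" by (rule mod_hom_comp[OF q(1) f])
  have "(\<lambda>x. f (q x)) ` V n \<subseteq> g ` carrier X" using g(2) mod_homD(1)[OF fq] by auto
  then obtain k where k: "k \<in> mod_hom R (free R n) X" "\<And>x. x \<in> V n \<Longrightarrow> g (k x) = f (q x)"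
    using lift_free[OF fq g(1) lm] by blast
  show "\<exists>h\<in>mod_hom R P X. \<forall>p\<in>carrier P. g (h p) = f p"
  proof (intro bexI ballI)
    show "(\<lambda>p. k (inv_into (carrier (free R n)) q p)) \<in> mod_hom R P X" by (rule mod_hom_comp[OF inv(1) k(1)])
    fix p assume p: "p \<in> carrier P"
    have "inv_into (carrier (free R n)) q p \<in> V n" using mod_homD(1)[OF inv(1) p] by simp
    then show "g (k (inv_into (carrier (free R n)) q p)) = f p" using k(2) inv(4)[OF p] by simp
  qed
qed

lemma free_projective: "projective R (free R n)"
  by (rule iso_free_projective[OF fr.left_module_axioms mod_hom_id, of n]) (simp add: bij_betw_def)

text \<open>A minimal surjection from a free module splits, and by Nakayama's lemma the splitting is
  onto. \<open>P\<close> must have the carrier type of \<open>umod\<close>, because the lifting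
  property is applied with \<open>P\<close> itself as target.\<close>

lemma projective_iso_free:
  fixes P :: "'a umod"
  assumes P: "projective R P"
  obtains n q where "q \<in> mod_hom R (free R n) P" "bij_betw q (V n) (carrier P)"
proof -
  have lm: "left_module R P" and fl: "mod_length R P \<noteq> \<infinity>" and flP: "fl_module R P"
    using P by (auto simp: projective_def fl_module_def)
  interpret P: lmod R P by (rule lmod.intro) fact
  obtain n q where q: "q \<in> mod_hom R (free R n) P" "q ` V n = carrier P" "a_kernel (free R n) P q \<subseteq> coords R J n"
    by (rule min_generators[OF lm fl])
  have "\<exists>h\<in>mod_hom R P (free R n). \<forall>p\<in>carrier P. q (h p) = p"
    using P free_fl flP q(1,2) mod_hom_id[of R P] unfolding projective_def by (metis free_simps(1))
  then obtain h where h: "h \<in> mod_hom R P (free R n)" "\<And>p. p \<in> carrier P \<Longrightarrow> q (h p) = p" by blast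
  note qh = mod_homD[OF q(1), simplified] and hh = mod_homD[OF h(1), simplified]
  have im: "submodule (h ` carrier P) R (free R n)" by (rule image_submodule[OF h(1) lm fr.left_module_axioms P.carrier_submodule])
  have surj: "h ` carrier P = carrier (free R n)"
  proof (rule nakayama[OF fr.left_module_axioms im])
    fix x assume x: "x \<in> carrier (free R n)"
    then have hx: "h (q x) \<in> carrier (free R n)" using qh(1) hh(1) by simp
    have "x \<ominus>\<^bsub>free R n\<^esub> h (q x) \<in> a_kernel (free R n) P q"
      using kernel_eq_iff[OF q(1) fr.left_module_axioms lm x hx] h(2) qh(1) x by simp
    then have "x \<ominus>\<^bsub>free R n\<^esub> h (q x) \<in> coords R J n" using q(3) by blast
    moreover have "x = h (q x) \<oplus>\<^bsub>free R n\<^esub> (x \<ominus>\<^bsub>free R n\<^esub> h (q x))"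
      using fr.minus_add_cancel[OF x hx] fr.M.a_comm[OF hx fr.M.minus_closed[OF x hx]] by metis
    ultimately show "\<exists>y\<in>h ` carrier P. \<exists>z\<in>JM (free R n). x = y \<oplus>\<^bsub>free R n\<^esub> z"
      unfolding JM_free using qh(1) x by fastforce
  qed
  have "inj_on q (V n)"
  proof (rule inj_onI)
    fix x y assume "x \<in> V n" "y \<in> V n" and e: "q x = q y"
    then have "x \<in> h ` carrier P" "y \<in> h ` carrier P" using surj by simp_all
    then obtain p p' where p: "p \<in> carrier P" "x = h p" "p' \<in> carrier P" "y = h p'" by blast
    then show "x = y" using e h(2) by simp
  qed
  then show ?thesis using that q(1,2) by (auto simp: bij_betw_def)
qed

text \<open>The definition of \<open>projective\<close> speaks of surjections between modules of
  type \<open>umod\<close>. By means of a basis, lifting extends to modules with any carrier type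
  and to maps \<open>g\<close> whose image merely contains that of \<open>f\<close>.\<close>

lemma lift_projective:
  fixes P :: "'a umod"
  assumes P: "projective R P" and f: "f \<in> mod_hom R P Y" and g: "g \<in> mod_hom R X Y"
    and X: "left_module R X" and Y: "left_module R Y" and im: "f ` carrier P \<subseteq> g ` carrier X"
  obtains h where "h \<in> mod_hom R P X" "\<And>x. x \<in> carrier P \<Longrightarrow> g (h x) = f x"
proof -
  obtain n q where q: "q \<in> mod_hom R (free R n) P" "bij_betw q (V n) (carrier P)"
    using projective_iso_free[OF P] by blast
  have b: "bij_betw q (carrier (free R n)) (carrier P)" using q(2) by simp
  note inv = mod_hom_inv[OF q(1) b fr.left_module_axioms]
  have fq: "(\<lambda>x. f (q x)) \<in> mod_hom R (free R n) Y" by (rule mod_hom_comp[OF q(1) f])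
  have "(\<lambda>x. f (q x)) ` V n \<subseteq> f ` carrier P" using mod_homD(1)[OF q(1)] by auto
  then have "(\<lambda>x. f (q x)) ` V n \<subseteq> g ` carrier X" using im by (rule order_trans)
  then obtain k where k: "k \<in> mod_hom R (free R n) X" "\<And>x. x \<in> V n \<Longrightarrow> g (k x) = f (q x)"
    using lift_free[OF fq g X Y] by blast
  have "g (k (inv_into (carrier (free R n)) q x)) = f x" if x: "x \<in> carrier P" for x
    using k(2)[of "inv_into (carrier (free R n)) q x"] inv(4)[OF x] mod_homD(1)[OF inv(1) x] by simp
  then show ?thesis using that[OF mod_hom_comp[OF inv(1) k(1)]] by blast
qed

text \<open>If a kernel element had a unit entry at \<open>i\<close>, the rows with zero entry at
  \<open>i\<close> would be a proper submodule that together with the kernel spans everything,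
  against the minimality of the cover.\<close>

lemma cover_kernel:
  fixes P :: "'a umod"
  assumes M: "left_module R M" and pc: "projective_cover R P p M"
    and q: "q \<in> mod_hom R (free R n) P" "bij_betw q (V n) (carrier P)"
  shows "a_kernel (free R n) M (\<lambda>x. p (q x)) \<subseteq> coords R J n"
proof
  have p: "p \<in> mod_hom R P M" "p ` carrier P = carrier M"
    and lmP: "left_module R P"
    and mn: "\<And>N. \<lbrakk>submodule N R P; N <+>\<^bsub>P\<^esub> a_kernel P M p = carrier P\<rbrakk> \<Longrightarrow> N = carrier P"
    using pc by (auto simp: projective_cover_def projective_def fl_module_def)
  interpret P: lmod R P by (rule lmod.intro) fact
  note qh = mod_homD[OF q(1), simplified]
  fix x assume "x \<in> a_kernel (free R n) M (\<lambda>x. p (q x))"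
  then have x: "x \<in> V n" "p (q x) = \<zero>\<^bsub>M\<^esub>" by (auto simp: a_kernel_def')
  show "x \<in> coords R J n"
  proof (rule ccontr)
    assume "x \<notin> coords R J n"
    then obtain i where i: "i < n" "x i \<notin> J" using x(1) by (auto simp: coords_def)
    obtain w where w: "w \<in> carrier R" "w \<otimes> x i = \<one>" using unit[OF coords_i[OF x(1)] i(2)] by blast
    have L: "submodule {y \<in> V n. y i = \<zero>} R (free R n)"
      by (rule fr.submodI) (auto simp: coords_def)
    have N: "submodule (q ` {y \<in> V n. y i = \<zero>}) R P"
      by (rule image_submodule[OF q(1) fr.left_module_axioms lmP L])
    have K: "submodule (a_kernel P M p) R P" by (rule kernel_submodule[OF p(1) lmP M])
    have "q ` {y \<in> V n. y i = \<zero>} <+>\<^bsub>P\<^esub> a_kernel P M p = carrier P"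
    proof (intro equalityI)
      show "q ` {y \<in> V n. y i = \<zero>} <+>\<^bsub>P\<^esub> a_kernel P M p \<subseteq> carrier P"
        by (rule submodD(1)[OF P.submodule_sum[OF N K]])
      show "carrier P \<subseteq> q ` {y \<in> V n. y i = \<zero>} <+>\<^bsub>P\<^esub> a_kernel P M p"
      proof
        fix z assume "z \<in> carrier P"
        then have "z \<in> q ` V n" using q(2) by (simp add: bij_betw_def)
        then obtain y where y: "y \<in> V n" "z = q y" by blast
        let ?t = "(y i \<otimes> w) \<odot>\<^bsub>free R n\<^esub> x"
        have yi: "y i \<in> carrier R" "x i \<in> carrier R" using coords_i y(1) x(1) by auto
        have t: "?t \<in> carrier (free R n)" by (rule fr.smult_closed) (use yi w x(1) in auto)
        have yt: "y \<ominus>\<^bsub>free R n\<^esub> ?t \<in> carrier (free R n)" by (rule fr.M.minus_closed) (use y(1) t in simp_all)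
        have "(\<lambda>u. u i) \<in> mod_hom R (free R n) (regular R)" by (rule mod_homI) (auto simp: coords_i)
        from mod_hom_minus[OF this fr.left_module_axioms reg.left_module_axioms, of y ?t]
        have "(y \<ominus>\<^bsub>free R n\<^esub> ?t) i = y i \<ominus> (y i \<otimes> w) \<otimes> x i" using y(1) t by simp
        also have "\<dots> = \<zero>" using yi w by (simp add: m_assoc minus_eq r_neg)
        finally have "y \<ominus>\<^bsub>free R n\<^esub> ?t \<in> {y \<in> V n. y i = \<zero>}" using yt by simp
        moreover have "q ?t \<in> a_kernel P M p"
        proof -
          have r: "y i \<otimes> w \<in> carrier R" using yi w by simp
          have qt: "q ?t = (y i \<otimes> w) \<odot>\<^bsub>P\<^esub> q x" using mod_homD(3)[OF q(1) r] x(1) by simp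
          have "q x \<in> a_kernel P M p" using x qh(1) by (auto simp: a_kernel_def')
          then show ?thesis unfolding qt using submodD(5)[OF K r] by simp
        qed
        moreover have "z = q (y \<ominus>\<^bsub>free R n\<^esub> ?t) \<oplus>\<^bsub>P\<^esub> q ?t"
          using mod_homD(2)[OF q(1) yt t] fr.minus_add_cancel[where n = n and x = y and y = ?t] y t by (simp del: free_simps(3,4))
        ultimately show "z \<in> q ` {y \<in> V n. y i = \<zero>} <+>\<^bsub>P\<^esub> a_kernel P M p"
          unfolding set_add_def' by blast
      qed
    qed
    then have "q ` {y \<in> V n. y i = \<zero>} = carrier P" by (rule mn[OF N])
    moreover have "q (evec R i) \<in> carrier P" using qh(1) i(1) by simp
    ultimately have "q (evec R i) \<in> q ` {y \<in> V n. y i = \<zero>}" by simp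
    then obtain y where y: "y \<in> V n" "y i = \<zero>" "q y = q (evec R i)" by (elim imageE) auto
    then have "y = evec R i" using q(2) i(1) by (auto simp: bij_betw_def inj_on_def)
    then show False using y(2) one_notin_J zero_J(1) by (auto simp: evec_def)
  qed
qed

text \<open>Lifts in both directions compose to endomorphisms that are the identity modulo the
  kernels. These lie in the radical, so \<open>unipotent_bij\<close> applies.\<close>

lemma min_presentation_unique:
  assumes Y: "left_module R Y"
    and q: "q \<in> mod_hom R (free R n) Y" "q ` V n = carrier Y" "a_kernel (free R n) Y q \<subseteq> coords R J n"
    and p: "p \<in> mod_hom R (free R m) Y" "p ` V m = carrier Y" "a_kernel (free R m) Y p \<subseteq> coords R J m"
  obtains h where "h \<in> mod_hom R (free R n) (free R m)" "bij_betw h (V n) (V m)" "\<And>x. x \<in> V n \<Longrightarrow> p (h x) = q x"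
proof -
  have bij: "bij_betw (\<lambda>x. g (h x)) (V n) (V n)"
    if h: "h \<in> mod_hom R (free R n) (free R m)" "\<And>x. x \<in> V n \<Longrightarrow> p (h x) = q x"
      and g: "g \<in> mod_hom R (free R m) (free R n)" "\<And>x. x \<in> V m \<Longrightarrow> q (g x) = p x"
      and q: "q \<in> mod_hom R (free R n) Y" and k: "a_kernel (free R n) Y q \<subseteq> coords R J n" for n m h g p q
  proof (rule unipotent_bij[OF mod_hom_comp[OF h(1) g(1)]])
    fix x assume x: "x \<in> V n"
    then have hx: "h x \<in> V m" using mod_homD(1)[OF h(1)] by simp
    then have gx: "g (h x) \<in> carrier (free R n)" using mod_homD(1)[OF g(1)] by simp
    show "g (h x) \<ominus>\<^bsub>free R n\<^esub> x \<in> coords R J n"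
      using kernel_eq_iff[OF q fr.left_module_axioms Y gx, of x] x hx h(2) g(2) k by auto
  qed
  obtain h where h: "h \<in> mod_hom R (free R n) (free R m)" "\<And>x. x \<in> V n \<Longrightarrow> p (h x) = q x"
    using lift_free[OF q(1) p(1) fr.left_module_axioms Y] q(2) p(2) by auto
  obtain g where g: "g \<in> mod_hom R (free R m) (free R n)" "\<And>x. x \<in> V m \<Longrightarrow> q (g x) = p x"
    using lift_free[OF p(1) q(1) fr.left_module_axioms Y] q(2) p(2) by auto
  have b1: "bij_betw (\<lambda>x. g (h x)) (V n) (V n)" by (rule bij[OF h g q(1,3)])
  have b2: "bij_betw (\<lambda>x. h (g x)) (V m) (V m)" by (rule bij[OF g h p(1,3)])
  have "inj_on h (V n)" using b1 by (auto simp: bij_betw_def inj_on_def)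
  moreover have "h ` V n = V m"
  proof
    show "h ` V n \<subseteq> V m" using mod_homD(1)[OF h(1)] by auto
    show "V m \<subseteq> h ` V n"
    proof
      fix y assume "y \<in> V m"
      then have "y \<in> (\<lambda>x. h (g x)) ` V m" using b2 by (simp add: bij_betw_def)
      then show "y \<in> h ` V n" using mod_homD(1)[OF g(1)] by auto
    qed
  qed
  ultimately show ?thesis using that h by (simp add: bij_betw_def)
qed

text \<open>\<open>is_Omega\<close> admits every projective cover and every isomorphic copy of its
  kernel; all of them are identified with the kernel of one given minimal presentation.\<close>

lemma Omega_unique:
  assumes Y: "left_module R Y"
    and q: "q \<in> mod_hom R (free R n) Y" "q ` V n = carrier Y" "a_kernel (free R n) Y q \<subseteq> coords R J n"
    and X: "is_Omega R Y X"
  obtains f where "f \<in> mod_hom R (sub (free R n) (a_kernel (free R n) Y q)) X" "left_module R X"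
    "bij_betw f (a_kernel (free R n) Y q) (carrier X)"
proof -
  obtain P :: "'a umod" and p where pc: "projective_cover R P p Y" and iso: "mod_iso R (sub P (a_kernel P Y p)) X"
    using X unfolding is_Omega_def by blast
  have p: "p \<in> mod_hom R P Y" "p ` carrier P = carrier Y" and P: "projective R P"
    using pc by (auto simp: projective_cover_def)
  obtain m th where th: "th \<in> mod_hom R (free R m) P" "bij_betw th (V m) (carrier P)"
    using projective_iso_free[OF P] by blast
  have pt: "(\<lambda>x. p (th x)) \<in> mod_hom R (free R m) Y" by (rule mod_hom_comp[OF th(1) p(1)])
  have "th ` V m = carrier P" using th(2) by (simp add: bij_betw_def)
  then have pts: "(\<lambda>x. p (th x)) ` V m = carrier Y" using p(2) by (metis image_image)
  obtain h where h: "h \<in> mod_hom R (free R n) (free R m)" "bij_betw h (V n) (V m)" "\<And>x. x \<in> V n \<Longrightarrow> p (th (h x)) = q x"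
    using min_presentation_unique[OF Y q pt pts cover_kernel[OF Y pc th]] by blast
  let ?K = "a_kernel (free R n) Y q" and ?L = "a_kernel P Y p"
  have hh: "(\<lambda>x. th (h x)) \<in> mod_hom R (free R n) P" by (rule mod_hom_comp[OF h(1) th(1)])
  have hb: "bij_betw (\<lambda>x. th (h x)) (V n) (carrier P)" using bij_betw_trans[OF h(2) th(2)] by (simp add: comp_def)
  have KV: "?K \<subseteq> V n" by (auto simp: a_kernel_def')
  have K: "(\<lambda>x. th (h x)) ` ?K = ?L"
  proof (intro equalityI subsetI)
    fix z assume "z \<in> (\<lambda>x. th (h x)) ` ?K"
    then show "z \<in> ?L" using h(3) mod_homD(1)[OF hh] by (auto simp: a_kernel_def')
  next
    fix z assume z: "z \<in> ?L"
    then have "z \<in> (\<lambda>x. th (h x)) ` V n" using hb by (simp add: bij_betw_def a_kernel_def')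
    then obtain x where "x \<in> V n" "z = th (h x)" by blast
    then show "z \<in> (\<lambda>x. th (h x)) ` ?K" using z h(3) by (auto simp: a_kernel_def')
  qed
  obtain i where i: "i \<in> mod_hom R (sub P ?L) X" "bij_betw i ?L (carrier X)" "left_module R X"
    using iso unfolding mod_iso_def by auto
  have "(\<lambda>x. th (h x)) \<in> mod_hom R (sub (free R n) ?K) (sub P ?L)"
    by (rule mod_hom_sub[OF hh]) (use KV K in auto)
  then have "(\<lambda>x. i (th (h x))) \<in> mod_hom R (sub (free R n) ?K) X" by (rule mod_hom_comp[OF _ i(1)])
  moreover have "bij_betw (\<lambda>x. th (h x)) ?K ?L" using hb K KV by (auto simp: bij_betw_def intro: inj_on_subset)
  then have "bij_betw (\<lambda>x. i (th (h x))) ?K (carrier X)" using bij_betw_trans[OF _ i(2)] by (auto simp: comp_def)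
  ultimately show ?thesis using that i(3) by blast
qed

text \<open>\<open>E\<close> induces an embedding \<open>u0\<close> of \<open>Y\<close> into
  \<open>A^k\<close>. By \<open>app\<close>, functionals on \<open>Y\<close> extend along it, so it
  is a left approximation; by \<open>mn\<close>, a functional that vanishes on its image is given by
  a column over \<open>J\<close>, so it is minimal. Comparing it with an arbitrary minimal
  approximation identifies the cokernels, and that of \<open>u0\<close> is the cokernel of
  \<open>E\<close>.\<close>

lemma mho_unique:
  assumes Y: "left_module R Y" and E: "E \<in> mod_hom R (free R m) (free R k)"
    and q: "q \<in> mod_hom R (free R m) Y" "q ` V m = carrier Y"
    and ker: "\<And>x. x \<in> V m \<Longrightarrow> q x = \<zero>\<^bsub>Y\<^esub> \<longleftrightarrow> E x = zv"
    and app: "\<And>b. \<lbrakk>b \<in> V m; \<And>x. \<lbrakk>x \<in> V m; E x = zv\<rbrakk> \<Longrightarrow> dot R m x b = \<zero>\<rbrakk> \<Longrightarrow> b \<in> tr R k m E ` V k"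
    and mn: "\<And>b. \<lbrakk>b \<in> V k; tr R k m E b = zv\<rbrakk> \<Longrightarrow> b \<in> coords R J k"
    and X: "is_mho R Y X"
  obtains q' where "q' \<in> mod_hom R (free R k) X" "q' ` V k = carrier X" "a_kernel (free R k) X q' = E ` V m"
    "left_module R X"
proof -
  obtain P :: "'a umod" and u where mla: "min_left_approx R Y u P" and iso: "mod_iso R (quot P (u ` carrier Y)) X"
    using X unfolding is_mho_def by blast
  have P: "projective R P" and u: "u \<in> mod_hom R Y P"
    and ext: "\<And>(Q :: 'a umod) f. \<lbrakk>projective R Q; f \<in> mod_hom R Y Q\<rbrakk> \<Longrightarrow> \<exists>h\<in>mod_hom R P Q. \<forall>x\<in>carrier Y. h (u x) = f x"
    and bij: "\<And>h. \<lbrakk>h \<in> mod_hom R P P; \<forall>x\<in>carrier Y. h (u x) = u x\<rbrakk> \<Longrightarrow> bij_betw h (carrier P) (carrier P)"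
    using mla unfolding min_left_approx_def by blast+
  have lmP: "left_module R P" using P by (simp add: projective_def fl_module_def)
  interpret P: lmod R P by (rule lmod.intro) fact
  interpret Y: lmod R Y by (rule lmod.intro) fact
  note qc = mod_homD(1)[OF q(1), simplified] and Ec = mod_homD(1)[OF E, simplified]
  have qs: "q ` carrier (free R m) = carrier Y" using q(2) by simp
  obtain u0 where u0: "u0 \<in> mod_hom R Y (free R k)" "\<And>x. x \<in> V m \<Longrightarrow> u0 (q x) = E x"
    using mod_hom_factor[OF q(1) qs E fr.left_module_axioms Y fr.left_module_axioms] ker by auto
  obtain r th where th: "th \<in> mod_hom R (free R r) P" "bij_betw th (V r) (carrier P)"
    using projective_iso_free[OF P] by blast
  have thb: "bij_betw th (carrier (free R r)) (carrier P)" using th(2) by simp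
  note inv = mod_hom_inv[OF th(1) thb fr.left_module_axioms]
  let ?ti = "inv_into (carrier (free R r)) th"
  define f where "f x = ?ti (u (q x))" for x
  have f: "f \<in> mod_hom R (free R m) (free R r)"
    unfolding f_def by (rule mod_hom_comp[OF mod_hom_comp[OF q(1) u] inv(1)])
  have fV: "f x \<in> V r" if "x \<in> V m" for x using mod_homD(1)[OF f] that by simp
  have ci: "(\<lambda>x. x i) \<in> mod_hom R (free R r) (regular R)" for i r by (rule mod_homI) (auto simp: coords_i)
  have fc: "\<exists>c\<in>V k. \<forall>x\<in>V m. dot R k (E x) c = f x i" for i
  proof -
    have fi: "(\<lambda>x. f x i) \<in> mod_hom R (free R m) (regular R)" by (rule mod_hom_comp[OF f ci])
    let ?b = "covec R m (\<lambda>x. f x i)"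
    have b: "?b \<in> V m" "\<And>x. x \<in> V m \<Longrightarrow> f x i = dot R m x ?b" using covec_closed[OF fi] functional_eq[OF fi] by auto
    have "dot R m x ?b = \<zero>" if x: "x \<in> V m" "E x = zv" for x
    proof -
      have "q x = \<zero>\<^bsub>Y\<^esub>" using ker x by blast
      then have "f x = \<zero>\<^bsub>free R r\<^esub>"
        unfolding f_def using mod_hom_zero[OF u Y lmP] mod_hom_zero[OF inv(1) lmP fr.left_module_axioms] by simp
      then show ?thesis using b(2)[OF x(1)] by simp
    qed
    from app[OF b(1) this] obtain c where c: "c \<in> V k" "?b = tr R k m E c" by blast
    then show ?thesis using b(2) tr_adj[OF E c(1)] by (intro bexI[of _ c]) auto
  qed
  then obtain c where c: "\<And>i. c i \<in> V k" "\<And>i x. x \<in> V m \<Longrightarrow> dot R k (E x) (c i) = f x i" by metis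
  \<comment> \<open>The coordinates of \<open>u\<close>, read in the basis \<open>th\<close>, factor
    through \<open>E\<close> one at a time. The columns \<open>c i\<close> form the matrix of the
    factorization.\<close>
  define H where "H z = (\<lambda>i. if i < r then dot R k z (c i) else \<zero>)" for z
  have H: "H \<in> mod_hom R (free R k) (free R r)"
  proof (rule mod_homI)
    fix x y s assume xy: "x \<in> carrier (free R k)" "y \<in> carrier (free R k)"
    show "H x \<in> carrier (free R r)" using xy c(1) by (auto simp: H_def coords_def[of _ _ r])
    show "H (x \<oplus>\<^bsub>free R k\<^esub> y) = H x \<oplus>\<^bsub>free R r\<^esub> H y"
      using xy c(1) mod_homD(2)[OF dot_hom[OF c(1)] xy] by (auto simp: H_def)
  next
    fix s x assume sx: "s \<in> carrier R" "x \<in> carrier (free R k)"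
    show "H (s \<odot>\<^bsub>free R k\<^esub> x) = s \<odot>\<^bsub>free R r\<^esub> H x"
      using sx c(1) dot_smult_left by (auto simp: H_def)
  qed
  have HE: "H (E x) = f x" if x: "x \<in> V m" for x
    using c(2)[OF x] fV[OF x] by (auto simp: H_def coords_def fun_eq_iff)
  define h where "h z = th (H z)" for z
  have h: "h \<in> mod_hom R (free R k) P" unfolding h_def by (rule mod_hom_comp[OF H th(1)])
  have hE: "h (E x) = u (q x)" if x: "x \<in> V m" for x
    using HE[OF x] inv(4)[OF mod_homD(1)[OF u qc[OF x]]] by (simp add: h_def f_def)
  have Yq: "\<exists>x\<in>V m. y = q x" if "y \<in> carrier Y" for y using that unfolding q(2)[symmetric] by blast
  obtain h' where h': "h' \<in> mod_hom R P (free R k)" "\<forall>x\<in>carrier Y. h' (u x) = u0 x"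
    using ext[OF free_projective u0(1)] by blast
  have hu0: "h (u0 y) = u y" if "y \<in> carrier Y" for y using Yq[OF that] u0(2) hE by auto
  \<comment> \<open>This composition fixes the image of \<open>u\<close>, so it is bijective by the
    minimality of the given approximation.\<close>
  have "bij_betw (\<lambda>z. h (h' z)) (carrier P) (carrier P)"
    by (rule bij[OF mod_hom_comp[OF h'(1) h]]) (use hu0 h'(2) in auto)
  then have "carrier P = (\<lambda>z. h (h' z)) ` carrier P" by (simp add: bij_betw_def)
  then have hs: "carrier P = h ` (h' ` carrier P)" by (simp add: image_image)
  have "h' ` carrier P \<subseteq> V k" "h ` V k \<subseteq> carrier P" using mod_homD(1)[OF h'(1)] mod_homD(1)[OF h] by auto
  then have hsurj: "h ` V k = carrier P" using hs by blast
  \<comment> \<open>The other composition minus the identity vanishes on the image of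
    \<open>E\<close>, so by \<open>mn\<close> it has entries in \<open>J\<close>.\<close>
  have "bij_betw (\<lambda>z. h' (h z)) (V k) (V k)"
  proof (rule unipotent_bij[OF mod_hom_comp[OF h h'(1)]])
    fix x assume x: "x \<in> V k"
    let ?N = "\<lambda>x. h' (h x) \<ominus>\<^bsub>free R k\<^esub> x"
    have N: "?N \<in> mod_hom R (free R k) (free R k)"
      by (rule mod_hom_diff[OF mod_hom_comp[OF h h'(1)] mod_hom_id fr.left_module_axioms])
    have NE: "?N (E z) = \<zero>\<^bsub>free R k\<^esub>" if z: "z \<in> V m" for z
    proof -
      have "h' (h (E z)) = E z" using hE[OF z] h'(2) qc[OF z] u0(2)[OF z] by simp
      then show ?thesis using fr.minus_eq_zero_iff[where n = k and x = "E z" and y = "E z"] Ec[OF z] by simp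
    qed
    have "?N x i \<in> J" for i
    proof -
      have Ni: "(\<lambda>x. ?N x i) \<in> mod_hom R (free R k) (regular R)" by (rule mod_hom_comp[OF N ci])
      let ?b = "covec R k (\<lambda>x. ?N x i)"
      have b: "?b \<in> V k" "\<And>x. x \<in> V k \<Longrightarrow> ?N x i = dot R k x ?b" using covec_closed[OF Ni] functional_eq[OF Ni] by auto
      have "tr R k m E ?b = zv"
      proof (rule dot_nondeg[OF tr_closed[OF E b(1)] zv_coords(3)])
        fix z assume z: "z \<in> V m"
        have "dot R m z (tr R k m E ?b) = ?N (E z) i" using tr_adj[OF E b(1) z] b(2)[OF Ec[OF z]] by simp
        also have "\<dots> = \<zero>" using NE[OF z] by simp
        also have "\<dots> = dot R m z zv" by (rule dot_zero[symmetric]) (simp add: coords_i[OF z])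
        finally show "dot R m z (tr R k m E ?b) = dot R m z zv" .
      qed
      then have "?b \<in> coords R J k" by (rule mn[OF b(1)])
      then have "dot R k x ?b \<in> J" by (intro dot_in[OF J_sub]) (use coords_i[OF x] in \<open>auto simp: coords_def J_mult\<close>)
      then show ?thesis using b(2)[OF x] by simp
    qed
    then show "?N x \<in> coords R J k" using mod_homD(1)[OF N, of x] x by (auto simp: coords_def)
  qed
  then have hinj: "inj_on h (V k)" by (auto simp: bij_betw_def inj_on_def)
  have U: "submodule (u ` carrier Y) R P" by (rule image_submodule[OF u Y lmP Y.carrier_submodule])
  note pr = P.proj_hom[OF U]
  obtain i where i: "i \<in> mod_hom R (quot P (u ` carrier Y)) X" "bij_betw i (carrier (quot P (u ` carrier Y))) (carrier X)" "left_module R X"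
    using iso unfolding mod_iso_def by blast
  define q' where "q' z = i (u ` carrier Y +>\<^bsub>P\<^esub> h z)" for z
  have q': "q' \<in> mod_hom R (free R k) X"
    unfolding q'_def by (rule mod_hom_comp[OF mod_hom_comp[OF h pr(1)] i(1)])
  have "q' ` V k = i ` ((\<lambda>z. u ` carrier Y +>\<^bsub>P\<^esub> z) ` (h ` V k))" by (simp add: image_image q'_def)
  also have "\<dots> = carrier X" unfolding hsurj pr(2) using i(2) by (simp add: bij_betw_def)
  finally have q's: "q' ` V k = carrier X" .
  have "a_kernel (free R k) X q' = E ` V m"
  proof (intro equalityI subsetI)
    fix z assume "z \<in> a_kernel (free R k) X q'"
    then have z: "z \<in> V k" "q' z = \<zero>\<^bsub>X\<^esub>" by (auto simp: a_kernel_def')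
    have hz: "h z \<in> carrier P" using mod_homD(1)[OF h] z by simp
    have "a_kernel (quot P (u ` carrier Y)) X i = {\<zero>\<^bsub>quot P (u ` carrier Y)\<^esub>}"
      using inj_on_kernel[OF i(1) pr(4) i(3)] i(2) by (simp add: bij_betw_def)
    then have "u ` carrier Y +>\<^bsub>P\<^esub> h z = \<zero>\<^bsub>quot P (u ` carrier Y)\<^esub>"
      using z(2) mod_homD(1)[OF pr(1) hz] unfolding q'_def a_kernel_def' by blast
    then have "h z \<in> u ` carrier Y" using pr(3) hz by (auto simp: a_kernel_def')
    then obtain y where y: "y \<in> carrier Y" "h z = u y" by blast
    then obtain x where x: "x \<in> V m" "y = q x" using Yq by blast
    then have "h z = h (E x)" using hE y by simp
    then have "z = E x" using hinj z(1) Ec[OF x(1)] by (auto simp: inj_on_def)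
    then show "z \<in> E ` V m" using x by blast
  next
    fix z assume "z \<in> E ` V m"
    then obtain x where x: "x \<in> V m" "z = E x" by blast
    have uq: "u (q x) \<in> u ` carrier Y" "u (q x) \<in> carrier P" using qc[OF x(1)] mod_homD(1)[OF u] by auto
    then have "u (q x) \<in> a_kernel P (quot P (u ` carrier Y)) (\<lambda>z. u ` carrier Y +>\<^bsub>P\<^esub> z)" unfolding pr(3) by simp
    then have "u ` carrier Y +>\<^bsub>P\<^esub> u (q x) = \<zero>\<^bsub>quot P (u ` carrier Y)\<^esub>" by (simp add: a_kernel_def')
    then have "q' z = \<zero>\<^bsub>X\<^esub>" using hE[OF x(1)] x(2) mod_hom_zero[OF i(1) pr(4) i(3)] by (simp add: q'_def)
    then show "z \<in> a_kernel (free R k) X q'" using Ec[OF x(1)] x(2) by (simp add: a_kernel_def')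
  qed
  then show ?thesis using that q' q's i(3) by blast
qed

text \<open>The rank of a minimal presentation is the length of the top; relations that contain
  \<open>J^2 F\<close> bound the Loewy length by 2; what is left of \<open>J F\<close> modulo the
  relations is the radical.\<close>

lemma dim_vec_presentation:
  assumes X: "left_module R X"
    and q: "q \<in> mod_hom R (free R n) X" "q ` V n = carrier X" "a_kernel (free R n) X q \<subseteq> coords R J n"
    and J2: "coords R J2 n \<subseteq> a_kernel (free R n) X q"
    and k: "mod_length R (sub (free R n) (a_kernel (free R n) X q)) = enat k"
  shows "has_dim_vec R J X n (n * (e + a) - k)"
proof -
  interpret X: lmod R X by (rule lmod.intro) fact
  have JX: "JM X = q ` coords R J n" by (rule JM_image[OF X q(1,2)])
  have s: "submodule (JM X) R X" by (rule JM_sub[OF X])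
  have lms: "left_module R (sub X (JM X))" by (rule X.sub_left_module[OF s])
  interpret S: lmod R "sub X (JM X)" by (rule lmod.intro) (rule lms)
  have "JM (sub X (JM X)) = {\<zero>\<^bsub>X\<^esub>}"
  proof
    have "JM (sub X (JM X)) \<subseteq> {\<zero>\<^bsub>sub X (JM X)\<^esub>}"
    proof (rule JM_least[OF S.zero_submodule])
      fix r x assume r: "r \<in> J" and x: "x \<in> carrier (sub X (JM X))"
      then obtain y where y: "y \<in> coords R J n" "x = q y" using JX by auto
      have ry: "(\<lambda>i. r \<otimes> y i) \<in> coords R J2 n" using r y(1) JJ_J2 J_carrier by (auto simp: coords_def)
      have "r \<odot>\<^bsub>X\<^esub> x = q (\<lambda>i. r \<otimes> y i)"
        using mod_homD(3)[OF q(1), of r y] r J_carrier coords_J_V[OF y(1)] y(2) by simp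
      also have "\<dots> = \<zero>\<^bsub>X\<^esub>" using J2 ry by (auto simp: a_kernel_def')
      finally show "r \<odot>\<^bsub>sub X (JM X)\<^esub> x \<in> {\<zero>\<^bsub>sub X (JM X)\<^esub>}" by simp
    qed
    then show "JM (sub X (JM X)) \<subseteq> {\<zero>\<^bsub>X\<^esub>}" by simp
    show "{\<zero>\<^bsub>X\<^esub>} \<subseteq> JM (sub X (JM X))" using submodD(3)[OF JM_sub[OF lms]] by simp
  qed
  moreover have "mod_length R (sub X (JM X)) = enat (n * (e + a) - k)"
  proof -
    have "a_kernel (free R n) X q \<inter> coords R J n = a_kernel (free R n) X q" using q(3) by blast
    then have "enat (n * (e + a)) = enat k + mod_length R (sub X (JM X))"
      using mod_length_image[OF q(1) fr.left_module_axioms X coords_J_sub] len_coords(1)[of n] k JX by simp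
    then show ?thesis by (cases "mod_length R (sub X (JM X))") auto
  qed
  ultimately show ?thesis unfolding has_dim_vec_def using X top_length_eq[OF X q] by simp
qed

text \<open>If \<open>f x\<close> were a unit, \<open>f\<close> would split off a free summand of
  rank 1, generated by the multiple \<open>m\<close> of \<open>x\<close> with
  \<open>f m = \<one>\<close>. By indecomposability \<open>M\<close> would be that summand.\<close>

lemma hom_to_ring_rad:
  assumes M: "left_module R M" and ind: "indecomposable R M" and np: "\<not> projective R M"
    and f: "f \<in> mod_hom R M (regular R)" and x: "x \<in> carrier M"
  shows "f x \<in> J"
proof (rule ccontr)
  assume nJ: "f x \<notin> J"
  interpret M: lmod R M by (rule lmod.intro) fact
  note fh = mod_homD[OF f, simplified]
  obtain w where w: "w \<in> carrier R" "f x \<otimes> w = \<one>" "w \<otimes> f x = \<one>" using unit[OF fh(1)[OF x] nJ] by blast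
  define m where "m = w \<odot>\<^bsub>M\<^esub> x"
  have m: "m \<in> carrier M" "f m = \<one>" using w x fh(3) M.smult_closed by (auto simp: m_def)
  have rm: "(\<lambda>r. r \<odot>\<^bsub>M\<^esub> m) \<in> mod_hom R (regular R) M"
    by (rule mod_homI) (auto simp: m M.smult_closed M.smult_l_distr M.smult_assoc)
  let ?X = "(\<lambda>r. r \<odot>\<^bsub>M\<^esub> m) ` carrier R" and ?Y = "a_kernel M (regular R) f"
  have Xs: "submodule ?X R M" using image_submodule[OF rm reg.left_module_axioms M reg.carrier_submodule] by simp
  have Ys: "submodule ?Y R M" by (rule kernel_submodule[OF f M reg.left_module_axioms])
  have frm: "f (r \<odot>\<^bsub>M\<^esub> m) = r" if "r \<in> carrier R" for r using fh(3)[OF that m(1)] m(2) that by simp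
  have int: "?X \<inter> ?Y = {\<zero>\<^bsub>M\<^esub>}"
    using frm m(1) submodD(3)[OF Xs] submodD(3)[OF Ys] by (auto simp: a_kernel_def')
  have sum: "?X <+>\<^bsub>M\<^esub> ?Y = carrier M"
  proof
    show "?X <+>\<^bsub>M\<^esub> ?Y \<subseteq> carrier M" by (rule submodD(1)[OF M.submodule_sum[OF Xs Ys]])
    show "carrier M \<subseteq> ?X <+>\<^bsub>M\<^esub> ?Y"
    proof
      fix y assume y: "y \<in> carrier M"
      let ?z = "f y \<odot>\<^bsub>M\<^esub> m"
      have z: "?z \<in> carrier M" using fh(1)[OF y] m(1) M.smult_closed by simp
      have "f y = f ?z" using frm fh(1)[OF y] by simp
      then have "y \<ominus>\<^bsub>M\<^esub> ?z \<in> ?Y" using kernel_eq_iff[OF f M reg.left_module_axioms y z] by simp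
      moreover have "?z \<in> ?X" using fh(1)[OF y] by blast
      moreover have "y = ?z \<oplus>\<^bsub>M\<^esub> (y \<ominus>\<^bsub>M\<^esub> ?z)" using M.minus_add_cancel[OF y z] M.M.a_comm[OF z M.M.minus_closed[OF y z]] by simp
      ultimately show "y \<in> ?X <+>\<^bsub>M\<^esub> ?Y" unfolding set_add_def' by blast
    qed
  qed
  have "?X \<noteq> {\<zero>\<^bsub>M\<^esub>}"
  proof
    assume e: "?X = {\<zero>\<^bsub>M\<^esub>}"
    have "m \<in> ?X" by (rule image_eqI[of _ _ \<one>]) (simp_all add: M.smult_one m(1))
    then have "m = \<zero>\<^bsub>M\<^esub>" unfolding e by simp
    then have "\<one> = \<zero>" using m(2) mod_hom_zero[OF f M reg.left_module_axioms] by simp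
    then show False using one_notin_J zero_J(1) by simp
  qed
  then have Y0: "?Y = {\<zero>\<^bsub>M\<^esub>}" using ind Xs Ys int sum unfolding indecomposable_def by blast
  have "projective R M"
  proof (rule iso_free_projective[OF M])
    have ev: "(\<lambda>x. x 0) \<in> mod_hom R (free R 1) (regular R)" by (rule mod_homI) (auto simp: coords_i)
    show "(\<lambda>x. x 0 \<odot>\<^bsub>M\<^esub> m) \<in> mod_hom R (free R 1) M" by (rule mod_hom_comp[OF ev rm])
    show "bij_betw (\<lambda>x. x 0 \<odot>\<^bsub>M\<^esub> m) (V 1) (carrier M)"
    proof (rule bij_betwI[where g = "\<lambda>y i. if i = 0 then f y else \<zero>"])
      show "(\<lambda>x. x 0 \<odot>\<^bsub>M\<^esub> m) \<in> V 1 \<rightarrow> carrier M" using m(1) M.smult_closed coords_i by auto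
      show "(\<lambda>y i. if i = 0 then f y else \<zero>) \<in> carrier M \<rightarrow> V 1" using fh(1) by (auto simp: coords_def)
      show "(\<lambda>i. if i = 0 then f (x 0 \<odot>\<^bsub>M\<^esub> m) else \<zero>) = x" if "x \<in> V 1" for x
        using that frm[OF coords_i[OF that]] by (auto simp: coords_def fun_eq_iff)
      show "(if 0 = (0 :: nat) then f y else \<zero>) \<odot>\<^bsub>M\<^esub> m = y" if y: "y \<in> carrier M" for y
      proof -
        have z: "f y \<odot>\<^bsub>M\<^esub> m \<in> carrier M" using fh(1)[OF y] m(1) M.smult_closed by simp
        have "f y = f (f y \<odot>\<^bsub>M\<^esub> m)" using frm fh(1)[OF y] by simp
        then have "y \<ominus>\<^bsub>M\<^esub> (f y \<odot>\<^bsub>M\<^esub> m) = \<zero>\<^bsub>M\<^esub>" using kernel_eq_iff[OF f M reg.left_module_axioms y z] Y0 by simp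
        then show ?thesis using M.minus_eq_zero_iff[OF y z] by simp
      qed
    qed
  qed
  then show False using np by simp
qed

end

section \<open>Injectivity and minimal resolutions\<close>

text \<open>A projective resolution without its augmentation: nothing is required at place
  0.\<close>

definition proj_complex :: "('a, 'x) ring_scheme \<Rightarrow> (nat \<Rightarrow> 'a umod) \<Rightarrow> (nat \<Rightarrow> (nat \<Rightarrow> 'a) \<Rightarrow> nat \<Rightarrow> 'a) \<Rightarrow> bool" where
  "proj_complex A P d \<longleftrightarrow> (\<forall>i. projective A (P i) \<and> d i \<in> mod_hom A (P (Suc i)) (P i) \<and>
     a_kernel (P (Suc i)) (P i) (d i) = d (Suc i) ` carrier (P (Suc (Suc i))))"

text \<open>The condition of \<open>ext_vanishes\<close> in degree \<open>Suc j\<close>, detached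
  from the module that is resolved.\<close>

definition dual_exact :: "('a, 'x) ring_scheme \<Rightarrow> (nat \<Rightarrow> 'a umod) \<Rightarrow> (nat \<Rightarrow> (nat \<Rightarrow> 'a) \<Rightarrow> nat \<Rightarrow> 'a) \<Rightarrow> nat \<Rightarrow> bool" where
  "dual_exact A P d j \<longleftrightarrow> (\<forall>\<phi>\<in>mod_hom A (P (Suc j)) (regular A).
     (\<forall>x\<in>carrier (P (Suc (Suc j))). \<phi> (d (Suc j) x) = \<zero>\<^bsub>A\<^esub>) \<longrightarrow>
     (\<exists>\<psi>\<in>mod_hom A (P j) (regular A). \<forall>x\<in>carrier (P (Suc j)). \<phi> x = \<psi> (d j x)))"

text \<open>In degrees \<open>i\<close> and \<open>i + 1\<close> there are chain maps \<open>f, F\<close> and \<open>g, G\<close> whose composition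
  \<open>G F\<close> is the identity up to a homotopy \<open>s\<close> and an error term that the differential kills.\<close>
definition comparable :: "('a, 'x) ring_scheme \<Rightarrow> (nat \<Rightarrow> 'a umod) \<Rightarrow> (nat \<Rightarrow> (nat \<Rightarrow> 'a) \<Rightarrow> nat \<Rightarrow> 'a) \<Rightarrow>
    (nat \<Rightarrow> 'a umod) \<Rightarrow> (nat \<Rightarrow> (nat \<Rightarrow> 'a) \<Rightarrow> nat \<Rightarrow> 'a) \<Rightarrow> nat \<Rightarrow> bool" where
  "comparable A P d P' d' i \<longleftrightarrow> (\<exists>f g F G s.
     f \<in> mod_hom A (P i) (P' i) \<and> g \<in> mod_hom A (P' i) (P i) \<and>
     F \<in> mod_hom A (P (Suc i)) (P' (Suc i)) \<and> G \<in> mod_hom A (P' (Suc i)) (P (Suc i)) \<and>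
     s \<in> mod_hom A (P i) (P (Suc i)) \<and>
     (\<forall>x\<in>carrier (P (Suc i)). d' i (F x) = f (d i x)) \<and>
     (\<forall>x\<in>carrier (P' (Suc i)). d i (G x) = g (d' i x)) \<and>
     (\<forall>x\<in>carrier (P (Suc i)). d i (G (F x)) = d i (x \<oplus>\<^bsub>P (Suc i)\<^esub> s (d i x))))"

lemma proj_complexD:
  assumes "proj_complex A P d"
  shows "projective A (P i)" "d i \<in> mod_hom A (P (Suc i)) (P i)" "left_module A (P i)"
    "\<And>x. x \<in> carrier (P (Suc i)) \<Longrightarrow> d i x = \<zero>\<^bsub>P i\<^esub> \<longleftrightarrow> x \<in> d (Suc i) ` carrier (P (Suc (Suc i)))"
    "\<And>x. x \<in> carrier (P (Suc (Suc i))) \<Longrightarrow> d i (d (Suc i) x) = \<zero>\<^bsub>P i\<^esub>"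
proof -
  show "projective A (P i)" and d: "d i \<in> mod_hom A (P (Suc i)) (P i)" using assms by (auto simp: proj_complex_def)
  then show "left_module A (P i)" by (simp add: projective_def fl_module_def)
  have k: "a_kernel (P (Suc i)) (P i) (d i) = d (Suc i) ` carrier (P (Suc (Suc i)))"
    using assms by (auto simp: proj_complex_def)
  show "d i x = \<zero>\<^bsub>P i\<^esub> \<longleftrightarrow> x \<in> d (Suc i) ` carrier (P (Suc (Suc i)))" if "x \<in> carrier (P (Suc i))" for x
    using that unfolding k[symmetric] by (simp add: a_kernel_def')
  show "d i (d (Suc i) x) = \<zero>\<^bsub>P i\<^esub>" if "x \<in> carrier (P (Suc (Suc i)))" for x
  proof -
    have "d (Suc i) x \<in> a_kernel (P (Suc i)) (P i) (d i)" unfolding k using that by blast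
    then show ?thesis by (simp add: a_kernel_def')
  qed
qed

section \<open>Comparison of resolutions\<close>

context short_local_ring
begin

text \<open>The usual inductive construction of chain maps and homotopies, by lifting along the
  differentials. By assumption the error \<open>G F - 1 - s d\<close> consists of cycles, and the
  new homotopy lifts it.\<close>

lemma comparable_Suc:
  assumes P: "proj_complex R P d" and P': "proj_complex R P' d'" and c: "comparable R P d P' d' i"
  shows "comparable R P d P' d' (Suc i)"
proof -
  note p = proj_complexD[OF P] and p' = proj_complexD[OF P']
  obtain f g F G s where f: "f \<in> mod_hom R (P i) (P' i)" and g: "g \<in> mod_hom R (P' i) (P i)"
    and F: "F \<in> mod_hom R (P (Suc i)) (P' (Suc i))" and G: "G \<in> mod_hom R (P' (Suc i)) (P (Suc i))"
    and s: "s \<in> mod_hom R (P i) (P (Suc i))"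
    and dF: "\<And>x. x \<in> carrier (P (Suc i)) \<Longrightarrow> d' i (F x) = f (d i x)"
    and dG: "\<And>x. x \<in> carrier (P' (Suc i)) \<Longrightarrow> d i (G x) = g (d' i x)"
    and dGF: "\<And>x. x \<in> carrier (P (Suc i)) \<Longrightarrow> d i (G (F x)) = d i (x \<oplus>\<^bsub>P (Suc i)\<^esub> s (d i x))"
    using c unfolding comparable_def by metis
  note dc = mod_homD(1)[OF p(2)] and dc' = mod_homD(1)[OF p'(2)]
  note Fc = mod_homD(1)[OF F] and Gc = mod_homD(1)[OF G] and sc = mod_homD(1)[OF s]
  interpret Pi: lmod R "P (Suc i)" by (rule lmod.intro) (rule p(3))
  have "(\<lambda>x. F (d (Suc i) x)) ` carrier (P (Suc (Suc i))) \<subseteq> d' (Suc i) ` carrier (P' (Suc (Suc i)))"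
  proof
    fix y assume "y \<in> (\<lambda>x. F (d (Suc i) x)) ` carrier (P (Suc (Suc i)))"
    then obtain x where x: "x \<in> carrier (P (Suc (Suc i)))" "y = F (d (Suc i) x)" by blast
    have "d' i y = \<zero>\<^bsub>P' i\<^esub>" using dF[OF dc[OF x(1)]] p(5)[OF x(1)] mod_hom_zero[OF f p(3) p'(3)] x(2) by simp
    moreover have "y \<in> carrier (P' (Suc i))" using Fc dc x by simp
    ultimately show "y \<in> d' (Suc i) ` carrier (P' (Suc (Suc i)))" using p'(4) by blast
  qed
  then obtain F2 where F2: "F2 \<in> mod_hom R (P (Suc (Suc i))) (P' (Suc (Suc i)))"
    "\<And>x. x \<in> carrier (P (Suc (Suc i))) \<Longrightarrow> d' (Suc i) (F2 x) = F (d (Suc i) x)"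
    using lift_projective[OF p(1) mod_hom_comp[OF p(2) F] p'(2) p'(3) p'(3)] by blast
  have "(\<lambda>x. G (d' (Suc i) x)) ` carrier (P' (Suc (Suc i))) \<subseteq> d (Suc i) ` carrier (P (Suc (Suc i)))"
  proof
    fix y assume "y \<in> (\<lambda>x. G (d' (Suc i) x)) ` carrier (P' (Suc (Suc i)))"
    then obtain x where x: "x \<in> carrier (P' (Suc (Suc i)))" "y = G (d' (Suc i) x)" by blast
    have "d i y = \<zero>\<^bsub>P i\<^esub>" using dG[OF dc'[OF x(1)]] p'(5)[OF x(1)] mod_hom_zero[OF g p'(3) p(3)] x(2) by simp
    moreover have "y \<in> carrier (P (Suc i))" using Gc dc' x by simp
    ultimately show "y \<in> d (Suc i) ` carrier (P (Suc (Suc i)))" using p(4) by blast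
  qed
  then obtain G2 where G2: "G2 \<in> mod_hom R (P' (Suc (Suc i))) (P (Suc (Suc i)))"
    "\<And>x. x \<in> carrier (P' (Suc (Suc i))) \<Longrightarrow> d (Suc i) (G2 x) = G (d' (Suc i) x)"
    using lift_projective[OF p'(1) mod_hom_comp[OF p'(2) G] p(2) p(3) p(3)] by blast
  let ?e = "\<lambda>x. G (F x) \<ominus>\<^bsub>P (Suc i)\<^esub> (x \<oplus>\<^bsub>P (Suc i)\<^esub> s (d i x))"
  have e: "?e \<in> mod_hom R (P (Suc i)) (P (Suc i))"
    by (rule mod_hom_diff[OF mod_hom_comp[OF F G] mod_hom_add[OF mod_hom_id mod_hom_comp[OF p(2) s] p(3)] p(3)])
  have "?e ` carrier (P (Suc i)) \<subseteq> d (Suc i) ` carrier (P (Suc (Suc i)))"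
  proof
    fix y assume "y \<in> ?e ` carrier (P (Suc i))"
    then obtain x where x: "x \<in> carrier (P (Suc i))" "y = ?e x" by blast
    have xs: "x \<oplus>\<^bsub>P (Suc i)\<^esub> s (d i x) \<in> carrier (P (Suc i))" using x(1) sc dc by simp
    have "y \<in> a_kernel (P (Suc i)) (P i) (d i)"
      using kernel_eq_iff[OF p(2) p(3) p(3) Gc[OF Fc[OF x(1)]] xs] dGF[OF x(1)] x(2) by simp
    then show "y \<in> d (Suc i) ` carrier (P (Suc (Suc i)))" using p(4) by (auto simp: a_kernel_def')
  qed
  then obtain s2 where s2: "s2 \<in> mod_hom R (P (Suc i)) (P (Suc (Suc i)))"
    "\<And>x. x \<in> carrier (P (Suc i)) \<Longrightarrow> d (Suc i) (s2 x) = ?e x"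
    using lift_projective[OF p(1) e p(2) p(3) p(3)] by blast
  have "d (Suc i) (G2 (F2 x)) = d (Suc i) (x \<oplus>\<^bsub>P (Suc (Suc i))\<^esub> s2 (d (Suc i) x))"
    if x: "x \<in> carrier (P (Suc (Suc i)))" for x
  proof -
    let ?y = "d (Suc i) x"
    have y: "?y \<in> carrier (P (Suc i))" using dc[OF x] .
    have GFy: "G (F ?y) \<in> carrier (P (Suc i))" using Gc Fc y by simp
    have "d (Suc i) (G2 (F2 x)) = G (F ?y)" using G2(2) F2(2) x mod_homD(1)[OF F2(1) x] by simp
    moreover have "d (Suc i) (x \<oplus>\<^bsub>P (Suc (Suc i))\<^esub> s2 ?y) = ?y \<oplus>\<^bsub>P (Suc i)\<^esub> ?e ?y"
      using mod_homD(2)[OF p(2) x mod_homD(1)[OF s2(1) y]] s2(2)[OF y] by simp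
    moreover have "?e ?y = G (F ?y) \<ominus>\<^bsub>P (Suc i)\<^esub> ?y"
      using p(5)[OF x] mod_hom_zero[OF s p(3) p(3)] y by simp
    moreover have "?y \<oplus>\<^bsub>P (Suc i)\<^esub> (G (F ?y) \<ominus>\<^bsub>P (Suc i)\<^esub> ?y) = G (F ?y)"
      using Pi.minus_add_cancel[OF GFy y] Pi.M.a_comm[OF y Pi.M.minus_closed[OF GFy y]] by simp
    ultimately show ?thesis by simp
  qed
  then show ?thesis unfolding comparable_def using F G F2 G2 s2(1) by blast
qed

text \<open>A cocycle \<open>\<phi>\<close> on \<open>P\<close> is carried over to the cocycle
  \<open>\<phi> G\<close> on \<open>P'\<close>, which factors through \<open>d'\<close> there;
  composing with \<open>f\<close> gives a factorization of \<open>\<phi> G F\<close> through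
  \<open>d\<close>.\<close>

lemma comparable_dual_exact:
  assumes P: "proj_complex R P d" and P': "proj_complex R P' d'" and c: "comparable R P d P' d' 0"
    and ex: "dual_exact R P' d' j"
  shows "dual_exact R P d j"
  unfolding dual_exact_def
proof (intro ballI impI)
  have cj: "comparable R P d P' d' i" for i by (induction i) (auto intro: c comparable_Suc[OF P P'])
  note p = proj_complexD[OF P] and p' = proj_complexD[OF P']
  obtain f g F G s where f: "f \<in> mod_hom R (P j) (P' j)" and g: "g \<in> mod_hom R (P' j) (P j)"
    and F: "F \<in> mod_hom R (P (Suc j)) (P' (Suc j))" and G: "G \<in> mod_hom R (P' (Suc j)) (P (Suc j))"
    and s: "s \<in> mod_hom R (P j) (P (Suc j))"
    and dF: "\<And>x. x \<in> carrier (P (Suc j)) \<Longrightarrow> d' j (F x) = f (d j x)"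
    and dG: "\<And>x. x \<in> carrier (P' (Suc j)) \<Longrightarrow> d j (G x) = g (d' j x)"
    and dGF: "\<And>x. x \<in> carrier (P (Suc j)) \<Longrightarrow> d j (G (F x)) = d j (x \<oplus>\<^bsub>P (Suc j)\<^esub> s (d j x))"
    using cj[of j] unfolding comparable_def by metis
  fix \<phi> assume \<phi>: "\<phi> \<in> mod_hom R (P (Suc j)) (regular R)"
    and z: "\<forall>x\<in>carrier (P (Suc (Suc j))). \<phi> (d (Suc j) x) = \<zero>"
  interpret Pj: lmod R "P (Suc j)" by (rule lmod.intro) (rule p(3))
  \<comment> \<open>By exactness a cocycle depends on \<open>d j x\<close> only. Hence the error
    terms that the differential kills do no harm.\<close>
  have k: "\<phi> x = \<phi> y" if "x \<in> carrier (P (Suc j))" "y \<in> carrier (P (Suc j))" "d j x = d j y" for x y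
  proof -
    have xy: "x \<ominus>\<^bsub>P (Suc j)\<^esub> y \<in> carrier (P (Suc j))" using that by simp
    have "x \<ominus>\<^bsub>P (Suc j)\<^esub> y \<in> a_kernel (P (Suc j)) (P j) (d j)" using kernel_eq_iff[OF p(2) p(3) p(3) that(1,2)] that(3) by simp
    then have "x \<ominus>\<^bsub>P (Suc j)\<^esub> y \<in> d (Suc j) ` carrier (P (Suc (Suc j)))" using p(4)[OF xy] by (simp add: a_kernel_def')
    then have "x \<ominus>\<^bsub>P (Suc j)\<^esub> y \<in> a_kernel (P (Suc j)) (regular R) \<phi>" using z xy by (auto simp: a_kernel_def')
    then show ?thesis using kernel_eq_iff[OF \<phi> p(3) reg.left_module_axioms that(1,2)] by simp
  qed
  have \<phi>G: "(\<lambda>x. \<phi> (G x)) \<in> mod_hom R (P' (Suc j)) (regular R)" by (rule mod_hom_comp[OF G \<phi>])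
  have "\<phi> (G (d' (Suc j) x)) = \<zero>" if x: "x \<in> carrier (P' (Suc (Suc j)))" for x
  proof -
    have x': "d' (Suc j) x \<in> carrier (P' (Suc j))" using mod_homD(1)[OF p'(2) x] .
    have "d j (G (d' (Suc j) x)) = \<zero>\<^bsub>P j\<^esub>" using dG[OF x'] p'(5)[OF x] mod_hom_zero[OF g p'(3) p(3)] by simp
    then have "\<phi> (G (d' (Suc j) x)) = \<phi> \<zero>\<^bsub>P (Suc j)\<^esub>"
      by (intro k) (use mod_homD(1)[OF G x'] mod_hom_zero[OF p(2) p(3) p(3)] Pj.M.zero_closed in auto)
    then show ?thesis using mod_hom_zero[OF \<phi> p(3) reg.left_module_axioms] by simp
  qed
  then obtain \<psi> where \<psi>: "\<psi> \<in> mod_hom R (P' j) (regular R)" "\<And>x. x \<in> carrier (P' (Suc j)) \<Longrightarrow> \<phi> (G x) = \<psi> (d' j x)"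
    using ex \<phi>G unfolding dual_exact_def by metis
  \<comment> \<open>The homotopy term turns the factorization of \<open>\<phi> G F\<close> into one
    of \<open>\<phi>\<close>.\<close>
  let ?\<psi> = "\<lambda>y. \<psi> (f y) \<ominus>\<^bsub>regular R\<^esub> \<phi> (s y)"
  have "?\<psi> \<in> mod_hom R (P j) (regular R)"
    by (rule mod_hom_diff[OF mod_hom_comp[OF f \<psi>(1)] mod_hom_comp[OF s \<phi>] reg.left_module_axioms])
  moreover have "\<phi> x = ?\<psi> (d j x)" if x: "x \<in> carrier (P (Suc j))" for x
  proof -
    have dx: "d j x \<in> carrier (P j)" using mod_homD(1)[OF p(2) x] .
    have sx: "s (d j x) \<in> carrier (P (Suc j))" using mod_homD(1)[OF s dx] .
    have c: "\<phi> x \<in> carrier R" "\<phi> (s (d j x)) \<in> carrier R" using mod_homD(1)[OF \<phi>] x sx by auto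
    have "\<psi> (f (d j x)) = \<phi> (G (F x))" using \<psi>(2)[OF mod_homD(1)[OF F x]] dF[OF x] by simp
    also have "\<dots> = \<phi> (x \<oplus>\<^bsub>P (Suc j)\<^esub> s (d j x))"
      by (rule k) (use dGF[OF x] x sx mod_homD(1)[OF G mod_homD(1)[OF F x]] in auto)
    also have "\<dots> = \<phi> x \<oplus> \<phi> (s (d j x))" using mod_homD(2)[OF \<phi> x sx] by simp
    finally have "\<psi> (f (d j x)) \<ominus> \<phi> (s (d j x)) = \<phi> x" using c by (simp add: minus_eq a_assoc r_neg)
    then show ?thesis by simp
  qed
  ultimately show "\<exists>\<psi>\<in>mod_hom R (P j) (regular R). \<forall>x\<in>carrier (P (Suc j)). \<phi> x = \<psi> (d j x)"
    by (intro bexI[of _ ?\<psi>] ballI)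
qed

section \<open>Minimal resolutions whose duals are exact\<close>

lemma next_syzygy:
  assumes X: "left_module R X" and D: "D \<in> mod_hom R (free R m) X"
  obtains m' E where "E \<in> mod_hom R (free R m') (free R m)" "E ` V m' = a_kernel (free R m) X D"
    "a_kernel (free R m') (free R m) E \<subseteq> coords R J m'"
proof -
  let ?K = "a_kernel (free R m) X D"
  have K: "submodule ?K R (free R m)" by (rule kernel_submodule[OF D fr.left_module_axioms X])
  have lm: "left_module R (sub (free R m) ?K)" by (rule fr.sub_left_module[OF K])
  have "mod_length R (sub (free R m) ?K) \<le> enat (m * (1 + e + a))"
    using mod_length_mono[OF fr.left_module_axioms K fr.carrier_submodule submodD(1)[OF K]] len_coords(3)[of m] fr.sub_carrier[of m] by simp
  then have fin: "mod_length R (sub (free R m) ?K) \<noteq> \<infinity>" by (metis infinity_ileE)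
  obtain m' E where E: "E \<in> mod_hom R (free R m') (sub (free R m) ?K)" "E ` V m' = carrier (sub (free R m) ?K)"
    "a_kernel (free R m') (sub (free R m) ?K) E \<subseteq> coords R J m'"
    by (rule min_generators[OF lm fin])
  have "E \<in> mod_hom R (free R m') (free R m)" by (rule mod_hom_sub_incl[OF E(1) submodD(1)[OF K]])
  moreover have "a_kernel (free R m') (free R m) E \<subseteq> coords R J m'" using E(3) by (simp add: a_kernel_def')
  ultimately show ?thesis using that E(2) by simp
qed

text \<open>Dependent choice, where a state consists of two ranks and the differential between them.
  The first differential is prescribed, so that the resolution of \<open>Tr M\<close> can start with
  the transpose of a presentation of \<open>M\<close>.\<close>

lemma min_resolution:
  assumes D0: "D0 \<in> mod_hom R (free R n1) (free R n0)" and k0: "a_kernel (free R n1) (free R n0) D0 \<subseteq> coords R J n1"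
  shows "\<exists>n D. n 0 = n0 \<and> n (Suc 0) = n1 \<and> D 0 = D0 \<and>
    (\<forall>i. D i \<in> mod_hom R (free R (n (Suc i))) (free R (n i)) \<and>
      a_kernel (free R (n (Suc i))) (free R (n i)) (D i) = D (Suc i) ` V (n (Suc (Suc i))) \<and>
      a_kernel (free R (n (Suc i))) (free R (n i)) (D i) \<subseteq> coords R J (n (Suc i)))"
proof -
  let ?P = "\<lambda>(i :: nat) s. case s of (k, m, D) \<Rightarrow> D \<in> mod_hom R (free R m) (free R k) \<and>
    a_kernel (free R m) (free R k) D \<subseteq> coords R J m \<and> (i = 0 \<longrightarrow> k = n0 \<and> m = n1 \<and> D = D0)"
  let ?Q = "\<lambda>(i :: nat) s s'. case s of (k, m, D) \<Rightarrow> case s' of (k', m', D') \<Rightarrow> k' = m \<and> D' ` V m' = a_kernel (free R m) (free R k) D"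
  have "\<exists>f. \<forall>i. ?P i (f i) \<and> ?Q i (f i) (f (Suc i))"
  proof (rule dependent_nat_choice)
    show "\<exists>x. ?P 0 x" using D0 k0 by (intro exI[of _ "(n0, n1, D0)"]) simp
    fix s i assume "?P i s"
    then obtain k m D where s: "s = (k, m, D)" "D \<in> mod_hom R (free R m) (free R k)" by (cases s) auto
    obtain m' E where "E \<in> mod_hom R (free R m') (free R m)" "E ` V m' = a_kernel (free R m) (free R k) D"
      "a_kernel (free R m') (free R m) E \<subseteq> coords R J m'" by (rule next_syzygy[OF fr.left_module_axioms s(2)])
    then show "\<exists>y. ?P (Suc i) y \<and> ?Q i s y" using s(1) by (intro exI[of _ "(m, m', E)"]) simp
  qed
  then obtain f where f0: "\<forall>i. ?P i (f i) \<and> ?Q i (f i) (f (Suc i))" by (rule exE)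
  have f: "?P i (f i)" "?Q i (f i) (f (Suc i))" for i using spec[OF f0, of i] by (rule conjunct1, rule conjunct2)
  define n D where "n i = fst (f i)" and "D i = snd (snd (f i))" for i
  have fi: "f i = (n i, n (Suc i), D i)" for i
    using f(2)[of i] by (simp add: n_def D_def split: prod.splits)
  show ?thesis
  proof (intro exI[of _ n] exI[of _ D] conjI allI)
    show "n 0 = n0" "n (Suc 0) = n1" "D 0 = D0" using f(1)[of 0] unfolding fi by auto
    fix i
    show "D i \<in> mod_hom R (free R (n (Suc i))) (free R (n i))"
      "a_kernel (free R (n (Suc i))) (free R (n i)) (D i) \<subseteq> coords R J (n (Suc i))"
      using f(1)[of i] unfolding fi by auto
    show "a_kernel (free R (n (Suc i))) (free R (n i)) (D i) = D (Suc i) ` V (n (Suc (Suc i)))"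
      using f(2)[of i] unfolding fi by auto
  qed
qed

text \<open>Columns are functionals, so dual exactness in all degrees is exactness for columns. The
  hypothesis \<open>cmp\<close> may offer a different complex for each degree \<open>j\<close>;
  comparability at place 0 is enough to transport exactness of the dual to the one minimal
  resolution.\<close>

lemma resolution_to_complex:
  assumes D0: "D0 \<in> mod_hom R (free R n1) (free R n0)" and k0: "a_kernel (free R n1) (free R n0) D0 \<subseteq> coords R J n1"
    and r0: "\<And>x. x \<in> V n1 \<Longrightarrow> D0 x \<in> coords R J n0"
    and cmp: "\<And>P d j. \<lbrakk>proj_complex R P d; P 0 = free R n0; P (Suc 0) = free R n1; d 0 = D0\<rbrakk> \<Longrightarrow>
      \<exists>P' d'. proj_complex R P' d' \<and> comparable R P d P' d' 0 \<and> dual_exact R P' d' j"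
  obtains n D where "min_complex R J e a n D" "n 0 = n0" "n (Suc 0) = n1" "D 0 = D0"
proof -
  obtain n D where nD: "n 0 = n0" "n (Suc 0) = n1" "D 0 = D0"
    and all: "\<forall>i. D i \<in> mod_hom R (free R (n (Suc i))) (free R (n i)) \<and>
      a_kernel (free R (n (Suc i))) (free R (n i)) (D i) = D (Suc i) ` V (n (Suc (Suc i))) \<and>
      a_kernel (free R (n (Suc i))) (free R (n i)) (D i) \<subseteq> coords R J (n (Suc i))"
    using min_resolution[OF D0 k0] by blast
  have hom: "D i \<in> mod_hom R (free R (n (Suc i))) (free R (n i))"
    and ker: "a_kernel (free R (n (Suc i))) (free R (n i)) (D i) = D (Suc i) ` V (n (Suc (Suc i)))"
    and kJ: "a_kernel (free R (n (Suc i))) (free R (n i)) (D i) \<subseteq> coords R J (n (Suc i))" for i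
    using spec[OF all, of i] by blast+
  have pc: "proj_complex R (\<lambda>i. free R (n i)) D"
    unfolding proj_complex_def by (simp add: free_projective hom ker)
  have DE: "dual_exact R (\<lambda>i. free R (n i)) D j" for j
  proof -
    have "\<exists>P' d'. proj_complex R P' d' \<and> comparable R (\<lambda>i. free R (n i)) D P' d' 0 \<and> dual_exact R P' d' j"
      by (rule cmp[OF pc]) (simp_all add: nD)
    then obtain P' d' where "proj_complex R P' d'" "comparable R (\<lambda>i. free R (n i)) D P' d' 0" "dual_exact R P' d' j"
      by blast
    then show ?thesis using comparable_dual_exact[OF pc] by blast
  qed
  have "min_complex R J e a n D"
  proof (intro min_complex.intro min_complex_axioms.intro)
    show "short_local_ring R J e a" by (rule short_local_ring_axioms)
    fix i
    show "D i \<in> mod_hom R (free R (n (Suc i))) (free R (n i))" by (rule hom)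
    show "D i x \<in> coords R J (n i)" if x: "x \<in> V (n (Suc i))" for x
    proof (cases i)
      case 0
      then show ?thesis using r0 nD x by simp
    next
      case (Suc j)
      then show ?thesis using ker[of j] kJ[of j] x by auto
    qed
    show "a_kernel (free R (n (Suc i))) (free R (n i)) (D i) = D (Suc i) ` V (n (Suc (Suc i)))" by (rule ker)
    let ?T = "\<lambda>i. tr R (n i) (n (Suc i)) (D i)"
    show "a_kernel (free (opp R) (n (Suc i))) (free (opp R) (n (Suc (Suc i)))) (?T (Suc i)) = ?T i ` V (n i)"
    proof (intro equalityI subsetI)
      fix b assume "b \<in> a_kernel (free (opp R) (n (Suc i))) (free (opp R) (n (Suc (Suc i)))) (?T (Suc i))"
      then have b: "b \<in> V (n (Suc i))" "?T (Suc i) b = zv" by (auto simp: a_kernel_def')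
      have "dot R (n (Suc i)) (D (Suc i) x) b = \<zero>" if x: "x \<in> V (n (Suc (Suc i)))" for x
        using tr_adj[OF hom b(1) x] b(2) dot_zero[of "n (Suc (Suc i))" x zv] coords_i[OF x] by simp
      then obtain \<psi> where \<psi>: "\<psi> \<in> mod_hom R (free R (n i)) (regular R)"
        "\<And>x. x \<in> V (n (Suc i)) \<Longrightarrow> dot R (n (Suc i)) x b = \<psi> (D i x)"
        using DE[of i] dot_hom[OF b(1)] unfolding dual_exact_def by fastforce
      let ?c = "covec R (n i) \<psi>"
      have c: "?c \<in> V (n i)" by (rule covec_closed[OF \<psi>(1)])
      have "b = ?T i ?c"
      proof (rule dot_nondeg[OF b(1) tr_closed[OF hom c]])
        fix x assume x: "x \<in> V (n (Suc i))"
        have "D i x \<in> V (n i)" using mod_homD(1)[OF hom] x by simp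
        then show "dot R (n (Suc i)) x b = dot R (n (Suc i)) x (?T i ?c)"
          using \<psi>(2)[OF x] functional_eq[OF \<psi>(1)] tr_adj[OF hom c x] by simp
      qed
      then show "b \<in> ?T i ` V (n i)" using c by blast
    next
      fix b assume "b \<in> ?T i ` V (n i)"
      then obtain c where c: "c \<in> V (n i)" "b = ?T i c" by blast
      have bV: "b \<in> V (n (Suc i))" using tr_closed[OF hom c(1)] c(2) by simp
      have "?T (Suc i) b = zv"
      proof (rule dot_nondeg[OF tr_closed[OF hom bV] zv_coords(3)])
        fix x assume x: "x \<in> V (n (Suc (Suc i)))"
        have Dx: "D (Suc i) x \<in> V (n (Suc i))" using mod_homD(1)[OF hom] x by simp
        have "D (Suc i) x \<in> a_kernel (free R (n (Suc i))) (free R (n i)) (D i)" unfolding ker using x by blast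
        then have z: "D i (D (Suc i) x) = zv" by (simp add: a_kernel_def')
        have "dot R (n (Suc (Suc i))) x (?T (Suc i) b) = dot R (n i) (D i (D (Suc i) x)) c"
          using tr_adj[OF hom bV x] tr_adj[OF hom c(1) Dx] c(2) by simp
        also have "\<dots> = \<zero>" unfolding z by (rule dot_zero) (use coords_i[OF c(1)] in simp)
        also have "\<dots> = dot R (n (Suc (Suc i))) x zv" by (rule dot_zero[symmetric]) (use coords_i[OF x] in simp)
        finally show "dot R (n (Suc (Suc i))) x (?T (Suc i) b) = dot R (n (Suc (Suc i))) x zv" .
      qed
      then show "b \<in> a_kernel (free (opp R) (n (Suc i))) (free (opp R) (n (Suc (Suc i)))) (?T (Suc i))"
        using bV by (simp add: a_kernel_def')
    qed
  qed
  then show ?thesis using that nD by blast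
qed

text \<open>The resolution supplied by \<open>ext_vanishes\<close> and the minimal one are compared
  by lifting the identity of \<open>M\<close> in both directions; at place 0 the two lifts compose
  to the identity up to a map into the kernel of \<open>q\<close>, which the homotopy
  \<open>s\<close> lifts.\<close>

theorem semi_Gorenstein_complex:
  assumes M: "left_module R M" and q: "q \<in> mod_hom R (free R n0) M" "q ` V n0 = carrier M"
    and D0: "D0 \<in> mod_hom R (free R n1) (free R n0)" and k0: "a_kernel (free R n1) (free R n0) D0 \<subseteq> coords R J n1"
    and r0: "\<And>x. x \<in> V n1 \<Longrightarrow> D0 x \<in> coords R J n0" and kq: "a_kernel (free R n0) M q = D0 ` V n1"
    and ext: "\<And>j. ext_vanishes R j M (regular R)"
  obtains n D where "min_complex R J e a n D" "n 0 = n0" "n (Suc 0) = n1" "D 0 = D0"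
proof (rule resolution_to_complex[OF D0 k0 r0])
  fix P :: "nat \<Rightarrow> 'a umod" and d j
  assume P: "proj_complex R P d" and P0: "P 0 = free R n0" "P (Suc 0) = free R n1" "d 0 = D0"
  obtain P' :: "nat \<Rightarrow> 'a umod" and d' p where res: "proj_resolution R P' d' p M" and de: "dual_exact R P' d' j"
    using ext[of j] unfolding ext_vanishes_def dual_exact_def regular_simps by blast
  have P': "proj_complex R P' d'" using res by (auto simp: proj_resolution_def proj_complex_def)
  have p: "p \<in> mod_hom R (P' 0) M" "p ` carrier (P' 0) = carrier M" "d' 0 ` carrier (P' 1) = a_kernel (P' 0) M p"
    using res by (auto simp: proj_resolution_def)
  note c = proj_complexD[OF P'] and c0 = proj_complexD[OF P]
  obtain f where f: "f \<in> mod_hom R (free R n0) (P' 0)" "\<And>x. x \<in> V n0 \<Longrightarrow> p (f x) = q x"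
    using lift_free[OF q(1) p(1) c(3) M] q(2) p(2) by auto
  obtain g where g: "g \<in> mod_hom R (P' 0) (free R n0)" "\<And>x. x \<in> carrier (P' 0) \<Longrightarrow> q (g x) = p x"
    using lift_projective[OF c(1) p(1) q(1) fr.left_module_axioms M] q(2) p(2) by auto
  note D0c = mod_homD(1)[OF D0, simplified]
  have qD: "q (D0 x) = \<zero>\<^bsub>M\<^esub>" if x: "x \<in> V n1" for x
  proof -
    have "D0 x \<in> a_kernel (free R n0) M q" unfolding kq using x by blast
    then show ?thesis by (simp add: a_kernel_def')
  qed
  have pd: "p (d' 0 x) = \<zero>\<^bsub>M\<^esub>" if x: "x \<in> carrier (P' 1)" for x
  proof -
    have "d' 0 x \<in> a_kernel (P' 0) M p" unfolding p(3)[symmetric] using x by blast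
    then show ?thesis by (simp add: a_kernel_def')
  qed
  have "(\<lambda>x. f (D0 x)) ` V n1 \<subseteq> d' 0 ` carrier (P' (Suc 0))"
  proof
    fix y assume "y \<in> (\<lambda>x. f (D0 x)) ` V n1"
    then obtain x where x: "x \<in> V n1" "y = f (D0 x)" by blast
    have "y \<in> a_kernel (P' 0) M p" using f(2)[OF D0c[OF x(1)]] qD[OF x(1)] mod_homD(1)[OF f(1)] D0c[OF x(1)] x(2) by (simp add: a_kernel_def')
    then show "y \<in> d' 0 ` carrier (P' (Suc 0))" using p(3) by simp
  qed
  then obtain F where F: "F \<in> mod_hom R (free R n1) (P' (Suc 0))" "\<And>x. x \<in> V n1 \<Longrightarrow> d' 0 (F x) = f (D0 x)"
    using lift_free[OF mod_hom_comp[OF D0 f(1)] c(2) c(3) c(3)] by blast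
  have "(\<lambda>x. g (d' 0 x)) ` carrier (P' (Suc 0)) \<subseteq> D0 ` carrier (free R n1)"
  proof
    fix y assume "y \<in> (\<lambda>x. g (d' 0 x)) ` carrier (P' (Suc 0))"
    then obtain x where x: "x \<in> carrier (P' (Suc 0))" "y = g (d' 0 x)" by blast
    have dx: "d' 0 x \<in> carrier (P' 0)" using mod_homD(1)[OF c(2) x(1)] .
    have "y \<in> a_kernel (free R n0) M q" using g(2)[OF dx] pd x mod_homD(1)[OF g(1) dx] by (simp add: a_kernel_def')
    then show "y \<in> D0 ` carrier (free R n1)" using kq by simp
  qed
  then obtain G where G: "G \<in> mod_hom R (P' (Suc 0)) (free R n1)" "\<And>x. x \<in> carrier (P' (Suc 0)) \<Longrightarrow> D0 (G x) = g (d' 0 x)"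
    using lift_projective[OF c(1) mod_hom_comp[OF c(2) g(1)] D0 fr.left_module_axioms fr.left_module_axioms] by blast
  let ?e = "\<lambda>x. g (f x) \<ominus>\<^bsub>free R n0\<^esub> x"
  have e: "?e \<in> mod_hom R (free R n0) (free R n0)"
    by (rule mod_hom_diff[OF mod_hom_comp[OF f(1) g(1)] mod_hom_id fr.left_module_axioms])
  have fc: "f x \<in> carrier (P' 0)" and gfc: "g (f x) \<in> carrier (free R n0)" if "x \<in> V n0" for x
    using mod_homD(1)[OF f(1)] mod_homD(1)[OF g(1)] that by auto
  have "?e ` V n0 \<subseteq> D0 ` carrier (free R n1)"
  proof
    fix y assume "y \<in> ?e ` V n0"
    then obtain x where x: "x \<in> V n0" "y = ?e x" by blast
    have "y \<in> a_kernel (free R n0) M q"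
      using kernel_eq_iff[OF q(1) fr.left_module_axioms M gfc[OF x(1)], of x] g(2)[OF fc[OF x(1)]] f(2) x by simp
    then show "y \<in> D0 ` carrier (free R n1)" using kq by simp
  qed
  then obtain s where s: "s \<in> mod_hom R (free R n0) (free R n1)" "\<And>x. x \<in> V n0 \<Longrightarrow> D0 (s x) = ?e x"
    using lift_free[OF e D0 fr.left_module_axioms fr.left_module_axioms] by blast
  have "D0 (G (F x)) = D0 (x \<oplus>\<^bsub>free R n1\<^esub> s (D0 x))" if x: "x \<in> V n1" for x
  proof -
    have y: "D0 x \<in> V n0" using D0c[OF x] .
    have sx: "s (D0 x) \<in> carrier (free R n1)" using mod_homD(1)[OF s(1)] y by simp
    have "D0 (G (F x)) = g (f (D0 x))" using G(2) F(2)[OF x] mod_homD(1)[OF F(1)] x by simp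
    moreover have "D0 (x \<oplus>\<^bsub>free R n1\<^esub> s (D0 x)) = D0 x \<oplus>\<^bsub>free R n0\<^esub> ?e (D0 x)"
      using mod_homD(2)[OF D0 _ sx, of x] x s(2)[OF y] by simp
    moreover have "D0 x \<oplus>\<^bsub>free R n0\<^esub> ?e (D0 x) = g (f (D0 x))"
    proof -
      have y': "D0 x \<in> carrier (free R n0)" using y by simp
      show ?thesis using fr.minus_add_cancel[OF gfc[OF y] y'] fr.M.a_comm[OF y' fr.M.minus_closed[OF gfc[OF y] y']] by metis
    qed
    ultimately show ?thesis by simp
  qed
  then have "comparable R P d P' d' 0"
    unfolding comparable_def P0 using f(1) g(1) F G s(1) by (intro exI[of _ f] exI[of _ g] exI[of _ F] exI[of _ G] exI[of _ s]) simp
  then show "\<exists>P' d'. proj_complex R P' d' \<and> comparable R P d P' d' 0 \<and> dual_exact R P' d' j" using P' de by blast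
next
  fix n D assume "min_complex R J e a n D" "n 0 = n0" "n (Suc 0) = n1" "D 0 = D0"
  then show thesis by (rule that)
qed

text \<open>Baer's criterion: it suffices to extend maps from \<open>J\<close> to \<open>A\<close>, since each proper submodule
  \<open>N\<close> of \<open>Y\<close> misses some \<open>y\<close> with \<open>J y \<subseteq> N\<close>.\<close>
theorem self_injective_of_ext1:
  assumes ext1: "ext1_top_vanishes R J"
  shows "self_injective R"
  unfolding self_injective_def injective_def
proof (intro conjI allI impI)
  show "fl_module R (regular R)" by (simp add: fl_module_def reg.left_module_axioms len_R)
  fix X Y :: "'a umod" and g f
  assume h: "fl_module R X \<and> fl_module R Y \<and> g \<in> mod_hom R X Y \<and> inj_on g (carrier X) \<and> f \<in> mod_hom R X (regular R)"
  then have X: "left_module R X" and Y: "left_module R Y" and g: "g \<in> mod_hom R X Y" "inj_on g (carrier X)"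
    and f: "f \<in> mod_hom R X (regular R)" and finY: "mod_length R Y < \<infinity>" by (auto simp: fl_module_def)
  interpret X: lmod R X by (rule lmod.intro) fact
  interpret Y: lmod R Y by (rule lmod.intro) fact
  obtain l where l: "mod_length R Y = enat l" using finY by (cases "mod_length R Y") auto
  define good where "good N h \<longleftrightarrow> submodule N R Y \<and> g ` carrier X \<subseteq> N \<and> h \<in> mod_hom R (sub Y N) (regular R) \<and>
    (\<forall>x\<in>carrier X. h (g x) = f x)" for N h
  have fin: "\<exists>k\<le>l. mod_length R (sub Y N) = enat k" if "good N h" for N h
  proof -
    have N: "submodule N R Y" using that by (simp add: good_def)
    have "mod_length R (sub Y N) \<le> enat l"
      using mod_length_mono[OF Y N Y.carrier_submodule submodD(1)[OF N]] l by simp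
    then show ?thesis by (cases "mod_length R (sub Y N)") auto
  qed
  have i0: "submodule (g ` carrier X) R Y" by (rule image_submodule[OF g(1) X Y X.carrier_submodule])
  have ker0: "a_kernel X Y g = {\<zero>\<^bsub>X\<^esub>}" using inj_on_kernel[OF g(1) X Y] g(2) by simp
  have gs: "g \<in> mod_hom R X (sub Y (g ` carrier X))" by (rule mod_hom_sub_cod[OF g(1)]) auto
  have gk: "f x = \<zero>\<^bsub>regular R\<^esub>" if "x \<in> carrier X" "g x = \<zero>\<^bsub>sub Y (g ` carrier X)\<^esub>" for x
  proof -
    have "x \<in> a_kernel X Y g" using that by (simp add: a_kernel_def')
    then have "x = \<zero>\<^bsub>X\<^esub>" unfolding ker0 by simp
    then show ?thesis using mod_hom_zero[OF f X reg.left_module_axioms] by simp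
  qed
  obtain h0 where h0: "h0 \<in> mod_hom R (sub Y (g ` carrier X)) (regular R)" "\<And>x. x \<in> carrier X \<Longrightarrow> h0 (g x) = f x"
    using mod_hom_factor[OF gs _ f X Y.sub_left_module[OF i0] reg.left_module_axioms gk] by auto
  have g0: "good (g ` carrier X) h0" using i0 h0 by (simp add: good_def)
  \<comment> \<open>The lengths of submodules of \<open>Y\<close> are bounded, so among the partial
    extensions there is one whose domain has the greatest length.\<close>
  let ?Q = "\<lambda>k. \<exists>N h. good N h \<and> mod_length R (sub Y N) = enat k"
  obtain k0 where k0: "?Q k0" using fin[OF g0] g0 by blast
  have "\<forall>k. ?Q k \<longrightarrow> k \<le> l" using fin by fastforce
  from Nat.ex_has_greatest_nat[where P = ?Q, OF k0 this]
  obtain k N h where gd: "good N h" and Nk: "mod_length R (sub Y N) = enat k" and mx: "\<And>j. ?Q j \<Longrightarrow> j \<le> k" by blast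
  have N: "submodule N R Y" and gN: "g ` carrier X \<subseteq> N" and hh: "h \<in> mod_hom R (sub Y N) (regular R)"
    and hg: "\<And>x. x \<in> carrier X \<Longrightarrow> h (g x) = f x" using gd by (auto simp: good_def)
  note d = submodD[OF N]
  note lmN = Y.sub_left_module[OF N]
  note h_hom = mod_homD[OF hh, simplified]
  have "N = carrier Y"
  proof (rule ccontr)
    assume "N \<noteq> carrier Y"
    then obtain y0 where y0: "y0 \<in> carrier Y" "y0 \<notin> N" using d(1) by blast
    \<comment> \<open>Otherwise three successive factors from \<open>J\<close> would lead from
      \<open>y0\<close> to an element outside \<open>N\<close>, which is zero by
      \<open>J^3 = 0\<close>.\<close>
    have "\<exists>y\<in>carrier Y. y \<notin> N \<and> (\<forall>r\<in>J. r \<odot>\<^bsub>Y\<^esub> y \<in> N)"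
    proof (rule ccontr)
      assume no: "\<not> ?thesis"
      then obtain r0 where r0: "r0 \<in> J" "r0 \<odot>\<^bsub>Y\<^esub> y0 \<notin> N" using y0 by blast
      have y1: "r0 \<odot>\<^bsub>Y\<^esub> y0 \<in> carrier Y" using y0 r0 J_carrier Y.smult_closed by simp
      then obtain r1 where r1: "r1 \<in> J" "r1 \<odot>\<^bsub>Y\<^esub> (r0 \<odot>\<^bsub>Y\<^esub> y0) \<notin> N" using no r0 by blast
      have y2: "r1 \<odot>\<^bsub>Y\<^esub> (r0 \<odot>\<^bsub>Y\<^esub> y0) \<in> carrier Y" using y1 r1 J_carrier Y.smult_closed by simp
      then obtain r2 where r2: "r2 \<in> J" "r2 \<odot>\<^bsub>Y\<^esub> (r1 \<odot>\<^bsub>Y\<^esub> (r0 \<odot>\<^bsub>Y\<^esub> y0)) \<notin> N" using no r1 by blast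
      have "r2 \<odot>\<^bsub>Y\<^esub> (r1 \<odot>\<^bsub>Y\<^esub> (r0 \<odot>\<^bsub>Y\<^esub> y0)) = (r2 \<otimes> r1 \<otimes> r0) \<odot>\<^bsub>Y\<^esub> y0"
        using r0 r1 r2 y0 J_carrier by (simp add: Y.smult_assoc Y.smult_closed)
      then show False using r2(2) J3[OF r2(1) r1(1) r0(1)] y0 d(3) by simp
    qed
    then obtain y where y: "y \<in> carrier Y" "y \<notin> N" "\<And>r. r \<in> J \<Longrightarrow> r \<odot>\<^bsub>Y\<^esub> y \<in> N" by blast
    have ry: "(\<lambda>r. r \<odot>\<^bsub>Y\<^esub> y) \<in> mod_hom R (regular R) Y"
      by (rule mod_homI) (auto simp: y(1) Y.smult_closed Y.smult_l_distr Y.smult_assoc)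
    have "(\<lambda>r. h (r \<odot>\<^bsub>Y\<^esub> y)) \<in> mod_hom R (sub (regular R) J) (regular R)"
      by (rule mod_hom_comp[OF mod_hom_sub[OF ry] hh]) (use y(3) J_carrier in auto)
    \<comment> \<open>On \<open>J y\<close> the map \<open>h\<close> is given by multiplication with
      \<open>b\<close> on the coefficient of \<open>y\<close>; sending \<open>y\<close> to
      \<open>b\<close> will extend \<open>h\<close> to \<open>N + A y\<close>.\<close>
    from bspec[OF ext1[unfolded ext1_top_vanishes_def] this]
    obtain b where b: "b \<in> carrier R" "\<And>r. r \<in> J \<Longrightarrow> h (r \<odot>\<^bsub>Y\<^esub> y) = r \<otimes> b" by blast
    \<comment> \<open>Two decompositions of the same element differ by a multiple of
      \<open>y\<close> that lies in \<open>N\<close>. Its coefficient is in \<open>J\<close>, since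
      a unit would put \<open>y\<close> itself into \<open>N\<close>; there \<open>h\<close> is
      known by the choice of \<open>b\<close>.\<close>
    have wd: "h x \<oplus> r \<otimes> b = h x' \<oplus> r' \<otimes> b"
      if c: "x \<in> N" "x' \<in> N" "r \<in> carrier R" "r' \<in> carrier R" and e: "x \<oplus>\<^bsub>Y\<^esub> r \<odot>\<^bsub>Y\<^esub> y = x' \<oplus>\<^bsub>Y\<^esub> r' \<odot>\<^bsub>Y\<^esub> y" for x x' r r'
    proof -
      have cc: "x \<in> carrier Y" "x' \<in> carrier Y" "r \<odot>\<^bsub>Y\<^esub> y \<in> carrier Y" "r' \<odot>\<^bsub>Y\<^esub> y \<in> carrier Y"
        using c d(2) y(1) Y.smult_closed by auto
      let ?s = "r \<ominus> r'"
      have s: "?s \<in> carrier R" using c by simp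
      have rs: "r = r' \<oplus> ?s" using c reg.minus_add_cancel[of r r'] s by (simp add: a_comm)
      have sy: "?s \<odot>\<^bsub>Y\<^esub> y \<in> carrier Y" using s y(1) Y.smult_closed by simp
      have "r \<odot>\<^bsub>Y\<^esub> y = r' \<odot>\<^bsub>Y\<^esub> y \<oplus>\<^bsub>Y\<^esub> ?s \<odot>\<^bsub>Y\<^esub> y" by (subst rs) (use Y.smult_l_distr c s y(1) in simp)
      then have "r' \<odot>\<^bsub>Y\<^esub> y \<oplus>\<^bsub>Y\<^esub> (x \<oplus>\<^bsub>Y\<^esub> ?s \<odot>\<^bsub>Y\<^esub> y) = r' \<odot>\<^bsub>Y\<^esub> y \<oplus>\<^bsub>Y\<^esub> x'"
        using e cc sy by (simp add: Y.M.a_ac)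
      then have xs: "x \<oplus>\<^bsub>Y\<^esub> ?s \<odot>\<^bsub>Y\<^esub> y = x'" using cc sy by (metis Y.M.r_neg1 Y.M.a_closed)
      then have sx: "?s \<odot>\<^bsub>Y\<^esub> y = \<ominus>\<^bsub>Y\<^esub> x \<oplus>\<^bsub>Y\<^esub> x'" using cc sy by (metis Y.M.r_neg1)
      then have syN: "?s \<odot>\<^bsub>Y\<^esub> y \<in> N" using d(4,6) c by simp
      have sJ: "?s \<in> J"
      proof (rule ccontr)
        assume "?s \<notin> J"
        then obtain w where w: "w \<in> carrier R" "w \<otimes> ?s = \<one>" using unit[OF s] by blast
        have "w \<odot>\<^bsub>Y\<^esub> (?s \<odot>\<^bsub>Y\<^esub> y) = y" using w s y(1) by (simp add: Y.smult_assoc[symmetric] Y.smult_one)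
        then show False using d(5)[OF w(1) syN] y(2) by simp
      qed
      have "h x' = h x \<oplus> ?s \<otimes> b" using h_hom(2)[OF c(1) syN] xs b(2)[OF sJ] by simp
      moreover have "r \<otimes> b = r' \<otimes> b \<oplus> ?s \<otimes> b" by (subst rs) (use l_distr c s b(1) in simp)
      moreover have "h x \<in> carrier R" using h_hom(1) c by simp
      ultimately show ?thesis using b(1) c s by (simp add: a_ac)
    qed
    let ?I = "(\<lambda>r. r \<odot>\<^bsub>Y\<^esub> y) ` carrier R"
    have I: "submodule ?I R Y" using image_submodule[OF ry reg.left_module_axioms Y reg.carrier_submodule] by simp
    let ?N' = "N <+>\<^bsub>Y\<^esub> ?I"
    have N': "submodule ?N' R Y" by (rule Y.submodule_sum[OF N I])
    have up: "N \<subseteq> ?N'" "?I \<subseteq> ?N'" using Y.sum_upper[OF N I] by auto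
    define h' where "h' w = (SOME v. \<exists>x\<in>N. \<exists>r\<in>carrier R. w = x \<oplus>\<^bsub>Y\<^esub> r \<odot>\<^bsub>Y\<^esub> y \<and> v = h x \<oplus> r \<otimes> b)" for w
    have h': "h' (x \<oplus>\<^bsub>Y\<^esub> r \<odot>\<^bsub>Y\<^esub> y) = h x \<oplus> r \<otimes> b" if xr: "x \<in> N" "r \<in> carrier R" for x r
    proof -
      have "\<exists>v. \<exists>x'\<in>N. \<exists>r'\<in>carrier R. x \<oplus>\<^bsub>Y\<^esub> r \<odot>\<^bsub>Y\<^esub> y = x' \<oplus>\<^bsub>Y\<^esub> r' \<odot>\<^bsub>Y\<^esub> y \<and> v = h x' \<oplus> r' \<otimes> b" using xr by blast
      then have "\<exists>x'\<in>N. \<exists>r'\<in>carrier R. x \<oplus>\<^bsub>Y\<^esub> r \<odot>\<^bsub>Y\<^esub> y = x' \<oplus>\<^bsub>Y\<^esub> r' \<odot>\<^bsub>Y\<^esub> y \<and> h' (x \<oplus>\<^bsub>Y\<^esub> r \<odot>\<^bsub>Y\<^esub> y) = h x' \<oplus> r' \<otimes> b"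
        unfolding h'_def by (rule someI_ex)
      then show ?thesis using wd xr by metis
    qed
    have dec: "\<exists>x\<in>N. \<exists>r\<in>carrier R. w = x \<oplus>\<^bsub>Y\<^esub> r \<odot>\<^bsub>Y\<^esub> y" if "w \<in> ?N'" for w
      using that unfolding set_add_def' by blast
    have hN: "h' x = h x" if "x \<in> N" for x
      using h'[OF that zero_closed] that d(2)[OF that] y(1) b(1) h_hom(1)[OF that] by simp
    have "good ?N' h'"
      unfolding good_def
    proof (intro conjI ballI)
      show "submodule ?N' R Y" by (rule N')
      show "g ` carrier X \<subseteq> ?N'" using gN up by blast
      show "h' (g x) = f x" if "x \<in> carrier X" for x using hN hg gN that by auto
      show "h' \<in> mod_hom R (sub Y ?N') (regular R)"
      proof (rule mod_homI)
        fix w assume "w \<in> carrier (sub Y ?N')"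
        then obtain x r where w: "x \<in> N" "r \<in> carrier R" "w = x \<oplus>\<^bsub>Y\<^esub> r \<odot>\<^bsub>Y\<^esub> y" using dec[of w] unfolding sub_simps by blast
        show "h' w \<in> carrier (regular R)" using h'[OF w(1,2)] w h_hom(1) b(1) by simp
        fix w' assume "w' \<in> carrier (sub Y ?N')"
        then obtain x' r' where w': "x' \<in> N" "r' \<in> carrier R" "w' = x' \<oplus>\<^bsub>Y\<^esub> r' \<odot>\<^bsub>Y\<^esub> y" using dec[of w'] unfolding sub_simps by blast
        have cc: "x \<in> carrier Y" "x' \<in> carrier Y" "r \<odot>\<^bsub>Y\<^esub> y \<in> carrier Y" "r' \<odot>\<^bsub>Y\<^esub> y \<in> carrier Y"
          using w w' d(2) y(1) Y.smult_closed by auto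
        have "w \<oplus>\<^bsub>Y\<^esub> w' = (x \<oplus>\<^bsub>Y\<^esub> x') \<oplus>\<^bsub>Y\<^esub> (r \<oplus> r') \<odot>\<^bsub>Y\<^esub> y"
          using w w' cc y(1) by (simp add: Y.smult_l_distr Y.M.a_ac)
        then have "h' (w \<oplus>\<^bsub>Y\<^esub> w') = h (x \<oplus>\<^bsub>Y\<^esub> x') \<oplus> (r \<oplus> r') \<otimes> b" using h'[OF d(4)[OF w(1) w'(1)], of "r \<oplus> r'"] w w' by simp
        also have "\<dots> = (h x \<oplus> r \<otimes> b) \<oplus> (h x' \<oplus> r' \<otimes> b)"
          using w w' h_hom(1,2) b(1) by (simp add: l_distr a_ac)
        finally show "h' (w \<oplus>\<^bsub>sub Y ?N'\<^esub> w') = h' w \<oplus>\<^bsub>regular R\<^esub> h' w'" using h' w w' by simp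
      next
        fix s w assume s: "s \<in> carrier R" and "w \<in> carrier (sub Y ?N')"
        then obtain x r where w: "x \<in> N" "r \<in> carrier R" "w = x \<oplus>\<^bsub>Y\<^esub> r \<odot>\<^bsub>Y\<^esub> y" using dec[of w] unfolding sub_simps by blast
        have cc: "x \<in> carrier Y" "r \<odot>\<^bsub>Y\<^esub> y \<in> carrier Y" using w d(2) y(1) Y.smult_closed by auto
        have "s \<odot>\<^bsub>Y\<^esub> w = s \<odot>\<^bsub>Y\<^esub> x \<oplus>\<^bsub>Y\<^esub> (s \<otimes> r) \<odot>\<^bsub>Y\<^esub> y"
          using w s cc y(1) by (simp add: Y.smult_r_distr Y.smult_assoc)
        then have "h' (s \<odot>\<^bsub>Y\<^esub> w) = h (s \<odot>\<^bsub>Y\<^esub> x) \<oplus> (s \<otimes> r) \<otimes> b" using h'[OF d(5)[OF s w(1)], of "s \<otimes> r"] w s by simp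
        also have "\<dots> = s \<otimes> (h x \<oplus> r \<otimes> b)"
          using w s h_hom(1,3) b(1) by (simp add: r_distr m_assoc)
        finally show "h' (s \<odot>\<^bsub>sub Y ?N'\<^esub> w) = s \<odot>\<^bsub>regular R\<^esub> h' w" using h' w by simp
      qed
    qed
    moreover from fin[OF this] obtain k' where k': "mod_length R (sub Y ?N') = enat k'" by blast
    ultimately have "k' \<le> k" using mx by blast
    have "y \<in> ?I" by (rule image_eqI[of _ _ \<one>]) (simp_all add: Y.smult_one y(1))
    then have "N \<subset> ?N'" using up y(2) by blast
    from mod_length_strict[OF Y N N' this Nk] show False using k' \<open>k' \<le> k\<close> by simp
  qed
  then show "\<exists>h\<in>mod_hom R Y (regular R). \<forall>x\<in>carrier X. h (g x) = f x" using hh hg by auto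
qed

end

section \<open>Duals and complexes that extend to the left\<close>

lemma dual_simps [simp]:
  "carrier (dual A M) = mod_hom A M (regular A) \<inter> extensional (carrier M)"
  "zero (dual A M) = (\<lambda>m\<in>carrier M. \<zero>\<^bsub>A\<^esub>)"
  "add (dual A M) f g = (\<lambda>m\<in>carrier M. f m \<oplus>\<^bsub>A\<^esub> g m)"
  "smult (dual A M) r f = (\<lambda>m\<in>carrier M. f m \<otimes>\<^bsub>A\<^esub> r)"
  by (simp_all add: dual_def)

lemma restrict_mod_hom:
  assumes "left_module A M" shows "restrict f (carrier M) \<in> mod_hom A M N \<longleftrightarrow> f \<in> mod_hom A M N"
proof -
  interpret M: lmod A M by (rule lmod.intro) fact
  show ?thesis using mod_hom_cong[OF _ assms, of f N "restrict f (carrier M)"] mod_hom_cong[OF _ assms, of "restrict f (carrier M)" N f]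
    by auto
qed

context short_local_ring
begin

text \<open>A simple left ideal contains a nonzero element annihilated by \<open>J\<close>, because
  \<open>J^3 = 0\<close>, and so is annihilated as a whole. Conversely, \<open>J\<close> annihilates
  \<open>J^2\<close>, so each nonzero element of \<open>J^2\<close> generates a simple left
  ideal.\<close>

lemma soc_regular:
  assumes s: "\<And>x. \<lbrakk>x \<in> carrier R; \<And>r. r \<in> J \<Longrightarrow> r \<otimes> x = \<zero>\<rbrakk> \<Longrightarrow> x \<in> J2"
  shows "soc R (regular R) = J2"
proof
  show "soc R (regular R) \<subseteq> J2"
    unfolding soc_def
  proof (rule span_least[OF J2_sub], rule Union_least)
    fix S assume "S \<in> {S. simple_submodule S R (regular R)}"
    then have S: "submodule S R (regular R)" and nz: "S \<noteq> {\<zero>}"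
      and mn: "\<And>N. \<lbrakk>submodule N R (regular R); N \<subseteq> S\<rbrakk> \<Longrightarrow> N = {\<zero>} \<or> N = S"
      by (auto simp: simple_submodule_def)
    note d = submodD[OF S, simplified]
    let ?L = "{x \<in> S. \<forall>r\<in>J. r \<otimes> x = \<zero>}"
    have L: "submodule ?L R (regular R)"
      by (rule reg.submodI) (auto simp: d r_distr J_carrier m_assoc[symmetric] J_mult)
    have "\<exists>x\<in>?L. x \<noteq> \<zero>"
    proof (rule ccontr)
      assume no: "\<not> ?thesis"
      obtain x where x: "x \<in> S" "x \<noteq> \<zero>" using nz d(3) by blast
      then obtain r where r: "r \<in> J" "r \<otimes> x \<noteq> \<zero>" using no by blast
      have "r \<otimes> x \<in> S" using d(5) r(1) x(1) J_carrier by simp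
      then obtain r' where r': "r' \<in> J" "r' \<otimes> (r \<otimes> x) \<noteq> \<zero>" using no r(2) by blast
      have "r' \<otimes> (r \<otimes> x) \<in> S" using d(5) r'(1) \<open>r \<otimes> x \<in> S\<close> J_carrier by simp
      then obtain r'' where r'': "r'' \<in> J" "r'' \<otimes> (r' \<otimes> (r \<otimes> x)) \<noteq> \<zero>" using no r'(2) by blast
      have "r'' \<otimes> (r' \<otimes> (r \<otimes> x)) = (r'' \<otimes> r' \<otimes> r) \<otimes> x"
        using r r' r'' x d(2) J_carrier by (simp add: m_assoc)
      then show False using r''(2) J3[OF r''(1) r'(1) r(1)] x d(2) by simp
    qed
    then have "?L = S" using mn[OF L] by blast
    then show "S \<subseteq> J2" using s d(2) by blast
  qed
  show "J2 \<subseteq> soc R (regular R)"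
  proof
    fix x assume x: "x \<in> J2"
    have xR: "x \<in> carrier R" using x J2_J J_carrier by blast
    have soc: "submodule (soc R (regular R)) R (regular R)"
      unfolding soc_def
    proof (rule reg.span_submodule, rule Union_least)
      fix S assume "S \<in> {S. simple_submodule S R (regular R)}"
      then have "submodule S R (regular R)" by (simp add: simple_submodule_def)
      then show "S \<subseteq> carrier (regular R)" by (rule submodD(1))
    qed
    show "x \<in> soc R (regular R)"
    proof (cases "x = \<zero>")
      case True
      then show ?thesis using submodD(3)[OF soc] by simp
    next
      case False
      let ?S = "(\<lambda>r. r \<otimes> x) ` carrier R"
      have h: "(\<lambda>r. r \<otimes> x) \<in> mod_hom R (regular R) (regular R)"
        by (rule mod_homI) (auto simp: xR l_distr m_assoc)
      have S: "submodule ?S R (regular R)"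
        using image_submodule[OF h reg.left_module_axioms reg.left_module_axioms reg.carrier_submodule] by simp
      have xS: "x \<in> ?S" using xR by (intro image_eqI[of _ _ \<one>]) auto
      have "N = {\<zero>} \<or> N = ?S" if N: "submodule N R (regular R)" "N \<subseteq> ?S" for N
      proof (cases "N = {\<zero>}")
        case False
        note dn = submodD[OF N(1), simplified]
        obtain y where y: "y \<in> N" "y \<noteq> \<zero>" using dn(3) False by blast
        obtain r where r: "r \<in> carrier R" "y = r \<otimes> x" using N(2) y(1) by blast
        have "r \<notin> J" using y(2) r(2) J_mult_J2[OF x] by blast
        then obtain w where w: "w \<in> carrier R" "w \<otimes> r = \<one>" using unit[OF r(1)] by blast
        have "w \<otimes> y = x" using w r xR by (simp add: m_assoc[symmetric])
        then have "x \<in> N" using dn(5)[OF w(1) y(1)] by simp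
        then have "?S \<subseteq> N" using dn(5) by auto
        then show ?thesis using N(2) by blast
      qed simp
      moreover have "?S \<noteq> {\<zero>}"
      proof
        assume "?S = {\<zero>}"
        then show False using xS \<open>x \<noteq> \<zero>\<close> by simp
      qed
      ultimately have "simple_submodule ?S R (regular R)" using S by (auto simp: simple_submodule_def)
      then show ?thesis using xS span_upper unfolding soc_def by fastforce
    qed
  qed
qed

lemma min_presentation:
  assumes M: "left_module R M" and fin: "mod_length R M \<noteq> \<infinity>"
  obtains n0 q n1 D0 where "q \<in> mod_hom R (free R n0) M" "q ` V n0 = carrier M"
    "D0 \<in> mod_hom R (free R n1) (free R n0)" "a_kernel (free R n0) M q = D0 ` V n1"
    "\<And>x. x \<in> V n1 \<Longrightarrow> D0 x \<in> coords R J n0" "a_kernel (free R n1) (free R n0) D0 \<subseteq> coords R J n1"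
proof -
  obtain n0 q where q: "q \<in> mod_hom R (free R n0) M" "q ` V n0 = carrier M" "a_kernel (free R n0) M q \<subseteq> coords R J n0"
    by (rule min_generators[OF M fin])
  obtain n1 D0 where D0: "D0 \<in> mod_hom R (free R n1) (free R n0)" "D0 ` V n1 = a_kernel (free R n0) M q"
    "a_kernel (free R n1) (free R n0) D0 \<subseteq> coords R J n1" by (rule next_syzygy[OF M q(1)])
  have r: "D0 x \<in> coords R J n0" if "x \<in> V n1" for x using D0(2) q(3) that by blast
  show ?thesis by (rule that[OF q(1,2) D0(1) D0(2)[symmetric] r D0(3)])
qed

lemma projective_of_trivial_relations:
  assumes M: "left_module R M" and q: "q \<in> mod_hom R (free R n0) M" "q ` V n0 = carrier M"
    and D0: "D0 \<in> mod_hom R (free R n1) (free R n0)" and k: "a_kernel (free R n0) M q = D0 ` V n1" and n1: "n1 = 0"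
  shows "projective R M"
proof (rule iso_free_projective[OF M q(1)])
  have "V n1 = {\<zero>\<^bsub>free R n1\<^esub>}" using n1 by (auto simp: coords_def fun_eq_iff)
  then have "a_kernel (free R n0) M q = {\<zero>\<^bsub>free R n0\<^esub>}"
    using k mod_hom_zero[OF D0 fr.left_module_axioms fr.left_module_axioms] by simp
  then show "bij_betw q (V n0) (carrier M)"
    using inj_on_kernel[OF q(1) fr.left_module_axioms M] q(2) by (simp add: bij_betw_def)
qed

lemma tr_zero_iff:
  assumes D: "D \<in> mod_hom R (free R m) (free R n)" and b: "b \<in> V n"
  shows "tr R n m D b = zv \<longleftrightarrow> (\<forall>x\<in>V m. dot R n (D x) b = \<zero>)"
proof
  assume z: "tr R n m D b = zv"
  show "\<forall>x\<in>V m. dot R n (D x) b = \<zero>"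
    using tr_adj[OF D b] z dot_zero[of m _ zv] coords_i by simp
next
  assume h: "\<forall>x\<in>V m. dot R n (D x) b = \<zero>"
  show "tr R n m D b = zv"
    by (rule dot_nondeg[OF tr_closed[OF D b] zv_coords(3)]) (use h tr_adj[OF D b] dot_zero[of m _ zv] coords_i in simp)
qed

text \<open>Functionals on \<open>M\<close> correspond to the columns that annihilate all relations,
  that is, to the kernel of the transposed relation matrix.\<close>

lemma functional_iff_relation:
  assumes M: "left_module R M" and q: "q \<in> mod_hom R (free R n0) M" "q ` V n0 = carrier M"
    and D0: "D0 \<in> mod_hom R (free R n1) (free R n0)" and k: "a_kernel (free R n0) M q = D0 ` V n1"
  shows "\<lbrakk>b \<in> V n0; tr R n0 n1 D0 b = zv\<rbrakk> \<Longrightarrow> \<exists>f\<in>mod_hom R M (regular R). \<forall>x\<in>V n0. f (q x) = dot R n0 x b"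
    "f \<in> mod_hom R M (regular R) \<Longrightarrow> \<exists>b\<in>V n0. tr R n0 n1 D0 b = zv \<and> (\<forall>x\<in>V n0. f (q x) = dot R n0 x b)"
proof -
  assume b: "b \<in> V n0" "tr R n0 n1 D0 b = zv"
  have "dot R n0 x b = \<zero>\<^bsub>regular R\<^esub>" if x: "x \<in> carrier (free R n0)" "q x = \<zero>\<^bsub>M\<^esub>" for x
  proof -
    have "x \<in> a_kernel (free R n0) M q" using x by (simp add: a_kernel_def')
    then show ?thesis unfolding k using b tr_zero_iff[OF D0 b(1)] by auto
  qed
  note z = this
  have qs: "q ` carrier (free R n0) = carrier M" using q(2) by simp
  show "\<exists>f\<in>mod_hom R M (regular R). \<forall>x\<in>V n0. f (q x) = dot R n0 x b"
  proof (rule mod_hom_factor[OF q(1) qs dot_hom[OF b(1)] fr.left_module_axioms M reg.left_module_axioms z])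
    fix g assume "g \<in> mod_hom R M (regular R)" "\<And>x. x \<in> carrier (free R n0) \<Longrightarrow> g (q x) = dot R n0 x b"
    then show ?thesis by (intro bexI[of _ g]) auto
  qed
next
  assume f: "f \<in> mod_hom R M (regular R)"
  have fq: "(\<lambda>x. f (q x)) \<in> mod_hom R (free R n0) (regular R)" by (rule mod_hom_comp[OF q(1) f])
  let ?b = "covec R n0 (\<lambda>x. f (q x))"
  have b: "?b \<in> V n0" by (rule covec_closed[OF fq])
  have fb: "\<And>x. x \<in> V n0 \<Longrightarrow> f (q x) = dot R n0 x ?b" by (rule functional_eq[OF fq])
  have "dot R n0 (D0 x) ?b = \<zero>" if x: "x \<in> V n1" for x
  proof -
    have "D0 x \<in> a_kernel (free R n0) M q" unfolding k using x by blast
    then have "D0 x \<in> V n0" "q (D0 x) = \<zero>\<^bsub>M\<^esub>" by (auto simp: a_kernel_def')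
    then show ?thesis using fb mod_hom_zero[OF f M reg.left_module_axioms] by fastforce
  qed
  then show "\<exists>b\<in>V n0. tr R n0 n1 D0 b = zv \<and> (\<forall>x\<in>V n0. f (q x) = dot R n0 x b)"
    using b fb tr_zero_iff[OF D0 b] by blast
qed

text \<open>As a right module, \<open>M^*\<close> is the kernel of the transposed relation matrix.
  Any \<open>E\<close> with this kernel as its image presents it, and the relations are then the
  kernel of \<open>E\<close>. The formula for \<open>p c\<close> on \<open>q x\<close> makes the
  identification usable for biduals.\<close>

lemma dual_presentation:
  assumes M: "left_module R M" and q: "q \<in> mod_hom R (free R n0) M" "q ` V n0 = carrier M"
    and D0: "D0 \<in> mod_hom R (free R n1) (free R n0)" and k: "a_kernel (free R n0) M q = D0 ` V n1"
    and E: "E \<in> mod_hom (opp R) (free (opp R) m) (free (opp R) n0)"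
      "E ` V m = a_kernel (free (opp R) n0) (free (opp R) n1) (tr R n0 n1 D0)"
  obtains p where "p \<in> mod_hom (opp R) (free (opp R) m) (dual R M)" "p ` V m = carrier (dual R M)"
    "left_module (opp R) (dual R M)" "\<And>c x. \<lbrakk>c \<in> V m; x \<in> V n0\<rbrakk> \<Longrightarrow> p c (q x) = dot R n0 x (E c)"
    "a_kernel (free (opp R) m) (dual R M) p = a_kernel (free (opp R) m) (free (opp R) n0) E"
proof -
  interpret op: short_local_ring "opp R" J e a by (rule opp_short)
  interpret M: lmod R M by (rule lmod.intro) fact
  note qc = mod_homD(1)[OF q(1), simplified] and Eh = mod_homD[OF E(1), simplified]
  have Mq: "\<exists>x\<in>V n0. y = q x" if "y \<in> carrier M" for y using that unfolding q(2)[symmetric] by blast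
  have "\<exists>f. f \<in> mod_hom R M (regular R) \<and> (\<forall>x\<in>V n0. f (q x) = dot R n0 x (E c))" if c: "c \<in> V m" for c
  proof -
    have "E c \<in> a_kernel (free (opp R) n0) (free (opp R) n1) (tr R n0 n1 D0)" unfolding E(2)[symmetric] using c by blast
    then have "E c \<in> V n0" "tr R n0 n1 D0 (E c) = zv" by (auto simp: a_kernel_def')
    then show ?thesis using functional_iff_relation(1)[OF M q D0 k] by blast
  qed
  then obtain F where F: "\<And>c. c \<in> V m \<Longrightarrow> F c \<in> mod_hom R M (regular R)"
    "\<And>c x. \<lbrakk>c \<in> V m; x \<in> V n0\<rbrakk> \<Longrightarrow> F c (q x) = dot R n0 x (E c)" by metis
  define p where "p c = restrict (F c) (carrier M)" for c
  have pq: "p c (q x) = dot R n0 x (E c)" if "c \<in> V m" "x \<in> V n0" for c x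
    using F(2)[OF that] qc[OF that(2)] by (simp add: p_def)
  have pc: "p c \<in> carrier (dual R M)" if "c \<in> V m" for c
    using F(1)[OF that] by (simp add: p_def restrict_mod_hom[OF M])
  have eqI: "f = g" if "f \<in> extensional (carrier M)" "g \<in> extensional (carrier M)" "\<And>x. x \<in> V n0 \<Longrightarrow> f (q x) = g (q x)" for f g :: "'b \<Rightarrow> 'a"
    by (rule extensionalityI[OF that(1,2)]) (use Mq that(3) in blast)
  have ph: "p \<in> mod_hom (opp R) (free (opp R) m) (dual R M)"
  proof (rule mod_homI)
    show "p c \<in> carrier (dual R M)" if "c \<in> carrier (free (opp R) m)" for c using pc that by simp
    show "p (c \<oplus>\<^bsub>free (opp R) m\<^esub> d) = p c \<oplus>\<^bsub>dual R M\<^esub> p d"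
      if "c \<in> carrier (free (opp R) m)" "d \<in> carrier (free (opp R) m)" for c d
    proof (rule eqI)
      fix x assume x: "x \<in> V n0"
      have cd: "c \<in> V m" "d \<in> V m" using that by auto
      have s: "(\<lambda>i. c i \<oplus> d i) \<in> V m" using cd by (auto simp: coords_def)
      have "E (\<lambda>i. c i \<oplus> d i) = (\<lambda>i. E c i \<oplus> E d i)" using Eh(2)[OF cd] by simp
      then show "p (c \<oplus>\<^bsub>free (opp R) m\<^esub> d) (q x) = (p c \<oplus>\<^bsub>dual R M\<^esub> p d) (q x)"
        using pq[OF s x] pq[OF cd(1) x] pq[OF cd(2) x] qc[OF x] dot_add_right[OF x Eh(1)[OF cd(1)] Eh(1)[OF cd(2)]] by simp
    qed (auto simp: p_def)
    show "p (r \<odot>\<^bsub>free (opp R) m\<^esub> c) = r \<odot>\<^bsub>dual R M\<^esub> p c" if "r \<in> carrier (opp R)" "c \<in> carrier (free (opp R) m)" for r c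
    proof (rule eqI)
      fix x assume x: "x \<in> V n0"
      have rc: "c \<in> V m" "r \<in> carrier R" using that by auto
      have s: "(\<lambda>i. c i \<otimes> r) \<in> V m" using rc by (auto simp: coords_def)
      have "E (\<lambda>i. c i \<otimes> r) = (\<lambda>i. E c i \<otimes> r)" using Eh(3)[OF rc(2,1)] by simp
      then show "p (r \<odot>\<^bsub>free (opp R) m\<^esub> c) (q x) = (r \<odot>\<^bsub>dual R M\<^esub> p c) (q x)"
        using pq[OF s x] pq[OF rc(1) x] qc[OF x] dot_smult_right[OF x Eh(1)[OF rc(1)] rc(2)] by simp
    qed (auto simp: p_def)
  qed
  have ps: "p ` V m = carrier (dual R M)"
  proof (intro equalityI subsetI)
    fix f assume f: "f \<in> carrier (dual R M)"
    then obtain b where b: "b \<in> V n0" "tr R n0 n1 D0 b = zv" "\<forall>x\<in>V n0. f (q x) = dot R n0 x b"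
      using functional_iff_relation(2)[OF M q D0 k, of f] by auto
    then have "b \<in> E ` V m" unfolding E(2) by (simp add: a_kernel_def')
    then obtain c where c: "c \<in> V m" "b = E c" by blast
    have "f = p c" by (rule eqI) (use f b c pq in \<open>auto simp: p_def\<close>)
    then show "f \<in> p ` V m" using c by blast
  qed (use pc in blast)
  have z: "p zv = \<zero>\<^bsub>dual R M\<^esub>"
  proof (rule eqI)
    fix x assume x: "x \<in> V n0"
    have "E zv = zv" using mod_hom_zero[OF E(1) op.fr.left_module_axioms op.fr.left_module_axioms] by simp
    then show "p zv (q x) = \<zero>\<^bsub>dual R M\<^esub> (q x)" using pq[OF zv_coords(3) x] dot_zero[of n0 x zv] coords_i[OF x] qc[OF x] by simp
  qed (auto simp: p_def)
  have lm: "left_module (opp R) (dual R M)"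
    by (rule surj_left_module[OF op.fr.left_module_axioms ph]) (use ps z in simp_all)
  have "p c = \<zero>\<^bsub>dual R M\<^esub> \<longleftrightarrow> E c = zv" if c: "c \<in> V m" for c
  proof
    assume "p c = \<zero>\<^bsub>dual R M\<^esub>"
    then have "dot R n0 x (E c) = \<zero>" if "x \<in> V n0" for x using pq[OF c that] qc[OF that] by simp
    then show "E c = zv"
      by (intro dot_nondeg[OF Eh(1)[OF c] zv_coords(3)]) (use dot_zero[of n0 _ zv] coords_i in simp)
  next
    assume Ec: "E c = zv"
    show "p c = \<zero>\<^bsub>dual R M\<^esub>"
      by (rule eqI) (use pq[OF c] Ec dot_zero[of n0 _ zv] coords_i qc in \<open>auto simp: p_def\<close>)
  qed
  then have "a_kernel (free (opp R) m) (dual R M) p = a_kernel (free (opp R) m) (free (opp R) n0) E"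
    by (auto simp: a_kernel_def')
  then show ?thesis using that[OF ph ps lm pq] by blast
qed

text \<open>The new differential is the transpose of a set of generators of the module of
  relations between the columns of \<open>D 0\<close>.\<close>
lemma extend_left:
  assumes C: "min_complex R J e a n D"
    and kJ: "\<And>b. \<lbrakk>b \<in> V (n 0); tr R (n 0) (n (Suc 0)) (D 0) b = zv\<rbrakk> \<Longrightarrow> b \<in> coords R J (n 0)"
    and sep: "\<And>x. \<lbrakk>x \<in> V (n 0); \<And>b. \<lbrakk>b \<in> V (n 0); tr R (n 0) (n (Suc 0)) (D 0) b = zv\<rbrakk> \<Longrightarrow> dot R (n 0) x b = \<zero>\<rbrakk>
      \<Longrightarrow> x \<in> D 0 ` V (n (Suc 0))"
  obtains n' D' where "min_complex R J e a n' D'" "\<And>i. n' (Suc i) = n i" "\<And>i. D' (Suc i) = D i"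
    "\<And>b. \<lbrakk>b \<in> V (n' 0); tr R (n' 0) (n' (Suc 0)) (D' 0) b = zv\<rbrakk> \<Longrightarrow> b \<in> coords R J (n' 0)"
proof -
  interpret op: short_local_ring "opp R" J e a by (rule opp_short)
  interpret C: min_complex R J e a n D by fact
  let ?T = "tr R (n 0) (n (Suc 0)) (D 0)"
  obtain m E where E: "E \<in> mod_hom (opp R) (free (opp R) m) (free (opp R) (n 0))"
    "E ` V m = a_kernel (free (opp R) (n 0)) (free (opp R) (n (Suc 0))) ?T"
    "a_kernel (free (opp R) m) (free (opp R) (n 0)) E \<subseteq> coords R J m"
    using op.next_syzygy[OF op.fr.left_module_axioms C.T_hom[of 0]] by (metis coords_opp opp_simps(1))
  have ET: "E c \<in> V (n 0)" "?T (E c) = zv" if "c \<in> V m" for c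
  proof -
    have "E c \<in> a_kernel (free (opp R) (n 0)) (free (opp R) (n (Suc 0))) ?T" unfolding E(2)[symmetric] using that by blast
    then show "E c \<in> V (n 0)" "?T (E c) = zv" by (auto simp: a_kernel_def')
  qed
  define D0 where "D0 = tr (opp R) (n 0) m E"
  have D0: "D0 \<in> mod_hom R (free R (n 0)) (free R m)" unfolding D0_def using op.tr_hom[OF E(1)] by simp
  have trD0: "tr R m (n 0) D0 c = E c" if "c \<in> V m" for c
    unfolding D0_def using op.tr_tr[OF E(1), of c] that by simp
  have adj0: "dot R m (D0 x) c = dot R (n 0) x (E c)" if "x \<in> V (n 0)" "c \<in> V m" for x c
    using tr_adj[OF D0 that(2,1)] trD0[OF that(2)] by simp
  have D0c: "D0 x \<in> V m" if "x \<in> V (n 0)" for x using mod_homD(1)[OF D0] that by simp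
  define n' D' where "n' = case_nat m n" and "D' = case_nat D0 D"
  have s [simp]: "n' 0 = m" "n' (Suc i) = n i" "D' 0 = D0" "D' (Suc i) = D i" for i
    by (simp_all add: n'_def D'_def)
  have "min_complex R J e a n' D'"
  proof (intro min_complex.intro min_complex_axioms.intro)
    show "short_local_ring R J e a" by (rule short_local_ring_axioms)
    fix i
    show "D' i \<in> mod_hom R (free R (n' (Suc i))) (free R (n' i))" using D0 C.hom by (cases i) auto
    show "D' i x \<in> coords R J (n' i)" if x: "x \<in> V (n' (Suc i))" for x
    proof (cases i)
      case 0
      have "E c \<in> coords R J (n 0)" if "c \<in> V m" for c using kJ ET that by blast
      then show ?thesis using op.tr_rad[OF E(1), of x] x 0 by (simp add: D0_def)
    qed (use x C.rad in auto)
    show "a_kernel (free R (n' (Suc i))) (free R (n' i)) (D' i) = D' (Suc i) ` V (n' (Suc (Suc i)))"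
    proof (cases i)
      case 0
      \<comment> \<open>\<open>D0\<close> kills exactly the rows that pair to zero with every
        relation between the columns. By \<open>sep\<close> this double annihilator of the
        boundaries is not larger than the boundaries.\<close>
      have "D0 x = zv \<longleftrightarrow> x \<in> D 0 ` V (n (Suc 0))" if x: "x \<in> V (n 0)" for x
      proof
        assume z: "D0 x = zv"
        show "x \<in> D 0 ` V (n (Suc 0))"
        proof (rule sep[OF x])
          fix b assume "b \<in> V (n 0)" "?T b = zv"
          then have "b \<in> E ` V m" unfolding E(2) by (simp add: a_kernel_def')
          then obtain c where c: "c \<in> V m" "b = E c" by blast
          then show "dot R (n 0) x b = \<zero>" using adj0[OF x c(1)] z dot_zero[of m zv c] coords_i[OF c(1)] by simp
        qed
      next
        assume "x \<in> D 0 ` V (n (Suc 0))"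
        then obtain y where y: "y \<in> V (n (Suc 0))" "x = D 0 y" by blast
        show "D0 x = zv"
        proof (rule dot_nondeg_left[OF D0c[OF x] zv_coords(3)])
          fix c assume c: "c \<in> V m"
          have "dot R m (D0 x) c = dot R (n (Suc 0)) y (?T (E c))" using adj0[OF x c] C.adj[OF y(1) ET(1)[OF c]] y(2) by simp
          then show "dot R m (D0 x) c = dot R m zv c"
            using ET(2)[OF c] dot_zero[of "n (Suc 0)" y zv] dot_zero[of m zv c] coords_i[OF c] coords_i[OF y(1)] by simp
        qed
      qed
      then show ?thesis using C.D_V[of _ 0] 0 by (auto simp: a_kernel_def')
    qed (use C.rows in auto)
    show "a_kernel (free (opp R) (n' (Suc i))) (free (opp R) (n' (Suc (Suc i)))) (tr R (n' (Suc i)) (n' (Suc (Suc i))) (D' (Suc i)))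
      = tr R (n' i) (n' (Suc i)) (D' i) ` V (n' i)"
    proof (cases i)
      case 0
      then show ?thesis using E(2) trD0 by (simp cong: image_cong)
    qed (use C.cols in auto)
  qed
  moreover have "b \<in> coords R J (n' 0)" if "b \<in> V (n' 0)" "tr R (n' 0) (n' (Suc 0)) (D' 0) b = zv" for b
    using that trD0 E(3) by (auto simp: a_kernel_def')
  ultimately show ?thesis using that by (metis s(2) s(4))
qed

section \<open>Dimension vectors of syzygies, cosyzygies and duals\<close>

context
  fixes n D
  assumes core: "core_complex R J e a n D"
begin

interpretation C: core_complex R J e a n D by (rule core)
interpretation op: short_local_ring "opp R" J e a by (rule opp_short)

text \<open>The length of \<open>J F\<close> minus that of the relations, where \<open>F\<close> has
  rank \<open>n (Suc i)\<close>.\<close>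

lemma arith_dim: "n (Suc i) * (e + a) - Suc a * n (Suc 0) = a * n (Suc 0)"
  using C.n_const[of i] C.e_eq by (simp add: algebra_simps)

lemma dim_vec_D:
  assumes X: "left_module R X" and q: "q \<in> mod_hom R (free R (n (Suc i))) X" "q ` V (n (Suc i)) = carrier X"
    "a_kernel (free R (n (Suc i))) X q = D (Suc i) ` V (n (Suc (Suc i)))"
  shows "has_dim_vec R J X (n (Suc 0)) (a * n (Suc 0))"
proof -
  have "D (Suc i) ` V (n (Suc (Suc i))) \<subseteq> coords R J (n (Suc i))" using C.rad by blast
  from dim_vec_presentation[OF X q(1,2), unfolded q(3), OF this C.J2_D_image C.len_D_image]
  show ?thesis using arith_dim[of i] C.n_const[of i] by simp
qed

lemma dim_vec_T:
  assumes X: "left_module (opp R) X" and q: "q \<in> mod_hom (opp R) (free (opp R) (n (Suc i))) X" "q ` V (n (Suc i)) = carrier X"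
    "a_kernel (free (opp R) (n (Suc i))) X q = C.T i ` V (n i)"
  shows "has_dim_vec (opp R) J X (n (Suc 0)) (a * n (Suc 0))"
proof -
  have "C.T i ` V (n i) \<subseteq> coords R J (n (Suc i))" using C.T_rad by blast
  from op.dim_vec_presentation[OF X q(1), unfolded q(3) J2_opp coords_opp opp_simps, OF q(2) this C.J2_T_image C.len_T_image]
  show ?thesis using arith_dim[of i] C.n_const[of i] by simp
qed

text \<open>The invariant is that \<open>Y\<close> is presented with the image of \<open>D i\<close>
  as relations; taking the syzygy moves it to the next differential. As \<open>is_Omega\<close>
  fixes \<open>X\<close> up to isomorphism only, the invariant is a presentation and not an equality
  of modules.\<close>

lemma Omega_step:
  assumes Y: "left_module R Y" and q: "q \<in> mod_hom R (free R (n i)) Y" "q ` V (n i) = carrier Y"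
    "a_kernel (free R (n i)) Y q = D i ` V (n (Suc i))" and X: "is_Omega R Y X"
  obtains q' where "left_module R X" "q' \<in> mod_hom R (free R (n (Suc i))) X" "q' ` V (n (Suc i)) = carrier X"
    "a_kernel (free R (n (Suc i))) X q' = D (Suc i) ` V (n (Suc (Suc i)))"
proof -
  have kJ: "a_kernel (free R (n i)) Y q \<subseteq> coords R J (n i)" unfolding q(3) using C.rad by auto
  obtain f where f: "f \<in> mod_hom R (sub (free R (n i)) (a_kernel (free R (n i)) Y q)) X" "left_module R X"
    "bij_betw f (a_kernel (free R (n i)) Y q) (carrier X)"
    by (rule Omega_unique[OF Y q(1,2) kJ X])
  have K: "submodule (a_kernel (free R (n i)) Y q) R (free R (n i))"
    by (rule kernel_submodule[OF q(1) fr.left_module_axioms Y])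
  have Dk: "D i \<in> mod_hom R (free R (n (Suc i))) (sub (free R (n i)) (a_kernel (free R (n i)) Y q))"
    unfolding q(3) by (rule mod_hom_sub_cod[OF C.hom]) auto
  have h: "(\<lambda>x. f (D i x)) \<in> mod_hom R (free R (n (Suc i))) X" by (rule mod_hom_comp[OF Dk f(1)])
  have s: "(\<lambda>x. f (D i x)) ` V (n (Suc i)) = carrier X"
    using f(3) unfolding q(3) by (simp add: bij_betw_def image_image)
  have "f (D i x) = \<zero>\<^bsub>X\<^esub> \<longleftrightarrow> D i x = zv" if x: "x \<in> V (n (Suc i))" for x
  proof -
    have "D i x \<in> a_kernel (free R (n i)) Y q" "zv \<in> a_kernel (free R (n i)) Y q"
      using q(3) x submodD(3)[OF K] by auto
    moreover have "f zv = \<zero>\<^bsub>X\<^esub>" using mod_hom_zero[OF f(1) fr.sub_left_module[OF K] f(2)] by simp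
    ultimately show ?thesis using f(3) by (metis bij_betw_def inj_onD)
  qed
  then have "a_kernel (free R (n (Suc i))) X (\<lambda>x. f (D i x)) = a_kernel (free R (n (Suc i))) (free R (n i)) (D i)"
    by (auto simp: a_kernel_def')
  then show ?thesis using that[OF f(2) h s] C.rows by simp
qed

text \<open>The counterpart along the transposed complex. Exactness of the rows says that
  functionals on \<open>Y\<close> extend along \<open>C.T (Suc i)\<close>, and minimality holds
  because cycles of rows have entries in \<open>J\<close>.\<close>

lemma mho_step:
  assumes Y: "left_module (opp R) Y" and q: "q \<in> mod_hom (opp R) (free (opp R) (n (Suc i))) Y" "q ` V (n (Suc i)) = carrier Y"
    "a_kernel (free (opp R) (n (Suc i))) Y q = C.T i ` V (n i)" and X: "is_mho (opp R) Y X"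
  obtains q' where "left_module (opp R) X" "q' \<in> mod_hom (opp R) (free (opp R) (n (Suc (Suc i)))) X"
    "q' ` V (n (Suc (Suc i))) = carrier X"
    "a_kernel (free (opp R) (n (Suc (Suc i)))) X q' = C.T (Suc i) ` V (n (Suc i))"
proof -
  let ?m = "n (Suc i)" and ?k = "n (Suc (Suc i))"
  have trT: "tr (opp R) ?k ?m (C.T (Suc i)) b = D (Suc i) b" if "b \<in> V ?k" for b
    by (rule tr_tr[OF C.hom that])
  have E: "C.T (Suc i) \<in> mod_hom (opp R) (free (opp R) ?m) (free (opp R) ?k)" by (rule C.T_hom)
  have ker: "q x = \<zero>\<^bsub>Y\<^esub> \<longleftrightarrow> C.T (Suc i) x = zv" if x: "x \<in> V ?m" for x
  proof -
    have "q x = \<zero>\<^bsub>Y\<^esub> \<longleftrightarrow> x \<in> a_kernel (free (opp R) ?m) Y q" using x by (simp add: a_kernel_def')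
    also have "\<dots> \<longleftrightarrow> C.T (Suc i) x = zv" unfolding q(3) C.cols[symmetric] using x by (simp add: a_kernel_def')
    finally show ?thesis .
  qed
  have app: "b \<in> tr (opp R) ?k ?m (C.T (Suc i)) ` V ?k"
    if b: "b \<in> V ?m" and z: "\<And>x. \<lbrakk>x \<in> V ?m; C.T (Suc i) x = zv\<rbrakk> \<Longrightarrow> dot R ?m b x = \<zero>" for b
  proof -
    have "D i b = zv"
    proof (rule dot_nondeg_left[OF C.D_V[OF b] zv_coords(3)])
      fix c assume c: "c \<in> V (n i)"
      have "C.T (Suc i) (C.T i c) = zv" using C.T_zero[OF C.T_V[OF c]] c by blast
      then have "dot R (n i) (D i b) c = \<zero>" using C.adj[OF b c] z[OF C.T_V[OF c]] by simp
      then show "dot R (n i) (D i b) c = dot R (n i) zv c" using dot_zero[of "n i" zv c] coords_i[OF c] by simp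
    qed
    then obtain y where "y \<in> V ?k" "b = D (Suc i) y" using C.D_zero[OF b] by blast
    then show ?thesis using trT by force
  qed
  have mn: "b \<in> coords R J ?k" if "b \<in> V ?k" "tr (opp R) ?k ?m (C.T (Suc i)) b = zv" for b
    using C.D_ker[of "Suc i"] that trT by (auto simp: a_kernel_def')
  obtain q' where "q' \<in> mod_hom (opp R) (free (opp R) ?k) X" "q' ` V ?k = carrier X"
    "a_kernel (free (opp R) ?k) X q' = C.T (Suc i) ` V ?m" "left_module (opp R) X"
    using op.mho_unique[OF Y E q(1), simplified, OF q(2) ker app mn X] by metis
  then show ?thesis using that by blast
qed

end

end

section \<open>From the homological conditions on a module to its complex\<close>

context short_local_ring
begin

lemma core_socles:
  assumes core: "core_complex R J e a n D"
  shows "2 \<le> a" "e = Suc a" "soc R (regular R) = J2" "soc (opp R) (regular (opp R)) = J2"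
proof -
  interpret C: core_complex R J e a n D by (rule core)
  show "2 \<le> a" "e = Suc a" by (rule C.a_ge_2, rule C.e_eq)
  show "soc R (regular R) = J2" by (rule soc_regular[OF C.left_socle])
  show "soc (opp R) (regular (opp R)) = J2"
    using short_local_ring.soc_regular[OF opp_short] C.right_socle J2_opp by simp
qed

lemma mod_iso_presentation:
  assumes iso: "mod_iso R Y X" and q: "q \<in> mod_hom R (free R n) Y" "q ` V n = carrier Y"
  obtains q' where "left_module R X" "q' \<in> mod_hom R (free R n) X" "q' ` V n = carrier X"
    "a_kernel (free R n) X q' = a_kernel (free R n) Y q"
proof -
  obtain f where f: "f \<in> mod_hom R Y X" "bij_betw f (carrier Y) (carrier X)" and lm: "left_module R Y" "left_module R X"
    using iso unfolding mod_iso_def by blast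
  have h: "(\<lambda>x. f (q x)) \<in> mod_hom R (free R n) X" by (rule mod_hom_comp[OF q(1) f(1)])
  have s: "(\<lambda>x. f (q x)) ` V n = carrier X" using f(2) q(2) by (metis bij_betw_def image_image)
  have "f y = \<zero>\<^bsub>X\<^esub> \<longleftrightarrow> y = \<zero>\<^bsub>Y\<^esub>" if "y \<in> carrier Y" for y
  proof -
    have "a_kernel Y X f = {\<zero>\<^bsub>Y\<^esub>}" using inj_on_kernel[OF f(1) lm] f(2) by (simp add: bij_betw_def)
    then show ?thesis using that by (auto simp: a_kernel_def')
  qed
  then have "a_kernel (free R n) X (\<lambda>x. f (q x)) = a_kernel (free R n) Y q"
    using mod_homD(1)[OF q(1)] by (auto simp: a_kernel_def')
  then show ?thesis using that[OF lm(2) h s] by blast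
qed

text \<open>What the first prolongation to the left requires. It follows from being torsionless as
  well as from reflexivity, and so serves both cases.\<close>

definition separated :: "('a, 'm) module \<Rightarrow> bool" where
  "separated M \<longleftrightarrow> (\<forall>x\<in>carrier M. x \<noteq> \<zero>\<^bsub>M\<^esub> \<longrightarrow> (\<exists>f\<in>mod_hom R M (regular R). f x \<noteq> \<zero>))"

lemma torsionless_separated:
  assumes M: "left_module R M" and t: "torsionless R M" shows "separated M"
  unfolding separated_def
proof (intro ballI impI)
  fix x assume x: "x \<in> carrier M" "x \<noteq> \<zero>\<^bsub>M\<^esub>"
  obtain P :: "'a umod" and u where P: "projective R P" and u: "u \<in> mod_hom R M P" "inj_on u (carrier M)"
    using t unfolding torsionless_def by blast
  have lmP: "left_module R P" using P by (simp add: projective_def fl_module_def)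
  interpret M: lmod R M by (rule lmod.intro) fact
  obtain r th where th: "th \<in> mod_hom R (free R r) P" "bij_betw th (V r) (carrier P)"
    using projective_iso_free[OF P] by blast
  have thb: "bij_betw th (carrier (free R r)) (carrier P)" using th(2) by simp
  note inv = mod_hom_inv[OF th(1) thb fr.left_module_axioms]
  let ?v = "inv_into (carrier (free R r)) th (u x)"
  have ux: "u x \<in> carrier P" using mod_homD(1)[OF u(1) x(1)] .
  have "?v \<noteq> zv"
  proof
    assume "?v = zv"
    then have "u x = \<zero>\<^bsub>P\<^esub>" using inv(4)[OF ux] mod_hom_zero[OF th(1) fr.left_module_axioms lmP] by simp
    then have "u x = u \<zero>\<^bsub>M\<^esub>" using mod_hom_zero[OF u(1) M lmP] by simp
    then show False using u(2) x M.M.zero_closed by (auto simp: inj_on_def)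
  qed
  then obtain i where i: "?v i \<noteq> \<zero>" by (auto simp: fun_eq_iff)
  have ci: "(\<lambda>x. x i) \<in> mod_hom R (free R r) (regular R)" by (rule mod_homI) (auto simp: coords_i)
  have "(\<lambda>x. inv_into (carrier (free R r)) th (u x) i) \<in> mod_hom R M (regular R)"
    by (rule mod_hom_comp[OF mod_hom_comp[OF u(1) inv(1)] ci])
  then show "\<exists>f\<in>mod_hom R M (regular R). f x \<noteq> \<zero>" by (rule bexI[rotated]) (rule i)
qed

lemma reflexive_separated:
  assumes M: "left_module R M" and r: "reflexive_module R M" shows "separated M"
  unfolding separated_def
proof (intro ballI impI, rule ccontr)
  interpret M: lmod R M by (rule lmod.intro) fact
  fix x assume x: "x \<in> carrier M" "x \<noteq> \<zero>\<^bsub>M\<^esub>" and no: "\<not> (\<exists>f\<in>mod_hom R M (regular R). f x \<noteq> \<zero>)"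
  have "(\<lambda>f\<in>carrier (dual R M). f x) = (\<lambda>f\<in>carrier (dual R M). f \<zero>\<^bsub>M\<^esub>)"
  proof (rule restrict_ext)
    fix f assume "f \<in> carrier (dual R M)"
    then have fh: "f \<in> mod_hom R M (regular R)" by simp
    then show "f x = f \<zero>\<^bsub>M\<^esub>" using no mod_hom_zero[OF fh M reg.left_module_axioms] by simp
  qed
  moreover have "inj_on (\<lambda>m. \<lambda>f\<in>carrier (dual R M). f m) (carrier M)"
    using r by (simp add: reflexive_module_def bij_betw_def)
  ultimately show False using x M.M.zero_closed by (auto simp: inj_on_def)
qed

text \<open>A column in the kernel of the transposed relation matrix is a functional on
  \<open>M\<close>, and its values lie in \<open>J\<close> since \<open>M\<close> has no free
  summand. This keeps the prolonged complexes minimal.\<close>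

lemma relations_rad:
  assumes M: "left_module R M" and ind: "indecomposable R M" and np: "\<not> projective R M"
    and q: "q \<in> mod_hom R (free R n0) M" "q ` V n0 = carrier M"
    and D0: "D0 \<in> mod_hom R (free R n1) (free R n0)" and k: "a_kernel (free R n0) M q = D0 ` V n1"
    and b: "b \<in> V n0" "tr R n0 n1 D0 b = zv"
  shows "b \<in> coords R J n0"
proof -
  obtain f where f: "f \<in> mod_hom R M (regular R)" "\<forall>x\<in>V n0. f (q x) = dot R n0 x b"
    using functional_iff_relation(1)[OF M q D0 k b] by blast
  have "b i \<in> J" if i: "i < n0" for i
  proof -
    have "f (q (evec R i)) \<in> J"
      by (rule hom_to_ring_rad[OF M ind np f(1)]) (use mod_homD(1)[OF q(1)] i in simp)
    then show ?thesis using f(2) i b(1) by simp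
  qed
  then show ?thesis using b(1) by (auto simp: coords_def)
qed

text \<open>Here \<open>M\<close> is the cokernel of \<open>D 0\<close>, at the place without
  exactness; so this complex serves for the statements about \<open>A\<close>, and dimension vectors
  need a prolongation. Place 1 has positive rank because \<open>M\<close> has relations.\<close>

lemma semi_Gorenstein_core:
  assumes M: "left_module R M" and ne: "\<not> ext1_top_vanishes R J"
    and np: "\<not> projective R M" and sgp: "semi_Gorenstein_projective R M"
  obtains n0 q n1 D0 n D where "q \<in> mod_hom R (free R n0) M" "q ` V n0 = carrier M"
    "D0 \<in> mod_hom R (free R n1) (free R n0)" "a_kernel (free R n0) M q = D0 ` V n1"
    "core_complex R J e a n D" "n 0 = n0" "n (Suc 0) = n1" "D 0 = D0"
proof -
  have fin: "mod_length R M \<noteq> \<infinity>" using sgp by (simp add: semi_Gorenstein_projective_def fl_module_def)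
  obtain n0 q n1 D0 where p: "q \<in> mod_hom R (free R n0) M" "q ` V n0 = carrier M"
    "D0 \<in> mod_hom R (free R n1) (free R n0)" "a_kernel (free R n0) M q = D0 ` V n1"
    "\<And>x. x \<in> V n1 \<Longrightarrow> D0 x \<in> coords R J n0" "a_kernel (free R n1) (free R n0) D0 \<subseteq> coords R J n1"
    using min_presentation[OF M fin] by metis
  obtain n D where C: "min_complex R J e a n D" "n 0 = n0" "n (Suc 0) = n1" "D 0 = D0"
    by (rule semi_Gorenstein_complex[OF M p(1-3,6,5,4)])
      (use sgp in \<open>auto simp: semi_Gorenstein_projective_def\<close>)
  have "n1 \<noteq> 0" using projective_of_trivial_relations[OF M p(1-4)] np by blast
  then have "core_complex R J e a n D"
    using C ne by (simp add: core_complex_def core_complex_axioms_def)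
  from that[OF p(1-4) this C(2-4)] show ?thesis .
qed

text \<open>After one prolongation \<open>M\<close> is the cokernel of \<open>D (Suc 0)\<close> and
  so lies in the range where ranks and lengths are known. The last clause is the minimality
  condition for prolonging a second time.\<close>

lemma torsionless_core:
  assumes M: "left_module R M" and ne: "\<not> ext1_top_vanishes R J" and ind: "indecomposable R M"
    and np: "\<not> projective R M" and sgp: "semi_Gorenstein_projective R M" and sep: "separated M"
  obtains n0 q n1 D0 n D where "q \<in> mod_hom R (free R n0) M" "q ` V n0 = carrier M"
    "D0 \<in> mod_hom R (free R n1) (free R n0)" "a_kernel (free R n0) M q = D0 ` V n1"
    "core_complex R J e a n D" "n (Suc 0) = n0" "n (Suc (Suc 0)) = n1" "D (Suc 0) = D0"
    "\<forall>b\<in>V (n 0). tr R (n 0) (n (Suc 0)) (D 0) b = zv \<longrightarrow> b \<in> coords R J (n 0)"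
proof -
  interpret M: lmod R M by (rule lmod.intro) fact
  obtain n0 q n1 D0 n D where p: "q \<in> mod_hom R (free R n0) M" "q ` V n0 = carrier M"
    "D0 \<in> mod_hom R (free R n1) (free R n0)" "a_kernel (free R n0) M q = D0 ` V n1"
    and core: "core_complex R J e a n D" and nD: "n 0 = n0" "n (Suc 0) = n1" "D 0 = D0"
    using semi_Gorenstein_core[OF M ne np sgp] by metis
  interpret C: core_complex R J e a n D by (rule core)
  obtain n' D' where C': "min_complex R J e a n' D'" "\<And>i. n' (Suc i) = n i" "\<And>i. D' (Suc i) = D i"
    "\<And>b. \<lbrakk>b \<in> V (n' 0); tr R (n' 0) (n' (Suc 0)) (D' 0) b = zv\<rbrakk> \<Longrightarrow> b \<in> coords R J (n' 0)"
  proof (rule extend_left[OF C.min_complex_axioms])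
    fix b assume "b \<in> V (n 0)" "tr R (n 0) (n (Suc 0)) (D 0) b = zv"
    then show "b \<in> coords R J (n 0)" using relations_rad[OF M ind np p] nD by simp
  next
    fix x assume x: "x \<in> V (n 0)"
      and h: "\<And>b. \<lbrakk>b \<in> V (n 0); tr R (n 0) (n (Suc 0)) (D 0) b = zv\<rbrakk> \<Longrightarrow> dot R (n 0) x b = \<zero>"
    have qx: "q x \<in> carrier M" using mod_homD(1)[OF p(1)] x nD by simp
    have "f (q x) = \<zero>" if "f \<in> mod_hom R M (regular R)" for f
      using functional_iff_relation(2)[OF M p that] h nD x by auto
    then have "q x = \<zero>\<^bsub>M\<^esub>" using sep qx unfolding separated_def by blast
    then have "x \<in> a_kernel (free R n0) M q" using x nD by (simp add: a_kernel_def')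
    then show "x \<in> D 0 ` V (n (Suc 0))" using p(4) nD by simp
  next
    fix n' D' assume "min_complex R J e a n' D'" "\<And>i. n' (Suc i) = n i" "\<And>i. D' (Suc i) = D i"
      "\<And>b. \<lbrakk>b \<in> V (n' 0); tr R (n' 0) (n' (Suc 0)) (D' 0) b = zv\<rbrakk> \<Longrightarrow> b \<in> coords R J (n' 0)"
    then show thesis by (rule that)
  qed
  have "n0 \<noteq> 0"
  proof
    assume "n0 = 0"
    then have "V n0 = {\<zero>\<^bsub>free R n0\<^esub>}" by (auto simp: coords_def fun_eq_iff)
    then have "carrier M = {\<zero>\<^bsub>M\<^esub>}" using p(2) mod_hom_zero[OF p(1) fr.left_module_axioms M] by (metis image_empty image_insert)
    then show False using ind by (simp add: indecomposable_def)
  qed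
  then have "core_complex R J e a n' D'"
    using C' ne nD by (simp add: core_complex_def core_complex_axioms_def)
  then show ?thesis using that[OF p, of n' D'] C' nD by simp
qed

theorem torsionless_dim_vec:
  assumes M: "left_module R M" and ne: "\<not> ext1_top_vanishes R J" and ind: "indecomposable R M"
    and np: "\<not> projective R M" and sgp: "semi_Gorenstein_projective R M" and tl: "torsionless R M"
    and t: "top_length R J M = enat t" and X: "is_Omega_pow R i M X"
  shows "has_dim_vec R J X t (a * t)"
proof -
  obtain n0 q n1 D0 n D where p: "q \<in> mod_hom R (free R n0) M" "q ` V n0 = carrier M"
    "D0 \<in> mod_hom R (free R n1) (free R n0)" "a_kernel (free R n0) M q = D0 ` V n1"
    and core: "core_complex R J e a n D" and nD: "n (Suc 0) = n0" "n (Suc (Suc 0)) = n1" "D (Suc 0) = D0"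
    using torsionless_core[OF M ne ind np sgp torsionless_separated[OF M tl]] by metis
  interpret C: core_complex R J e a n D by (rule core)
  have kJ: "a_kernel (free R n0) M q \<subseteq> coords R J n0" using C.rad[of _ "Suc 0"] nD p(4) by auto
  have t0: "t = n0" using top_length_eq[OF M p(1,2) kJ] t by simp
  have "\<exists>q. left_module R X \<and> q \<in> mod_hom R (free R (n (Suc i))) X \<and> q ` V (n (Suc i)) = carrier X \<and>
    a_kernel (free R (n (Suc i))) X q = D (Suc i) ` V (n (Suc (Suc i)))"
    using X
  proof (induction i arbitrary: X)
    case 0
    then have "mod_iso R M X" by simp
    from mod_iso_presentation[OF this p(1,2)] show ?case using p(4) nD by metis
  next
    case (Suc i)
    then obtain Y where Y: "is_Omega_pow R i M Y" "is_Omega R Y X" by auto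
    obtain q where "left_module R Y" "q \<in> mod_hom R (free R (n (Suc i))) Y" "q ` V (n (Suc i)) = carrier Y"
      "a_kernel (free R (n (Suc i))) Y q = D (Suc i) ` V (n (Suc (Suc i)))" using Suc.IH[OF Y(1)] by blast
    from Omega_step[OF core this Y(2)] show ?case by metis
  qed
  then obtain q' where q': "left_module R X" "q' \<in> mod_hom R (free R (n (Suc i))) X" "q' ` V (n (Suc i)) = carrier X"
    "a_kernel (free R (n (Suc i))) X q' = D (Suc i) ` V (n (Suc (Suc i)))" by blast
  show ?thesis using dim_vec_D[OF core q'] t0 nD by simp
qed

text \<open>\<open>M^*\<close> is the image of \<open>C.T 0\<close>, where \<open>C\<close> is the
  complex prolonged once; its relations form the kernel of \<open>C.T 0\<close>, which has to be an
  image for the counts to apply. A second prolongation provides this, and reflexivity is what it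
  requires.\<close>

theorem reflexive_dim_vec:
  assumes M: "left_module R M" and ne: "\<not> ext1_top_vanishes R J" and ind: "indecomposable R M"
    and np: "\<not> projective R M" and sgp: "semi_Gorenstein_projective R M" and rf: "reflexive_module R M"
    and t: "top_length R J M = enat t"
  shows "has_dim_vec (opp R) J (dual R M) t (a * t)"
proof -
  interpret op: short_local_ring "opp R" J e a by (rule opp_short)
  obtain n0 q n1 D0 n D where p: "q \<in> mod_hom R (free R n0) M" "q ` V n0 = carrier M"
    "D0 \<in> mod_hom R (free R n1) (free R n0)" "a_kernel (free R n0) M q = D0 ` V n1"
    and core: "core_complex R J e a n D" and nD: "n (Suc 0) = n0" "n (Suc (Suc 0)) = n1" "D (Suc 0) = D0"
    and kT: "\<forall>b\<in>V (n 0). tr R (n 0) (n (Suc 0)) (D 0) b = zv \<longrightarrow> b \<in> coords R J (n 0)"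
    by (rule torsionless_core[OF M ne ind np sgp reflexive_separated[OF M rf]])
  interpret C: core_complex R J e a n D by (rule core)
  have kJ: "a_kernel (free R n0) M q \<subseteq> coords R J n0" using C.rad[of _ "Suc 0"] nD p(4) by auto
  have t0: "t = n0" using top_length_eq[OF M p(1,2) kJ] t by simp
  have T0: "C.T 0 \<in> mod_hom (opp R) (free (opp R) (n 0)) (free (opp R) n0)" using C.T_hom[of 0] nD by simp
  have T0i: "C.T 0 ` V (n 0) = a_kernel (free (opp R) n0) (free (opp R) n1) (tr R n0 n1 D0)" using C.cols[of 0] nD by simp
  obtain P where P: "P \<in> mod_hom (opp R) (free (opp R) (n 0)) (dual R M)" "P ` V (n 0) = carrier (dual R M)"
    "left_module (opp R) (dual R M)" "\<And>c x. \<lbrakk>c \<in> V (n 0); x \<in> V n0\<rbrakk> \<Longrightarrow> P c (q x) = dot R n0 x (C.T 0 c)"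
    "a_kernel (free (opp R) (n 0)) (dual R M) P = a_kernel (free (opp R) (n 0)) (free (opp R) n0) (C.T 0)"
    using dual_presentation[OF M p T0 T0i] by metis
  obtain n' D' where C': "min_complex R J e a n' D'" "\<And>i. n' (Suc i) = n i" "\<And>i. D' (Suc i) = D i"
  proof (rule extend_left[OF C.min_complex_axioms])
    fix b assume "b \<in> V (n 0)" "tr R (n 0) (n (Suc 0)) (D 0) b = zv"
    then show "b \<in> coords R J (n 0)" using kT by blast
  next
    fix x assume x: "x \<in> V (n 0)"
      and h: "\<And>b. \<lbrakk>b \<in> V (n 0); tr R (n 0) (n (Suc 0)) (D 0) b = zv\<rbrakk> \<Longrightarrow> dot R (n 0) x b = \<zero>"
    have dk: "dot R (n 0) x c = \<zero>\<^bsub>regular (opp R)\<^esub>" if c: "c \<in> carrier (free (opp R) (n 0))" "P c = \<zero>\<^bsub>dual R M\<^esub>" for c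
    proof -
      have "c \<in> a_kernel (free (opp R) (n 0)) (dual R M) P" using c by (simp add: a_kernel_def')
      then have "C.T 0 c = zv" "c \<in> V (n 0)" unfolding P(5) by (auto simp: a_kernel_def')
      then show ?thesis using h by simp
    qed
    have Ps: "P ` carrier (free (opp R) (n 0)) = carrier (dual R M)" using P(2) by simp
    \<comment> \<open>A row that pairs to zero with the relations of \<open>M^*\<close> is a
      functional on \<open>M^*\<close>. By reflexivity it is the evaluation at some
      \<open>q y\<close>, and comparing pairings gives \<open>x = D 0 y\<close>.\<close>
    have "\<exists>\<xi>\<in>mod_hom (opp R) (dual R M) (regular (opp R)). \<forall>c\<in>V (n 0). \<xi> (P c) = dot R (n 0) x c"
    proof (rule mod_hom_factor[OF P(1) Ps dot_hom_right[OF x] op.fr.left_module_axioms P(3) op.reg.left_module_axioms dk])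
      fix g assume "g \<in> mod_hom (opp R) (dual R M) (regular (opp R))"
        "\<And>c. c \<in> carrier (free (opp R) (n 0)) \<Longrightarrow> g (P c) = dot R (n 0) x c"
      then show ?thesis by (intro bexI[of _ g]) auto
    qed
    then obtain \<xi> where \<xi>: "\<xi> \<in> mod_hom (opp R) (dual R M) (regular (opp R))" "\<And>c. c \<in> V (n 0) \<Longrightarrow> \<xi> (P c) = dot R (n 0) x c"
      by blast
    have "restrict \<xi> (carrier (dual R M)) \<in> carrier (dual (opp R) (dual R M))"
      using \<xi>(1) unfolding dual_simps(1)[of "opp R"] by (simp add: restrict_mod_hom[OF P(3)] del: dual_simps(1))
    then have "restrict \<xi> (carrier (dual R M)) \<in> (\<lambda>m. \<lambda>f\<in>carrier (dual R M). f m) ` carrier M"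
      using rf unfolding reflexive_module_def bij_betw_def by simp
    then obtain m where m: "m \<in> carrier M" "restrict \<xi> (carrier (dual R M)) = (\<lambda>f\<in>carrier (dual R M). f m)" by blast
    have "m \<in> q ` V n0" using m(1) p(2) by simp
    then obtain y where y: "y \<in> V n0" "m = q y" by blast
    have yV: "y \<in> V (n (Suc 0))" using y nD by simp
    have "x = D 0 y"
    proof (rule dot_nondeg_left[OF x C.D_V[OF yV]])
      fix c assume c: "c \<in> V (n 0)"
      have Pc: "P c \<in> carrier (dual R M)" using P(2) c by blast
      have "\<xi> (P c) = P c m" using fun_cong[OF m(2), of "P c"] Pc by (simp del: dual_simps(1))
      then show "dot R (n 0) x c = dot R (n 0) (D 0 y) c"
        using \<xi>(2)[OF c] P(4)[OF c y(1)] y(2) C.adj[OF yV c] nD by simp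
    qed
    then show "x \<in> D 0 ` V (n (Suc 0))" using yV by blast
  next
    fix n' D' assume "min_complex R J e a n' D'" "\<And>i. n' (Suc i) = n i" "\<And>i. D' (Suc i) = D i"
    then show thesis by (rule that)
  qed
  \<comment> \<open>With rank zero at place 0 the unit row at place 1 would be a cycle, but cycles
    have entries in \<open>J\<close>.\<close>
  have "n 0 \<noteq> 0"
  proof
    assume z: "n 0 = 0"
    have n0: "n0 \<noteq> 0" using C.n1 nD by simp
    have "evec R 0 \<in> V (n (Suc 0))" using n0 nD by simp
    from C.D_V[OF this] have "D 0 (evec R 0) = zv" using z by (auto simp: coords_def fun_eq_iff)
    then have "evec R 0 \<in> a_kernel (free R (n (Suc 0))) (free R (n 0)) (D 0)" using n0 nD by (simp add: a_kernel_def')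
    then have "evec R 0 \<in> coords R J (n (Suc 0))" using C.D_ker by blast
    then show False using n0 nD one_notin_J by (auto simp: coords_def evec_def)
  qed
  then have core': "core_complex R J e a n' D'"
    using C' ne by (simp add: core_complex_def core_complex_axioms_def)
  interpret C': core_complex R J e a n' D' by (rule core')
  have "a_kernel (free (opp R) (n' (Suc 0))) (dual R M) P = C'.T 0 ` V (n' 0)"
    using P(5) C'.cols[of 0] C'(2,3) nD by simp
  from dim_vec_T[OF core' P(3), of P 0, OF _ _ this] P(1,2)
  have "has_dim_vec (opp R) J (dual R M) (n 0) (a * n 0)" using C'(2) by simp
  moreover have "n 0 = n0" using C'.n_const[of 1] C'(2) nD by simp
  ultimately show ?thesis using t0 by simp
qed

text \<open>The hypotheses describe a presentation of \<open>M\<close> whose transpose starts a minimal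
  resolution of \<open>Tr M\<close>.\<close>
context
  fixes M :: "('a, 'm) module" and n0 q n1 D0 \<nu> G
  assumes M: "left_module R M" and q: "q \<in> mod_hom R (free R n0) M" "q ` V n0 = carrier M"
    and D0: "D0 \<in> mod_hom R (free R n1) (free R n0)" and k: "a_kernel (free R n0) M q = D0 ` V n1"
    and core: "core_complex (opp R) J e a \<nu> G"
    and \<nu>: "\<nu> 0 = n1" "\<nu> (Suc 0) = n0" "G 0 = tr R n0 n1 D0"
begin

interpretation op: short_local_ring "opp R" J e a by (rule opp_short)
interpretation C: core_complex "opp R" J e a \<nu> G by (rule core)

text \<open>Transposing twice returns \<open>D0\<close>, so \<open>M\<close> is the cokernel of
  \<open>C.T 0\<close> and sits at place 1.\<close>

lemma transpose_kernel: "a_kernel (free R (\<nu> (Suc 0))) M q = C.T 0 ` V (\<nu> 0)"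
  unfolding k \<nu> by (rule image_cong) (simp_all add: tr_tr[OF D0])

lemma transpose_top: "top_length R J M = enat n0"
  by (rule top_length_eq[OF M q]) (use transpose_kernel C.T_rad[of _ 0] \<nu> in auto)

text \<open>The complex lives over \<open>opp R\<close>, so its transposes are maps of left
  \<open>R\<close>-modules, and the step along them applies over
  \<open>opp (opp R) = R\<close>.\<close>

lemma mho_dim_vec:
  assumes "is_mho_pow R i M X" shows "has_dim_vec R J X n0 (a * n0)"
proof -
  have "\<exists>q. left_module R X \<and> q \<in> mod_hom R (free R (\<nu> (Suc i))) X \<and> q ` V (\<nu> (Suc i)) = carrier X \<and>
    a_kernel (free R (\<nu> (Suc i))) X q = C.T i ` V (\<nu> i)"
    using assms
  proof (induction i arbitrary: X)
    case 0
    then have "mod_iso R M X" by simp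
    from mod_iso_presentation[OF this q] show ?case using transpose_kernel \<nu> by metis
  next
    case (Suc i)
    then obtain Y where Y: "is_mho_pow R i M Y" "is_mho R Y X" by auto
    obtain q where "left_module R Y" "q \<in> mod_hom R (free R (\<nu> (Suc i))) Y" "q ` V (\<nu> (Suc i)) = carrier Y"
      "a_kernel (free R (\<nu> (Suc i))) Y q = C.T i ` V (\<nu> i)" using Suc.IH[OF Y(1)] by blast
    from op.mho_step[OF core, simplified, OF this Y(2)] show ?case by metis
  qed
  then obtain q' where q': "left_module R X" "q' \<in> mod_hom R (free R (\<nu> (Suc i))) X" "q' ` V (\<nu> (Suc i)) = carrier X"
    "a_kernel (free R (\<nu> (Suc i))) X q' = C.T i ` V (\<nu> i)" by blast
  show ?thesis using op.dim_vec_T[OF core, simplified, OF q'] \<nu> by simp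
qed

text \<open>\<open>M^*\<close> is the kernel of \<open>G 0\<close>, hence the image of
  \<open>G (Suc 0)\<close> and the cokernel of \<open>G (Suc (Suc 0))\<close>, where ranks and
  lengths are known.\<close>

lemma transpose_dual_dim_vec: "has_dim_vec (opp R) J (dual R M) n0 (a * n0)"
proof -
  have E: "G (Suc 0) \<in> mod_hom (opp R) (free (opp R) (\<nu> (Suc (Suc 0)))) (free (opp R) n0)" using C.hom[of "Suc 0"] \<nu> by simp
  have Ei: "G (Suc 0) ` V (\<nu> (Suc (Suc 0))) = a_kernel (free (opp R) n0) (free (opp R) n1) (tr R n0 n1 D0)"
    using C.rows[of 0] \<nu> by simp
  obtain P where P: "P \<in> mod_hom (opp R) (free (opp R) (\<nu> (Suc (Suc 0)))) (dual R M)" "P ` V (\<nu> (Suc (Suc 0))) = carrier (dual R M)"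
    "left_module (opp R) (dual R M)"
    "a_kernel (free (opp R) (\<nu> (Suc (Suc 0)))) (dual R M) P = a_kernel (free (opp R) (\<nu> (Suc (Suc 0)))) (free (opp R) n0) (G (Suc 0))"
    using dual_presentation[OF M q D0 k E Ei] by metis
  have "a_kernel (free (opp R) (\<nu> (Suc (Suc 0)))) (dual R M) P = G (Suc (Suc 0)) ` V (\<nu> (Suc (Suc (Suc 0))))"
    using P(4) C.rows[of "Suc 0"] \<nu> by simp
  from op.dim_vec_D[OF core P(3), of P "Suc 0", OF P(1) _ _] this P(2) show ?thesis using \<nu> by simp
qed

end

section \<open>Presentations of \<open>Tr M\<close>\<close>

lemma dual_of_free:
  assumes P: "left_module R P" and th: "th \<in> mod_hom R (free R n) P" "bij_betw th (V n) (carrier P)"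
  obtains al where "al \<in> mod_hom (opp R) (free (opp R) n) (dual R P)" "al ` V n = carrier (dual R P)"
    "left_module (opp R) (dual R P)" "\<And>c x. \<lbrakk>c \<in> V n; x \<in> V n\<rbrakk> \<Longrightarrow> al c (th x) = dot R n x c" "inj_on al (V n)"
proof -
  interpret op: short_local_ring "opp R" J e a by (rule opp_short)
  have ths: "th ` V n = carrier P" using th(2) by (simp add: bij_betw_def)
  have Z: "(\<lambda>x. zv) \<in> mod_hom R (free R 0) (free R n)" by (rule mod_homI) auto
  have V0: "V 0 = {zv}" by (auto simp: coords_def fun_eq_iff)
  have k: "a_kernel (free R n) P th = (\<lambda>x. zv) ` V 0"
    using inj_on_kernel[OF th(1) fr.left_module_axioms P] th(2) V0 by (simp add: bij_betw_def)
  have idk: "(\<lambda>x. x) ` V n = a_kernel (free (opp R) n) (free (opp R) 0) (tr R n 0 (\<lambda>x. zv))"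
    using tr_closed[OF Z] V0 by (auto simp: a_kernel_def')
  obtain al where al: "al \<in> mod_hom (opp R) (free (opp R) n) (dual R P)" "al ` V n = carrier (dual R P)"
    "left_module (opp R) (dual R P)" "\<And>c x. \<lbrakk>c \<in> V n; x \<in> V n\<rbrakk> \<Longrightarrow> al c (th x) = dot R n x c"
    "a_kernel (free (opp R) n) (dual R P) al = a_kernel (free (opp R) n) (free (opp R) n) (\<lambda>x. x)"
    using dual_presentation[OF P th(1) ths Z k mod_hom_id idk] by metis
  have "a_kernel (free (opp R) n) (dual R P) al = {\<zero>\<^bsub>free (opp R) n\<^esub>}" unfolding al(5) by (auto simp: a_kernel_def')
  then have "inj_on al (V n)" using inj_on_kernel[OF al(1) op.fr.left_module_axioms al(3)] by simp
  then show ?thesis using that[OF al(1-4)] by blast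
qed

text \<open>Bases of the two covers turn the presentation into a matrix \<open>D0\<close>; the dual
  bases turn the cokernel that defines \<open>Tr M\<close> into the cokernel of the transposed
  matrix.\<close>

lemma transpose_presentation:
  assumes M: "left_module R M" and T: "is_transpose R M T"
  obtains n0 q n1 D0 qT where "q \<in> mod_hom R (free R n0) M" "q ` V n0 = carrier M"
    "D0 \<in> mod_hom R (free R n1) (free R n0)" "a_kernel (free R n0) M q = D0 ` V n1"
    "\<And>x. x \<in> V n1 \<Longrightarrow> D0 x \<in> coords R J n0"
    "left_module (opp R) T" "qT \<in> mod_hom (opp R) (free (opp R) n1) T" "qT ` V n1 = carrier T"
    "a_kernel (free (opp R) n1) T qT = tr R n0 n1 D0 ` V n0"
proof -
  interpret op: short_local_ring "opp R" J e a by (rule opp_short)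
  obtain P0 P1 :: "'a umod" and p f where c0: "projective_cover R P0 p M"
    and c1: "projective_cover R P1 f (sub P0 (a_kernel P0 M p))"
    and iso: "mod_iso (opp R) (quot (dual R P1) (dual_map P1 f ` carrier (dual R P0))) T"
    using T unfolding is_transpose_def by blast
  have P0: "projective R P0" and p: "p \<in> mod_hom R P0 M" "p ` carrier P0 = carrier M"
    and P1: "projective R P1" and f: "f \<in> mod_hom R P1 (sub P0 (a_kernel P0 M p))" "f ` carrier P1 = a_kernel P0 M p"
    using c0 c1 by (auto simp: projective_cover_def)
  have lm: "left_module R P0" "left_module R P1" using P0 P1 by (auto simp: projective_def fl_module_def)
  have K: "submodule (a_kernel P0 M p) R P0" by (rule kernel_submodule[OF p(1) lm(1) M])
  have f': "f \<in> mod_hom R P1 P0" by (rule mod_hom_sub_incl[OF f(1) submodD(1)[OF K]])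
  obtain n0 th0 where th0: "th0 \<in> mod_hom R (free R n0) P0" "bij_betw th0 (V n0) (carrier P0)"
    using projective_iso_free[OF P0] by blast
  obtain n1 th1 where th1: "th1 \<in> mod_hom R (free R n1) P1" "bij_betw th1 (V n1) (carrier P1)"
    using projective_iso_free[OF P1] by blast
  have th0b: "bij_betw th0 (carrier (free R n0)) (carrier P0)" using th0(2) by simp
  note inv = mod_hom_inv[OF th0(1) th0b fr.left_module_axioms]
  let ?i0 = "inv_into (carrier (free R n0)) th0"
  have th0s: "th0 ` V n0 = carrier P0" and th1s: "th1 ` V n1 = carrier P1" using th0(2) th1(2) by (auto simp: bij_betw_def)
  define q where "q x = p (th0 x)" for x
  define D0 where "D0 x = ?i0 (f (th1 x))" for x
  have q: "q \<in> mod_hom R (free R n0) M" unfolding q_def by (rule mod_hom_comp[OF th0(1) p(1)])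
  have qs: "q ` V n0 = carrier M" unfolding q_def using th0s p(2) by (metis image_image)
  have qJ: "a_kernel (free R n0) M q \<subseteq> coords R J n0" unfolding q_def by (rule cover_kernel[OF M c0 th0])
  have D0: "D0 \<in> mod_hom R (free R n1) (free R n0)"
    unfolding D0_def by (rule mod_hom_comp[OF mod_hom_comp[OF th1(1) f'] inv(1)])
  have ft: "th0 (D0 x) = f (th1 x)" if "x \<in> V n1" for x
    unfolding D0_def by (rule inv(4)) (use mod_homD(1)[OF f'] mod_homD(1)[OF th1(1)] that in simp)
  have k: "a_kernel (free R n0) M q = D0 ` V n1"
  proof (intro equalityI subsetI)
    fix x assume "x \<in> a_kernel (free R n0) M q"
    then have x: "x \<in> V n0" "th0 x \<in> a_kernel P0 M p" using mod_homD(1)[OF th0(1)] by (auto simp: a_kernel_def' q_def)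
    then have "th0 x \<in> f ` (th1 ` V n1)" using f(2) th1s by simp
    then obtain y where y: "y \<in> V n1" "th0 x = th0 (D0 y)" using ft by auto
    have "D0 y \<in> V n0" using mod_homD(1)[OF D0] y by simp
    then have "x = D0 y" using y x th0(2) by (auto simp: bij_betw_def inj_on_def)
    then show "x \<in> D0 ` V n1" using y by blast
  next
    fix x assume "x \<in> D0 ` V n1"
    then obtain y where y: "y \<in> V n1" "x = D0 y" by blast
    have "th1 y \<in> carrier P1" using mod_homD(1)[OF th1(1)] y by simp
    then have "f (th1 y) \<in> a_kernel P0 M p" using f(2) by blast
    then show "x \<in> a_kernel (free R n0) M q" using y ft mod_homD(1)[OF D0] by (simp add: a_kernel_def' q_def)
  qed
  have r0: "D0 x \<in> coords R J n0" if "x \<in> V n1" for x using k qJ that by blast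
  obtain a0 where a0: "a0 \<in> mod_hom (opp R) (free (opp R) n0) (dual R P0)" "a0 ` V n0 = carrier (dual R P0)"
    "left_module (opp R) (dual R P0)" "\<And>c x. \<lbrakk>c \<in> V n0; x \<in> V n0\<rbrakk> \<Longrightarrow> a0 c (th0 x) = dot R n0 x c" "inj_on a0 (V n0)"
    using dual_of_free[OF lm(1) th0] by metis
  obtain a1 where a1: "a1 \<in> mod_hom (opp R) (free (opp R) n1) (dual R P1)" "a1 ` V n1 = carrier (dual R P1)"
    "left_module (opp R) (dual R P1)" "\<And>c x. \<lbrakk>c \<in> V n1; x \<in> V n1\<rbrakk> \<Longrightarrow> a1 c (th1 x) = dot R n1 x c" "inj_on a1 (V n1)"
    using dual_of_free[OF lm(2) th1] by metis
  let ?t = "tr R n0 n1 D0"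
  have tc: "?t c \<in> V n1" if "c \<in> V n0" for c by (rule tr_closed[OF D0 that])
  \<comment> \<open>In terms of columns, the dual of \<open>f\<close> is the transpose of
    \<open>D0\<close>; both sides are compared on the images of rows by adjointness.\<close>
  have dm: "dual_map P1 f (a0 c) = a1 (?t c)" if c: "c \<in> V n0" for c
  proof (rule extensionalityI)
    show "dual_map P1 f (a0 c) \<in> extensional (carrier P1)" by (simp add: dual_map_def)
    have "a1 (?t c) \<in> carrier (dual R P1)" using a1(2) tc[OF c] by blast
    then show "a1 (?t c) \<in> extensional (carrier P1)" by simp
    fix y assume y: "y \<in> carrier P1"
    then have "y \<in> th1 ` V n1" using th1s by simp
    then obtain x where x: "x \<in> V n1" "y = th1 x" by blast
    have "D0 x \<in> V n0" using mod_homD(1)[OF D0] x by simp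
    then show "dual_map P1 f (a0 c) y = a1 (?t c) y"
      using x y a0(4)[OF c, of "D0 x"] ft[OF x(1)] a1(4)[OF tc[OF c] x(1)] tr_adj[OF D0 c x(1)] by (simp add: dual_map_def)
  qed
  let ?B = "dual_map P1 f ` carrier (dual R P0)"
  have B: "?B = a1 ` (?t ` V n0)" unfolding a0(2)[symmetric] image_image by (rule image_cong) (simp_all add: dm)
  have tsub: "submodule (?t ` V n0) (opp R) (free (opp R) n1)"
    using image_submodule[OF tr_hom[OF D0] op.fr.left_module_axioms op.fr.left_module_axioms op.fr.carrier_submodule] by simp
  have Bs: "submodule ?B (opp R) (dual R P1)"
    unfolding B by (rule image_submodule[OF a1(1) op.fr.left_module_axioms a1(3) tsub])
  interpret d: lmod "opp R" "dual R P1" by (rule lmod.intro) (rule a1(3))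
  note pr = d.proj_hom[OF Bs]
  let ?Q = "quot (dual R P1) ?B"
  define q1 where "q1 c = ?B +>\<^bsub>dual R P1\<^esub> a1 c" for c
  have q1: "q1 \<in> mod_hom (opp R) (free (opp R) n1) ?Q" unfolding q1_def by (rule mod_hom_comp[OF a1(1) pr(1)])
  have q1s: "q1 ` V n1 = carrier ?Q"
    using pr(2) a1(2) unfolding q1_def by (metis image_image)
  have "q1 c = \<zero>\<^bsub>?Q\<^esub> \<longleftrightarrow> c \<in> ?t ` V n0" if c: "c \<in> V n1" for c
  proof -
    have a1c: "a1 c \<in> carrier (dual R P1)" using a1(2) c by blast
    have "q1 c = \<zero>\<^bsub>?Q\<^esub> \<longleftrightarrow> a1 c \<in> a_kernel (dual R P1) ?Q (\<lambda>x. ?B +>\<^bsub>dual R P1\<^esub> x)"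
      using a1c by (simp add: a_kernel_def' q1_def del: dual_simps quot_simps)
    also have "\<dots> \<longleftrightarrow> a1 c \<in> ?B" by (simp only: pr(3))
    also have "\<dots> \<longleftrightarrow> a1 c \<in> a1 ` (?t ` V n0)" by (simp only: B)
    also have "\<dots> \<longleftrightarrow> c \<in> ?t ` V n0" using a1(5) c tc by (auto simp: inj_on_def)
    finally show ?thesis .
  qed
  then have q1k: "a_kernel (free (opp R) n1) ?Q q1 = ?t ` V n0" using tc by (auto simp: a_kernel_def')
  obtain qT where qT: "left_module (opp R) T" "qT \<in> mod_hom (opp R) (free (opp R) n1) T" "qT ` V n1 = carrier T"
    "a_kernel (free (opp R) n1) T qT = a_kernel (free (opp R) n1) ?Q q1"
    using op.mod_iso_presentation[OF iso q1] q1s by (metis coords_opp opp_simps(1))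
  have kT: "a_kernel (free (opp R) n1) T qT = ?t ` V n0" by (simp only: qT(4) q1k)
  show ?thesis by (rule that) (rule q qs D0 k qT(1) qT(2) qT(3) kT r0 | assumption)+
qed

text \<open>The place where the symmetry of Ext^1(k, A) = 0 enters: the complex is one over
  \<open>opp R\<close>, the hypothesis one on \<open>R\<close>.\<close>

lemma core_opp:
  assumes "min_complex (opp R) J e a \<nu> G" "\<not> ext1_top_vanishes R J" "\<nu> (Suc 0) \<noteq> 0"
  shows "core_complex (opp R) J e a \<nu> G"
proof -
  have "\<not> ext1_top_vanishes (opp R) J"
    using short_local_ring.ext1_opp[OF opp_short] assms(2) by (metis opp_simps(6))
  then show ?thesis using assms by (simp add: core_complex_def core_complex_axioms_def)
qed

lemma generators_nonzero:
  assumes M: "left_module R M" and ind: "indecomposable R M"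
    and q: "q \<in> mod_hom R (free R n0) M" "q ` V n0 = carrier M"
  shows "n0 \<noteq> 0"
proof
  assume "n0 = 0"
  then have "V n0 = {\<zero>\<^bsub>free R n0\<^esub>}" by (auto simp: coords_def fun_eq_iff)
  then have "carrier M = {\<zero>\<^bsub>M\<^esub>}" using q(2) mod_hom_zero[OF q(1) fr.left_module_axioms M] by (metis image_empty image_insert)
  then show False using ind by (simp add: indecomposable_def)
qed

text \<open>Since \<open>M\<close> has no free summand, the kernel of the transposed relation matrix
  lies in the radical, so this matrix is the first differential of a minimal resolution of
  \<open>Tr M\<close>. The ranks at places 0 and 1 count the relations and the generators of
  \<open>M\<close>.\<close>

theorem inf_torsionfree_core:
  assumes M: "left_module R M" and ne: "\<not> ext1_top_vanishes R J" and ind: "indecomposable R M"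
    and np: "\<not> projective R M" and tf: "inf_torsionfree R M"
  obtains n0 q n1 D0 \<nu> G where "q \<in> mod_hom R (free R n0) M" "q ` V n0 = carrier M"
    "D0 \<in> mod_hom R (free R n1) (free R n0)" "a_kernel (free R n0) M q = D0 ` V n1"
    "core_complex (opp R) J e a \<nu> G" "\<nu> 0 = n1" "\<nu> (Suc 0) = n0" "G 0 = tr R n0 n1 D0"
proof -
  interpret op: short_local_ring "opp R" J e a by (rule opp_short)
  obtain T :: "'a umod" where T: "is_transpose R M T" and sgp: "semi_Gorenstein_projective (opp R) T"
    using tf unfolding inf_torsionfree_def by blast
  obtain n0 q n1 D0 qT where p: "q \<in> mod_hom R (free R n0) M" "q ` V n0 = carrier M"
    "D0 \<in> mod_hom R (free R n1) (free R n0)" "a_kernel (free R n0) M q = D0 ` V n1"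
    and r0: "\<And>x. x \<in> V n1 \<Longrightarrow> D0 x \<in> coords R J n0"
    and lT: "left_module (opp R) T" and qT: "qT \<in> mod_hom (opp R) (free (opp R) n1) T" "qT ` V n1 = carrier T"
    "a_kernel (free (opp R) n1) T qT = tr R n0 n1 D0 ` V n0"
    using transpose_presentation[OF M T] by metis
  have kJ: "a_kernel (free (opp R) n0) (free (opp R) n1) (tr R n0 n1 D0) \<subseteq> coords R J n0"
    using relations_rad[OF M ind np p] by (auto simp: a_kernel_def')
  have ev: "ext_vanishes (opp R) j T (regular (opp R))" for j
    using sgp by (simp add: semi_Gorenstein_projective_def)
  obtain \<nu> G where C: "min_complex (opp R) J e a \<nu> G" "\<nu> 0 = n1" "\<nu> (Suc 0) = n0" "G 0 = tr R n0 n1 D0"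
    using op.semi_Gorenstein_complex[OF lT qT(1) _ tr_hom[OF p(3)], simplified, OF qT(2) kJ tr_rad[OF p(3) r0] qT(3) ev] by metis
  have "core_complex (opp R) J e a \<nu> G"
    by (rule core_opp[OF C(1) ne]) (use generators_nonzero[OF M ind p(1,2)] C(3) in simp)
  from that[OF p this C(2-4)] show ?thesis .
qed

end

section \<open>Gorenstein-projective modules\<close>

context short_local_ring
begin

lemma tr_cong:
  assumes "\<And>x. x \<in> V m \<Longrightarrow> D x = D' x" shows "tr R n m D b = tr R n m D' b"
proof -
  have "D (evec R k) = D' (evec R k)" if "k < m" for k by (rule assms[OF evec_closed[OF that]])
  then show ?thesis unfolding tr_def covec_def by (intro ext) simp
qed

text \<open>The complete complex in coordinates: bases replace the projective modules by free ones,
  the degrees are shifted so that \<open>M\<close> is the image of \<open>B 0\<close>, and exactness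
  of the dual complex becomes exactness for columns.\<close>

lemma Gorenstein_free_complex:
  assumes M: "left_module R M" and gp: "Gorenstein_projective R M"
  obtains m :: "int \<Rightarrow> nat" and B \<pi> where
    "\<forall>l. B l \<in> mod_hom R (free R (m l)) (free R (m (l - 1)))"
    "\<forall>l. \<forall>x\<in>V (m l). B l x = zv \<longleftrightarrow> x \<in> B (l + 1) ` V (m (l + 1))"
    "\<forall>l. \<forall>c\<in>V (m (l - 1)). tr R (m (l - 1)) (m l) (B l) c = zv \<longleftrightarrow> c \<in> tr R (m (l - 2)) (m (l - 1)) (B (l - 1)) ` V (m (l - 2))"
    "\<pi> \<in> mod_hom R (free R (m 0)) M" "\<pi> ` V (m 0) = carrier M" "\<forall>x\<in>V (m 0). \<pi> x = \<zero>\<^bsub>M\<^esub> \<longleftrightarrow> B 0 x = zv"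
proof -
  obtain P :: "int \<Rightarrow> 'a umod" and d i where
    Pd: "\<And>i. projective R (P i)" "\<And>i. d i \<in> mod_hom R (P i) (P (i - 1))"
    and rP: "\<And>i. d (i + 1) ` carrier (P (i + 1)) = a_kernel (P i) (P (i - 1)) (d i)"
    and cP: "\<And>i. dual_map (P i) (d i) ` carrier (dual R (P (i - 1))) =
             a_kernel (dual R (P i)) (dual R (P (i + 1))) (dual_map (P (i + 1)) (d (i + 1)))"
    and iso: "mod_iso R (sub (P (i - 1)) (d i ` carrier (P i))) M"
    using gp unfolding Gorenstein_projective_def by metis
  \<comment> \<open>The index \<open>i\<close> is the one whose image is isomorphic to
    \<open>M\<close>; it becomes degree 0.\<close>
  define Q where "Q l = P (i + l)" for l
  define dd where "dd l = d (i + l)" for l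
  have ar: "i + (l - 1) = i + l - 1" "i + (l + 1) = i + l + 1" for l by auto
  have Qp: "projective R (Q l)" for l by (simp add: Q_def Pd)
  have lm: "left_module R (Q l)" for l using Qp[of l] by (simp add: projective_def fl_module_def)
  have dh: "dd l \<in> mod_hom R (Q l) (Q (l - 1))" for l using Pd(2)[of "i + l"] by (simp add: Q_def dd_def ar)
  have rQ: "dd (l + 1) ` carrier (Q (l + 1)) = a_kernel (Q l) (Q (l - 1)) (dd l)" for l
    using rP[of "i + l"] by (simp add: Q_def dd_def ar)
  have cQ: "dual_map (Q l) (dd l) ` carrier (dual R (Q (l - 1))) =
             a_kernel (dual R (Q l)) (dual R (Q (l + 1))) (dual_map (Q (l + 1)) (dd (l + 1)))" for l
    using cP[of "i + l"] by (simp add: Q_def dd_def ar del: dual_simps)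
  have "\<forall>l. \<exists>k t. t \<in> mod_hom R (free R k) (Q l) \<and> bij_betw t (V k) (carrier (Q l))"
    using projective_iso_free[OF Qp] by metis
  then obtain m th where th: "\<And>l. th l \<in> mod_hom R (free R (m l)) (Q l)" "\<And>l. bij_betw (th l) (V (m l)) (carrier (Q l))" by metis
  have thb: "bij_betw (th l) (carrier (free R (m l))) (carrier (Q l))" for l using th(2) by simp
  note inv = mod_hom_inv[OF th(1) thb fr.left_module_axioms]
  have ths: "th l ` V (m l) = carrier (Q l)" and thi: "inj_on (th l) (V (m l))" for l using th(2)[of l] by (auto simp: bij_betw_def)
  have thc: "th l x \<in> carrier (Q l)" if "x \<in> V (m l)" for l x using mod_homD(1)[OF th(1)] that by simp
  have thz: "th l x = \<zero>\<^bsub>Q l\<^esub> \<longleftrightarrow> x = zv" if "x \<in> V (m l)" for l x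
  proof -
    have "th l zv = \<zero>\<^bsub>Q l\<^esub>" using mod_hom_zero[OF th(1) fr.left_module_axioms lm, of l] by simp
    then show ?thesis using inj_on_eq_iff[OF thi that, of zv] by auto
  qed
  define B where "B l x = inv_into (carrier (free R (m (l - 1)))) (th (l - 1)) (dd l (th l x))" for l x
  have Bh: "B l \<in> mod_hom R (free R (m l)) (free R (m (l - 1)))" for l
    unfolding B_def by (rule mod_hom_comp[OF mod_hom_comp[OF th(1) dh] inv(1)])
  have Bc: "B l x \<in> V (m (l - 1))" if "x \<in> V (m l)" for l x using mod_homD(1)[OF Bh] that by simp
  have tB: "th (l - 1) (B l x) = dd l (th l x)" if "x \<in> V (m l)" for l x
    unfolding B_def by (rule inv(4)) (rule mod_homD(1)[OF dh thc[OF that]])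
  have rows: "B l x = zv \<longleftrightarrow> x \<in> B (l + 1) ` V (m (l + 1))" if x: "x \<in> V (m l)" for l x
  proof -
    have "B l x = zv \<longleftrightarrow> th l x \<in> a_kernel (Q l) (Q (l - 1)) (dd l)"
      using thz[OF Bc[OF x]] tB[OF x] thc[OF x] by (simp add: a_kernel_def')
    also have "\<dots> \<longleftrightarrow> th l x \<in> dd (l + 1) ` (th (l + 1) ` V (m (l + 1)))" unfolding rQ[symmetric] ths ..
    also have "\<dots> \<longleftrightarrow> th l x \<in> th l ` (B (l + 1) ` V (m (l + 1)))"
      using tB[of _ "l + 1"] by (auto simp: image_iff)
    also have "\<dots> \<longleftrightarrow> x \<in> B (l + 1) ` V (m (l + 1))"
      by (rule inj_on_image_mem_iff[OF thi x]) (use Bc[of _ "l + 1"] in auto)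
    finally show ?thesis .
  qed
  have cols: "tr R (m (l - 1)) (m l) (B l) c = zv \<longleftrightarrow> c \<in> tr R (m (l - 2)) (m (l - 1)) (B (l - 1)) ` V (m (l - 2))"
    if c: "c \<in> V (m (l - 1))" for l c
  proof
    have l2: "l - 1 - 1 = l - 2" for l :: int by simp
    have Bh': "B (l - 1) \<in> mod_hom R (free R (m (l - 1))) (free R (m (l - 2)))" using Bh[of "l - 1"] by (simp add: l2)
    {
      assume z: "tr R (m (l - 1)) (m l) (B l) c = zv"
      \<comment> \<open>The column \<open>c\<close> read as a functional on
        \<open>Q (l - 1)\<close>, restricted to the carrier so that it is an element of the
        dual.\<close>
      define ph where "ph = (\<lambda>y\<in>carrier (Q (l - 1)). dot R (m (l - 1)) (inv_into (carrier (free R (m (l - 1)))) (th (l - 1)) y) c)"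
      have "(\<lambda>y. dot R (m (l - 1)) (inv_into (carrier (free R (m (l - 1)))) (th (l - 1)) y) c) \<in> mod_hom R (Q (l - 1)) (regular R)"
        by (rule mod_hom_comp[OF inv(1) dot_hom[OF c]])
      then have ph: "ph \<in> carrier (dual R (Q (l - 1)))" unfolding ph_def by (simp add: restrict_mod_hom[OF lm])
      have pht: "ph (th (l - 1) x) = dot R (m (l - 1)) x c" if x: "x \<in> V (m (l - 1))" for x
        using inv(3)[of x "l - 1"] thc[OF x] x by (simp add: ph_def)
      have "dual_map (Q l) (dd l) ph = \<zero>\<^bsub>dual R (Q l)\<^esub>"
      proof (rule extensionalityI)
        fix y assume y: "y \<in> carrier (Q l)"
        then have "y \<in> th l ` V (m l)" unfolding ths .
        then obtain x where x: "x \<in> V (m l)" "y = th l x" by blast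
        have "ph (dd l y) = dot R (m (l - 1)) (B l x) c" using tB[OF x(1)] pht[OF Bc[OF x(1)]] x(2) by simp
        then show "dual_map (Q l) (dd l) ph y = \<zero>\<^bsub>dual R (Q l)\<^esub> y"
          using tr_zero_iff[OF Bh c] z x(1) y by (simp add: dual_map_def)
      qed (auto simp: dual_map_def)
      then have "ph \<in> a_kernel (dual R (Q (l - 1))) (dual R (Q (l - 1 + 1))) (dual_map (Q (l - 1 + 1)) (dd (l - 1 + 1)))"
        using ph by (simp add: a_kernel_def' del: dual_simps)
      then have "ph \<in> dual_map (Q (l - 1)) (dd (l - 1)) ` carrier (dual R (Q (l - 2)))" unfolding cQ[symmetric] l2 .
      then obtain ps where ps: "ps \<in> mod_hom R (Q (l - 2)) (regular R)" "ph = dual_map (Q (l - 1)) (dd (l - 1)) ps" by auto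
      have pt: "(\<lambda>x. ps (th (l - 2) x)) \<in> mod_hom R (free R (m (l - 2))) (regular R)" by (rule mod_hom_comp[OF th(1) ps(1)])
      let ?b = "covec R (m (l - 2)) (\<lambda>x. ps (th (l - 2) x))"
      have b: "?b \<in> V (m (l - 2))" by (rule covec_closed[OF pt])
      have "c = tr R (m (l - 2)) (m (l - 1)) (B (l - 1)) ?b"
      proof (rule dot_nondeg[OF c tr_closed[OF Bh' b]])
        fix x assume x: "x \<in> V (m (l - 1))"
        have Bx: "B (l - 1) x \<in> V (m (l - 2))" using Bc[OF x] by (simp add: l2)
        have "dot R (m (l - 1)) x c = ps (dd (l - 1) (th (l - 1) x))"
          using pht[OF x] ps(2) thc[OF x] by (simp add: dual_map_def)
        also have "\<dots> = ps (th (l - 2) (B (l - 1) x))" using tB[OF x] by (simp add: l2)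
        also have "\<dots> = dot R (m (l - 1)) x (tr R (m (l - 2)) (m (l - 1)) (B (l - 1)) ?b)"
          using functional_eq[OF pt Bx] tr_adj[OF Bh' b x] by simp
        finally show "dot R (m (l - 1)) x c = dot R (m (l - 1)) x (tr R (m (l - 2)) (m (l - 1)) (B (l - 1)) ?b)" .
      qed
      then show "c \<in> tr R (m (l - 2)) (m (l - 1)) (B (l - 1)) ` V (m (l - 2))" using b by blast
    }
    assume "c \<in> tr R (m (l - 2)) (m (l - 1)) (B (l - 1)) ` V (m (l - 2))"
    then obtain b where b: "b \<in> V (m (l - 2))" "c = tr R (m (l - 2)) (m (l - 1)) (B (l - 1)) b" by blast
    have "dot R (m (l - 1)) (B l x) c = \<zero>" if x: "x \<in> V (m l)" for x
    proof -
      have "B (l - 1) (B l x) = zv" using rows[OF Bc[OF x]] x by auto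
      then show ?thesis using tr_adj[OF Bh' b(1) Bc[OF x]] b(2) dot_zero[of "m (l - 2)" zv b] coords_i[OF b(1)] by simp
    qed
    then show "tr R (m (l - 1)) (m l) (B l) c = zv" using tr_zero_iff[OF Bh c] by blast
  qed
  obtain f where f: "f \<in> mod_hom R (sub (P (i - 1)) (d i ` carrier (P i))) M" "bij_betw f (d i ` carrier (P i)) (carrier M)"
    using iso unfolding mod_iso_def by auto
  have Q0: "P i = Q 0" "d i = dd 0" "P (i - 1) = Q (- 1)" by (simp_all add: Q_def dd_def)
  have im: "submodule (dd 0 ` carrier (Q 0)) R (Q (- 1))"
    using image_submodule[OF _ lm lm lmod.carrier_submodule[OF lmod.intro[OF lm]], of "dd 0" 0 "-1"] dh[of 0] by simp
  note f' = f[unfolded Q0]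
  have d0: "dd 0 \<in> mod_hom R (Q 0) (sub (Q (- 1)) (dd 0 ` carrier (Q 0)))"
    by (rule mod_hom_sub_cod) (use dh[of 0] in auto)
  define \<pi> where "\<pi> x = f (dd 0 (th 0 x))" for x
  have pi: "\<pi> \<in> mod_hom R (free R (m 0)) M" unfolding \<pi>_def by (rule mod_hom_comp[OF mod_hom_comp[OF th(1) d0] f'(1)])
  have "\<pi> ` V (m 0) = f ` (dd 0 ` (th 0 ` V (m 0)))" by (simp add: \<pi>_def image_image)
  then have pis: "\<pi> ` V (m 0) = carrier M" using f'(2) unfolding ths by (simp add: bij_betw_def)
  have pik: "\<pi> x = \<zero>\<^bsub>M\<^esub> \<longleftrightarrow> B 0 x = zv" if x: "x \<in> V (m 0)" for x
  proof -
    have lmi: "left_module R (sub (Q (- 1)) (dd 0 ` carrier (Q 0)))" by (rule lmod.sub_left_module[OF lmod.intro[OF lm] im])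
    have y: "dd 0 (th 0 x) \<in> dd 0 ` carrier (Q 0)" using thc[OF x] by blast
    have "a_kernel (sub (Q (- 1)) (dd 0 ` carrier (Q 0))) M f = {\<zero>\<^bsub>Q (- 1)\<^esub>}"
      using inj_on_kernel[OF f'(1) lmi M] f'(2) by (simp add: bij_betw_def)
    then have "f (dd 0 (th 0 x)) = \<zero>\<^bsub>M\<^esub> \<longleftrightarrow> dd 0 (th 0 x) = \<zero>\<^bsub>Q (- 1)\<^esub>" using y by (auto simp: a_kernel_def')
    also have "\<dots> \<longleftrightarrow> B 0 x = zv" using thz[OF Bc[OF x]] tB[OF x] by simp
    finally show ?thesis by (simp add: \<pi>_def)
  qed
  show ?thesis by (rule that[of B m \<pi>]) (use Bh rows cols pi pis pik in blast)+
qed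

text \<open>The half of the complete complex in degrees \<open>\<ge> 0\<close> resolves
  \<open>M\<close> and is exact in the dual, while \<open>B 0\<close> factors through an embedding
  of \<open>M\<close> into a free module.\<close>

lemma Gorenstein_semi_Gorenstein:
  assumes M: "fl_module R M" and gp: "Gorenstein_projective R M"
  shows "semi_Gorenstein_projective R M" "torsionless R M"
proof -
  have lm: "left_module R M" using M by (simp add: fl_module_def)
  obtain m :: "int \<Rightarrow> nat" and B \<pi> where
    hom: "\<forall>l. B l \<in> mod_hom R (free R (m l)) (free R (m (l - 1)))"
    and rows: "\<forall>l. \<forall>x\<in>V (m l). B l x = zv \<longleftrightarrow> x \<in> B (l + 1) ` V (m (l + 1))"
    and cols: "\<forall>l. \<forall>c\<in>V (m (l - 1)). tr R (m (l - 1)) (m l) (B l) c = zv \<longleftrightarrow> c \<in> tr R (m (l - 2)) (m (l - 1)) (B (l - 1)) ` V (m (l - 2))"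
    and pi: "\<pi> \<in> mod_hom R (free R (m 0)) M" "\<pi> ` V (m 0) = carrier M" "\<forall>x\<in>V (m 0). \<pi> x = \<zero>\<^bsub>M\<^esub> \<longleftrightarrow> B 0 x = zv"
    by (rule Gorenstein_free_complex[OF lm gp])
  define n where "n k = m (int k)" for k
  \<comment> \<open>A shift by one: \<open>D k\<close> starts at place \<open>k + 1\<close>, whereas
    \<open>B l\<close> starts at degree \<open>l\<close>.\<close>
  define D where "D k = B (int k + 1)" for k
  have ar: "int (Suc k) = int k + 1" for k by simp
  have h: "D k \<in> mod_hom R (free R (n (Suc k))) (free R (n k))" for k
    using spec[OF hom, of "int k + 1"] by (simp add: n_def D_def ar del: of_nat_Suc)
  have r: "D k x = zv \<longleftrightarrow> x \<in> D (Suc k) ` V (n (Suc (Suc k)))" if "x \<in> V (n (Suc k))" for k x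
    using bspec[OF spec[OF rows, of "int k + 1"], of x] that by (simp add: n_def D_def ar del: of_nat_Suc)
  have c: "tr R (n (Suc k)) (n (Suc (Suc k))) (D (Suc k)) b = zv \<longleftrightarrow> b \<in> tr R (n k) (n (Suc k)) (D k) ` V (n k)"
    if "b \<in> V (n (Suc k))" for k b
  proof -
    have i: "int k + 2 - 1 = int k + 1" "int k + 2 - 2 = int k" "int (Suc (Suc k)) = int k + 2" "int (Suc k) + 1 = int k + 2"
      "int (Suc k) = int k + 1" "int k + 1 + 1 = int k + 2" by simp_all
    show ?thesis using bspec[OF spec[OF cols, of "int k + 2", unfolded i], of b] that unfolding n_def D_def i by blast
  qed
  have pk: "a_kernel (free R (n 0)) M \<pi> = D 0 ` V (n (Suc 0))"
  proof -
    have "\<pi> x = \<zero>\<^bsub>M\<^esub> \<longleftrightarrow> x \<in> D 0 ` V (n (Suc 0))" if "x \<in> V (n 0)" for x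
      using pi(3) bspec[OF spec[OF rows, of 0], of x] that by (simp add: n_def D_def)
    moreover have "D 0 x \<in> V (n 0)" if "x \<in> V (n (Suc 0))" for x using mod_homD(1)[OF h, of x 0] that by simp
    ultimately show ?thesis by (auto simp: a_kernel_def')
  qed
  have res: "proj_resolution R (\<lambda>k. free R (n k)) D \<pi> M"
    unfolding proj_resolution_def
  proof (intro conjI allI)
    show "D (Suc i) ` carrier (free R (n (Suc (Suc i)))) = a_kernel (free R (n (Suc i))) (free R (n i)) (D i)" for i
      using r mod_homD(1)[OF h, of _ "Suc i"] by (auto simp: a_kernel_def')
  qed (use free_projective h pi pk in \<open>simp_all add: n_def\<close>)
  have "ext_vanishes R j M (regular R)" for j
    unfolding ext_vanishes_def
  proof (intro exI[of _ "\<lambda>k. free R (n k)"] exI[of _ D] exI[of _ \<pi>] conjI ballI impI res)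
    fix \<phi> assume \<phi>: "\<phi> \<in> mod_hom R (free R (n (Suc j))) (regular R)"
      and z: "\<forall>x\<in>carrier (free R (n (Suc (Suc j)))). \<phi> (D (Suc j) x) = \<zero>\<^bsub>regular R\<^esub>"
    let ?b = "covec R (n (Suc j)) \<phi>"
    have b: "?b \<in> V (n (Suc j))" "\<And>x. x \<in> V (n (Suc j)) \<Longrightarrow> \<phi> x = dot R (n (Suc j)) x ?b"
      using covec_closed[OF \<phi>] functional_eq[OF \<phi>] by auto
    have "dot R (n (Suc j)) (D (Suc j) x) ?b = \<zero>" if x: "x \<in> V (n (Suc (Suc j)))" for x
      using b(2)[of "D (Suc j) x"] mod_homD(1)[OF h, of x "Suc j"] x z by simp
    then have "tr R (n (Suc j)) (n (Suc (Suc j))) (D (Suc j)) ?b = zv" using tr_zero_iff[OF h b(1)] by blast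
    then obtain c' where c': "c' \<in> V (n j)" "?b = tr R (n j) (n (Suc j)) (D j) c'" using c[OF b(1)] by blast
    show "\<exists>g\<in>mod_hom R (free R (n j)) (regular R). \<forall>x\<in>carrier (free R (n (Suc j))). \<phi> x = g (D j x)"
      by (rule bexI[OF _ dot_hom[OF c'(1)]]) (use b(2) c'(2) tr_adj[OF h c'(1)] in simp)
  qed
  then show "semi_Gorenstein_projective R M" using M by (simp add: semi_Gorenstein_projective_def)
  have B0: "B 0 \<in> mod_hom R (free R (m 0)) (free R (m (- 1)))" using spec[OF hom, of 0] by simp
  have ps: "\<pi> ` carrier (free R (m 0)) = carrier M" using pi(2) by simp
  have pz: "B 0 x = \<zero>\<^bsub>free R (m (- 1))\<^esub>" if "x \<in> carrier (free R (m 0))" "\<pi> x = \<zero>\<^bsub>M\<^esub>" for x using pi(3) that by simp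
  obtain u where u: "u \<in> mod_hom R M (free R (m (- 1)))" "\<And>x. x \<in> carrier (free R (m 0)) \<Longrightarrow> u (\<pi> x) = B 0 x"
  proof (rule mod_hom_factor[OF pi(1) ps B0 fr.left_module_axioms lm fr.left_module_axioms pz])
    fix u assume "u \<in> mod_hom R M (free R (m (- 1)))" "\<And>x. x \<in> carrier (free R (m 0)) \<Longrightarrow> u (\<pi> x) = B 0 x"
    then show thesis by (rule that)
  qed
  interpret M: lmod R M by (rule lmod.intro) (rule lm)
  have "a_kernel M (free R (m (- 1))) u = {\<zero>\<^bsub>M\<^esub>}"
  proof (intro equalityI subsetI)
    fix y assume "y \<in> a_kernel M (free R (m (- 1))) u"
    then have y: "y \<in> \<pi> ` V (m 0)" "u y = zv" using pi(2) by (auto simp: a_kernel_def')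
    then obtain x where "x \<in> V (m 0)" "y = \<pi> x" by blast
    then show "y \<in> {\<zero>\<^bsub>M\<^esub>}" using u(2) y(2) pi(3) by simp
  next
    fix y assume "y \<in> {\<zero>\<^bsub>M\<^esub>}"
    then show "y \<in> a_kernel M (free R (m (- 1))) u" using mod_hom_zero[OF u(1) lm fr.left_module_axioms] M.M.zero_closed by (simp add: a_kernel_def')
  qed
  then have "inj_on u (carrier M)" using inj_on_kernel[OF u(1) lm fr.left_module_axioms] by simp
  then show "torsionless R M" unfolding torsionless_def using u(1) free_projective by blast
qed

text \<open>The transposes of the lifts of the identity of \<open>M\<close> to its two presentations compare the
  minimal resolution of \<open>Tr M\<close> with the dual of the given complete complex.\<close>
theorem Gorenstein_core:
  assumes M: "fl_module R M" and ne: "\<not> ext1_top_vanishes R J" and ind: "indecomposable R M"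
    and np: "\<not> projective R M" and gp: "Gorenstein_projective R M"
  obtains n0 q n1 D0 \<nu> G where "q \<in> mod_hom R (free R n0) M" "q ` V n0 = carrier M"
    "D0 \<in> mod_hom R (free R n1) (free R n0)" "a_kernel (free R n0) M q = D0 ` V n1"
    "core_complex (opp R) J e a \<nu> G" "\<nu> 0 = n1" "\<nu> (Suc 0) = n0" "G 0 = tr R n0 n1 D0"
proof -
  interpret op: short_local_ring "opp R" J e a by (rule opp_short)
  have lm: "left_module R M" and fin: "mod_length R M \<noteq> \<infinity>" using M by (auto simp: fl_module_def)
  obtain m :: "int \<Rightarrow> nat" and B \<pi> where
    hom: "\<forall>l. B l \<in> mod_hom R (free R (m l)) (free R (m (l - 1)))"
    and rows: "\<forall>l. \<forall>x\<in>V (m l). B l x = zv \<longleftrightarrow> x \<in> B (l + 1) ` V (m (l + 1))"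
    and cols: "\<forall>l. \<forall>c\<in>V (m (l - 1)). tr R (m (l - 1)) (m l) (B l) c = zv \<longleftrightarrow> c \<in> tr R (m (l - 2)) (m (l - 1)) (B (l - 1)) ` V (m (l - 2))"
    and pi: "\<pi> \<in> mod_hom R (free R (m 0)) M" "\<pi> ` V (m 0) = carrier M" "\<forall>x\<in>V (m 0). \<pi> x = \<zero>\<^bsub>M\<^esub> \<longleftrightarrow> B 0 x = zv"
    by (rule Gorenstein_free_complex[OF lm gp])
  obtain n0 q n1 D0 where p: "q \<in> mod_hom R (free R n0) M" "q ` V n0 = carrier M"
    "D0 \<in> mod_hom R (free R n1) (free R n0)" "a_kernel (free R n0) M q = D0 ` V n1"
    and r0: "\<And>x. x \<in> V n1 \<Longrightarrow> D0 x \<in> coords R J n0"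
    using min_presentation[OF lm fin] by metis
  have kJ: "a_kernel (free (opp R) n0) (free (opp R) n1) (tr R n0 n1 D0) \<subseteq> coords R J n0"
    using relations_rad[OF lm ind np p] by (auto simp: a_kernel_def')
  have B1: "B 1 \<in> mod_hom R (free R (m 1)) (free R (m 0))" using spec[OF hom, of 1] by simp
  have pk: "\<pi> x = \<zero>\<^bsub>M\<^esub> \<longleftrightarrow> x \<in> B 1 ` V (m 1)" if "x \<in> V (m 0)" for x
    using pi(3) bspec[OF spec[OF rows, of 0], of x] that by simp
  have qk: "q x = \<zero>\<^bsub>M\<^esub> \<longleftrightarrow> x \<in> D0 ` V n1" if "x \<in> V n0" for x
    using that unfolding p(4)[symmetric] by (simp add: a_kernel_def')
  have D0c: "D0 x \<in> V n0" if "x \<in> V n1" for x using mod_homD(1)[OF p(3)] that by simp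
  have B1c: "B 1 x \<in> V (m 0)" if "x \<in> V (m 1)" for x using mod_homD(1)[OF B1] that by simp
  obtain a0 where a0: "a0 \<in> mod_hom R (free R n0) (free R (m 0))" "\<And>x. x \<in> V n0 \<Longrightarrow> \<pi> (a0 x) = q x"
    using lift_free[OF p(1) pi(1) fr.left_module_axioms lm] p(2) pi(2) by auto
  obtain b0 where b0: "b0 \<in> mod_hom R (free R (m 0)) (free R n0)" "\<And>x. x \<in> V (m 0) \<Longrightarrow> q (b0 x) = \<pi> x"
    using lift_free[OF pi(1) p(1) fr.left_module_axioms lm] p(2) pi(2) by auto
  have a0c: "a0 x \<in> V (m 0)" if "x \<in> V n0" for x using mod_homD(1)[OF a0(1)] that by simp
  have b0c: "b0 x \<in> V n0" if "x \<in> V (m 0)" for x using mod_homD(1)[OF b0(1)] that by simp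
  have "(\<lambda>x. a0 (D0 x)) ` V n1 \<subseteq> B 1 ` carrier (free R (m 1))"
    using pk[OF a0c[OF D0c]] a0(2)[OF D0c] qk[OF D0c] by auto
  then obtain a1 where a1: "a1 \<in> mod_hom R (free R n1) (free R (m 1))" "\<And>x. x \<in> V n1 \<Longrightarrow> B 1 (a1 x) = a0 (D0 x)"
    using lift_free[OF mod_hom_comp[OF p(3) a0(1)] B1 fr.left_module_axioms fr.left_module_axioms] by blast
  have "(\<lambda>x. b0 (B 1 x)) ` V (m 1) \<subseteq> D0 ` carrier (free R n1)"
    using qk[OF b0c[OF B1c]] b0(2)[OF B1c] pk[OF B1c] by auto
  then obtain b1 where b1: "b1 \<in> mod_hom R (free R (m 1)) (free R n1)" "\<And>x. x \<in> V (m 1) \<Longrightarrow> D0 (b1 x) = b0 (B 1 x)"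
    using lift_free[OF mod_hom_comp[OF B1 b0(1)] p(3) fr.left_module_axioms fr.left_module_axioms] by blast
  let ?e = "\<lambda>x. b0 (a0 x) \<ominus>\<^bsub>free R n0\<^esub> x"
  have eh: "?e \<in> mod_hom R (free R n0) (free R n0)"
    by (rule mod_hom_diff[OF mod_hom_comp[OF a0(1) b0(1)] mod_hom_id fr.left_module_axioms])
  have ba: "b0 (a0 x) \<in> carrier (free R n0)" if "x \<in> V n0" for x using b0c[OF a0c[OF that]] by simp
  have "?e ` V n0 \<subseteq> D0 ` carrier (free R n1)"
  proof
    fix y assume "y \<in> ?e ` V n0"
    then obtain x where x: "x \<in> V n0" "y = ?e x" by blast
    have "y \<in> a_kernel (free R n0) M q"
      using kernel_eq_iff[OF p(1) fr.left_module_axioms lm ba[OF x(1)], of x] b0(2)[OF a0c[OF x(1)]] a0(2) x by simp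
    then show "y \<in> D0 ` carrier (free R n1)" using p(4) by simp
  qed
  then obtain s where s: "s \<in> mod_hom R (free R n0) (free R n1)" "\<And>x. x \<in> V n0 \<Longrightarrow> D0 (s x) = ?e x"
    using lift_free[OF eh p(3) fr.left_module_axioms fr.left_module_axioms] by blast
  \<comment> \<open>The columns of the complete complex, in degrees from 1 downwards. The first map
    is the transpose of \<open>B 1\<close>, whose cokernel plays the part of \<open>Tr M\<close>;
    place \<open>k\<close> carries degree \<open>1 - k\<close>.\<close>
  define P' where "P' k = free (opp R) (m (1 - int k))" for k
  define d' where "d' k = tr R (m (- int k)) (m (1 - int k)) (B (1 - int k))" for k
  have Bk: "B (1 - int k) \<in> mod_hom R (free R (m (1 - int k))) (free R (m (- int k)))" for k
    using spec[OF hom, of "1 - int k"] by simp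
  have ar: "1 - int (Suc k) = - int k" "- int (Suc k) = - int k - 1" for k by simp_all
  have P': "proj_complex (opp R) P' d'"
    unfolding proj_complex_def
  proof (intro allI conjI)
    fix k
    show "projective (opp R) (P' k)" by (simp add: P'_def op.free_projective)
    show "d' k \<in> mod_hom (opp R) (P' (Suc k)) (P' k)" unfolding P'_def d'_def ar by (rule tr_hom[OF Bk])
    have "tr R (m (- int k)) (m (1 - int k)) (B (1 - int k)) c = zv \<longleftrightarrow>
      c \<in> tr R (m (- int k - 1)) (m (- int k)) (B (- int k)) ` V (m (- int k - 1))" if "c \<in> V (m (- int k))" for c
    proof -
      have i: "1 - int k - 1 = - int k" "1 - int k - 2 = - int k - 1" by simp_all
      show ?thesis using bspec[OF spec[OF cols, of "1 - int k", unfolded i], of c] that by blast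
    qed
    moreover have "tr R (m (- int k - 1)) (m (- int k)) (B (- int k)) c \<in> V (m (- int k))" if "c \<in> V (m (- int k - 1))" for c
      by (rule tr_closed[OF spec[OF hom] that])
    ultimately show "a_kernel (P' (Suc k)) (P' k) (d' k) = d' (Suc k) ` carrier (P' (Suc (Suc k)))"
      unfolding P'_def d'_def ar by (auto simp: a_kernel_def')
  qed
  \<comment> \<open>Dualizing the columns gives back the rows, so this is exactness of the given
    complex itself.\<close>
  have DE: "dual_exact (opp R) P' d' j" for j
    unfolding dual_exact_def
  proof (intro ballI impI)
    fix \<phi> assume "\<phi> \<in> mod_hom (opp R) (P' (Suc j)) (regular (opp R))"
      and z: "\<forall>c\<in>carrier (P' (Suc (Suc j))). \<phi> (d' (Suc j) c) = \<zero>\<^bsub>opp R\<^esub>"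
    then have \<phi>: "\<phi> \<in> mod_hom (opp R) (free (opp R) (m (- int j))) (regular (opp R))" by (simp add: P'_def)
    let ?x = "covec R (m (- int j)) \<phi>"
    have x: "?x \<in> V (m (- int j))" using op.covec_closed[OF \<phi>] by simp
    have \<phi>x: "\<phi> c = dot R (m (- int j)) ?x c" if "c \<in> V (m (- int j))" for c using op.functional_eq[OF \<phi>, of c] that by simp
    have Bj: "B (- int j) \<in> mod_hom R (free R (m (- int j))) (free R (m (- int j - 1)))" using spec[OF hom, of "- int j"] by simp
    have "B (- int j) ?x = zv"
    proof (rule dot_nondeg_left[OF _ zv_coords(3)])
      show "B (- int j) ?x \<in> V (m (- int j - 1))" using mod_homD(1)[OF Bj] x by simp
      fix c assume c: "c \<in> V (m (- int j - 1))"
      have "dot R (m (- int j - 1)) (B (- int j) ?x) c = \<phi> (tr R (m (- int j - 1)) (m (- int j)) (B (- int j)) c)"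
        using tr_adj[OF Bj c x] \<phi>x[OF tr_closed[OF Bj c]] by simp
      also have "\<dots> = \<zero>" using z c unfolding P'_def d'_def ar by simp
      finally show "dot R (m (- int j - 1)) (B (- int j) ?x) c = dot R (m (- int j - 1)) zv c"
        using dot_zero[of "m (- int j - 1)" zv c] coords_i[OF c] by simp
    qed
    then obtain y where y: "y \<in> V (m (1 - int j))" "?x = B (1 - int j) y"
      using bspec[OF spec[OF rows, of "- int j"] x] by (auto simp: add.commute)
    show "\<exists>\<psi>\<in>mod_hom (opp R) (P' j) (regular (opp R)). \<forall>c\<in>carrier (P' (Suc j)). \<phi> c = \<psi> (d' j c)"
      unfolding P'_def d'_def ar
      by (rule bexI[OF _ dot_hom_right[OF y(1)]]) (use \<phi>x y tr_adj[OF Bk _ y(1)] in simp)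
  qed
  obtain \<nu> G where C: "min_complex (opp R) J e a \<nu> G" "\<nu> 0 = n1" "\<nu> (Suc 0) = n0" "G 0 = tr R n0 n1 D0"
  proof (rule op.resolution_to_complex[OF tr_hom[OF p(3)]])
    show "a_kernel (free (opp R) n0) (free (opp R) n1) (tr R n0 n1 D0) \<subseteq> coords (opp R) J n0" using kJ by simp
    show "tr R n0 n1 D0 x \<in> coords (opp R) J n1" if "x \<in> coords (opp R) (carrier (opp R)) n0" for x
      using tr_rad[OF p(3) r0, of x] that by simp
    fix P d j assume P: "proj_complex (opp R) P d" and P0: "P 0 = free (opp R) n1" "P (Suc 0) = free (opp R) n0" "d 0 = tr R n0 n1 D0"
    have P'0: "P' 0 = free (opp R) (m 1)" "P' (Suc 0) = free (opp R) (m 0)" "d' 0 = tr R (m 0) (m 1) (B 1)"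
      by (simp_all add: P'_def d'_def)
    have "comparable (opp R) P d P' d' 0"
      unfolding comparable_def P0 P'0
    proof (intro exI conjI ballI)
      show "tr R n1 (m 1) b1 \<in> mod_hom (opp R) (free (opp R) n1) (free (opp R) (m 1))" by (rule tr_hom[OF b1(1)])
      show "tr R (m 1) n1 a1 \<in> mod_hom (opp R) (free (opp R) (m 1)) (free (opp R) n1)" by (rule tr_hom[OF a1(1)])
      show "tr R n0 (m 0) b0 \<in> mod_hom (opp R) (free (opp R) n0) (free (opp R) (m 0))" by (rule tr_hom[OF b0(1)])
      show "tr R (m 0) n0 a0 \<in> mod_hom (opp R) (free (opp R) (m 0)) (free (opp R) n0)" by (rule tr_hom[OF a0(1)])
      show "tr R n1 n0 s \<in> mod_hom (opp R) (free (opp R) n1) (free (opp R) n0)" by (rule tr_hom[OF s(1)])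
      show "tr R (m 0) (m 1) (B 1) (tr R n0 (m 0) b0 x) = tr R n1 (m 1) b1 (tr R n0 n1 D0 x)"
        if "x \<in> carrier (free (opp R) n0)" for x
      proof -
        have x: "x \<in> V n0" using that by simp
        show ?thesis
          unfolding tr_comp[OF B1 b0(1) x, symmetric] tr_comp[OF b1(1) p(3) x, symmetric]
          by (rule tr_cong) (simp add: b1(2))
      qed
      show "tr R n0 n1 D0 (tr R (m 0) n0 a0 x) = tr R (m 1) n1 a1 (tr R (m 0) (m 1) (B 1) x)"
        if "x \<in> carrier (free (opp R) (m 0))" for x
      proof -
        have x: "x \<in> V (m 0)" using that by simp
        show ?thesis
          unfolding tr_comp[OF p(3) a0(1) x, symmetric] tr_comp[OF a1(1) B1 x, symmetric]
          by (rule tr_cong) (simp add: a1(2))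
      qed
      \<comment> \<open>Transposing reverses compositions: \<open>b0 a0 = 1 + D0 s\<close> on rows
        becomes the identity plus the transpose of \<open>s\<close> after that of \<open>D0\<close>
        on columns. Equality holds here even before the outer differential is applied.\<close>
      show "tr R n0 n1 D0 (tr R (m 0) n0 a0 (tr R n0 (m 0) b0 x)) =
         tr R n0 n1 D0 (x \<oplus>\<^bsub>free (opp R) n0\<^esub> tr R n1 n0 s (tr R n0 n1 D0 x))"
        if "x \<in> carrier (free (opp R) n0)" for x
      proof -
        have x: "x \<in> V n0" using that by simp
        have tx: "tr R n1 n0 s (tr R n0 n1 D0 x) \<in> V n0" by (rule tr_closed[OF s(1) tr_closed[OF p(3) x]])
        have "tr R (m 0) n0 a0 (tr R n0 (m 0) b0 x) = (\<lambda>i. x i \<oplus> tr R n1 n0 s (tr R n0 n1 D0 x) i)"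
        proof (rule dot_nondeg[OF tr_closed[OF a0(1) tr_closed[OF b0(1) x]]])
          show "(\<lambda>i. x i \<oplus> tr R n1 n0 s (tr R n0 n1 D0 x) i) \<in> V n0" using x tx by (auto simp: coords_def)
          fix y assume y: "y \<in> V n0"
          have sy: "s y \<in> V n1" using mod_homD(1)[OF s(1)] y by simp
          have "dot R n0 y (tr R (m 0) n0 a0 (tr R n0 (m 0) b0 x)) = dot R n0 (b0 (a0 y)) x"
            using tr_adj[OF a0(1) tr_closed[OF b0(1) x] y] tr_adj[OF b0(1) x a0c[OF y]] by simp
          also have "b0 (a0 y) = D0 (s y) \<oplus>\<^bsub>free R n0\<^esub> y"
            using s(2)[OF y] fr.minus_add_cancel[OF ba[OF y], of y] y by simp
          also have "dot R n0 (D0 (s y) \<oplus>\<^bsub>free R n0\<^esub> y) x = dot R n0 (D0 (s y)) x \<oplus> dot R n0 y x"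
            using mod_homD(2)[OF dot_hom[OF x], of "D0 (s y)" y] D0c[OF sy] y by simp
          also have "dot R n0 (D0 (s y)) x = dot R n0 y (tr R n1 n0 s (tr R n0 n1 D0 x))"
            using tr_adj[OF p(3) x sy] tr_adj[OF s(1) tr_closed[OF p(3) x] y] by simp
          finally show "dot R n0 y (tr R (m 0) n0 a0 (tr R n0 (m 0) b0 x)) = dot R n0 y (\<lambda>i. x i \<oplus> tr R n1 n0 s (tr R n0 n1 D0 x) i)"
            using dot_add_right[OF y x tx] dot_closed[OF y x] dot_closed[OF y tx] by (simp add: a_comm)
        qed
        then show ?thesis by simp
      qed
    qed
    then show "\<exists>P' d'. proj_complex (opp R) P' d' \<and> comparable (opp R) P d P' d' 0 \<and> dual_exact (opp R) P' d' j"
      using P' DE by blast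
  next
    fix \<nu> G assume "min_complex (opp R) J e a \<nu> G" "\<nu> 0 = n1" "\<nu> (Suc 0) = n0" "G 0 = tr R n0 n1 D0"
    then show thesis by (rule that)
  qed
  have "core_complex (opp R) J e a \<nu> G"
    by (rule core_opp[OF C(1) ne]) (use generators_nonzero[OF lm ind p(1,2)] C(3) in simp)
  from that[OF p this C(2-4)] show ?thesis .
qed

end

section \<open>Short local algebras\<close>

text \<open>The geometric series \<open>1 - v + v^2\<close>.\<close>

lemma (in ring) one_plus_nilpotent_inverse:
  assumes v: "v \<in> carrier R" "v \<otimes> v \<otimes> v = \<zero>"
  shows "\<exists>t\<in>carrier R. (\<one> \<oplus> v) \<otimes> t = \<one> \<and> t \<otimes> (\<one> \<oplus> v) = \<one>"
proof
  have v': "v \<otimes> (v \<otimes> v) = \<zero>" using v m_assoc by simp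
  let ?t = "\<one> \<ominus> v \<oplus> v \<otimes> v"
  show "?t \<in> carrier R" using v by simp
  have "(\<one> \<oplus> v) \<otimes> ?t = ?t \<oplus> (v \<ominus> v \<otimes> v \<oplus> v \<otimes> (v \<otimes> v))"
    using v(1) by (simp add: l_distr r_distr minus_eq r_minus minus_add a_ac)
  moreover have "?t \<otimes> (\<one> \<oplus> v) = ?t \<oplus> (v \<ominus> v \<otimes> v \<oplus> v \<otimes> v \<otimes> v)"
    using v(1) by (simp add: l_distr r_distr minus_eq l_minus minus_add a_ac)
  moreover have "?t \<oplus> (v \<ominus> v \<otimes> v) = \<one>"
  proof -
    have "?t \<oplus> (v \<ominus> v \<otimes> v) = \<one> \<oplus> (\<ominus> v \<oplus> (v \<otimes> v \<oplus> (v \<oplus> \<ominus> (v \<otimes> v))))"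
      using v(1) by (simp add: minus_eq a_assoc)
    also have "v \<otimes> v \<oplus> (v \<oplus> \<ominus> (v \<otimes> v)) = v" using v(1) by (simp add: a_lcomm r_neg)
    finally show ?thesis using v(1) by (simp add: l_neg)
  qed
  ultimately show "(\<one> \<oplus> v) \<otimes> ?t = \<one> \<and> ?t \<otimes> (\<one> \<oplus> v) = \<one>" using v v' by simp
qed

context short_local_algebra
begin

text \<open>All conditions come from \<open>A = k 1 + J\<close>, which is what the residue field
  condition gives. Scalars are central, so centrality holds up to \<open>J\<close>; an element
  outside \<open>J\<close> is a nonzero scalar plus an element of \<open>J\<close>, and after
  division by the scalar the geometric series inverts it.\<close>

lemma algebra_short_local_ring:
  assumes hilb: "hilbert_type A e a"
  shows "short_local_ring A (jacobson_radical A) e a"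
proof -
  let ?J = "jacobson_radical A"
  interpret reg: lmod A "regular A" by (rule lmod.intro) (rule regular_left_module[OF A.ring_axioms])
  obtain I where I: "maximal_submodule I A (regular A)" "\<And>I'. maximal_submodule I' A (regular A) \<Longrightarrow> I' = I"
    using unique_maximal_left_ideal by blast
  have IC: "I \<subseteq> carrier A" using submodD(1)[of I A "regular A"] I(1) by (simp add: maximal_submodule_def)
  have "{I. maximal_submodule I A (regular A)} = {I}" using I by blast
  then have JI: "?J = I" using IC by (auto simp: jacobson_radical_def)
  have sub: "submodule ?J A (regular A)" and ne: "?J \<noteq> carrier A" using I(1) by (auto simp: maximal_submodule_def JI)
  note d = submodD[OF sub, simplified]
  have one: "\<one>\<^bsub>A\<^esub> \<notin> ?J"
  proof
    assume "\<one>\<^bsub>A\<^esub> \<in> ?J"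
    then have "x \<in> ?J" if "x \<in> carrier A" for x using d(5)[OF that] that by fastforce
    then show False using ne d(1) by blast
  qed
  have dec: "\<exists>c\<in>carrier K. x \<ominus>\<^bsub>A\<^esub> (c \<odot>\<^bsub>A\<^esub> \<one>\<^bsub>A\<^esub>) \<in> ?J" if x: "x \<in> carrier A" for x
  proof -
    have "?J +>\<^bsub>A\<^esub> x \<in> carrier (A Quot ?J)" using x by (auto simp: FactRing_def A_RCOSETS_def RCOSETS_def a_r_coset_def)
    then have "?J +>\<^bsub>A\<^esub> x \<in> (\<lambda>c. ?J +>\<^bsub>A\<^esub> (c \<odot>\<^bsub>A\<^esub> \<one>\<^bsub>A\<^esub>)) ` carrier K" using residue_field by (simp add: bij_betw_def)
    then obtain c where c: "c \<in> carrier K" "?J +>\<^bsub>A\<^esub> x = ?J +>\<^bsub>A\<^esub> (c \<odot>\<^bsub>A\<^esub> \<one>\<^bsub>A\<^esub>)" by blast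
    have "?J +>\<^bsub>regular A\<^esub> y = ?J +>\<^bsub>A\<^esub> y" for y by (simp add: a_r_coset_def')
    then have "x \<ominus>\<^bsub>A\<^esub> (c \<odot>\<^bsub>A\<^esub> \<one>\<^bsub>A\<^esub>) \<in> ?J"
      using reg.coset_eq_iff[OF sub, of x "c \<odot>\<^bsub>A\<^esub> \<one>\<^bsub>A\<^esub>"] c x by simp
    then show ?thesis using c(1) by blast
  qed
  have cen: "(c \<odot>\<^bsub>A\<^esub> \<one>\<^bsub>A\<^esub>) \<otimes>\<^bsub>A\<^esub> y = y \<otimes>\<^bsub>A\<^esub> (c \<odot>\<^bsub>A\<^esub> \<one>\<^bsub>A\<^esub>)" if "c \<in> carrier K" "y \<in> carrier A" for c y
    using that smult_mult_l[of c "\<one>\<^bsub>A\<^esub>" y] smult_mult_r[of c y "\<one>\<^bsub>A\<^esub>"] by simp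
  have dec': "\<exists>c\<in>carrier K. \<exists>j\<in>?J. x = c \<odot>\<^bsub>A\<^esub> \<one>\<^bsub>A\<^esub> \<oplus>\<^bsub>A\<^esub> j" if x: "x \<in> carrier A" for x
  proof -
    obtain c where c: "c \<in> carrier K" "x \<ominus>\<^bsub>A\<^esub> (c \<odot>\<^bsub>A\<^esub> \<one>\<^bsub>A\<^esub>) \<in> ?J" using dec[OF x] by blast
    have "x = c \<odot>\<^bsub>A\<^esub> \<one>\<^bsub>A\<^esub> \<oplus>\<^bsub>A\<^esub> (x \<ominus>\<^bsub>A\<^esub> (c \<odot>\<^bsub>A\<^esub> \<one>\<^bsub>A\<^esub>))"
      using reg.minus_add_cancel[of x "c \<odot>\<^bsub>A\<^esub> \<one>\<^bsub>A\<^esub>"] x c(1) d(2)[OF c(2)] by (simp add: reg.M.a_comm[simplified])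
    then show ?thesis using c by blast
  qed
  \<comment> \<open>As an intersection of left ideals, the radical is so far known to be a left
    ideal only. Right multiplication by a scalar equals left multiplication, and right
    multiplication by an element of \<open>J\<close> multiplies two elements of
    \<open>J\<close>.\<close>
  have right: "j \<otimes>\<^bsub>A\<^esub> x \<in> ?J" if j: "j \<in> ?J" and x: "x \<in> carrier A" for j x
  proof -
    obtain c j' where c: "c \<in> carrier K" "j' \<in> ?J" "x = c \<odot>\<^bsub>A\<^esub> \<one>\<^bsub>A\<^esub> \<oplus>\<^bsub>A\<^esub> j'" using dec'[OF x] by blast
    have "j \<otimes>\<^bsub>A\<^esub> x = (c \<odot>\<^bsub>A\<^esub> \<one>\<^bsub>A\<^esub>) \<otimes>\<^bsub>A\<^esub> j \<oplus>\<^bsub>A\<^esub> j \<otimes>\<^bsub>A\<^esub> j'"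
      using c j d(2) cen[OF c(1) d(2)[OF j]] by (simp add: A.r_distr)
    then show ?thesis using d(4)[OF d(5) d(5)] c j d(2) by simp
  qed
  have J3: "x \<otimes>\<^bsub>A\<^esub> y \<otimes>\<^bsub>A\<^esub> z = \<zero>\<^bsub>A\<^esub>" if "x \<in> ?J" "y \<in> ?J" "z \<in> ?J" for x y z
    using ideal_prod.prod[OF ideal_prod.prod[OF that(1,2)] that(3), of A] short by blast
  have unit: "\<exists>y\<in>carrier A. x \<otimes>\<^bsub>A\<^esub> y = \<one>\<^bsub>A\<^esub> \<and> y \<otimes>\<^bsub>A\<^esub> x = \<one>\<^bsub>A\<^esub>" if x: "x \<in> carrier A" "x \<notin> ?J" for x
  proof -
    obtain c j where c: "c \<in> carrier K" "j \<in> ?J" "x = c \<odot>\<^bsub>A\<^esub> \<one>\<^bsub>A\<^esub> \<oplus>\<^bsub>A\<^esub> j" using dec'[OF x(1)] by blast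
    have c0: "c \<noteq> \<zero>\<^bsub>K\<^esub>" using c x d(2) by auto
    let ?i = "inv\<^bsub>K\<^esub> c"
    have i: "?i \<in> carrier K" "?i \<otimes>\<^bsub>K\<^esub> c = \<one>\<^bsub>K\<^esub>" using c(1) c0 K.field_Units by auto
    let ?w = "?i \<odot>\<^bsub>A\<^esub> \<one>\<^bsub>A\<^esub>"
    have w: "?w \<in> carrier A" using i by simp
    have wc: "?w \<otimes>\<^bsub>A\<^esub> (c \<odot>\<^bsub>A\<^esub> \<one>\<^bsub>A\<^esub>) = \<one>\<^bsub>A\<^esub>"
      using i c(1) smult_mult_l[OF i(1), of "\<one>\<^bsub>A\<^esub>" "c \<odot>\<^bsub>A\<^esub> \<one>\<^bsub>A\<^esub>"] smult_assoc1[OF i(1) c(1), of "\<one>\<^bsub>A\<^esub>"] by simp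
    have wj: "?w \<otimes>\<^bsub>A\<^esub> j \<in> ?J" using d(5) w c(2) by simp
    have wx: "?w \<otimes>\<^bsub>A\<^esub> x = \<one>\<^bsub>A\<^esub> \<oplus>\<^bsub>A\<^esub> ?w \<otimes>\<^bsub>A\<^esub> j" using c w wc d(2) by (simp add: A.r_distr)
    obtain t where t: "t \<in> carrier A" "(?w \<otimes>\<^bsub>A\<^esub> x) \<otimes>\<^bsub>A\<^esub> t = \<one>\<^bsub>A\<^esub>" "t \<otimes>\<^bsub>A\<^esub> (?w \<otimes>\<^bsub>A\<^esub> x) = \<one>\<^bsub>A\<^esub>"
      unfolding wx using A.one_plus_nilpotent_inverse[OF d(2)[OF wj] J3[OF wj wj wj]] by blast
    have "x \<otimes>\<^bsub>A\<^esub> (?w \<otimes>\<^bsub>A\<^esub> t) = (?w \<otimes>\<^bsub>A\<^esub> x) \<otimes>\<^bsub>A\<^esub> t" using cen[OF i(1) x(1)] x(1) w t(1) by (simp add: A.m_assoc[symmetric])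
    moreover have "(?w \<otimes>\<^bsub>A\<^esub> t) \<otimes>\<^bsub>A\<^esub> x = t \<otimes>\<^bsub>A\<^esub> (?w \<otimes>\<^bsub>A\<^esub> x)"
      using cen[OF i(1) t(1)] x(1) w t(1) by (simp add: A.m_assoc)
    ultimately show ?thesis using t w by (intro bexI[of _ "?w \<otimes>\<^bsub>A\<^esub> t"]) auto
  qed
  show ?thesis
  proof (intro short_local_ring.intro short_local_ring_axioms.intro)
    show "ring A" by (rule A.ring_axioms)
    show "ideal ?J A"
    proof (rule idealI)
      show "subgroup ?J (add_monoid A)" using sub by (simp add: submodule_def subgroup_def m_inv_def)
    qed (use d(5) right A.ring_axioms in auto)
    show "\<exists>z\<in>carrier A. (\<forall>y\<in>carrier A. z \<otimes>\<^bsub>A\<^esub> y = y \<otimes>\<^bsub>A\<^esub> z) \<and> x \<ominus>\<^bsub>A\<^esub> z \<in> ?J" if x: "x \<in> carrier A" for x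
    proof -
      obtain c where c: "c \<in> carrier K" "x \<ominus>\<^bsub>A\<^esub> (c \<odot>\<^bsub>A\<^esub> \<one>\<^bsub>A\<^esub>) \<in> ?J" using dec[OF x] by blast
      then show ?thesis using cen by (intro bexI[of _ "c \<odot>\<^bsub>A\<^esub> \<one>\<^bsub>A\<^esub>"]) auto
    qed
    show "mod_length A (quot (sub (regular A) ?J) (ideal_prod A ?J ?J)) = enat e"
      "mod_length A (sub (regular A) (ideal_prod A ?J ?J)) = enat a"
      using hilb by (auto simp: hilbert_type_def Let_def)
  qed (use unit one J3 in auto)
qed

end

theorem theorem1p4:
  fixes K :: "'k ring" and A :: "('k, 'a) module" and M :: "('a, 'm) module"
    and J :: "'a set" and e a t :: nat
  assumes alg: "short_local_algebra K A"
    and J_def: "J = jacobson_radical A"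
    and hilb: "hilbert_type A e a"
    and not_self_inj: "\<not> self_injective A"
    and M_fl: "fl_module A M"
    and M_indec: "indecomposable A M"
    and M_nonproj: "\<not> projective A M"
    and M_cond: "semi_Gorenstein_projective A M \<or> inf_torsionfree A M"
    and t_def: "top_length A J M = enat t"
  shows "2 \<le> a \<and> a = e - 1 \<and>
    ideal_prod A J J = soc A (regular A) \<and>
    ideal_prod A J J = soc (opp A) (regular (opp A)) \<and>
    (torsionless A M \<and> semi_Gorenstein_projective A M \<longrightarrow>
      (\<forall>i X. is_Omega_pow A i M X \<longrightarrow> has_dim_vec A J X t (a * t))) \<and>
    (inf_torsionfree A M \<longrightarrow>
      (\<forall>i X. is_mho_pow A i M X \<longrightarrow> has_dim_vec A J X t (a * t))) \<and>
    ((reflexive_module A M \<and> semi_Gorenstein_projective A M) \<or> inf_torsionfree A M \<longrightarrow>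
      has_dim_vec (opp A) J (dual A M) t (a * t)) \<and>
    (Gorenstein_projective A M \<longrightarrow>
      (\<forall>i X. is_Omega_pow A i M X \<or> is_mho_pow A i M X \<longrightarrow> has_dim_vec A J X t (a * t)) \<and>
      has_dim_vec (opp A) J (dual A M) t (a * t))"
proof -
  interpret short_local_ring A J e a
    unfolding J_def by (rule short_local_algebra.algebra_short_local_ring[OF alg hilb])
  interpret op: short_local_ring "opp A" J e a by (rule opp_short)
  have M: "left_module A M" using M_fl by (simp add: fl_module_def)
  have ne: "\<not> ext1_top_vanishes A J" using self_injective_of_ext1 not_self_inj by blast
  \<comment> \<open>Common to the two conditions under which a complex over \<open>opp A\<close>
    starts with the transpose of a presentation of \<open>M\<close>, namely infinite torsionfreeness
    and Gorenstein-projectivity.\<close>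
  have tr_case: "2 \<le> a \<and> e = Suc a \<and> soc A (regular A) = ideal_prod A J J \<and>
      soc (opp A) (regular (opp A)) = ideal_prod A J J \<and>
      (\<forall>i X. is_mho_pow A i M X \<longrightarrow> has_dim_vec A J X t (a * t)) \<and> has_dim_vec (opp A) J (dual A M) t (a * t)"
    if p: "q \<in> mod_hom A (free A n0) M" "q ` V n0 = carrier M"
      "D0 \<in> mod_hom A (free A n1) (free A n0)" "a_kernel (free A n0) M q = D0 ` V n1"
      and core: "core_complex (opp A) J e a \<nu> G" and \<nu>: "\<nu> 0 = n1" "\<nu> (Suc 0) = n0" "G 0 = tr A n0 n1 D0" for q n0 D0 n1 \<nu> G
  proof -
    note c = op.core_socles[OF core, simplified, unfolded J2_opp]
    have "n0 = t" using transpose_top[OF M p core \<nu>] t_def by simp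
    then show ?thesis using c mho_dim_vec[OF M p core \<nu>] transpose_dual_dim_vec[OF M p core \<nu>] by simp
  qed
  have tf: "2 \<le> a \<and> e = Suc a \<and> soc A (regular A) = ideal_prod A J J \<and>
      soc (opp A) (regular (opp A)) = ideal_prod A J J \<and>
      (\<forall>i X. is_mho_pow A i M X \<longrightarrow> has_dim_vec A J X t (a * t)) \<and> has_dim_vec (opp A) J (dual A M) t (a * t)"
    if "inf_torsionfree A M"
    by (rule inf_torsionfree_core[OF M ne M_indec M_nonproj that]) (rule tr_case)
  have gp: "2 \<le> a \<and> e = Suc a \<and> soc A (regular A) = ideal_prod A J J \<and>
      soc (opp A) (regular (opp A)) = ideal_prod A J J \<and>
      (\<forall>i X. is_mho_pow A i M X \<longrightarrow> has_dim_vec A J X t (a * t)) \<and> has_dim_vec (opp A) J (dual A M) t (a * t)"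
    if "Gorenstein_projective A M"
    by (rule Gorenstein_core[OF M_fl ne M_indec M_nonproj that]) (rule tr_case)
  have sg: "2 \<le> a \<and> e = Suc a \<and> soc A (regular A) = ideal_prod A J J \<and> soc (opp A) (regular (opp A)) = ideal_prod A J J"
    if "semi_Gorenstein_projective A M"
  proof (rule semi_Gorenstein_core[OF M ne M_nonproj that])
    fix n D assume c: "core_complex A J e a n D"
    show ?thesis using core_socles[OF c] by blast
  qed
  have main: "2 \<le> a \<and> e = Suc a \<and> soc A (regular A) = ideal_prod A J J \<and> soc (opp A) (regular (opp A)) = ideal_prod A J J"
    using M_cond tf sg by blast
  have om: "has_dim_vec A J X t (a * t)" if "torsionless A M" "semi_Gorenstein_projective A M" "is_Omega_pow A i M X" for i X
    by (rule torsionless_dim_vec[OF M ne M_indec M_nonproj that(2,1) t_def that(3)])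
  have rf: "has_dim_vec (opp A) J (dual A M) t (a * t)" if "reflexive_module A M" "semi_Gorenstein_projective A M"
    by (rule reflexive_dim_vec[OF M ne M_indec M_nonproj that(2,1) t_def])
  \<comment> \<open>For Gorenstein-projective \<open>M\<close> the syzygies are covered by the
    torsionless semi-Gorenstein-projective case, the cosyzygies and the dual by the complex over
    \<open>opp A\<close>.\<close>
  show ?thesis
    using main tf gp om rf Gorenstein_semi_Gorenstein[OF M_fl] by auto
qed

end
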